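(* Let $X\subseteq\mathbb{P}^N$ be a subvariety of dimension $n$ and let $L\subset X$ be a line contracted by the Gauss map of $X$. Assume $X\neq\mathbb{P}^n$, i.e. $X$ is not a linear subspace of $\mathbb{P}^N$. Then $L\subset X$ is locally obstructed.
   Context: The base field $k$ is algebraically closed of characteristic $0$. A variety is an integral separated scheme of finite type over $k$; a subvariety $X\subseteq\mathbb{P}^N$ is a closed subvariety, possibly singular. A line is a smooth rational curve of degree one. Gauss map: $\gamma:X\dashrightarrow\mathbb{G}(n,N)$ sends a smooth point $x\in X$ to the embedded tangent space $\widehat{T}_xX\subseteq\mathbb{P}^N$. A subvariety $V\subseteq X$ is contracted by $\gamma$ if $V\not\subseteq X_{\mathrm{Sing}}$ and the restricted rational map $\gamma|_V:V\dashrightarrow\mathbb{G}(n,N)$ is constant. Local obstructedness: let $Z\hookrightarrow Y$ be a closed subscheme of a $k$-scheme. $Z\subset Y$ is locally unobstructed if for every point $z\in Z$ the embedded deformations of $\mathrm{Spec}\,\mathcal{O}_{Z,z}$ in $\mathrm{Spec}\,\mathcal{O}_{Y,z}$ are unobstructed, i.e. for every exact sequence $0\to J\to B\to A\to0$ with $A,B$ local Artin $k$-algebras with residue field $k$ and $J\mathfrak{m}_B=0$, every closed subscheme of $\mathrm{Spec}(\mathcal{O}_{Y,z}\otimes_kA)$ flat over $A$ and restricting to $\mathrm{Spec}\,\mathcal{O}_{Z,z}$ extends to a closed subscheme of $\mathrm{Spec}(\mathcal{O}_{Y,z}\otimes_kB)$ flat over $B$. $Z\subset Y$ is locally obstructed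 if it is not locally unobstructed. *)

theory Defs
  imports
    "HOL-Analysis.Cartesian_Space"
    "HOL-Analysis.Abstract_Topology_2"
    "HOL-Algebra.QuotRing"
    "HOL-Algebra.Module"
    "HOL-Algebra.Generated_Groups"
    "HOL-Algebra.Free_Abelian_Groups"
    "HOL-Computational_Algebra.Polynomial"
    "HOL-Library.Poly_Mapping"
    "HOL-Library.Numeral_Type"
    "HOL-Library.Extended_Nat"
begin

section \<open>Homogeneous polynomials\<close>

text \<open>Polynomials in variables indexed by a finite type: finitely supported functions from
  exponent vectors to coefficients, with the convolution product.\<close>

type_synonym ('k, 'n) mpoly = "('n \<Rightarrow>\<^sub>0 nat) \<Rightarrow>\<^sub>0 'k"

definition mpoly_eval :: "('k::field, 'n::finite) mpoly \<Rightarrow> 'k ^ 'n \<Rightarrow> 'k" where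
  "mpoly_eval F v =
     (\<Sum>m\<in>Poly_Mapping.keys F.
        Poly_Mapping.lookup F m * (\<Prod>i\<in>UNIV. (v $ i) ^ Poly_Mapping.lookup m i))"

definition mpoly_pderiv :: "'n \<Rightarrow> ('k::field, 'n::finite) mpoly \<Rightarrow> ('k, 'n) mpoly" where
  "mpoly_pderiv i F =
     (\<Sum>m\<in>Poly_Mapping.keys F.
        Poly_Mapping.single (m - Poly_Mapping.single i 1)
          (of_nat (Poly_Mapping.lookup m i) * Poly_Mapping.lookup F m))"

definition homogeneous_polys :: "nat \<Rightarrow> ('k::field, 'n::finite) mpoly set" where
  "homogeneous_polys d =
     {F. \<forall>m\<in>Poly_Mapping.keys F. (\<Sum>i\<in>UNIV. Poly_Mapping.lookup m i) = d}"

interpretation mpoly: vector_space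
  "\<lambda>(c::'k::field) (F::('k, 'n::finite) mpoly). Poly_Mapping.single 0 c * F"
  by unfold_locales
    (simp_all add: distrib_left distrib_right single_add mult_single flip: mult.assoc)


section \<open>Subvarieties of projective space\<close>

text \<open>A point of \<open>\<P>\<^sup>N\<close> is a line through the origin of \<open>k\<^sup>N\<^sup>+\<^sup>1\<close>; here \<open>N + 1\<close> is the cardinality
  of the index type of the coordinates.  As \<open>k\<close> is algebraically closed, subvarieties are given by
  their sets of closed points.\<close>

type_synonym ('k, 'n) point = "('k ^ 'n) set"

definition proj_space :: "('k::field, 'n::finite) point set" where
  "proj_space = {x. vec.subspace x \<and> vec.dim x = 1}"

definition vanishes_at :: "('k::field, 'n::finite) mpoly \<Rightarrow> ('k, 'n) point \<Rightarrow> bool" where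
  "vanishes_at F x \<longleftrightarrow> (\<forall>v\<in>x. mpoly_eval F v = 0)"

definition zariski :: "('k::field, 'n::finite) point topology" where
  "zariski = topology_generated_by
     {{x \<in> proj_space. \<not> vanishes_at F x} | F d. F \<in> homogeneous_polys d}"

definition irreducible_space :: "'a topology \<Rightarrow> bool" where
  "irreducible_space T \<longleftrightarrow> topspace T \<noteq> {} \<and>
     (\<forall>C D. closedin T C \<and> closedin T D \<and> C \<union> D = topspace T
        \<longrightarrow> C = topspace T \<or> D = topspace T)"

definition subvariety :: "('k::field, 'n::finite) point set \<Rightarrow> bool" where
  "subvariety X \<longleftrightarrow> closedin zariski X \<and> irreducible_space (subtopology zariski X)"

definition variety_dim :: "('k::field, 'n::finite) point set \<Rightarrow> enat" where
  "variety_dim X = Sup {enat d | d. \<exists>Z. (\<forall>i\<le>d. subvariety (Z i) \<and> Z i \<subseteq> X) \<and> (\<forall>i<d. Z i \<subset> Z (Suc i))}"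

definition linear_subspace :: "('k::field, 'n::finite) point set \<Rightarrow> bool" where
  "linear_subspace X \<longleftrightarrow> (\<exists>W. vec.subspace W \<and> X = {x \<in> proj_space. x \<subseteq> W})"

definition vanishing_polys :: "('k::field, 'n::finite) point set \<Rightarrow> nat \<Rightarrow> ('k, 'n) mpoly set" where
  "vanishing_polys X d = {F \<in> homogeneous_polys d. \<forall>x\<in>X. vanishes_at F x}"


section \<open>Tangent spaces and the Gauss map\<close>

text \<open>A linear subspace of \<open>\<P>\<^sup>N\<close> (a point of a Grassmannian) is represented by the corresponding
  linear subspace of \<open>k\<^sup>N\<^sup>+\<^sup>1\<close>, whose vector space dimension is larger by one.\<close>

definition embedded_tangent_space ::
    "('k::field, 'n::finite) point set \<Rightarrow> ('k, 'n) point \<Rightarrow> ('k ^ 'n) set" where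
  "embedded_tangent_space X x =
     {w. \<forall>d. \<forall>F\<in>vanishing_polys X d. \<forall>v\<in>x. (\<Sum>i\<in>UNIV. mpoly_eval (mpoly_pderiv i F) v * w $ i) = 0}"

definition smooth_locus :: "('k::field, 'n::finite) point set \<Rightarrow> ('k, 'n) point set" where
  "smooth_locus X = {x \<in> X. enat (vec.dim (embedded_tangent_space X x)) = variety_dim X + 1}"

definition singular_locus :: "('k::field, 'n::finite) point set \<Rightarrow> ('k, 'n) point set" where
  "singular_locus X = X - smooth_locus X"

definition gauss_map ::
    "('k::field, 'n::finite) point set \<Rightarrow> ('k, 'n) point \<Rightarrow> ('k ^ 'n) set" where
  "gauss_map X = restrict (embedded_tangent_space X) (smooth_locus X)"

text \<open>The Gauss map is a morphism on the smooth locus, so its restriction to \<open>V\<close> is defined on the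
  dense open subset \<open>V - singular_locus X\<close> of \<open>V\<close>.\<close>

definition gauss_contracted ::
    "('k::field, 'n::finite) point set \<Rightarrow> ('k, 'n) point set \<Rightarrow> bool" where
  "gauss_contracted X V \<longleftrightarrow> subvariety V \<and> V \<subseteq> X \<and> \<not> V \<subseteq> singular_locus X \<and>
     gauss_map X constant_on (V - singular_locus X)"


section \<open>Regular functions and lines\<close>

text \<open>Used for \<open>U\<close> locally closed in projective space.\<close>

definition regular_on ::
    "('k::field, 'n::finite) point set \<Rightarrow> (('k, 'n) point \<Rightarrow> 'k) \<Rightarrow> bool" where
  "regular_on U f \<longleftrightarrow>
     (\<forall>x\<in>U. \<exists>W d. \<exists>G\<in>homogeneous_polys d. \<exists>H\<in>homogeneous_polys d.
        openin (subtopology zariski U) W \<and> x \<in> W \<and>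
        (\<forall>y\<in>W. \<forall>v\<in>y - {0}. mpoly_eval H v \<noteq> 0 \<and> f y = mpoly_eval G v / mpoly_eval H v))"

definition morphism_on ::
    "('k::field, 'n::finite) point set \<Rightarrow> ('k, 'm::finite) point set
      \<Rightarrow> (('k, 'n) point \<Rightarrow> ('k, 'm) point) \<Rightarrow> bool" where
  "morphism_on U W \<phi> \<longleftrightarrow>
     continuous_map (subtopology zariski U) (subtopology zariski W) \<phi> \<and>
     (\<forall>W' f. openin (subtopology zariski W) W' \<and> regular_on W' f
        \<longrightarrow> regular_on {x \<in> U. \<phi> x \<in> W'} (f \<circ> \<phi>))"

definition birational ::
    "('k::field, 'n::finite) point set \<Rightarrow> ('k, 'm::finite) point set \<Rightarrow> bool" where
  "birational X Y \<longleftrightarrow>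
     (\<exists>U W \<phi> \<psi>. openin (subtopology zariski X) U \<and> U \<noteq> {} \<and>
        openin (subtopology zariski Y) W \<and> W \<noteq> {} \<and>
        morphism_on U W \<phi> \<and> morphism_on W U \<psi> \<and>
        (\<forall>x\<in>U. \<psi> (\<phi> x) = x) \<and> (\<forall>y\<in>W. \<phi> (\<psi> y) = y))"

text \<open>The dimension of the degree \<open>m\<close> part of the homogeneous coordinate ring.\<close>

definition hilbert_function :: "('k::field, 'n::finite) point set \<Rightarrow> nat \<Rightarrow> nat" where
  "hilbert_function X m =
     mpoly.dim (homogeneous_polys m :: ('k, 'n) mpoly set) - mpoly.dim (vanishing_polys X m)"

text \<open>The degree is \<open>r!\<close> times the leading coefficient of the Hilbert polynomial, \<open>r\<close> being the
  dimension.\<close>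

definition has_degree :: "('k::field, 'n::finite) point set \<Rightarrow> nat \<Rightarrow> bool" where
  "has_degree X e \<longleftrightarrow>
     (\<exists>r (p :: rat poly). variety_dim X = enat r \<and>
        (\<forall>\<^sub>F m in sequentially. poly p (of_nat m) = of_nat (hilbert_function X m)) \<and>
        fact r * Polynomial.coeff p r = of_nat e)"

definition line :: "('k::field, 'n::finite) point set \<Rightarrow> bool" where
  "line L \<longleftrightarrow> subvariety L \<and> variety_dim L = 1 \<and> smooth_locus L = L \<and>
     birational L (proj_space :: ('k, 2) point set) \<and> has_degree L 1"


section \<open>Local rings of a subvariety\<close>

text \<open>Points of the scheme \<open>X\<close> correspond to subvarieties \<open>V \<subseteq> X\<close>, a closed point \<open>x\<close> to \<open>V = {x}\<close>
  and the generic point of \<open>V\<close> to \<open>V\<close> itself.  Its open neighbourhoods correspond to the open subsets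
  \<open>U\<close> of \<open>X\<close> meeting \<open>V\<close>, and the stalk consists of the germs of regular functions on those.\<close>

type_synonym ('k, 'n) germ = "(('k, 'n) point set \<times> (('k, 'n) point \<Rightarrow> 'k)) set"

definition local_sections ::
    "('k::field, 'n::finite) point set \<Rightarrow> ('k, 'n) point set \<Rightarrow> ('k, 'n) germ" where
  "local_sections X V = {(U, f). openin (subtopology zariski X) U \<and> U \<inter> V \<noteq> {} \<and> regular_on U f}"

definition germ_rel :: "('k::field, 'n::finite) point set \<Rightarrow> ('k, 'n) point set \<Rightarrow>
    (('k, 'n) point set \<times> (('k, 'n) point \<Rightarrow> 'k)) rel" where
  "germ_rel X V = {((U, f), (U', g)).
     (U, f) \<in> local_sections X V \<and> (U', g) \<in> local_sections X V \<and>
     (\<exists>W. openin (subtopology zariski X) W \<and> W \<inter> V \<noteq> {} \<and> W \<subseteq> U \<inter> U' \<and> (\<forall>x\<in>W. f x = g x))}"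

definition germ_op :: "('k::field, 'n::finite) point set \<Rightarrow> ('k, 'n) point set \<Rightarrow>
    ('k \<Rightarrow> 'k \<Rightarrow> 'k) \<Rightarrow> ('k, 'n) germ \<Rightarrow> ('k, 'n) germ \<Rightarrow> ('k, 'n) germ" where
  "germ_op X V h p q =
     (\<Union>(U, f)\<in>p. \<Union>(U', g)\<in>q. germ_rel X V `` {(U \<inter> U', \<lambda>x. h (f x) (g x))})"

definition const_germ ::
    "('k::field, 'n::finite) point set \<Rightarrow> ('k, 'n) point set \<Rightarrow> 'k \<Rightarrow> ('k, 'n) germ" where
  "const_germ X V c = germ_rel X V `` {(X, \<lambda>_. c)}"

definition local_ring ::
    "('k::field, 'n::finite) point set \<Rightarrow> ('k, 'n) point set \<Rightarrow> ('k, ('k, 'n) germ) module" where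
  "local_ring X V =
     \<lparr>carrier = local_sections X V // germ_rel X V,
      monoid.mult = germ_op X V (*),
      monoid.one = const_germ X V 1,
      ring.zero = const_germ X V 0,
      ring.add = germ_op X V (+),
      module.smult = (\<lambda>c. germ_op X V (*) (const_germ X V c))\<rparr>"

text \<open>The kernel of the restriction from the local ring of \<open>X\<close> to that of \<open>Z\<close>.\<close>

definition local_ideal :: "('k::field, 'n::finite) point set \<Rightarrow> ('k, 'n) point set \<Rightarrow>
    ('k, 'n) point set \<Rightarrow> ('k, 'n) germ set" where
  "local_ideal X Z V = {p \<in> carrier (local_ring X V). \<exists>(U, f)\<in>p. \<forall>x\<in>U \<inter> Z. f x = 0}"


section \<open>Tensor products and flatness\<close>

text \<open>The tensor product of \<open>S\<close>-modules \<open>M\<close> and \<open>N\<close> is the free abelian group on pairs modulo the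
  usual relations.  Its multiplicative structure is meaningful when \<open>M\<close> and \<open>N\<close> are
  \<open>S\<close>-algebras.\<close>

definition tensor_rels :: "('s, 'r) ring_scheme \<Rightarrow> ('s, 'a, 'c) module_scheme \<Rightarrow>
    ('s, 'b, 'd) module_scheme \<Rightarrow> ('a \<times> 'b \<Rightarrow>\<^sub>0 int) set" where
  "tensor_rels S M N = generate (free_Abelian_group (carrier M \<times> carrier N))
     ({frag_of (x \<oplus>\<^bsub>M\<^esub> x', y) - frag_of (x, y) - frag_of (x', y)
        | x x' y. x \<in> carrier M \<and> x' \<in> carrier M \<and> y \<in> carrier N} \<union>
      {frag_of (x, y \<oplus>\<^bsub>N\<^esub> y') - frag_of (x, y) - frag_of (x, y')
        | x y y'. x \<in> carrier M \<and> y \<in> carrier N \<and> y' \<in> carrier N} \<union>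
      {frag_of (s \<odot>\<^bsub>M\<^esub> x, y) - frag_of (x, s \<odot>\<^bsub>N\<^esub> y)
        | s x y. s \<in> carrier S \<and> x \<in> carrier M \<and> y \<in> carrier N})"

text \<open>The union of the cosets of the relations that meet a given set.\<close>

definition tensor_class :: "('s, 'r) ring_scheme \<Rightarrow> ('s, 'a, 'c) module_scheme \<Rightarrow>
    ('s, 'b, 'd) module_scheme \<Rightarrow> ('a \<times> 'b \<Rightarrow>\<^sub>0 int) set \<Rightarrow> ('a \<times> 'b \<Rightarrow>\<^sub>0 int) set" where
  "tensor_class S M N X =
     tensor_rels S M N <#>\<^bsub>free_Abelian_group (carrier M \<times> carrier N)\<^esub> X"

definition pure_tensor :: "('s, 'r) ring_scheme \<Rightarrow> ('s, 'a, 'c) module_scheme \<Rightarrow>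
    ('s, 'b, 'd) module_scheme \<Rightarrow> 'a \<Rightarrow> 'b \<Rightarrow> ('a \<times> 'b \<Rightarrow>\<^sub>0 int) set" where
  "pure_tensor S M N x y = tensor_class S M N {frag_of (x, y)}"

text \<open>The map \<open>f \<otimes> g\<close> from \<open>M \<otimes> N\<close> to \<open>M' \<otimes> N'\<close>; only the target is needed to form the class.\<close>

definition tensor_map :: "('s, 'r) ring_scheme \<Rightarrow> ('s, 'c, 'e) module_scheme \<Rightarrow>
    ('s, 'd, 'f) module_scheme \<Rightarrow> ('a \<Rightarrow> 'c) \<Rightarrow> ('b \<Rightarrow> 'd) \<Rightarrow>
    ('a \<times> 'b \<Rightarrow>\<^sub>0 int) set \<Rightarrow> ('c \<times> 'd \<Rightarrow>\<^sub>0 int) set" where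
  "tensor_map S M' N' f g X =
     tensor_class S M' N' (frag_extend (\<lambda>(x, y). frag_of (f x, g y)) ` X)"

definition tensor :: "('s, 'r) ring_scheme \<Rightarrow> ('s, 'a, 'c) module_scheme \<Rightarrow>
    ('s, 'b, 'd) module_scheme \<Rightarrow> ('s, ('a \<times> 'b \<Rightarrow>\<^sub>0 int) set) module" where
  "tensor S M N =
     \<lparr>carrier = carrier (free_Abelian_group (carrier M \<times> carrier N) Mod tensor_rels S M N),
      monoid.mult = (\<lambda>X Y. tensor_class S M N
        {frag_extend (\<lambda>(x, y). frag_extend (\<lambda>(x', y'). frag_of (x \<otimes>\<^bsub>M\<^esub> x', y \<otimes>\<^bsub>N\<^esub> y')) b) a
          | a b. a \<in> X \<and> b \<in> Y}),
      monoid.one = pure_tensor S M N \<one>\<^bsub>M\<^esub> \<one>\<^bsub>N\<^esub>,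
      ring.zero = tensor_rels S M N,
      ring.add = monoid.mult (free_Abelian_group (carrier M \<times> carrier N) Mod tensor_rels S M N),
      module.smult = (\<lambda>s. tensor_map S M N (\<lambda>x. s \<odot>\<^bsub>M\<^esub> x) id)\<rparr>"

definition linear_maps :: "('s, 'r) ring_scheme \<Rightarrow> ('s, 'a, 'c) module_scheme \<Rightarrow>
    ('s, 'b, 'd) module_scheme \<Rightarrow> ('a \<Rightarrow> 'b) set" where
  "linear_maps S M N = {f \<in> carrier M \<rightarrow> carrier N.
     (\<forall>x\<in>carrier M. \<forall>y\<in>carrier M. f (x \<oplus>\<^bsub>M\<^esub> y) = f x \<oplus>\<^bsub>N\<^esub> f y) \<and>
     (\<forall>s\<in>carrier S. \<forall>x\<in>carrier M. f (s \<odot>\<^bsub>M\<^esub> x) = s \<odot>\<^bsub>N\<^esub> f x)}"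

text \<open>Flatness: tensoring with \<open>M\<close> preserves injectivity.  HOL cannot quantify over all types of
  carriers; it is enough to test injections between finitely generated modules (even inclusions of
  finitely generated ideals).  Every finitely generated module is a quotient of some \<open>S\<^sup>n\<close>, so it
  occurs up to isomorphism with carrier a set of subsets of \<open>nat \<Rightarrow> 's\<close>.\<close>

definition flat_module :: "('s, 'r) ring_scheme \<Rightarrow> ('s, 'a, 'c) module_scheme \<Rightarrow> bool" where
  "flat_module S M \<longleftrightarrow> Module.module S M \<and>
     (\<forall>(N' :: ('s, (nat \<Rightarrow> 's) set) module) (N :: ('s, (nat \<Rightarrow> 's) set) module).
        \<forall>f\<in>linear_maps S N' N.
          Module.module S N' \<and> Module.module S N \<and> inj_on f (carrier N')
          \<longrightarrow> inj_on (tensor_map S M N id f) (carrier (tensor S M N')))"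


section \<open>Local Artin algebras\<close>

text \<open>The field \<open>k\<close> as a ring and as an algebra over itself.\<close>

definition base_field :: "('k::field, 'k) module" where
  "base_field = \<lparr>carrier = UNIV, monoid.mult = (*), monoid.one = 1,
     ring.zero = 0, ring.add = (+), module.smult = (*)\<rparr>"

definition algebra_homs :: "('k::field, 'a, 'c) module_scheme \<Rightarrow> ('k, 'b, 'd) module_scheme \<Rightarrow>
    ('a \<Rightarrow> 'b) set" where
  "algebra_homs A B = ring_hom A B \<inter> linear_maps base_field A B"

definition artinian :: "('a, 'c) ring_scheme \<Rightarrow> bool" where
  "artinian A \<longleftrightarrow>
     (\<forall>I :: nat \<Rightarrow> 'a set. (\<forall>i. ideal (I i) A \<and> I (Suc i) \<subseteq> I i) \<longrightarrow> (\<exists>n. \<forall>m\<ge>n. I m = I n))"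

definition local_artin_algebra :: "('k::field, 'a, 'c) module_scheme \<Rightarrow> bool" where
  "local_artin_algebra A \<longleftrightarrow> Module.algebra base_field A \<and> artinian A \<and>
     (\<exists>!m. maximalideal m A) \<and>
     (\<forall>m. maximalideal m A \<longrightarrow>
        bij_betw (\<lambda>c. m +>\<^bsub>A\<^esub> (c \<odot>\<^bsub>A\<^esub> \<one>\<^bsub>A\<^esub>)) UNIV (carrier (A Quot m)))"

text \<open>\<open>\<phi>\<close> is the surjection of an exact sequence \<open>0 \<rightarrow> J \<rightarrow> B \<rightarrow> A \<rightarrow> 0\<close> in which \<open>J\<close> is killed
  by the maximal ideal of \<open>B\<close>.\<close>

definition small_extension :: "('k::field, 'b, 'd) module_scheme \<Rightarrow>
    ('k, 'a, 'c) module_scheme \<Rightarrow> ('b \<Rightarrow> 'a) \<Rightarrow> bool" where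
  "small_extension B A \<phi> \<longleftrightarrow> \<phi> \<in> algebra_homs B A \<and> \<phi> ` carrier B = carrier A \<and>
     (\<forall>m. maximalideal m B \<longrightarrow> (\<forall>j\<in>a_kernel B A \<phi>. \<forall>x\<in>m. j \<otimes>\<^bsub>B\<^esub> x = \<zero>\<^bsub>B\<^esub>))"


section \<open>Embedded deformations\<close>

text \<open>\<open>(R \<otimes> A)/I\<close> as a module over \<open>A\<close>.\<close>

definition family_module :: "('k::field, 'r, 'c) module_scheme \<Rightarrow> ('k, 'a, 'd) module_scheme \<Rightarrow>
    ('r \<times> 'a \<Rightarrow>\<^sub>0 int) set set \<Rightarrow> ('a, ('r \<times> 'a \<Rightarrow>\<^sub>0 int) set set) module" where
  "family_module R A I =
     (let Q = tensor base_field R A Quot I in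
      \<lparr>carrier = carrier Q, monoid.mult = monoid.mult Q, monoid.one = monoid.one Q,
       ring.zero = ring.zero Q, ring.add = ring.add Q,
       module.smult = (\<lambda>a q. (I +>\<^bsub>tensor base_field R A\<^esub> pure_tensor base_field R A \<one>\<^bsub>R\<^esub> a) \<otimes>\<^bsub>Q\<^esub> q)\<rparr>)"

text \<open>A closed subscheme of \<open>Spec (R \<otimes> A)\<close> flat over \<open>A\<close>, given by its ideal.\<close>

definition flat_family :: "('k::field, 'r, 'c) module_scheme \<Rightarrow> ('k, 'a, 'd) module_scheme \<Rightarrow>
    ('r \<times> 'a \<Rightarrow>\<^sub>0 int) set set \<Rightarrow> bool" where
  "flat_family R A I \<longleftrightarrow> ideal I (tensor base_field R A) \<and> flat_module A (family_module R A I)"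

text \<open>Restriction of a closed subscheme of \<open>Spec (R \<otimes> B)\<close> along a surjection from \<open>B\<close> to \<open>A\<close>.  The
  image of the ideal is an ideal because \<open>id \<otimes> \<phi>\<close> is surjective.\<close>

definition restrict_family :: "('k::field, 'r, 'c) module_scheme \<Rightarrow> ('k, 'a, 'd) module_scheme \<Rightarrow>
    ('b \<Rightarrow> 'a) \<Rightarrow> ('r \<times> 'b \<Rightarrow>\<^sub>0 int) set set \<Rightarrow> ('r \<times> 'a \<Rightarrow>\<^sub>0 int) set set" where
  "restrict_family R A \<phi> I = tensor_map base_field R A id \<phi> ` I"

text \<open>Flat families over \<open>A\<close> whose restriction along the residue map of \<open>A\<close> is the closed subscheme
  of \<open>Spec R\<close> with ideal \<open>I0\<close>, where \<open>R\<close> is identified with \<open>R \<otimes> k\<close>.\<close>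

definition embedded_deformation :: "('k::field, 'r, 'c) module_scheme \<Rightarrow> 'r set \<Rightarrow>
    ('k, 'a, 'd) module_scheme \<Rightarrow> ('r \<times> 'a \<Rightarrow>\<^sub>0 int) set set \<Rightarrow> bool" where
  "embedded_deformation R I0 A I \<longleftrightarrow> flat_family R A I \<and>
     (\<exists>\<epsilon>\<in>algebra_homs A base_field.
        restrict_family R base_field \<epsilon> I = (\<lambda>r. pure_tensor base_field R base_field r 1) ` I0)"

text \<open>A local Artin \<open>k\<close>-algebra with residue field \<open>k\<close> is finite dimensional over \<open>k\<close>, so up to
  isomorphism its carrier is a subset of \<open>nat \<Rightarrow> 'k\<close>.\<close>

definition deformations_unobstructed ::
    "('k::field, 'r, 'c) module_scheme \<Rightarrow> 'r set \<Rightarrow> bool" where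
  "deformations_unobstructed R I0 \<longleftrightarrow>
     (\<forall>(A :: ('k, nat \<Rightarrow> 'k) module) (B :: ('k, nat \<Rightarrow> 'k) module) \<phi> I.
        local_artin_algebra A \<and> local_artin_algebra B \<and> small_extension B A \<phi> \<and>
        embedded_deformation R I0 A I
        \<longrightarrow> (\<exists>I'. flat_family R B I' \<and> restrict_family R A \<phi> I' = I))"

definition locally_unobstructed ::
    "('k::field, 'n::finite) point set \<Rightarrow> ('k, 'n) point set \<Rightarrow> bool" where
  "locally_unobstructed Z Y \<longleftrightarrow>
     (\<forall>V. subvariety V \<and> V \<subseteq> Z
        \<longrightarrow> deformations_unobstructed (local_ring Y V) (local_ideal Y Z V))"

definition locally_obstructed ::
    "('k::field, 'n::finite) point set \<Rightarrow> ('k, 'n) point set \<Rightarrow> bool" where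
  "locally_obstructed Z Y \<longleftrightarrow> \<not> locally_unobstructed Z Y"

end

theory Submission
  imports
    Defs
    "HOL-Analysis.Determinants"
    "HOL-Computational_Algebra.Polynomial_Factorial"
    "HOL-Computational_Algebra.Formal_Power_Series"
begin

text \<open>Suppose that \<open>L \<subset> X\<close> is locally unobstructed, and let \<open>T\<close> be the common tangent space of \<open>X\<close> at
  the general points of \<open>L\<close>.  It is tangent to \<open>X\<close> along all of \<open>L\<close>, and it has dimension \<open>n + 1\<close>
  because the rank of the Jacobian matrix is at most the codimension of \<open>X\<close>.

  Fix \<open>u \<in> T\<close> and assume that \<open>F(v + \<epsilon>u) = O(\<epsilon>\<^sup>M)\<close> with \<open>M \<ge> 2\<close>, for all \<open>v\<close> on \<open>L\<close> and all forms
  \<open>F\<close> vanishing on \<open>X\<close>.  Then \<open>L + \<epsilon>u\<close> is a family over \<open>k[\<epsilon>]/(\<epsilon>\<^sup>M)\<close>.  Extending it to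
  \<open>k[\<epsilon>]/(\<epsilon>\<^sup>M\<^sup>+\<^sup>1)\<close> shows that locally on \<open>L\<close> the coefficient of \<open>\<epsilon>\<^sup>M\<close> in \<open>F(v + \<epsilon>u)\<close> is \<open>dF\<^sub>v(g(v))\<close>
  with a vector \<open>g\<close> of rational functions that does not depend on \<open>F\<close>.  As \<open>g\<close> is unique modulo \<open>T\<close>,
  the local solutions glue to a section of a sum of copies of \<open>\<O>(1 - M)\<close> on \<open>L\<close>, which is zero.  So
  \<open>g\<close> takes values in \<open>T\<close>, and \<open>F(v + \<epsilon>u) = O(\<epsilon>\<^sup>M\<^sup>+\<^sup>1)\<close>.

  By induction every \<open>F\<close> vanishes on \<open>T\<close>, hence the linear space \<open>\<P>(T)\<close> of dimension \<open>n\<close> is contained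
  in \<open>X\<close>, so it is equal to \<open>X\<close>.

  That \<open>L\<close> is the projectivization of a plane follows from its Hilbert polynomial: a linear form
  vanishing at two points of \<open>L\<close> but not on \<open>L\<close> would make the Hilbert function grow by two at each
  step.\<close>

section \<open>Tensor products\<close>

text \<open>Unobstructedness concerns local rings, the vanishing of the coefficient of \<epsilon>^M
  concerns the whole line. The bridge is the parameter t on \<open>p + t *s q\<close>. Local
  solutions are vectors over k[t] with a denominator; the admissible denominators form an ideal of
  k[t] without common zero, so 1 is among them and the chart has a polynomial solution. A second
  solution is regular at \<open>q\<close>. For a form of degree d the coefficient of \<epsilon>^M is
  homogeneous of degree d - M along the line and the differential of degree d - 1. The gap M - 1 is
  the twist, and it is positive only for M \<ge> 2.

  Flatness is used through one consequence: if \<epsilon>^M z lies in the ideal of the extended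
  family, then z vanishes on the line at \<epsilon> = 0. Applied to the expansion of a form that is
  zero on X, this yields the linear equation for the correction.

  Since dimension is defined by chains of subvarieties, the rank bound for the Jacobian matrix is
  reached through prime ideals of the affine cone and algebraic independence of coordinates modulo
  them.\<close>

lemma keys_frag_diff_subset:
  "Poly_Mapping.keys a \<subseteq> S \<Longrightarrow> Poly_Mapping.keys b \<subseteq> S \<Longrightarrow> Poly_Mapping.keys (a - b :: 'a \<Rightarrow>\<^sub>0 int) \<subseteq> S"
  using keys_diff[of a b] by blast

lemma keys_frag_add_subset:
  "Poly_Mapping.keys a \<subseteq> S \<Longrightarrow> Poly_Mapping.keys b \<subseteq> S \<Longrightarrow> Poly_Mapping.keys (a + b :: 'a \<Rightarrow>\<^sub>0 int) \<subseteq> S"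
  using Poly_Mapping.keys_add[of a b] by blast

lemma keys_frag_extend_subset:
  assumes "Poly_Mapping.keys a \<subseteq> S" "\<And>x. x \<in> S \<Longrightarrow> Poly_Mapping.keys (f x) \<subseteq> T"
  shows "Poly_Mapping.keys (frag_extend f a) \<subseteq> T"
  using keys_frag_extend[of f a] assms by blast

locale tensor_modules =
  M: module S M + N: module S N
  for S :: "('s, 'r) ring_scheme" (structure) and M :: "('s, 'a, 'c) module_scheme"
    and N :: "('s, 'b, 'd) module_scheme"
begin

definition "gens = {frag_of (x \<oplus>\<^bsub>M\<^esub> x', y) - frag_of (x, y) - frag_of (x', y)
        | x x' y. x \<in> carrier M \<and> x' \<in> carrier M \<and> y \<in> carrier N} \<union>
      {frag_of (x, y \<oplus>\<^bsub>N\<^esub> y') - frag_of (x, y) - frag_of (x, y')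
        | x y y'. x \<in> carrier M \<and> y \<in> carrier N \<and> y' \<in> carrier N} \<union>
      {frag_of (s \<odot>\<^bsub>M\<^esub> x, y) - frag_of (x, s \<odot>\<^bsub>N\<^esub> y)
        | s x y. s \<in> carrier S \<and> x \<in> carrier M \<and> y \<in> carrier N}"

abbreviation "FF \<equiv> free_Abelian_group (carrier M \<times> carrier N)"
abbreviation "HH \<equiv> tensor_rels S M N"
abbreviation "TT \<equiv> tensor S M N"
abbreviation "cls a \<equiv> tensor_class S M N {a}"
abbreviation "pure x y \<equiv> pure_tensor S M N x y"

lemma tensor_rels_eq: "HH = generate FF gens"
  unfolding tensor_rels_def gens_def ..

lemma gens_cases:
  assumes "g \<in> gens"
  obtains (a) x z y where "x \<in> carrier M" "z \<in> carrier M" "y \<in> carrier N"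
        "g = frag_of (x \<oplus>\<^bsub>M\<^esub> z, y) - frag_of (x, y) - frag_of (z, y)"
      | (b) x y z where "x \<in> carrier M" "y \<in> carrier N" "z \<in> carrier N"
        "g = frag_of (x, y \<oplus>\<^bsub>N\<^esub> z) - frag_of (x, y) - frag_of (x, z)"
      | (c) s x y where "s \<in> carrier S" "x \<in> carrier M" "y \<in> carrier N"
        "g = frag_of (s \<odot>\<^bsub>M\<^esub> x, y) - frag_of (x, s \<odot>\<^bsub>N\<^esub> y)"
  using assms unfolding gens_def
  apply (elim UnE CollectE exE conjE)
    apply (rule that(1); assumption)
   apply (rule that(2); assumption)
  apply (rule that(3); assumption)
  done

lemma gens_subset: "gens \<subseteq> carrier FF"
proof
  fix g assume "g \<in> gens"
  then show "g \<in> carrier FF"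
    by (cases rule: gens_cases)
       (simp_all only: carrier_free_Abelian_group_iff, (intro keys_frag_diff_subset; simp add: keys_frag_of)+)
qed

lemma rels_subgroup: "subgroup HH FF"
  unfolding tensor_rels_eq by (rule group.generate_is_subgroup[OF group_free_Abelian_group gens_subset])

lemma rels_keys: "h \<in> HH \<Longrightarrow> Poly_Mapping.keys h \<subseteq> carrier M \<times> carrier N"
  using subgroup.mem_carrier[OF rels_subgroup] by auto

lemma rels_zero: "0 \<in> HH"
  using subgroup.one_closed[OF rels_subgroup] by simp

lemma rels_add: "h \<in> HH \<Longrightarrow> h' \<in> HH \<Longrightarrow> h + h' \<in> HH"
  using subgroup.m_closed[OF rels_subgroup] by simp

lemma rels_uminus: "h \<in> HH \<Longrightarrow> - h \<in> HH"
  using subgroup.m_inv_closed[OF rels_subgroup] rels_keys by fastforce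

lemma rels_diff: "h \<in> HH \<Longrightarrow> h' \<in> HH \<Longrightarrow> h - h' \<in> HH"
  using rels_add[OF _ rels_uminus] by fastforce

lemma gens_rels: "g \<in> gens \<Longrightarrow> g \<in> HH"
  unfolding tensor_rels_eq by (rule generate.incl)

lemma rels_induct [consumes 1, case_names zero gen add uminus]:
  assumes "h \<in> HH" "P 0" "\<And>g. g \<in> gens \<Longrightarrow> P g"
    "\<And>a b. a \<in> HH \<Longrightarrow> b \<in> HH \<Longrightarrow> P a \<Longrightarrow> P b \<Longrightarrow> P (a + b)" "\<And>a. a \<in> HH \<Longrightarrow> P a \<Longrightarrow> P (- a)"
  shows "P h"
  using assms(1) unfolding tensor_rels_eq
proof (induction rule: generate.induct)
  case one show ?case using assms(2) by simp
next
  case (incl h) then show ?case using assms(3) by simp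
next
  case (inv h)
  then have "Poly_Mapping.keys h \<subseteq> carrier M \<times> carrier N"
    using subsetD[OF gens_subset inv] by (simp only: carrier_free_Abelian_group_iff)
  then show ?case using assms(3,5) inv gens_rels by simp
next
  case (eng h1 h2) then show ?case using assms(4) unfolding tensor_rels_eq by simp
qed

lemma cls_def': "cls a = {h + a |h. h \<in> HH}"
  unfolding tensor_class_def set_mult_def by auto

lemma mem_cls: "b \<in> cls a \<longleftrightarrow> b - a \<in> HH"
proof
  assume "b \<in> cls a"
  then show "b - a \<in> HH" unfolding cls_def' by auto
next
  assume "b - a \<in> HH"
  moreover have "b = (b - a) + a" by simp
  ultimately show "b \<in> cls a" unfolding cls_def' by blast
qed

lemma cls_eq: "cls a = cls b \<longleftrightarrow> a - b \<in> HH"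
proof
  assume "cls a = cls b"
  moreover have "a \<in> cls a" using rels_zero by (simp add: mem_cls)
  ultimately show "a - b \<in> HH" by (simp add: mem_cls)
next
  assume *: "a - b \<in> HH"
  show "cls a = cls b"
  proof (rule Set.set_eqI)
    fix c
    have "c - a = (c - b) - (a - b)" "c - b = (c - a) + (a - b)" by simp_all
    then show "c \<in> cls a \<longleftrightarrow> c \<in> cls b" unfolding mem_cls using * rels_add rels_diff by metis
  qed
qed

text \<open>\<open>tensor_map\<close> and the product take the union of all cosets that meet a set
  of representatives; once that set lies in one coset, the union is this coset. This makes
  computations with single representatives legitimate.\<close>

lemma tensor_class_single:
  assumes "X \<subseteq> cls a" "X \<noteq> {}"
  shows "tensor_class S M N X = cls a"
proof -
  have "tensor_class S M N X = (\<Union>b\<in>X. cls b)"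
    unfolding tensor_class_def set_mult_def by auto
  also have "\<dots> = cls a"
    using assms cls_eq mem_cls by blast
  finally show ?thesis .
qed

lemma carrier_tensor: "carrier TT = cls ` carrier FF"
proof -
  have "cls a = HH #>\<^bsub>FF\<^esub> a" for a
    unfolding tensor_class_def set_mult_def r_coset_def by simp
  then show ?thesis
    unfolding tensor_def FactGroup_def RCOSETS_def by auto
qed

lemma cls_carrier: "Poly_Mapping.keys a \<subseteq> carrier M \<times> carrier N \<Longrightarrow> cls a \<in> carrier TT"
  unfolding carrier_tensor by auto

lemma carrier_cases:
  assumes "t \<in> carrier TT"
  obtains a where "Poly_Mapping.keys a \<subseteq> carrier M \<times> carrier N" "t = cls a"
  using assms unfolding carrier_tensor by auto

lemma cls_add: "cls a \<oplus>\<^bsub>TT\<^esub> cls b = cls (a + b)"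
proof -
  have "cls a \<oplus>\<^bsub>TT\<^esub> cls b = cls a <#>\<^bsub>FF\<^esub> cls b"
    unfolding tensor_def FactGroup_def by simp
  also have "\<dots> = cls (a + b)"
  proof (rule Set.set_eqI)
    fix c
    show "c \<in> cls a <#>\<^bsub>FF\<^esub> cls b \<longleftrightarrow> c \<in> cls (a + b)"
    proof
      assume "c \<in> cls a <#>\<^bsub>FF\<^esub> cls b"
      then obtain h h' where "h \<in> HH" "h' \<in> HH" "c = (h + a) + (h' + b)"
        unfolding set_mult_def cls_def' by auto
      moreover from this have "c = (h + h') + (a + b)" by simp
      ultimately show "c \<in> cls (a + b)" unfolding cls_def' using rels_add by blast
    next
      assume "c \<in> cls (a + b)"
      then obtain h where "h \<in> HH" "c = (h + a) + (0 + b)"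
        unfolding cls_def' by (auto simp: add.assoc)
      then show "c \<in> cls a <#>\<^bsub>FF\<^esub> cls b" unfolding set_mult_def cls_def' using rels_zero by auto
    qed
  qed
  finally show ?thesis .
qed

lemma zero_tensor: "\<zero>\<^bsub>TT\<^esub> = cls 0"
  unfolding cls_def' by (simp add: tensor_def)

lemma abelian_group_tensor: "abelian_group TT"
proof (rule abelian_groupI)
  fix x y assume "x \<in> carrier TT" "y \<in> carrier TT"
  then show "x \<oplus>\<^bsub>TT\<^esub> y \<in> carrier TT"
    by (elim carrier_cases) (simp add: cls_add cls_carrier keys_frag_add_subset)
next
  show "\<zero>\<^bsub>TT\<^esub> \<in> carrier TT" unfolding zero_tensor by (simp add: cls_carrier)
next
  fix x y z assume "x \<in> carrier TT" "y \<in> carrier TT" "z \<in> carrier TT"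
  then show "x \<oplus>\<^bsub>TT\<^esub> y \<oplus>\<^bsub>TT\<^esub> z = x \<oplus>\<^bsub>TT\<^esub> (y \<oplus>\<^bsub>TT\<^esub> z)"
    by (elim carrier_cases) (simp add: cls_add add.assoc)
next
  fix x y assume "x \<in> carrier TT" "y \<in> carrier TT"
  then show "x \<oplus>\<^bsub>TT\<^esub> y = y \<oplus>\<^bsub>TT\<^esub> x"
    by (elim carrier_cases) (simp add: cls_add add.commute)
next
  fix x assume "x \<in> carrier TT"
  then show "\<zero>\<^bsub>TT\<^esub> \<oplus>\<^bsub>TT\<^esub> x = x"
    by (elim carrier_cases) (simp add: cls_add zero_tensor)
next
  fix x assume "x \<in> carrier TT"
  then obtain a where a: "Poly_Mapping.keys a \<subseteq> carrier M \<times> carrier N" "x = cls a" by (rule carrier_cases)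
  then have "cls (- a) \<in> carrier TT" "cls (- a) \<oplus>\<^bsub>TT\<^esub> x = \<zero>\<^bsub>TT\<^esub>"
    by (simp_all add: cls_add zero_tensor cls_carrier)
  then show "\<exists>y\<in>carrier TT. y \<oplus>\<^bsub>TT\<^esub> x = \<zero>\<^bsub>TT\<^esub>" by blast
qed

sublocale T: abelian_group TT by (rule abelian_group_tensor)

lemma pure_closed [simp]: "x \<in> carrier M \<Longrightarrow> y \<in> carrier N \<Longrightarrow> pure x y \<in> carrier TT"
  unfolding pure_tensor_def by (rule cls_carrier) (simp add: keys_frag_of)

lemma pure_add_left: "x \<in> carrier M \<Longrightarrow> x' \<in> carrier M \<Longrightarrow> y \<in> carrier N \<Longrightarrow>
    pure (x \<oplus>\<^bsub>M\<^esub> x') y = pure x y \<oplus>\<^bsub>TT\<^esub> pure x' y"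
  unfolding pure_tensor_def cls_add cls_eq
  by (rule gens_rels, unfold gens_def diff_diff_eq[symmetric]) blast

lemma pure_add_right: "x \<in> carrier M \<Longrightarrow> y \<in> carrier N \<Longrightarrow> y' \<in> carrier N \<Longrightarrow>
    pure x (y \<oplus>\<^bsub>N\<^esub> y') = pure x y \<oplus>\<^bsub>TT\<^esub> pure x y'"
  unfolding pure_tensor_def cls_add cls_eq
  by (rule gens_rels, unfold gens_def diff_diff_eq[symmetric]) blast

lemma pure_smult: "s \<in> carrier S \<Longrightarrow> x \<in> carrier M \<Longrightarrow> y \<in> carrier N \<Longrightarrow>
    pure (s \<odot>\<^bsub>M\<^esub> x) y = pure x (s \<odot>\<^bsub>N\<^esub> y)"
  unfolding pure_tensor_def cls_eq
  by (rule gens_rels, unfold gens_def) blast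

lemma pure_zero_left: assumes "y \<in> carrier N" shows "pure \<zero>\<^bsub>M\<^esub> y = \<zero>\<^bsub>TT\<^esub>"
  using pure_add_left[of "\<zero>\<^bsub>M\<^esub>" "\<zero>\<^bsub>M\<^esub>" y] assms T.add.r_cancel_one' by simp

lemma pure_zero_right: assumes "x \<in> carrier M" shows "pure x \<zero>\<^bsub>N\<^esub> = \<zero>\<^bsub>TT\<^esub>"
  using pure_add_right[of x "\<zero>\<^bsub>N\<^esub>" "\<zero>\<^bsub>N\<^esub>"] assms T.add.r_cancel_one' by simp

lemma cls_uminus: "Poly_Mapping.keys a \<subseteq> carrier M \<times> carrier N \<Longrightarrow> \<ominus>\<^bsub>TT\<^esub> cls a = cls (- a)"
  by (rule T.minus_equality) (simp_all add: cls_add zero_tensor cls_carrier)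

lemma pure_uminus_left: assumes "x \<in> carrier M" "y \<in> carrier N"
  shows "pure (\<ominus>\<^bsub>M\<^esub> x) y = \<ominus>\<^bsub>TT\<^esub> pure x y"
  using pure_add_left[of "\<ominus>\<^bsub>M\<^esub> x" x y] assms
  by (intro T.minus_equality[symmetric]) (simp_all add: M.l_neg pure_zero_left)

text \<open>Negatives need no case of their own because -(x \<otimes> y) = (-x) \<otimes> y is pure.
  The induction over the free abelian group therefore carries the property for \<open>a\<close> and
  \<open>- a\<close> at the same time.\<close>

lemma tensor_induct [consumes 1, case_names pure add]:
  assumes t: "t \<in> carrier TT"
    and pure: "\<And>x y. x \<in> carrier M \<Longrightarrow> y \<in> carrier N \<Longrightarrow> P (pure x y)"
    and add: "\<And>s t. s \<in> carrier TT \<Longrightarrow> t \<in> carrier TT \<Longrightarrow> P s \<Longrightarrow> P t \<Longrightarrow> P (s \<oplus>\<^bsub>TT\<^esub> t)"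
  shows "P t"
proof -
  obtain a where a: "Poly_Mapping.keys a \<subseteq> carrier M \<times> carrier N" "t = cls a"
    using t by (rule carrier_cases)
  from a(1) have "P (cls a) \<and> P (cls (- a)) \<and> Poly_Mapping.keys a \<subseteq> carrier M \<times> carrier N"
  proof (induction a rule: frag_induction)
    case zero
    have "P (pure \<zero>\<^bsub>M\<^esub> \<zero>\<^bsub>N\<^esub>)" by (rule pure) simp_all
    then show ?case using pure_zero_left[of "\<zero>\<^bsub>N\<^esub>"] by (simp add: zero_tensor)
  next
    case (one z)
    obtain x y where z: "z = (x, y)" "x \<in> carrier M" "y \<in> carrier N" using one by auto
    have "P (pure x y)" "P (pure (\<ominus>\<^bsub>M\<^esub> x) y)" using z pure by simp_all
    then show ?case using z pure_uminus_left[of x y] cls_uminus[of "frag_of z"]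
      by (simp add: pure_tensor_def keys_frag_of)
  next
    case (diff a b)
    then have "P (cls a \<oplus>\<^bsub>TT\<^esub> cls (- b))" "P (cls b \<oplus>\<^bsub>TT\<^esub> cls (- a))"
      using add cls_carrier by simp_all
    then show ?case using diff by (simp add: cls_add keys_frag_diff_subset)
  qed
  then show ?thesis using a(2) by simp
qed

text \<open>A balanced biadditive map kills the three kinds of generating relations, so its
  extension to the free abelian group descends to cosets. Coordinates with respect to a basis, the
  expansion in \<epsilon> and the functional on the socle are all obtained from this.\<close>

lemma universal:
  fixes G :: "('g, 'h) ring_scheme"
  assumes G: "abelian_group G"
    and closed: "\<And>x y. x \<in> carrier M \<Longrightarrow> y \<in> carrier N \<Longrightarrow> \<beta> x y \<in> carrier G"
    and addl: "\<And>x x' y. x \<in> carrier M \<Longrightarrow> x' \<in> carrier M \<Longrightarrow> y \<in> carrier N \<Longrightarrow>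
        \<beta> (x \<oplus>\<^bsub>M\<^esub> x') y = \<beta> x y \<oplus>\<^bsub>G\<^esub> \<beta> x' y"
    and addr: "\<And>x y y'. x \<in> carrier M \<Longrightarrow> y \<in> carrier N \<Longrightarrow> y' \<in> carrier N \<Longrightarrow>
        \<beta> x (y \<oplus>\<^bsub>N\<^esub> y') = \<beta> x y \<oplus>\<^bsub>G\<^esub> \<beta> x y'"
    and bal: "\<And>s x y. s \<in> carrier S \<Longrightarrow> x \<in> carrier M \<Longrightarrow> y \<in> carrier N \<Longrightarrow>
        \<beta> (s \<odot>\<^bsub>M\<^esub> x) y = \<beta> x (s \<odot>\<^bsub>N\<^esub> y)"
  shows "\<exists>h. (\<forall>t\<in>carrier TT. h t \<in> carrier G) \<and>
    (\<forall>t\<in>carrier TT. \<forall>t'\<in>carrier TT. h (t \<oplus>\<^bsub>TT\<^esub> t') = h t \<oplus>\<^bsub>G\<^esub> h t') \<and>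
    (\<forall>x\<in>carrier M. \<forall>y\<in>carrier N. h (pure x y) = \<beta> x y)"
proof -
  interpret G: abelian_group G by fact
  have "(\<lambda>(x, y). \<beta> x y) ` (carrier M \<times> carrier N) \<subseteq> carrier (add_monoid G)"
    using closed by auto
  then obtain h0 where h0: "h0 \<in> hom FF (add_monoid G)"
    "\<And>z. z \<in> carrier M \<times> carrier N \<Longrightarrow> h0 (frag_of z) = (case z of (x, y) \<Rightarrow> \<beta> x y)"
    using comm_group.free_Abelian_group_universal[OF G.a_comm_group] by blast
  have cl: "h0 a \<in> carrier G" if "Poly_Mapping.keys a \<subseteq> carrier M \<times> carrier N" for a
    using h0(1) that by (auto simp: hom_def Pi_def)
  have add: "h0 (a + b) = h0 a \<oplus>\<^bsub>G\<^esub> h0 b"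
    if "Poly_Mapping.keys a \<subseteq> carrier M \<times> carrier N" "Poly_Mapping.keys b \<subseteq> carrier M \<times> carrier N" for a b
    using h0(1) that by (simp add: hom_def)
  have zero: "h0 0 = \<zero>\<^bsub>G\<^esub>"
    using add[of 0 0] cl[of 0] G.add.r_cancel_one' by simp
  have um: "h0 (- a) = \<ominus>\<^bsub>G\<^esub> h0 a" if "Poly_Mapping.keys a \<subseteq> carrier M \<times> carrier N" for a
    using add[of "- a" a] cl[of a] cl[of "- a"] zero that by (intro G.minus_equality[symmetric]) auto
  have diff: "h0 (a - b) = h0 a \<ominus>\<^bsub>G\<^esub> h0 b"
    if "Poly_Mapping.keys a \<subseteq> carrier M \<times> carrier N" "Poly_Mapping.keys b \<subseteq> carrier M \<times> carrier N" for a b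
    using add[of a "- b"] um[of b] that by (simp add: a_minus_def)
  have fr: "h0 (frag_of (x, y)) = \<beta> x y" "Poly_Mapping.keys (frag_of (x, y)) \<subseteq> carrier M \<times> carrier N"
    if "x \<in> carrier M" "y \<in> carrier N" for x y
    using h0(2) that by (auto simp: keys_frag_of)
  have kill: "h0 h = \<zero>\<^bsub>G\<^esub>" if "h \<in> HH" for h
    using that
  proof (induction rule: rels_induct)
    case (gen g)
    have 3: "h0 (frag_of (a, b) - frag_of (c, d) - frag_of (e, f)) = \<beta> a b \<ominus>\<^bsub>G\<^esub> \<beta> c d \<ominus>\<^bsub>G\<^esub> \<beta> e f"
      if "a \<in> carrier M" "b \<in> carrier N" "c \<in> carrier M" "d \<in> carrier N" "e \<in> carrier M" "f \<in> carrier N"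
      for a b c d e f
      using that by (simp add: diff fr keys_frag_diff_subset)
    have 2: "h0 (frag_of (a, b) - frag_of (c, d)) = \<beta> a b \<ominus>\<^bsub>G\<^esub> \<beta> c d"
      if "a \<in> carrier M" "b \<in> carrier N" "c \<in> carrier M" "d \<in> carrier N" for a b c d
      using that by (simp add: diff fr)
    have G1: "u \<oplus>\<^bsub>G\<^esub> v \<ominus>\<^bsub>G\<^esub> u \<ominus>\<^bsub>G\<^esub> v = \<zero>\<^bsub>G\<^esub>" if "u \<in> carrier G" "v \<in> carrier G" for u v
    proof -
      have "u \<oplus>\<^bsub>G\<^esub> v \<ominus>\<^bsub>G\<^esub> u \<ominus>\<^bsub>G\<^esub> v = (u \<oplus>\<^bsub>G\<^esub> v) \<oplus>\<^bsub>G\<^esub> (\<ominus>\<^bsub>G\<^esub> (u \<oplus>\<^bsub>G\<^esub> v))"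
        using that by (simp add: a_minus_def G.minus_add G.a_assoc)
      then show ?thesis using that by (simp add: G.r_neg)
    qed
    have G2: "u \<ominus>\<^bsub>G\<^esub> u = \<zero>\<^bsub>G\<^esub>" if "u \<in> carrier G" for u
      using that by (simp add: a_minus_def G.r_neg)
    from gen show ?case
    proof (cases rule: gens_cases)
      case (a x z y)
      then show ?thesis using closed by (simp only: 3 addl G1 M.a_closed)
    next
      case (b x y z)
      then show ?thesis using closed by (simp only: 3 addr G1 N.a_closed)
    next
      case (c s x y)
      then show ?thesis using closed by (simp only: 2 bal G2 M.smult_closed N.smult_closed)
    qed
  qed (simp_all add: zero add rels_keys um)
  \<comment> \<open>Any representative will do: two of them differ by a relation, on which
    \<open>h0\<close> is zero.\<close>
  define h where "h t = h0 (SOME a. Poly_Mapping.keys a \<subseteq> carrier M \<times> carrier N \<and> t = cls a)" for t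
  have h: "h (cls a) = h0 a" if "Poly_Mapping.keys a \<subseteq> carrier M \<times> carrier N" for a
  proof -
    define b where "b = (SOME b. Poly_Mapping.keys b \<subseteq> carrier M \<times> carrier N \<and> cls a = cls b)"
    have b: "Poly_Mapping.keys b \<subseteq> carrier M \<times> carrier N \<and> cls a = cls b"
      unfolding b_def by (rule someI[of _ a]) (simp add: that)
    then have "a - b \<in> HH" using cls_eq by blast
    then have "h0 (a - b) = \<zero>\<^bsub>G\<^esub>" by (rule kill)
    then have "h0 a \<oplus>\<^bsub>G\<^esub> (\<ominus>\<^bsub>G\<^esub> h0 b) = \<zero>\<^bsub>G\<^esub>"
      using diff[of a b] that b by (simp add: a_minus_def)
    then have "\<ominus>\<^bsub>G\<^esub> (\<ominus>\<^bsub>G\<^esub> h0 b) = h0 a"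
      using cl[of a] cl[of b] that b by (intro G.minus_equality) simp_all
    then have "h0 a = h0 b" using cl[of b] b by simp
    then show ?thesis unfolding h_def b_def by simp
  qed
  have "h t \<in> carrier G" if "t \<in> carrier TT" for t
    using that by (elim carrier_cases) (simp add: h cl)
  moreover have "h (t \<oplus>\<^bsub>TT\<^esub> t') = h t \<oplus>\<^bsub>G\<^esub> h t'" if "t \<in> carrier TT" "t' \<in> carrier TT" for t t'
    using that by (elim carrier_cases) (simp add: h add cls_add keys_frag_add_subset)
  moreover have "h (pure x y) = \<beta> x y" if "x \<in> carrier M" "y \<in> carrier N" for x y
    using that unfolding pure_tensor_def by (simp add: h fr)
  ultimately show ?thesis by (intro exI[of _ h] conjI ballI)
qed

end

section \<open>Functoriality of the tensor product\<close>

locale tensor_hom =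
  A: tensor_modules S M N + B: tensor_modules S M' N'
  for S :: "('s, 'r) ring_scheme" (structure) and M :: "('s, 'a, 'c) module_scheme"
    and N :: "('s, 'b, 'd) module_scheme" and M' :: "('s, 'e, 'f) module_scheme"
    and N' :: "('s, 'g, 'h) module_scheme" +
  fixes f g
  assumes f: "f \<in> linear_maps S M M'" and g: "g \<in> linear_maps S N N'"
begin

abbreviation "ext a \<equiv> frag_extend (\<lambda>(x, y). frag_of (f x, g y)) a"

lemma ext_diff: "ext (a - b) = ext a - ext b"
  by (simp add: frag_extend_diff)

text \<open>Linearity of \<open>f\<close> and \<open>g\<close> sends each generating relation to a
  generating relation of the same kind.\<close>

lemma ext_rels: "h \<in> A.HH \<Longrightarrow> ext h \<in> B.HH"
proof (induction rule: A.rels_induct)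
  case (gen k)
  have cl: "f x \<in> carrier M'" "g y \<in> carrier N'" if "x \<in> carrier M" "y \<in> carrier N" for x y
    using f g that unfolding linear_maps_def by auto
  have "ext k \<in> B.gens"
  proof -
    from gen show ?thesis
    proof (cases rule: A.gens_cases)
      case (a x x' y)
      then have "ext k = frag_of (f x \<oplus>\<^bsub>M'\<^esub> f x', g y) - frag_of (f x, g y) - frag_of (f x', g y)"
        using f by (simp add: ext_diff linear_maps_def)
      then show ?thesis unfolding B.gens_def using a cl by blast
    next
      case (b x y y')
      then have "ext k = frag_of (f x, g y \<oplus>\<^bsub>N'\<^esub> g y') - frag_of (f x, g y) - frag_of (f x, g y')"
        using g by (simp add: ext_diff linear_maps_def)
      then show ?thesis unfolding B.gens_def using b cl by blast
    next
      case (c s x y)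
      then have "ext k = frag_of (s \<odot>\<^bsub>M'\<^esub> f x, g y) - frag_of (f x, s \<odot>\<^bsub>N'\<^esub> g y)"
        using f g by (simp add: ext_diff linear_maps_def)
      then show ?thesis unfolding B.gens_def using c cl by blast
    qed
  qed
  then show ?case by (rule B.gens_rels)
qed (simp_all add: B.rels_zero frag_extend_add frag_extend_minus B.rels_add B.rels_uminus)

abbreviation "tm \<equiv> tensor_map S M' N' f g"

lemma tensor_map_cls: "tm (A.cls a) = B.cls (ext a)"
  unfolding tensor_map_def
proof (rule B.tensor_class_single)
  show "ext ` A.cls a \<subseteq> B.cls (ext a)"
    using ext_rels by (auto simp: A.mem_cls B.mem_cls ext_diff[symmetric])
  show "ext ` A.cls a \<noteq> {}" using A.rels_zero by (force simp: A.cls_def')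
qed

lemma ext_keys: "Poly_Mapping.keys a \<subseteq> carrier M \<times> carrier N \<Longrightarrow> Poly_Mapping.keys (ext a) \<subseteq> carrier M' \<times> carrier N'"
  by (rule keys_frag_extend_subset, assumption)
     (use f g in \<open>auto simp: keys_frag_of linear_maps_def\<close>)

lemma tensor_map_closed: "t \<in> carrier A.TT \<Longrightarrow> tm t \<in> carrier B.TT"
  by (elim A.carrier_cases) (simp add: tensor_map_cls B.cls_carrier ext_keys)

lemma tensor_map_add: "t \<in> carrier A.TT \<Longrightarrow> t' \<in> carrier A.TT \<Longrightarrow>
    tm (t \<oplus>\<^bsub>A.TT\<^esub> t') = tm t \<oplus>\<^bsub>B.TT\<^esub> tm t'"
  by (elim A.carrier_cases) (simp add: tensor_map_cls A.cls_add B.cls_add frag_extend_add)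

lemma tensor_map_pure: "tm (A.pure x y) = B.pure (f x) (g y)"
  unfolding pure_tensor_def tensor_map_cls by simp

end

subsection \<open>Tensor products of algebras\<close>

locale tensor_algebras =
  M: algebra S M + N: algebra S N
  for S :: "('s, 'r) ring_scheme" (structure) and M :: "('s, 'a, 'c) module_scheme"
    and N :: "('s, 'b, 'd) module_scheme"
begin

sublocale tensor_modules S M N
  by (intro tensor_modules.intro M.module N.module)

definition mulf :: "('a \<times> 'b \<Rightarrow>\<^sub>0 int) \<Rightarrow> ('a \<times> 'b \<Rightarrow>\<^sub>0 int) \<Rightarrow> ('a \<times> 'b \<Rightarrow>\<^sub>0 int)" where
  "mulf a b = frag_extend (\<lambda>(x, y). frag_extend (\<lambda>(x', y'). frag_of (x \<otimes>\<^bsub>M\<^esub> x', y \<otimes>\<^bsub>N\<^esub> y')) b) a"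

lemma mulf_frag_of: "mulf (frag_of (x, y)) (frag_of (x', y')) = frag_of (x \<otimes>\<^bsub>M\<^esub> x', y \<otimes>\<^bsub>N\<^esub> y')"
  unfolding mulf_def by simp

lemma mulf_diff_left: "mulf (a - a') b = mulf a b - mulf a' b"
  unfolding mulf_def by (rule frag_extend_diff)

lemma frag_extend_pointwise_diff:
  "frag_extend (\<lambda>z. f z - g z) a = frag_extend f a - frag_extend g a"
  unfolding frag_extend_def
  by (simp add: sum_subtractf[symmetric] frag_cmul_diff_distrib[symmetric])
     (simp add: algebra_simps poly_mapping_eq_iff fun_eq_iff lookup_minus lookup_sum)

lemma mulf_diff_right: "mulf a (b - b') = mulf a b - mulf a b'"
proof -
  have "(\<lambda>(x, y). frag_extend (\<lambda>(x', y'). frag_of (x \<otimes>\<^bsub>M\<^esub> x', y \<otimes>\<^bsub>N\<^esub> y')) (b - b')) =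
     (\<lambda>z. (case z of (x, y) \<Rightarrow> frag_extend (\<lambda>(x', y'). frag_of (x \<otimes>\<^bsub>M\<^esub> x', y \<otimes>\<^bsub>N\<^esub> y')) b)
        - (case z of (x, y) \<Rightarrow> frag_extend (\<lambda>(x', y'). frag_of (x \<otimes>\<^bsub>M\<^esub> x', y \<otimes>\<^bsub>N\<^esub> y')) b'))"
    by (auto simp: frag_extend_diff)
  then show ?thesis unfolding mulf_def by (simp add: frag_extend_pointwise_diff)
qed

lemma mulf_zero [simp]: "mulf 0 b = 0" "mulf a 0 = 0"
  using mulf_diff_left[of 0 0 b] mulf_diff_right[of a 0 0] by simp_all

lemma mulf_uminus: "mulf (- a) b = - mulf a b" "mulf a (- b) = - mulf a b"
  using mulf_diff_left[of 0 a b] mulf_diff_right[of a 0 b] by simp_all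

lemma mulf_add_left: "mulf (a + a') b = mulf a b + mulf a' b"
  using mulf_diff_left[of a "- a'" b] by (simp add: mulf_uminus)

lemma mulf_keys:
  assumes "Poly_Mapping.keys a \<subseteq> carrier M \<times> carrier N" "Poly_Mapping.keys b \<subseteq> carrier M \<times> carrier N"
  shows "Poly_Mapping.keys (mulf a b) \<subseteq> carrier M \<times> carrier N"
  unfolding mulf_def
proof (rule keys_frag_extend_subset[OF assms(1)])
  fix z assume "z \<in> carrier M \<times> carrier N"
  then obtain x y where z: "z = (x, y)" "x \<in> carrier M" "y \<in> carrier N" by auto
  show "Poly_Mapping.keys (case z of (x, y) \<Rightarrow>
      frag_extend (\<lambda>(x', y'). frag_of (x \<otimes>\<^bsub>M\<^esub> x', y \<otimes>\<^bsub>N\<^esub> y')) b) \<subseteq> carrier M \<times> carrier N"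
    unfolding z(1) prod.case
    by (rule keys_frag_extend_subset[OF assms(2)]) (use z in \<open>auto simp: keys_frag_of\<close>)
qed

lemma mulf_commute:
  assumes "Poly_Mapping.keys a \<subseteq> carrier M \<times> carrier N" "Poly_Mapping.keys b \<subseteq> carrier M \<times> carrier N"
  shows "mulf a b = mulf b a"
  using assms(1)
proof (induction a rule: frag_induction)
  case (one z)
  obtain x y where z: "z = (x, y)" "x \<in> carrier M" "y \<in> carrier N" using one by auto
  from assms(2) show ?case
  proof (induction b rule: frag_induction)
    case (one w)
    obtain x' y' where "w = (x', y')" "x' \<in> carrier M" "y' \<in> carrier N" using one by auto
    then show ?case using z by (simp add: mulf_frag_of M.m_comm N.m_comm)
  qed (simp_all add: mulf_diff_left mulf_diff_right)
qed (simp_all add: mulf_diff_left mulf_diff_right)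

lemma mulf_assoc:
  assumes "Poly_Mapping.keys a \<subseteq> carrier M \<times> carrier N" "Poly_Mapping.keys b \<subseteq> carrier M \<times> carrier N"
    "Poly_Mapping.keys c \<subseteq> carrier M \<times> carrier N"
  shows "mulf (mulf a b) c = mulf a (mulf b c)"
  using assms(1)
proof (induction a rule: frag_induction)
  case (one z)
  obtain x y where z: "z = (x, y)" "x \<in> carrier M" "y \<in> carrier N" using one by auto
  from assms(2) show ?case
  proof (induction b rule: frag_induction)
    case (one w)
    obtain x' y' where w: "w = (x', y')" "x' \<in> carrier M" "y' \<in> carrier N" using one by auto
    from assms(3) show ?case
    proof (induction c rule: frag_induction)
      case (one v)
      obtain x'' y'' where "v = (x'', y'')" "x'' \<in> carrier M" "y'' \<in> carrier N" using one by auto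
      then show ?case using z w by (simp add: mulf_frag_of M.m_assoc N.m_assoc)
    qed (simp_all add: mulf_diff_left mulf_diff_right)
  qed (simp_all add: mulf_diff_left mulf_diff_right)
qed (simp_all add: mulf_diff_left mulf_diff_right)

lemma mulf_one:
  assumes "Poly_Mapping.keys a \<subseteq> carrier M \<times> carrier N"
  shows "mulf (frag_of (\<one>\<^bsub>M\<^esub>, \<one>\<^bsub>N\<^esub>)) a = a"
  using assms
proof (induction a rule: frag_induction)
  case (one z)
  then show ?case by (auto simp: mulf_frag_of)
qed (simp_all add: mulf_diff_right)

text \<open>A generating relation times a pair is again a generating relation of the same kind, by
  distributivity or by compatibility of scalars with the product. So the relations form an ideal and
  the product descends to cosets.\<close>

lemma mulf_rels_left:
  assumes "h \<in> HH" "Poly_Mapping.keys b \<subseteq> carrier M \<times> carrier N"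
  shows "mulf h b \<in> HH"
  using assms(1)
proof (induction rule: rels_induct)
  case (gen g)
  from assms(2) show ?case
  proof (induction b rule: frag_induction)
    case (one w)
    obtain x' y' where w: "w = (x', y')" "x' \<in> carrier M" "y' \<in> carrier N" using one by auto
    from gen show ?case
    proof (cases rule: gens_cases)
      case (a x z y)
      then have "mulf g (frag_of w) = frag_of (x \<otimes>\<^bsub>M\<^esub> x' \<oplus>\<^bsub>M\<^esub> z \<otimes>\<^bsub>M\<^esub> x', y \<otimes>\<^bsub>N\<^esub> y') -
          frag_of (x \<otimes>\<^bsub>M\<^esub> x', y \<otimes>\<^bsub>N\<^esub> y') - frag_of (z \<otimes>\<^bsub>M\<^esub> x', y \<otimes>\<^bsub>N\<^esub> y')"
        using w by (simp add: mulf_diff_left mulf_frag_of M.l_distr)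
      moreover have "x \<otimes>\<^bsub>M\<^esub> x' \<in> carrier M" "z \<otimes>\<^bsub>M\<^esub> x' \<in> carrier M" "y \<otimes>\<^bsub>N\<^esub> y' \<in> carrier N"
        using a w by simp_all
      ultimately have "mulf g (frag_of w) \<in> gens" unfolding gens_def by blast
      then show ?thesis by (rule gens_rels)
    next
      case (b x y z)
      then have "mulf g (frag_of w) = frag_of (x \<otimes>\<^bsub>M\<^esub> x', y \<otimes>\<^bsub>N\<^esub> y' \<oplus>\<^bsub>N\<^esub> z \<otimes>\<^bsub>N\<^esub> y') -
          frag_of (x \<otimes>\<^bsub>M\<^esub> x', y \<otimes>\<^bsub>N\<^esub> y') - frag_of (x \<otimes>\<^bsub>M\<^esub> x', z \<otimes>\<^bsub>N\<^esub> y')"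
        using w by (simp add: mulf_diff_left mulf_frag_of N.l_distr)
      moreover have "x \<otimes>\<^bsub>M\<^esub> x' \<in> carrier M" "z \<otimes>\<^bsub>N\<^esub> y' \<in> carrier N" "y \<otimes>\<^bsub>N\<^esub> y' \<in> carrier N"
        using b w by simp_all
      ultimately have "mulf g (frag_of w) \<in> gens" unfolding gens_def by blast
      then show ?thesis by (rule gens_rels)
    next
      case (c s x y)
      then have "mulf g (frag_of w) = frag_of (s \<odot>\<^bsub>M\<^esub> (x \<otimes>\<^bsub>M\<^esub> x'), y \<otimes>\<^bsub>N\<^esub> y') -
          frag_of (x \<otimes>\<^bsub>M\<^esub> x', s \<odot>\<^bsub>N\<^esub> (y \<otimes>\<^bsub>N\<^esub> y'))"
        using w by (simp add: mulf_diff_left mulf_frag_of M.smult_assoc2 N.smult_assoc2)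
      moreover have "x \<otimes>\<^bsub>M\<^esub> x' \<in> carrier M" "y \<otimes>\<^bsub>N\<^esub> y' \<in> carrier N"
        using c w by simp_all
      ultimately have "mulf g (frag_of w) \<in> gens" unfolding gens_def using c by blast
      then show ?thesis by (rule gens_rels)
    qed
  qed (simp_all add: rels_zero mulf_diff_right rels_diff)
qed (simp_all add: rels_zero mulf_uminus mulf_add_left rels_add rels_uminus)

lemma cls_mult:
  assumes "Poly_Mapping.keys a \<subseteq> carrier M \<times> carrier N" "Poly_Mapping.keys b \<subseteq> carrier M \<times> carrier N"
  shows "cls a \<otimes>\<^bsub>TT\<^esub> cls b = cls (mulf a b)"
proof -
  have k: "Poly_Mapping.keys a' \<subseteq> carrier M \<times> carrier N" if "a' \<in> cls a'' "
    "Poly_Mapping.keys a'' \<subseteq> carrier M \<times> carrier N" for a' a''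
    using that rels_keys[of "a' - a''"] keys_frag_add_subset[of "a' - a''" _ a''] by (simp add: mem_cls)
  have "cls a \<otimes>\<^bsub>TT\<^esub> cls b = tensor_class S M N {mulf a' b' |a' b'. a' \<in> cls a \<and> b' \<in> cls b}"
    by (simp add: tensor_def mulf_def)
  also have "\<dots> = cls (mulf a b)"
  proof (rule tensor_class_single)
    show "{mulf a' b' |a' b'. a' \<in> cls a \<and> b' \<in> cls b} \<subseteq> cls (mulf a b)"
    proof safe
      fix a' b' assume *: "a' \<in> cls a" "b' \<in> cls b"
      \<comment> \<open>One factor is changed at a time; commutativity moves the relation
        \<open>b' - b\<close> into the first position.\<close>
      have "mulf a' b' - mulf a b = mulf (a' - a) b' + mulf (b' - b) a"
        using mulf_commute[of b' a] mulf_commute[of b a] assms k[OF *(2)]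
        by (simp add: mulf_diff_left)
      then show "mulf a' b' \<in> cls (mulf a b)"
        using * assms k[OF *(2)] by (simp add: mem_cls rels_add mulf_rels_left)
    qed
    show "{mulf a' b' |a' b'. a' \<in> cls a \<and> b' \<in> cls b} \<noteq> {}"
    proof -
      have "a \<in> cls a" "b \<in> cls b" using rels_zero by (simp_all add: mem_cls)
      then show ?thesis by blast
    qed
  qed
  finally show ?thesis .
qed

lemma one_tensor: "\<one>\<^bsub>TT\<^esub> = cls (frag_of (\<one>\<^bsub>M\<^esub>, \<one>\<^bsub>N\<^esub>))"
  by (simp add: tensor_def pure_tensor_def)

lemma cring_tensor: "cring TT"
proof (rule cringI)
  show "abelian_group TT" ..
  show "Group.comm_monoid TT"
  proof (rule comm_monoidI)
    fix x y assume "x \<in> carrier TT" "y \<in> carrier TT"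
    then show "x \<otimes>\<^bsub>TT\<^esub> y \<in> carrier TT"
      by (elim carrier_cases) (simp add: cls_mult mulf_keys cls_carrier)
  next
    show "\<one>\<^bsub>TT\<^esub> \<in> carrier TT" by (simp add: one_tensor cls_carrier keys_frag_of)
  next
    fix x y z assume "x \<in> carrier TT" "y \<in> carrier TT" "z \<in> carrier TT"
    then show "x \<otimes>\<^bsub>TT\<^esub> y \<otimes>\<^bsub>TT\<^esub> z = x \<otimes>\<^bsub>TT\<^esub> (y \<otimes>\<^bsub>TT\<^esub> z)"
      by (elim carrier_cases) (simp add: cls_mult mulf_assoc mulf_keys)
  next
    fix x assume "x \<in> carrier TT"
    then show "\<one>\<^bsub>TT\<^esub> \<otimes>\<^bsub>TT\<^esub> x = x"
      by (elim carrier_cases) (simp add: cls_mult one_tensor mulf_one keys_frag_of)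
  next
    fix x y assume "x \<in> carrier TT" "y \<in> carrier TT"
    then show "x \<otimes>\<^bsub>TT\<^esub> y = y \<otimes>\<^bsub>TT\<^esub> x"
      by (elim carrier_cases) (metis cls_mult mulf_commute)
  qed
  fix x y z assume "x \<in> carrier TT" "y \<in> carrier TT" "z \<in> carrier TT"
  then show "(x \<oplus>\<^bsub>TT\<^esub> y) \<otimes>\<^bsub>TT\<^esub> z = x \<otimes>\<^bsub>TT\<^esub> z \<oplus>\<^bsub>TT\<^esub> y \<otimes>\<^bsub>TT\<^esub> z"
    by (elim carrier_cases) (simp add: cls_mult cls_add keys_frag_add_subset mulf_add_left)
qed

lemma pure_mult: "x \<in> carrier M \<Longrightarrow> y \<in> carrier N \<Longrightarrow> x' \<in> carrier M \<Longrightarrow> y' \<in> carrier N \<Longrightarrow>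
    pure x y \<otimes>\<^bsub>TT\<^esub> pure x' y' = pure (x \<otimes>\<^bsub>M\<^esub> x') (y \<otimes>\<^bsub>N\<^esub> y')"
  unfolding pure_tensor_def by (simp add: cls_mult keys_frag_of mulf_frag_of)

lemma pure_one: "pure \<one>\<^bsub>M\<^esub> \<one>\<^bsub>N\<^esub> = \<one>\<^bsub>TT\<^esub>"
  by (simp add: tensor_def)

sublocale T: cring TT by (rule cring_tensor)

end

section \<open>Flatness of free modules\<close>

lemma additive_finsum:
  fixes G :: "('a, 'c) ring_scheme" and H :: "('b, 'd) ring_scheme"
  assumes "abelian_group G" "abelian_group H"
    and closed: "\<And>x. x \<in> carrier G \<Longrightarrow> h x \<in> carrier H"
    and add: "\<And>x y. x \<in> carrier G \<Longrightarrow> y \<in> carrier G \<Longrightarrow> h (x \<oplus>\<^bsub>G\<^esub> y) = h x \<oplus>\<^bsub>H\<^esub> h y"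
    and "finite S" "g \<in> S \<rightarrow> carrier G"
  shows "h (finsum G g S) = finsum H (\<lambda>i. h (g i)) S"
proof -
  interpret G: abelian_group G by fact
  interpret H: abelian_group H by fact
  have zero: "h \<zero>\<^bsub>G\<^esub> = \<zero>\<^bsub>H\<^esub>"
    using add[of "\<zero>\<^bsub>G\<^esub>" "\<zero>\<^bsub>G\<^esub>"] closed[of "\<zero>\<^bsub>G\<^esub>"] H.add.r_cancel_one' by simp
  from assms(5,6) show ?thesis
  proof (induction S rule: finite_induct)
    case (insert x F)
    then show ?case using closed by (subst G.finsum_insert H.finsum_insert; auto simp: add Pi_def)+
  qed (simp add: zero)
qed

lemma additive_zero:
  fixes G :: "('a, 'c) ring_scheme" and H :: "('b, 'd) ring_scheme"
  assumes "abelian_group G" "abelian_group H"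
    and closed: "\<And>x. x \<in> carrier G \<Longrightarrow> h x \<in> carrier H"
    and add: "\<And>x y. x \<in> carrier G \<Longrightarrow> y \<in> carrier G \<Longrightarrow> h (x \<oplus>\<^bsub>G\<^esub> y) = h x \<oplus>\<^bsub>H\<^esub> h y"
  shows "h \<zero>\<^bsub>G\<^esub> = \<zero>\<^bsub>H\<^esub>"
  using additive_finsum[OF assms(1,2), of h "{}" "\<lambda>_. \<zero>\<^bsub>G\<^esub>"] assms(3,4)
  by (simp add: abelian_monoid.finsum_empty abelian_group.axioms(1) assms(1,2))

lemma additive_uminus:
  fixes G :: "('a, 'c) ring_scheme" and H :: "('b, 'd) ring_scheme"
  assumes "abelian_group G" "abelian_group H"
    and closed: "\<And>x. x \<in> carrier G \<Longrightarrow> h x \<in> carrier H"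
    and add: "\<And>x y. x \<in> carrier G \<Longrightarrow> y \<in> carrier G \<Longrightarrow> h (x \<oplus>\<^bsub>G\<^esub> y) = h x \<oplus>\<^bsub>H\<^esub> h y"
    and "x \<in> carrier G"
  shows "h (\<ominus>\<^bsub>G\<^esub> x) = \<ominus>\<^bsub>H\<^esub> h x"
proof -
  interpret G: abelian_group G by fact
  interpret H: abelian_group H by fact
  show ?thesis
    using add[of "\<ominus>\<^bsub>G\<^esub> x" x] additive_zero[OF assms(1-4)] assms closed
    by (intro H.minus_equality[symmetric]) (simp_all add: G.l_neg)
qed

text \<open>Each coordinate \<open>co b\<close> induces an additive map from Q \<otimes> N' to N',
  natural in N'. If f is injective, an element killed by id \<otimes> f has all coordinates zero,
  hence is zero. The expansion is demanded for every finite index set above some S, so that the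
  expansions of two summands can be written over the same set.\<close>

lemma flat_module_free:
  fixes A :: "('s, 'r) ring_scheme" and Q :: "('s, 'q, 'c) module_scheme"
  assumes "module A Q"
    and e: "\<And>b. b \<in> Bs \<Longrightarrow> e b \<in> carrier Q"
    and c: "\<And>b q. b \<in> Bs \<Longrightarrow> q \<in> carrier Q \<Longrightarrow> co b q \<in> carrier A"
    and c_add: "\<And>b q q'. b \<in> Bs \<Longrightarrow> q \<in> carrier Q \<Longrightarrow> q' \<in> carrier Q \<Longrightarrow> co b (q \<oplus>\<^bsub>Q\<^esub> q') = co b q \<oplus>\<^bsub>A\<^esub> co b q'"
    and c_smult: "\<And>b a q. b \<in> Bs \<Longrightarrow> a \<in> carrier A \<Longrightarrow> q \<in> carrier Q \<Longrightarrow> co b (a \<odot>\<^bsub>Q\<^esub> q) = a \<otimes>\<^bsub>A\<^esub> co b q"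
    and expand: "\<And>q. q \<in> carrier Q \<Longrightarrow> \<exists>S. finite S \<and> S \<subseteq> Bs \<and>
      (\<forall>S'. finite S' \<and> S \<subseteq> S' \<and> S' \<subseteq> Bs \<longrightarrow> q = finsum Q (\<lambda>b. co b q \<odot>\<^bsub>Q\<^esub> e b) S')"
  shows "flat_module A Q"
  unfolding flat_module_def
proof (intro conjI allI ballI impI)
  show "module A Q" by fact
  fix N' :: "('s, (nat \<Rightarrow> 's) set) module" and N :: "('s, (nat \<Rightarrow> 's) set) module" and f
  assume f0: "f \<in> linear_maps A N' N" and *: "module A N' \<and> module A N \<and> inj_on f (carrier N')"
  interpret Q: module A Q by fact
  interpret N: module A N using * by simp
  interpret N': module A N' using * by simp
  interpret tensor_hom A Q N' Q N id f
    by unfold_locales (use f0 in \<open>auto simp: linear_maps_def\<close>)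
  have fc: "f x \<in> carrier N" and fadd: "f (x \<oplus>\<^bsub>N'\<^esub> y) = f x \<oplus>\<^bsub>N\<^esub> f y"
    and fsm: "a \<in> carrier A \<Longrightarrow> f (a \<odot>\<^bsub>N'\<^esub> x) = a \<odot>\<^bsub>N\<^esub> f x"
    if "x \<in> carrier N'" "y \<in> carrier N'" for x y a
    using f0 that by (auto simp: linear_maps_def)
  define PH where "PH b h \<longleftrightarrow> (\<forall>t\<in>carrier A.TT. h t \<in> carrier N') \<and>
      (\<forall>t\<in>carrier A.TT. \<forall>t'\<in>carrier A.TT. h (t \<oplus>\<^bsub>A.TT\<^esub> t') = h t \<oplus>\<^bsub>N'\<^esub> h t') \<and>
      (\<forall>q\<in>carrier Q. \<forall>x\<in>carrier N'. h (A.pure q x) = co b q \<odot>\<^bsub>N'\<^esub> x)" for b h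
  define PH' where "PH' b h \<longleftrightarrow> (\<forall>t\<in>carrier B.TT. h t \<in> carrier N) \<and>
      (\<forall>t\<in>carrier B.TT. \<forall>t'\<in>carrier B.TT. h (t \<oplus>\<^bsub>B.TT\<^esub> t') = h t \<oplus>\<^bsub>N\<^esub> h t') \<and>
      (\<forall>q\<in>carrier Q. \<forall>x\<in>carrier N. h (B.pure q x) = co b q \<odot>\<^bsub>N\<^esub> x)" for b h
  have "\<exists>h. PH b h" if "b \<in> Bs" for b
    unfolding PH_def
    by (rule A.universal[where G = N' and \<beta> = "\<lambda>q x. co b q \<odot>\<^bsub>N'\<^esub> x"])
       (auto simp: that c c_add c_smult N'.smult_l_distr N'.smult_r_distr N'.smult_assoc1[symmetric] Q.R.m_comm N'.abelian_group_axioms)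
  then obtain h where h: "\<And>b. b \<in> Bs \<Longrightarrow> PH b (h b)" by metis
  have "\<exists>h. PH' b h" if "b \<in> Bs" for b
    unfolding PH'_def
    by (rule B.universal[where G = N and \<beta> = "\<lambda>q x. co b q \<odot>\<^bsub>N\<^esub> x"])
       (auto simp: that c c_add c_smult N.smult_l_distr N.smult_r_distr N.smult_assoc1[symmetric] Q.R.m_comm N.abelian_group_axioms)
  then obtain h' where h': "\<And>b. b \<in> Bs \<Longrightarrow> PH' b (h' b)" by metis
  have nat: "f (h b t) = h' b (tm t)" if "b \<in> Bs" "t \<in> carrier A.TT" for b t
    using that(2)
  proof (induction rule: A.tensor_induct)
    case (pure x y)
    then show ?case using h[OF that(1)] h'[OF that(1)] that
      unfolding tensor_map_pure by (simp add: PH_def PH'_def fc fsm c)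
  next
    case (add s t)
    then show ?case using h[OF that(1)] h'[OF that(1)] tensor_map_closed[OF add(1)] tensor_map_closed[OF add(2)]
      unfolding tensor_map_add[OF add(1,2)] by (simp add: PH_def PH'_def fadd id_def)
  qed
  have expT: "\<exists>S. finite S \<and> S \<subseteq> Bs \<and> (\<forall>S'. finite S' \<and> S \<subseteq> S' \<and> S' \<subseteq> Bs \<longrightarrow>
      t = finsum A.TT (\<lambda>b. A.pure (e b) (h b t)) S')" if "t \<in> carrier A.TT" for t
    using that
  proof (induction rule: A.tensor_induct)
    case (pure q x)
    obtain S where S: "finite S" "S \<subseteq> Bs"
      "\<And>S'. finite S' \<and> S \<subseteq> S' \<and> S' \<subseteq> Bs \<Longrightarrow> q = finsum Q (\<lambda>b. co b q \<odot>\<^bsub>Q\<^esub> e b) S'"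
      using expand[OF pure(1)] by blast
    have "A.pure q x = finsum A.TT (\<lambda>b. A.pure (e b) (h b (A.pure q x))) S'"
      if S': "finite S' \<and> S \<subseteq> S' \<and> S' \<subseteq> Bs" for S'
    proof -
      have "A.pure q x = A.pure (finsum Q (\<lambda>b. co b q \<odot>\<^bsub>Q\<^esub> e b) S') x"
        using S(3)[OF S'] by simp
      also have "\<dots> = finsum A.TT (\<lambda>b. A.pure (co b q \<odot>\<^bsub>Q\<^esub> e b) x) S'"
        by (rule additive_finsum[where G = Q and H = A.TT and h = "\<lambda>q. A.pure q x"])
           (use S' pure c e in \<open>auto simp: A.pure_add_left Q.abelian_group_axioms A.T.abelian_group_axioms\<close>)
      also have "\<dots> = finsum A.TT (\<lambda>b. A.pure (e b) (h b (A.pure q x))) S'"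
        by (rule A.T.finsum_cong')
           (use S' pure c e h in \<open>auto simp: PH_def A.pure_smult\<close>)
      finally show ?thesis .
    qed
    then show ?case using S(1,2) by blast
  next
    case (add s t)
    obtain S1 where S1: "finite S1" "S1 \<subseteq> Bs" "\<And>S'. finite S' \<and> S1 \<subseteq> S' \<and> S' \<subseteq> Bs \<Longrightarrow>
      s = finsum A.TT (\<lambda>b. A.pure (e b) (h b s)) S'" using add(3) by blast
    obtain S2 where S2: "finite S2" "S2 \<subseteq> Bs" "\<And>S'. finite S' \<and> S2 \<subseteq> S' \<and> S' \<subseteq> Bs \<Longrightarrow>
      t = finsum A.TT (\<lambda>b. A.pure (e b) (h b t)) S'" using add(4) by blast
    have "s \<oplus>\<^bsub>A.TT\<^esub> t = finsum A.TT (\<lambda>b. A.pure (e b) (h b (s \<oplus>\<^bsub>A.TT\<^esub> t))) S'"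
      if S': "finite S' \<and> S1 \<union> S2 \<subseteq> S' \<and> S' \<subseteq> Bs" for S'
    proof -
      have "s \<oplus>\<^bsub>A.TT\<^esub> t = finsum A.TT (\<lambda>b. A.pure (e b) (h b s)) S' \<oplus>\<^bsub>A.TT\<^esub> finsum A.TT (\<lambda>b. A.pure (e b) (h b t)) S'"
        by (rule arg_cong2[where f = "ring.add A.TT", OF S1(3) S2(3)]) (use S' in blast)+
      also have "\<dots> = finsum A.TT (\<lambda>b. A.pure (e b) (h b s) \<oplus>\<^bsub>A.TT\<^esub> A.pure (e b) (h b t)) S'"
        by (rule A.T.finsum_addf[symmetric]) (use S' add(1,2) h e in \<open>auto simp: PH_def\<close>)
      also have "\<dots> = finsum A.TT (\<lambda>b. A.pure (e b) (h b (s \<oplus>\<^bsub>A.TT\<^esub> t))) S'"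
        by (rule A.T.finsum_cong') (use S' add(1,2) h e in \<open>auto simp: PH_def A.pure_add_right\<close>)
      finally show ?thesis .
    qed
    moreover have "finite (S1 \<union> S2)" "S1 \<union> S2 \<subseteq> Bs" using S1 S2 by auto
    ultimately show ?case by blast
  qed
  have ker: "t = \<zero>\<^bsub>A.TT\<^esub>" if t: "t \<in> carrier A.TT" "tm t = \<zero>\<^bsub>B.TT\<^esub>" for t
  proof -
    have z: "h b t = \<zero>\<^bsub>N'\<^esub>" if b: "b \<in> Bs" for b
    proof -
      have "h' b \<zero>\<^bsub>B.TT\<^esub> = \<zero>\<^bsub>N\<^esub>"
        using h'[OF b] by (intro additive_zero) (auto simp: PH'_def B.T.abelian_group_axioms N.abelian_group_axioms)
      then have "f (h b t) = \<zero>\<^bsub>N\<^esub>" using nat[OF b t(1)] t(2) by simp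
      moreover have "f \<zero>\<^bsub>N'\<^esub> = \<zero>\<^bsub>N\<^esub>"
        by (rule additive_zero) (auto simp: N'.abelian_group_axioms N.abelian_group_axioms fc fadd)
      moreover have "h b t \<in> carrier N'" using h[OF b] t by (simp add: PH_def)
      moreover have "inj_on f (carrier N')" using * by simp
      ultimately show ?thesis by (metis inj_onD N'.zero_closed)
    qed
    obtain S where S0: "finite S" "S \<subseteq> Bs" "\<forall>S'. finite S' \<and> S \<subseteq> S' \<and> S' \<subseteq> Bs \<longrightarrow>
        t = finsum A.TT (\<lambda>b. A.pure (e b) (h b t)) S'"
      using expT[OF t(1)] by (elim exE conjE)
    have S: "finite S" "S \<subseteq> Bs" "t = finsum A.TT (\<lambda>b. A.pure (e b) (h b t)) S"
      using S0(1,2) by (simp, simp) (rule S0(3)[rule_format], simp add: S0(1,2))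
    have "finsum A.TT (\<lambda>b. A.pure (e b) (h b t)) S = finsum A.TT (\<lambda>b. \<zero>\<^bsub>A.TT\<^esub>) S"
      by (rule A.T.finsum_cong') (use S(2) z e in \<open>auto simp: A.pure_zero_right\<close>)
    then show ?thesis using S(3) by simp
  qed
  show "inj_on (tensor_map A Q N id f) (carrier (tensor A Q N'))"
  proof (rule inj_onI)
    fix t t' assume t: "t \<in> carrier A.TT" "t' \<in> carrier A.TT" "tm t = tm t'"
    have um: "tm (\<ominus>\<^bsub>A.TT\<^esub> t') = \<ominus>\<^bsub>B.TT\<^esub> tm t'"
      by (rule additive_uminus[OF A.T.abelian_group_axioms B.T.abelian_group_axioms tensor_map_closed tensor_map_add t(2)])
    have "tm (t \<oplus>\<^bsub>A.TT\<^esub> \<ominus>\<^bsub>A.TT\<^esub> t') = \<zero>\<^bsub>B.TT\<^esub>"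
      using t um tensor_map_closed[of t'] by (simp add: tensor_map_add B.T.r_neg)
    then have "t \<oplus>\<^bsub>A.TT\<^esub> \<ominus>\<^bsub>A.TT\<^esub> t' = \<zero>\<^bsub>A.TT\<^esub>" using t by (intro ker) simp_all
    then have "\<ominus>\<^bsub>A.TT\<^esub> (\<ominus>\<^bsub>A.TT\<^esub> t') = t" using t by (intro A.T.minus_equality) simp_all
    then show "t = t'" using t by simp
  qed
qed

section \<open>Truncated polynomial algebras\<close>

definition trunc_coeffs :: "nat \<Rightarrow> 'a::zero fps \<Rightarrow> nat \<Rightarrow> 'a" where
  "trunc_coeffs n f = (\<lambda>i. if i < n then fps_nth f i else 0)"

text \<open>The algebra k[\<epsilon>]/(\<epsilon>^n), an element being its coefficient sequence.
  This places the carrier in the type \<open>nat \<Rightarrow> 'k\<close> over which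
  unobstructedness quantifies.\<close>

definition trunc :: "nat \<Rightarrow> ('k::field, nat \<Rightarrow> 'k) module" where
  "trunc n = \<lparr>carrier = {f. \<forall>i\<ge>n. f i = 0},
     monoid.mult = (\<lambda>f g. trunc_coeffs n (Abs_fps f * Abs_fps g)), monoid.one = trunc_coeffs n 1,
     ring.zero = (\<lambda>_. 0), ring.add = (\<lambda>f g i. f i + g i), module.smult = (\<lambda>c f i. c * f i)\<rparr>"

lemma trunc_coeffs_carrier [simp]: "trunc_coeffs n f \<in> carrier (trunc n)"
  by (simp add: trunc_def trunc_coeffs_def)

lemma trunc_carrier_iff: "f \<in> carrier (trunc n) \<longleftrightarrow> (\<forall>i\<ge>n. f i = 0)"
  by (simp add: trunc_def)

lemma trunc_coeffs_Abs: "f \<in> carrier (trunc n) \<Longrightarrow> trunc_coeffs n (Abs_fps f) = f"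
  by (auto simp: trunc_def trunc_coeffs_def fun_eq_iff)

lemma trunc_carrier_cases:
  assumes "f \<in> carrier (trunc n)"
  obtains F where "f = trunc_coeffs n F"
  using trunc_coeffs_Abs[OF assms] by metis

text \<open>Coefficients below n of a product see only coefficients below n of the factors.\<close>

lemma trunc_coeffs_mult_left:
  "trunc_coeffs n (Abs_fps (trunc_coeffs n F) * G) = trunc_coeffs n (F * G :: 'a::comm_ring_1 fps)"
  by (auto simp: trunc_coeffs_def fun_eq_iff fps_mult_nth intro!: sum.cong)

lemma trunc_mult: "trunc_coeffs n F \<otimes>\<^bsub>trunc n\<^esub> trunc_coeffs n G = trunc_coeffs n (F * G)"
  using trunc_coeffs_mult_left[of n F "Abs_fps (trunc_coeffs n G)"] trunc_coeffs_mult_left[of n G F]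
  by (simp add: trunc_def mult.commute)

lemma trunc_add: "trunc_coeffs n F \<oplus>\<^bsub>trunc n\<^esub> trunc_coeffs n G = trunc_coeffs n (F + G)"
  by (auto simp: trunc_def trunc_coeffs_def)

lemma trunc_zero: "\<zero>\<^bsub>trunc n\<^esub> = trunc_coeffs n 0"
  by (auto simp: trunc_def trunc_coeffs_def)

lemma trunc_one: "\<one>\<^bsub>trunc n\<^esub> = trunc_coeffs n 1"
  by (auto simp: trunc_def)

lemma trunc_smult: "c \<odot>\<^bsub>trunc n\<^esub> trunc_coeffs n F = trunc_coeffs n (fps_const c * F)"
  by (auto simp: trunc_def trunc_coeffs_def fun_eq_iff)

lemmas trunc_ops = trunc_mult trunc_add trunc_zero trunc_one trunc_smult

lemma trunc_add_apply: "(f \<oplus>\<^bsub>trunc n\<^esub> g) i = f i + g i"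
  by (simp add: trunc_def)

lemma trunc_zero_apply: "\<zero>\<^bsub>trunc n\<^esub> i = 0"
  by (simp add: trunc_def)

lemma trunc_mult_apply: "i < n \<Longrightarrow> (f \<otimes>\<^bsub>trunc n\<^esub> g) i = fps_nth (Abs_fps f * Abs_fps g) i"
  by (simp add: trunc_def trunc_coeffs_def)

lemma trunc_smult_apply: "(c \<odot>\<^bsub>trunc n\<^esub> g) i = c * g i"
  by (simp add: trunc_def)

lemma abelian_group_trunc: "abelian_group (trunc n)"
proof (rule abelian_groupI)
  fix x :: "nat \<Rightarrow> 'a" assume "x \<in> carrier (trunc n)"
  then obtain F where "x = trunc_coeffs n F" by (rule trunc_carrier_cases)
  then have "trunc_coeffs n (- F) \<oplus>\<^bsub>trunc n\<^esub> x = \<zero>\<^bsub>trunc n\<^esub>" by (simp add: trunc_ops)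
  then show "\<exists>y\<in>carrier (trunc n). y \<oplus>\<^bsub>trunc n\<^esub> x = \<zero>\<^bsub>trunc n\<^esub>"
    using trunc_coeffs_carrier by blast
qed (auto elim!: trunc_carrier_cases simp: trunc_ops add_ac)

lemma cring_trunc: "cring (trunc n)"
proof (rule cringI)
  show "abelian_group (trunc n)" by (rule abelian_group_trunc)
  show "Group.comm_monoid (trunc n)"
    by (rule comm_monoidI) (auto elim!: trunc_carrier_cases simp: trunc_ops mult_ac)
qed (auto elim!: trunc_carrier_cases simp: trunc_ops algebra_simps)

definition add_ring :: "'a::ring_1 ring" where
  "add_ring = \<lparr>carrier = UNIV, monoid.mult = (*), monoid.one = 1, ring.zero = 0, ring.add = (+)\<rparr>"

lemma abelian_group_add_ring: "abelian_group (add_ring :: 'a::ring_1 ring)"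
  by (rule abelian_groupI) (auto simp: add_ring_def add_ac intro: exI[of _ "- x" for x] add.left_inverse)

lemma cring_base_field: "cring (base_field :: ('k::field, 'k) module)"
proof (rule cringI)
  show "abelian_group (base_field :: ('k::field, 'k) module)"
    by (rule abelian_groupI) (auto simp: base_field_def add_ac intro: exI[of _ "- x" for x] add.left_inverse)
  show "Group.comm_monoid (base_field :: ('k::field, 'k) module)"
    by (rule comm_monoidI) (auto simp: base_field_def mult_ac)
qed (auto simp: base_field_def algebra_simps)

lemma algebra_base_field: "algebra base_field (base_field :: ('k::field, 'k) module)"
  by (rule algebraI) (auto simp: cring_base_field, auto simp: base_field_def algebra_simps)

lemma algebra_trunc: "algebra base_field (trunc n :: ('k::field, nat \<Rightarrow> 'k) module)"
  by (rule algebraI)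
     (auto simp: cring_base_field cring_trunc, auto simp: base_field_def trunc_ops algebra_simps
        fps_const_add[symmetric] fps_const_mult[symmetric]
        elim!: trunc_carrier_cases simp del: fps_const_add fps_const_mult)

lemma trunc_unit:
  assumes "f \<in> carrier (trunc n)" "f 0 \<noteq> 0"
  shows "\<exists>g\<in>carrier (trunc n). f \<otimes>\<^bsub>trunc n\<^esub> g = \<one>\<^bsub>trunc n\<^esub>"
proof -
  have "trunc_coeffs n (Abs_fps f) \<otimes>\<^bsub>trunc n\<^esub> trunc_coeffs n (inverse (Abs_fps f)) = \<one>\<^bsub>trunc n\<^esub>"
    using assms(2) inverse_mult_eq_1[of "Abs_fps f"] by (simp add: trunc_ops mult.commute)
  then show ?thesis using trunc_coeffs_Abs[OF assms(1)] trunc_coeffs_carrier by metis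
qed

abbreviation "trunc_order n k \<equiv> {f \<in> carrier (trunc n). \<forall>j<k. f j = 0}"

lemma trunc_mult_low:
  assumes "\<And>j. j \<le> i \<Longrightarrow> g j = 0" "i < n"
  shows "(f \<otimes>\<^bsub>trunc n\<^esub> g) i = 0" "(g \<otimes>\<^bsub>trunc n\<^esub> f) i = 0"
  using assms by (simp_all add: trunc_mult_apply fps_mult_nth)

lemma ideal_trunc_order: "ideal (trunc_order n k) (trunc n :: ('k::field, nat \<Rightarrow> 'k) module)"
proof (rule idealI)
  interpret cring "trunc n :: ('k, nat \<Rightarrow> 'k) module" by (rule cring_trunc)
  show "ring (trunc n :: ('k, nat \<Rightarrow> 'k) module)" ..
  have um: "(\<ominus>\<^bsub>trunc n\<^esub> f) i = - f i" if "f \<in> carrier (trunc n)" for f :: "nat \<Rightarrow> 'k" and i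
    using fun_cong[OF l_neg[OF that], of i] by (simp add: trunc_add_apply trunc_zero_apply eq_neg_iff_add_eq_0)
  show "subgroup (trunc_order n k) (add_monoid (trunc n :: ('k, nat \<Rightarrow> 'k) module))"
    by (rule add.subgroupI) (auto simp: um trunc_add_apply trunc_zero_apply intro!: exI[of _ "\<zero>\<^bsub>trunc n\<^esub>"] simp del: add.inv_eq_1_iff)
  fix a x :: "nat \<Rightarrow> 'k" assume *: "a \<in> trunc_order n k" "x \<in> carrier (trunc n)"
  have "(x \<otimes>\<^bsub>trunc n\<^esub> a) j = 0 \<and> (a \<otimes>\<^bsub>trunc n\<^esub> x) j = 0" if "j < k" for j
  proof (cases "j < n")
    case True then show ?thesis using * that using trunc_mult_low[of j a n x] by auto
  next
    case False then show ?thesis using m_closed[of x a] m_closed[of a x] * by (simp add: trunc_carrier_iff)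
  qed
  then show "x \<otimes>\<^bsub>trunc n\<^esub> a \<in> trunc_order n k" "a \<otimes>\<^bsub>trunc n\<^esub> x \<in> trunc_order n k"
    using * by auto
qed

text \<open>An element of least order k in the ideal is \<epsilon>^k times a unit, so it generates
  everything of order at least k. Consequently there are only finitely many ideals, from which the
  descending chain condition follows.\<close>

lemma trunc_ideal_eq:
  fixes I :: "(nat \<Rightarrow> 'k::field) set"
  assumes "ideal I (trunc n)"
  shows "\<exists>k\<le>n. I = trunc_order n k"
proof -
  interpret ideal I "trunc n" by fact
  define k where "k = (LEAST i. i = n \<or> (\<exists>f\<in>I. f i \<noteq> 0))"
  have k: "k = n \<or> (\<exists>f\<in>I. f k \<noteq> 0)" unfolding k_def by (rule LeastI[of _ n]) simp
  have kn: "k \<le> n" unfolding k_def by (rule Least_le) simp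
  have below: "f i = 0" if "f \<in> I" "i < k" for f i
    using not_less_Least[of i "\<lambda>i. i = n \<or> (\<exists>f\<in>I. f i \<noteq> 0)"] that unfolding k_def by blast
  have "I = trunc_order n k"
  proof
    show "I \<subseteq> trunc_order n k" using below a_subset by auto
    show "trunc_order n k \<subseteq> I"
    proof
      fix f :: "nat \<Rightarrow> 'k" assume f: "f \<in> trunc_order n k"
      show "f \<in> I"
      proof (cases "k = n")
        case True
        then have "f = \<zero>\<^bsub>trunc n\<^esub>" using f by (simp add: trunc_def fun_eq_iff) (metis not_le)
        then show ?thesis by simp
      next
        case False
        then obtain g where g: "g \<in> I" "g k \<noteq> 0" using k by auto
        define G F where "G = Abs_fps g" "F = Abs_fps f"
        have G: "G = fps_X ^ k * fps_shift k G" "F = fps_X ^ k * fps_shift k F"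
          unfolding G_F_def using below[OF g(1)] f
          by (auto simp: fps_eq_iff fps_X_power_mult_nth)
        have u: "fps_nth (fps_shift k G) 0 \<noteq> 0" using g by (simp add: G_F_def)
        have "G * (inverse (fps_shift k G) * fps_shift k F)
            = fps_X ^ k * (fps_shift k G * inverse (fps_shift k G)) * fps_shift k F"
          by (subst G(1)) (simp add: mult_ac)
        also have "\<dots> = F" using inverse_mult_eq_1'[OF u] G(2) by simp
        finally have "trunc_coeffs n G \<otimes>\<^bsub>trunc n\<^esub> trunc_coeffs n (inverse (fps_shift k G) * fps_shift k F) = trunc_coeffs n F"
          by (simp only: trunc_mult)
        moreover have "trunc_coeffs n G = g" "trunc_coeffs n F = f"
          unfolding G_F_def using g(1) a_subset f by (auto intro!: trunc_coeffs_Abs)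
        ultimately show "f \<in> I" using I_r_closed[OF g(1)] trunc_coeffs_carrier by metis
      qed
    qed
  qed
  then show ?thesis using kn by blast
qed

lemma artinian_trunc: "artinian (trunc n)"
  unfolding artinian_def
proof (intro allI impI)
  fix I :: "nat \<Rightarrow> (nat \<Rightarrow> 'a) set"
  assume I: "\<forall>i. ideal (I i) (trunc n) \<and> I (Suc i) \<subseteq> I i"
  have "range I \<subseteq> trunc_order n ` {..n}"
  proof
    fix J assume "J \<in> range I"
    then have "ideal J (trunc n)" using I by blast
    then show "J \<in> trunc_order n ` {..n}" using trunc_ideal_eq[of J n] by auto
  qed
  then have "finite (range I)" by (rule finite_subset) simp
  then obtain J where J: "J \<in> range I" "\<forall>K\<in>range I. K \<subseteq> J \<longrightarrow> J = K"
    using finite_has_minimal[of "range I"] by blast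
  then obtain m where m: "J = I m" by blast
  have "I k \<subseteq> I m" if "m \<le> k" for k
    by (rule lift_Suc_antimono_le[OF _ that]) (use I in simp)
  then have "\<forall>k\<ge>m. I m = I k" using J(2) unfolding m by simp
  then have "\<forall>k\<ge>m. I k = I m" by simp
  then show "\<exists>m. \<forall>k\<ge>m. I k = I m" by (rule exI)
qed

text \<open>A sequence with nonzero constant term is a unit, so every proper ideal consists of
  sequences with constant term zero.\<close>

lemma maximalideal_trunc_iff:
  assumes "0 < n"
  shows "maximalideal m (trunc n :: ('k::field, nat \<Rightarrow> 'k) module) \<longleftrightarrow> m = trunc_order n 1"
proof -
  interpret cring "trunc n :: ('k, nat \<Rightarrow> 'k) module" by (rule cring_trunc)
  have one: "\<one>\<^bsub>trunc n\<^esub> 0 = (1::'k)" using assms by (simp add: trunc_one trunc_coeffs_def)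
  have unit: "J = carrier (trunc n)"
    if "ideal J (trunc n)" "f \<in> J" "f 0 \<noteq> 0" for J and f :: "nat \<Rightarrow> 'k"
  proof -
    interpret J: ideal J "trunc n" by fact
    have "f \<in> carrier (trunc n)" using that(2) J.a_subset by (rule subsetD[rotated])
    from trunc_unit[OF this that(3)]
    obtain g where "g \<in> carrier (trunc n)" "f \<otimes>\<^bsub>trunc n\<^esub> g = \<one>\<^bsub>trunc n\<^esub>"
      by (rule bexE)
    then have "\<one>\<^bsub>trunc n\<^esub> \<in> J" using J.I_r_closed[OF that(2)] by metis
    then show ?thesis by (rule J.one_imp_carrier)
  qed
  have proper: "carrier (trunc n) \<noteq> (trunc_order n 1 :: (nat \<Rightarrow> 'k) set)"
  proof
    assume "carrier (trunc n) = (trunc_order n 1 :: (nat \<Rightarrow> 'k) set)"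
    then have "\<one>\<^bsub>trunc n\<^esub> \<in> (trunc_order n 1 :: (nat \<Rightarrow> 'k) set)" using one_closed by (simp only:)
    then show False using one by simp
  qed
  have max: "maximalideal (trunc_order n 1) (trunc n :: ('k, nat \<Rightarrow> 'k) module)"
  proof (rule maximalidealI)
    show "ideal (trunc_order n 1) (trunc n :: ('k, nat \<Rightarrow> 'k) module)" by (rule ideal_trunc_order)
    show "carrier (trunc n) \<noteq> (trunc_order n 1 :: (nat \<Rightarrow> 'k) set)" by (rule proper)
    fix J :: "(nat \<Rightarrow> 'k) set"
    assume J: "ideal J (trunc n)" "trunc_order n 1 \<subseteq> J" "J \<subseteq> carrier (trunc n)"
    show "J = trunc_order n 1 \<or> J = carrier (trunc n)"
    proof (cases "\<exists>f\<in>J. f 0 \<noteq> 0")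
      case True then show ?thesis using unit J by blast
    next
      case False then show ?thesis using J by auto
    qed
  qed
  show ?thesis
  proof
    assume m: "maximalideal m (trunc n)"
    then interpret m: maximalideal m "trunc n" .
    have "f 0 = 0" if "f \<in> m" for f
      using unit[OF m.ideal_axioms that] m.I_notcarr by auto
    then have sub: "m \<subseteq> trunc_order n 1" using m.a_subset by auto
    have "(trunc_order n 1 :: (nat \<Rightarrow> 'k) set) = m \<or> (trunc_order n 1 :: (nat \<Rightarrow> 'k) set) = carrier (trunc n)"
      by (rule m.I_maximal[OF ideal_trunc_order sub]) auto
    then show "m = trunc_order n 1" using proper by simp
  next
    assume "m = trunc_order n 1"
    then show "maximalideal m (trunc n)" using max by (simp only:)
  qed
qed

lemma local_artin_algebra_trunc:
  assumes "0 < n"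
  shows "local_artin_algebra (trunc n :: ('k::field, nat \<Rightarrow> 'k) module)"
  unfolding local_artin_algebra_def maximalideal_trunc_iff[OF assms]
proof (intro conjI allI impI)
  show "algebra base_field (trunc n :: ('k, nat \<Rightarrow> 'k) module)" by (rule algebra_trunc)
  show "artinian (trunc n :: ('k, nat \<Rightarrow> 'k) module)" by (rule artinian_trunc)
  show "\<exists>!m. m = (trunc_order n 1 :: (nat \<Rightarrow> 'k) set)" by blast
  fix m :: "(nat \<Rightarrow> 'k) set" assume m: "m = trunc_order n 1"
  interpret algebra base_field "trunc n :: ('k, nat \<Rightarrow> 'k) module" by (rule algebra_trunc)
  interpret m: ideal m "trunc n" unfolding m by (rule ideal_trunc_order)
  have c: "c \<odot>\<^bsub>trunc n\<^esub> \<one>\<^bsub>trunc n\<^esub> \<in> carrier (trunc n)" "(c \<odot>\<^bsub>trunc n\<^esub> \<one>\<^bsub>trunc n\<^esub>) 0 = c" for c :: 'k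
    using assms by (simp_all add: trunc_ops, simp add: trunc_coeffs_def)
  have eq: "f 0 = g 0" if "m +>\<^bsub>trunc n\<^esub> f = m +>\<^bsub>trunc n\<^esub> g" "f \<in> carrier (trunc n)" "g \<in> carrier (trunc n)" for f g :: "nat \<Rightarrow> 'k"
  proof -
    have "f \<in> m +>\<^bsub>trunc n\<^esub> g" using m.a_rcos_self[OF that(2)] unfolding that(1) .
    then obtain h where "h \<in> m" "f = h \<oplus>\<^bsub>trunc n\<^esub> g"
      unfolding a_r_coset_def' by (elim UN_E singletonE)
    moreover from this(1) have "h 0 = 0" unfolding m by simp
    ultimately show ?thesis by (simp only: trunc_add_apply) simp
  qed
  show "bij_betw (\<lambda>c. m +>\<^bsub>trunc n\<^esub> (c \<odot>\<^bsub>trunc n\<^esub> \<one>\<^bsub>trunc n\<^esub>)) UNIV (carrier (trunc n Quot m))"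
    unfolding bij_betw_def
  proof
    show "inj (\<lambda>c::'k. m +>\<^bsub>trunc n\<^esub> (c \<odot>\<^bsub>trunc n\<^esub> \<one>\<^bsub>trunc n\<^esub>))"
      by (rule injI) (metis eq c)
    show "range (\<lambda>c::'k. m +>\<^bsub>trunc n\<^esub> (c \<odot>\<^bsub>trunc n\<^esub> \<one>\<^bsub>trunc n\<^esub>)) = carrier (trunc n Quot m)"
    proof safe
      fix c :: 'k
      show "m +>\<^bsub>trunc n\<^esub> (c \<odot>\<^bsub>trunc n\<^esub> \<one>\<^bsub>trunc n\<^esub>) \<in> carrier (trunc n Quot m)"
        unfolding FactRing_def A_RCOSETS_def' using c by auto
    next
      fix X assume "X \<in> carrier (trunc n Quot m)"
      then obtain f where f: "f \<in> carrier (trunc n)" "X = m +>\<^bsub>trunc n\<^esub> f"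
        unfolding FactRing_def A_RCOSETS_def' by auto
      have "f \<in> m +>\<^bsub>trunc n\<^esub> (f 0 \<odot>\<^bsub>trunc n\<^esub> \<one>\<^bsub>trunc n\<^esub>)"
      proof -
        define h where "h = (\<lambda>i. if i = 0 then 0 else f i)"
        have "h \<in> m" "f = h \<oplus>\<^bsub>trunc n\<^esub> (f 0 \<odot>\<^bsub>trunc n\<^esub> \<one>\<^bsub>trunc n\<^esub>)"
          using f assms by (auto simp: h_def m trunc_def trunc_coeffs_def fun_eq_iff)
        then show ?thesis unfolding a_r_coset_def' by blast
      qed
      then have "X = m +>\<^bsub>trunc n\<^esub> (f 0 \<odot>\<^bsub>trunc n\<^esub> \<one>\<^bsub>trunc n\<^esub>)"
        using f c m.a_repr_independence' by metis
      then show "X \<in> range (\<lambda>c::'k. m +>\<^bsub>trunc n\<^esub> (c \<odot>\<^bsub>trunc n\<^esub> \<one>\<^bsub>trunc n\<^esub>))" by blast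
    qed
  qed
qed

definition trunc_restr :: "nat \<Rightarrow> (nat \<Rightarrow> 'k::field) \<Rightarrow> nat \<Rightarrow> 'k" where
  "trunc_restr n f = trunc_coeffs n (Abs_fps f)"

lemma trunc_restr_coeffs: "n \<le> m \<Longrightarrow> trunc_restr n (trunc_coeffs m F) = trunc_coeffs n F"
  by (auto simp: trunc_restr_def trunc_coeffs_def)

lemma trunc_restr_hom:
  assumes "n \<le> m"
  shows "trunc_restr n \<in> algebra_homs (trunc m) (trunc n :: ('k::field, nat \<Rightarrow> 'k) module)"
  unfolding algebra_homs_def linear_maps_def ring_hom_def
  using assms by (auto elim!: trunc_carrier_cases simp: trunc_ops trunc_restr_coeffs)

text \<open>The kernel consists of the multiples of \<epsilon>^n and the maximal ideal of the
  multiples of \<epsilon>, so their products have order n + 1 and vanish.\<close>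

lemma small_extension_trunc:
  assumes "0 < n"
  shows "small_extension (trunc (Suc n)) (trunc n :: ('k::field, nat \<Rightarrow> 'k) module) (trunc_restr n)"
  unfolding small_extension_def
proof (intro conjI allI impI ballI)
  show "trunc_restr n \<in> algebra_homs (trunc (Suc n)) (trunc n :: ('k, nat \<Rightarrow> 'k) module)"
    by (rule trunc_restr_hom) simp
  have "trunc_restr n f \<in> carrier (trunc n)" for f :: "nat \<Rightarrow> 'k" by (simp add: trunc_restr_def)
  moreover have "f \<in> trunc_restr n ` carrier (trunc (Suc n))" if "f \<in> carrier (trunc n)" for f :: "nat \<Rightarrow> 'k"
  proof -
    obtain F where "f = trunc_coeffs n F" using \<open>f \<in> carrier (trunc n)\<close> by (rule trunc_carrier_cases)
    then have "f = trunc_restr n (trunc_coeffs (Suc n) F)" by (simp add: trunc_restr_coeffs)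
    then show ?thesis using trunc_coeffs_carrier by (rule image_eqI)
  qed
  ultimately show "trunc_restr n ` carrier (trunc (Suc n)) = carrier (trunc n :: ('k, nat \<Rightarrow> 'k) module)"
    by blast
  fix m j x
  assume "maximalideal m (trunc (Suc n) :: ('k, nat \<Rightarrow> 'k) module)"
    and j: "j \<in> a_kernel (trunc (Suc n)) (trunc n) (trunc_restr n :: (nat \<Rightarrow> 'k) \<Rightarrow> _)" and x: "x \<in> m"
  then have x: "x 0 = 0" by (simp add: maximalideal_trunc_iff)
  have j: "j i = 0" if "i < n" for i
    using j that unfolding a_kernel_def' by (auto simp: trunc_restr_def trunc_zero trunc_coeffs_def fun_eq_iff dest!: spec[of _ i])
  have "fps_nth (Abs_fps j * Abs_fps x) i = 0" if "i < Suc n" for i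
    unfolding fps_mult_nth
  proof (rule sum.neutral, safe)
    fix l assume "l \<in> {0..i}"
    then show "fps_nth (Abs_fps j) l * fps_nth (Abs_fps x) (i - l) = 0"
      using j[of l] x that by (cases "l < n") auto
  qed
  then show "j \<otimes>\<^bsub>trunc (Suc n)\<^esub> x = \<zero>\<^bsub>trunc (Suc n)\<^esub>"
    by (auto simp: trunc_def trunc_coeffs_def fun_eq_iff)
qed

section \<open>Evaluation of polynomials\<close>

text \<open>Homomorphisms between rings that are whole types. The rings on a carrier, such as the
  tensor products, are reached through \<open>mpoly_hom_exists\<close>.\<close>

locale type_ring_hom =
  fixes h :: "'a::comm_ring_1 \<Rightarrow> 'b::comm_ring_1"
  assumes zero [simp]: "h 0 = 0" and one [simp]: "h 1 = 1"
    and add [simp]: "h (x + y) = h x + h y" and mult [simp]: "h (x * y) = h x * h y"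
begin

lemma sum [simp]: "h (\<Sum>i\<in>I. f i) = (\<Sum>i\<in>I. h (f i))"
  by (induction I rule: infinite_finite_induct) auto

lemma prod [simp]: "h (\<Prod>i\<in>I. f i) = (\<Prod>i\<in>I. h (f i))"
  by (induction I rule: infinite_finite_induct) auto

lemma power [simp]: "h (x ^ n) = h x ^ n"
  by (induction n) auto

lemma uminus [simp]: "h (- x) = - h x"
  using add[of "- x" x] by (simp add: eq_neg_iff_add_eq_0)

lemma diff [simp]: "h (x - y) = h x - h y"
  using add[of x "- y"] by simp

lemma of_int [simp]: "h (of_int i) = of_int i"
proof (cases i)
  case (nonneg n)
  have "h (of_nat n) = of_nat n" by (induction n) auto
  then show ?thesis using nonneg by simp
next
  case (neg n)
  have "h (of_nat m) = of_nat m" for m by (induction m) auto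
  from this[of "Suc n"] show ?thesis using neg by (simp del: of_nat_Suc)
qed

end

lemma type_ring_hom_id: "type_ring_hom (\<lambda>x. x)"
  by unfold_locales auto

lemma type_ring_hom_comp: "type_ring_hom f \<Longrightarrow> type_ring_hom g \<Longrightarrow> type_ring_hom (\<lambda>x. g (f x))"
  by (simp add: type_ring_hom_def)

abbreviation mconst :: "'k \<Rightarrow> ('k::field, 'n::finite) mpoly" where
  "mconst c \<equiv> Poly_Mapping.single 0 c"

definition mvar :: "'n \<Rightarrow> ('k::field, 'n::finite) mpoly" where
  "mvar i = Poly_Mapping.single (Poly_Mapping.single i 1) 1"

lemma type_ring_hom_mconst: "type_ring_hom (mconst :: 'k::field \<Rightarrow> ('k, 'n::finite) mpoly)"
  by unfold_locales (simp_all add: single_add mult_single)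

text \<open>The coefficient map is a parameter because the same polynomial is evaluated in k, in
  k[\<epsilon>], in k[t][\<epsilon>], in k(t) and in larger polynomial rings.\<close>

definition mev :: "('k::field \<Rightarrow> 'a::comm_ring_1) \<Rightarrow> ('n::finite \<Rightarrow> 'a) \<Rightarrow> ('k, 'n) mpoly \<Rightarrow> 'a" where
  "mev c a F = (\<Sum>m\<in>Poly_Mapping.keys F. c (Poly_Mapping.lookup F m) * (\<Prod>i\<in>UNIV. a i ^ Poly_Mapping.lookup m i))"

lemma mpoly_eval_mev: "mpoly_eval F v = mev (\<lambda>x. x) (vec_nth v) F"
  unfolding mpoly_eval_def mev_def ..

lemma poly_mapping_sum_singles:
  "(\<Sum>m\<in>Poly_Mapping.keys F. Poly_Mapping.single m (Poly_Mapping.lookup F m)) = F"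
  by (rule poly_mapping_eqI)
     (simp add: lookup_sum lookup_single when_def sum.delta' not_in_keys_iff_lookup_eq_zero if_distrib cong: if_cong)

lemma mpoly_sum_induct [case_names zero add]:
  assumes "P 0" "\<And>F m c. P F \<Longrightarrow> P (Poly_Mapping.single m c + F)"
  shows "P (F :: ('k::field, 'n::finite) mpoly)"
proof -
  have "P (\<Sum>m\<in>I. Poly_Mapping.single m (Poly_Mapping.lookup F m))" if "finite I" for I
    using that by (induction I rule: finite_induct) (auto intro: assms)
  then show ?thesis using poly_mapping_sum_singles[of F] finite_keys[of F] by metis
qed

locale coeff_hom = type_ring_hom c for c :: "'k::field \<Rightarrow> 'a::comm_ring_1"
begin

lemma mev_superset:
  assumes "finite S" "Poly_Mapping.keys F \<subseteq> S"
  shows "mev c a F = (\<Sum>m\<in>S. c (Poly_Mapping.lookup F m) * (\<Prod>i\<in>UNIV. a i ^ Poly_Mapping.lookup m i))"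
  unfolding mev_def
  by (rule sum.mono_neutral_left) (use assms in \<open>auto simp: not_in_keys_iff_lookup_eq_zero\<close>)

lemma mev_add [simp]: "mev c a (F + G) = mev c a F + mev c a G"
proof -
  let ?S = "Poly_Mapping.keys F \<union> Poly_Mapping.keys G"
  have "Poly_Mapping.keys (F + G) \<subseteq> ?S" by (rule Poly_Mapping.keys_add)
  then show ?thesis
    by (subst (1 2 3) mev_superset[of ?S]) (auto simp: lookup_add distrib_right sum.distrib)
qed

lemma mev_zero [simp]: "mev c a 0 = 0"
  by (simp add: mev_def)

lemma mev_single: "mev c a (Poly_Mapping.single m x) = c x * (\<Prod>i\<in>UNIV. a i ^ Poly_Mapping.lookup m i)"
  by (subst mev_superset[of "{m}"]) auto

lemma mev_mconst [simp]: "mev c a (mconst x) = c x"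
  by (simp add: mev_single)

lemma mev_one [simp]: "mev c a 1 = 1"
  using mev_mconst[of a 1] by simp

lemma mev_mvar [simp]: "mev c a (mvar i) = a i"
proof -
  have "(\<Prod>j\<in>UNIV. a j ^ Poly_Mapping.lookup (Poly_Mapping.single i 1) j) = (\<Prod>j\<in>UNIV. if j = i then a j else 1)"
    by (rule prod.cong) (auto simp: lookup_single when_def)
  then show ?thesis by (simp add: mvar_def mev_single)
qed

lemma mev_mult [simp]: "mev c a (F * G) = mev c a F * mev c a G"
proof (induction F rule: mpoly_sum_induct)
  case (add F m x)
  have "mev c a (Poly_Mapping.single m x * G) = mev c a (Poly_Mapping.single m x) * mev c a G"
    by (induction G rule: mpoly_sum_induct)
       (simp_all add: distrib_left mult_single mev_single lookup_add power_add prod.distrib mult_ac)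
  then show ?case using add by (simp add: distrib_right)
qed simp

lemma type_ring_hom_mev: "type_ring_hom (mev c a)"
  by unfold_locales auto

sublocale ev: type_ring_hom "mev c a" for a by (rule type_ring_hom_mev)

end

lemma coeff_hom_id: "coeff_hom (\<lambda>x. x :: 'k::field)"
  by (intro coeff_hom.intro type_ring_hom_id)

lemma coeff_hom_mconst: "coeff_hom (mconst :: 'k::field \<Rightarrow> ('k, 'n::finite) mpoly)"
  by (intro coeff_hom.intro type_ring_hom_mconst)

lemma single_eq_mconst_mult: "Poly_Mapping.single m x = mconst x * Poly_Mapping.single m 1"
  by (simp add: mult_single)

lemma single_monom_eq_prod:
  "Poly_Mapping.single m 1 = (\<Prod>i\<in>UNIV. (mvar i :: ('k::field, 'n::finite) mpoly) ^ Poly_Mapping.lookup m i)"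
proof -
  have pow: "(mvar i :: ('k, 'n) mpoly) ^ e = Poly_Mapping.single (Poly_Mapping.single i e) 1" for i e
    by (induction e) (simp_all add: mvar_def mult_single single_add[symmetric])
  have "(\<Prod>i\<in>I. (mvar i :: ('k, 'n) mpoly) ^ Poly_Mapping.lookup m i)
      = Poly_Mapping.single (\<Sum>i\<in>I. Poly_Mapping.single i (Poly_Mapping.lookup m i)) 1" if "finite I" for I
    using that by (induction I rule: finite_induct) (simp_all add: pow mult_single)
  moreover have "(\<Sum>i\<in>UNIV. Poly_Mapping.single i (Poly_Mapping.lookup m i)) = m"
    by (rule poly_mapping_eqI) (simp add: lookup_sum lookup_single when_def)
  ultimately show ?thesis by simp
qed

lemma mpoly_induct [case_names const var add mult]:
  assumes const: "\<And>c. P (mconst c)" and var: "\<And>i. P (mvar i)"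
    and add: "\<And>F G. P F \<Longrightarrow> P G \<Longrightarrow> P (F + G)" and mult: "\<And>F G. P F \<Longrightarrow> P G \<Longrightarrow> P (F * G)"
  shows "P (F :: ('k::field, 'n::finite) mpoly)"
proof (induction F rule: mpoly_sum_induct)
  case zero
  then show ?case using const[of 0] by simp
next
  case (add F m x)
  have one: "P 1" using const[of 1] by simp
  have pow: "P (mvar i ^ e)" for i e by (induction e) (auto intro: one var mult)
  have "P (\<Prod>i\<in>I. (mvar i :: ('k, 'n) mpoly) ^ Poly_Mapping.lookup m i)" if "finite I" for I
    using that by (induction I rule: finite_induct) (auto intro: one pow mult)
  then have "P (Poly_Mapping.single m 1)" by (simp add: single_monom_eq_prod)
  then have "P (mconst x * Poly_Mapping.single m 1)" by (intro mult const)
  then have "P (Poly_Mapping.single m x)" by (subst single_eq_mconst_mult)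
  then show ?case using add assms(3) by blast
qed

lemma mev_hom:
  assumes "type_ring_hom h" "coeff_hom c"
  shows "h (mev c a F) = mev (\<lambda>x. h (c x)) (\<lambda>i. h (a i)) F"
proof -
  interpret h: type_ring_hom h by fact
  show ?thesis by (simp add: mev_def)
qed

subsection \<open>Partial derivatives\<close>

lemma mpoly_pderiv_superset:
  assumes "finite S" "Poly_Mapping.keys F \<subseteq> S"
  shows "mpoly_pderiv i F = (\<Sum>m\<in>S. Poly_Mapping.single (m - Poly_Mapping.single i 1)
          (of_nat (Poly_Mapping.lookup m i) * Poly_Mapping.lookup F m))"
  unfolding mpoly_pderiv_def
  by (rule sum.mono_neutral_left) (use assms in \<open>auto simp: not_in_keys_iff_lookup_eq_zero\<close>)

lemma mpoly_pderiv_add [simp]: "mpoly_pderiv i (F + G) = mpoly_pderiv i F + mpoly_pderiv i G"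
proof -
  let ?S = "Poly_Mapping.keys F \<union> Poly_Mapping.keys G"
  have "Poly_Mapping.keys (F + G) \<subseteq> ?S" by (rule Poly_Mapping.keys_add)
  then show ?thesis
    by (subst (1 2 3) mpoly_pderiv_superset[of ?S]) (auto simp: lookup_add distrib_left sum.distrib single_add)
qed

lemma mpoly_pderiv_zero [simp]: "mpoly_pderiv i 0 = 0"
  by (simp add: mpoly_pderiv_def)

lemma mpoly_pderiv_single: "mpoly_pderiv i (Poly_Mapping.single m x) =
    Poly_Mapping.single (m - Poly_Mapping.single i 1) (of_nat (Poly_Mapping.lookup m i) * x)"
  by (subst mpoly_pderiv_superset[of "{m}"]) auto

lemma mpoly_pderiv_mult: "mpoly_pderiv i (F * G) = mpoly_pderiv i F * G + F * mpoly_pderiv i G"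
proof (induction F rule: mpoly_sum_induct)
  case (add F m x)
  have "mpoly_pderiv i (Poly_Mapping.single m x * G) =
      mpoly_pderiv i (Poly_Mapping.single m x) * G + Poly_Mapping.single m x * mpoly_pderiv i G"
  proof (induction G rule: mpoly_sum_induct)
    case (add G m' x')
    let ?e = "Poly_Mapping.single i (1::nat)"
    \<comment> \<open>Subtraction of exponents is truncated at 0, so the two monomials may differ
      when i does not occur in m; then the coefficient is 0 and both sides vanish.\<close>
    have 1: "Poly_Mapping.single (m + m' - ?e) (of_nat (Poly_Mapping.lookup m i) * y) =
        Poly_Mapping.single (m - ?e + m') (of_nat (Poly_Mapping.lookup m i) * y)" for y
    proof (cases "Poly_Mapping.lookup m i = 0")
      case False
      then have "m + m' - ?e = m - ?e + m'"
        by (intro poly_mapping_eqI) (auto simp: lookup_add lookup_minus lookup_single when_def)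
      then show ?thesis by simp
    qed simp
    have 2: "Poly_Mapping.single (m + m' - ?e) (of_nat (Poly_Mapping.lookup m' i) * y) =
        Poly_Mapping.single (m + (m' - ?e)) (of_nat (Poly_Mapping.lookup m' i) * y)" for y
    proof (cases "Poly_Mapping.lookup m' i = 0")
      case False
      then have "m + m' - ?e = m + (m' - ?e)"
        by (intro poly_mapping_eqI) (auto simp: lookup_add lookup_minus lookup_single when_def)
      then show ?thesis by simp
    qed simp
    have "mpoly_pderiv i (Poly_Mapping.single m x * Poly_Mapping.single m' x') =
       Poly_Mapping.single (m + m' - ?e) (of_nat (Poly_Mapping.lookup m i) * (x * x')) +
       Poly_Mapping.single (m + m' - ?e) (of_nat (Poly_Mapping.lookup m' i) * (x * x'))"
      by (simp add: mult_single mpoly_pderiv_single lookup_add distrib_right single_add)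
    also have "\<dots> = mpoly_pderiv i (Poly_Mapping.single m x) * Poly_Mapping.single m' x' +
       Poly_Mapping.single m x * mpoly_pderiv i (Poly_Mapping.single m' x')"
      unfolding 1 2 by (simp add: mult_single mpoly_pderiv_single mult_ac add.commute)
    finally show ?case using add by (simp add: distrib_left)
  qed simp
  then show ?case using add by (simp add: distrib_right)
qed simp

lemma mpoly_pderiv_mconst [simp]: "mpoly_pderiv i (mconst c) = 0"
  by (simp add: mpoly_pderiv_single)

lemma mpoly_pderiv_mvar: "mpoly_pderiv i (mvar j) = (if i = j then 1 else 0)"
  by (auto simp: mvar_def mpoly_pderiv_single lookup_single when_def)

context coeff_hom
begin

text \<open>Changing the argument by b changes the value by a member of the ideal generated by the
  components of b. With lifted generators of a family as b, the change lies in the ideal of that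
  family.\<close>

lemma mev_add_diff:
  "\<exists>r. mev c (\<lambda>i. a i + b i) F = mev c a F + (\<Sum>i\<in>UNIV. b i * r i)"
proof (induction F rule: mpoly_induct)
  case (const x) then show ?case by (auto intro: exI[of _ "\<lambda>_. 0"])
next
  case (var j)
  have "(\<Sum>i\<in>UNIV. b i * (if i = j then 1 else 0)) = b j" by (simp add: if_distrib cong: if_cong)
  then show ?case by (intro exI[of _ "\<lambda>i. if i = j then 1 else 0"]) simp
next
  case (add F G)
  obtain r s where "mev c (\<lambda>i. a i + b i) F = mev c a F + (\<Sum>i\<in>UNIV. b i * r i)"
    "mev c (\<lambda>i. a i + b i) G = mev c a G + (\<Sum>i\<in>UNIV. b i * s i)" using add by blast
  then show ?case by (intro exI[of _ "\<lambda>i. r i + s i"]) (simp add: algebra_simps sum.distrib)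
next
  case (mult F G)
  obtain r s where r: "mev c (\<lambda>i. a i + b i) F = mev c a F + (\<Sum>i\<in>UNIV. b i * r i)"
    "mev c (\<lambda>i. a i + b i) G = mev c a G + (\<Sum>i\<in>UNIV. b i * s i)" using mult by blast
  let ?G = "mev c (\<lambda>i. a i + b i) G"
  have "mev c (\<lambda>i. a i + b i) (F * G) = mev c a F * ?G + (\<Sum>i\<in>UNIV. b i * r i) * ?G"
    unfolding mev_mult r(1) by (simp add: distrib_right)
  also have "mev c a F * ?G = mev c a (F * G) + mev c a F * (\<Sum>i\<in>UNIV. b i * s i)"
    unfolding r(2) by (simp add: distrib_left)
  finally show ?case
    by (intro exI[of _ "\<lambda>i. mev c a F * s i + r i * ?G"])
       (simp add: sum_distrib_left sum_distrib_right distrib_left sum.distrib mult_ac)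
qed

text \<open>Used with e the parameter of a line, to identify the linear coefficient with the
  differential, and with e = \<epsilon>^M, where the remainder keeps a factor \<epsilon>^M after
  division by e.\<close>

lemma mev_taylor:
  "\<exists>r. mev c (\<lambda>i. a i + e * b i) F =
    mev c a F + e * (\<Sum>i\<in>UNIV. mev c a (mpoly_pderiv i F) * b i) + e * e * r"
proof (induction F rule: mpoly_induct)
  case (const x) then show ?case by (auto intro: exI[of _ 0])
next
  case (var j)
  have "(\<Sum>i\<in>UNIV. mev c a (mpoly_pderiv i (mvar j)) * b i) = (\<Sum>i\<in>UNIV. if i = j then b i else 0)"
    by (rule sum.cong) (auto simp: mpoly_pderiv_mvar)
  then show ?case by (intro exI[of _ 0]) simp
next
  case (add F G)
  obtain r s where "mev c (\<lambda>i. a i + e * b i) F =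
      mev c a F + e * (\<Sum>i\<in>UNIV. mev c a (mpoly_pderiv i F) * b i) + e * e * r"
    "mev c (\<lambda>i. a i + e * b i) G =
      mev c a G + e * (\<Sum>i\<in>UNIV. mev c a (mpoly_pderiv i G) * b i) + e * e * s"
    using add by blast
  then show ?case by (intro exI[of _ "r + s"]) (simp add: algebra_simps sum.distrib)
next
  case (mult F G)
  define dF dG where "dF = (\<Sum>i\<in>UNIV. mev c a (mpoly_pderiv i F) * b i)"
    "dG = (\<Sum>i\<in>UNIV. mev c a (mpoly_pderiv i G) * b i)"
  obtain r s where r: "mev c (\<lambda>i. a i + e * b i) F = mev c a F + e * dF + e * e * r"
    "mev c (\<lambda>i. a i + e * b i) G = mev c a G + e * dG + e * e * s"
    using mult unfolding dF_dG_def by blast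
  have "(\<Sum>i\<in>UNIV. mev c a (mpoly_pderiv i (F * G)) * b i) = dF * mev c a G + mev c a F * dG"
    unfolding dF_dG_def sum_distrib_left sum_distrib_right sum.distrib[symmetric]
    by (rule sum.cong) (auto simp: mpoly_pderiv_mult algebra_simps)
  then show ?case unfolding mev_mult r
    by (intro exI[of _ "dF * dG + r * mev c a G + mev c a F * s + e * (dF * s + r * dG) + e * e * r * s"])
       (simp add: algebra_simps)
qed

end

subsection \<open>Evaluation at points\<close>

lemma mpoly_eval_add [simp]: "mpoly_eval (F + G) v = mpoly_eval F v + mpoly_eval G v"
  and mpoly_eval_mult [simp]: "mpoly_eval (F * G) v = mpoly_eval F v * mpoly_eval G v"
  and mpoly_eval_mconst [simp]: "mpoly_eval (mconst c) v = c"
  and mpoly_eval_mvar [simp]: "mpoly_eval (mvar i) v = vec_nth v i"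
  and mpoly_eval_zero [simp]: "mpoly_eval 0 v = 0"
  and mpoly_eval_one [simp]: "mpoly_eval 1 v = 1"
  unfolding mpoly_eval_mev
  by (simp_all only: coeff_hom.mev_add[OF coeff_hom_id] coeff_hom.mev_mult[OF coeff_hom_id]
      coeff_hom.mev_mconst[OF coeff_hom_id] coeff_hom.mev_mvar[OF coeff_hom_id]
      coeff_hom.mev_zero[OF coeff_hom_id] coeff_hom.mev_one[OF coeff_hom_id])

lemma type_ring_hom_mpoly_eval: "type_ring_hom (\<lambda>F. mpoly_eval F v)"
  by unfold_locales auto

lemma mpoly_eval_sum [simp]: "mpoly_eval (\<Sum>i\<in>I. F i) v = (\<Sum>i\<in>I. mpoly_eval (F i) v)"
  by (rule type_ring_hom.sum[OF type_ring_hom_mpoly_eval])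

lemma mpoly_eval_diff [simp]: "mpoly_eval (F - G) v = mpoly_eval F v - mpoly_eval G v"
  by (rule type_ring_hom.diff[OF type_ring_hom_mpoly_eval])

lemma mpoly_eval_prod [simp]: "mpoly_eval (\<Prod>i\<in>I. F i) v = (\<Prod>i\<in>I. mpoly_eval (F i) v)"
  by (rule type_ring_hom.prod[OF type_ring_hom_mpoly_eval])

lemma mpoly_eval_smult_homogeneous:
  assumes "F \<in> homogeneous_polys d"
  shows "mpoly_eval F (s *s v) = s ^ d * mpoly_eval F v"
  unfolding mpoly_eval_def sum_distrib_left
proof (rule sum.cong)
  fix m assume "m \<in> Poly_Mapping.keys F"
  then have "d = (\<Sum>i\<in>UNIV. Poly_Mapping.lookup m i)" using assms by (auto simp: homogeneous_polys_def)
  then have "(\<Prod>i\<in>UNIV. vec_nth (s *s v) i ^ Poly_Mapping.lookup m i)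
      = s ^ d * (\<Prod>i\<in>UNIV. vec_nth v i ^ Poly_Mapping.lookup m i)"
    by (simp add: power_mult_distrib prod.distrib power_sum)
  then show "Poly_Mapping.lookup F m * (\<Prod>i\<in>UNIV. vec_nth (s *s v) i ^ Poly_Mapping.lookup m i)
      = s ^ d * (Poly_Mapping.lookup F m * (\<Prod>i\<in>UNIV. vec_nth v i ^ Poly_Mapping.lookup m i))"
    by (simp add: mult_ac)
qed simp

lemma homogeneous_polys_zero [simp]: "0 \<in> homogeneous_polys d"
  by (simp add: homogeneous_polys_def)

lemma homogeneous_polys_add: "F \<in> homogeneous_polys d \<Longrightarrow> G \<in> homogeneous_polys d \<Longrightarrow> F + G \<in> homogeneous_polys d"
  using Poly_Mapping.keys_add[of F G] by (auto simp: homogeneous_polys_def)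

lemma homogeneous_polys_single: "(\<Sum>i\<in>UNIV. Poly_Mapping.lookup m i) = d \<Longrightarrow> Poly_Mapping.single m c \<in> homogeneous_polys d"
  by (auto simp: homogeneous_polys_def)

lemma homogeneous_polys_mconst: "mconst c \<in> homogeneous_polys 0"
  by (rule homogeneous_polys_single) simp

lemma homogeneous_polys_one: "1 \<in> homogeneous_polys 0"
  using homogeneous_polys_mconst[of 1] by simp

lemma homogeneous_polys_mvar: "mvar i \<in> homogeneous_polys 1"
  unfolding mvar_def by (rule homogeneous_polys_single) (simp add: lookup_single when_def)

lemma homogeneous_polys_mult:
  assumes "F \<in> homogeneous_polys d" "G \<in> homogeneous_polys e"
  shows "F * G \<in> homogeneous_polys (d + e)"
proof -
  have "(\<Sum>i\<in>UNIV. Poly_Mapping.lookup m i) = d + e" if m: "m \<in> Poly_Mapping.keys (F * G)" for m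
  proof -
    obtain a b where "m = a + b" "a \<in> Poly_Mapping.keys F" "b \<in> Poly_Mapping.keys G"
      using subsetD[OF Poly_Mapping.keys_mult m] by blast
    then show ?thesis using assms by (auto simp: homogeneous_polys_def lookup_add sum.distrib)
  qed
  then show ?thesis by (auto simp: homogeneous_polys_def)
qed

lemma homogeneous_polys_cmult: "F \<in> homogeneous_polys d \<Longrightarrow> mconst c * F \<in> homogeneous_polys d"
  using homogeneous_polys_mult[OF homogeneous_polys_mconst] by fastforce

lemma homogeneous_polys_sum: "(\<And>i. i \<in> I \<Longrightarrow> F i \<in> homogeneous_polys d) \<Longrightarrow> (\<Sum>i\<in>I. F i) \<in> homogeneous_polys d"
  by (induction I rule: infinite_finite_induct) (auto intro: homogeneous_polys_add)

lemma homogeneous_polys_pderiv: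
  assumes "F \<in> homogeneous_polys (Suc d)"
  shows "mpoly_pderiv i F \<in> homogeneous_polys d"
  unfolding mpoly_pderiv_def
proof (rule homogeneous_polys_sum)
  fix m assume "m \<in> Poly_Mapping.keys F"
  then have m: "(\<Sum>i\<in>UNIV. Poly_Mapping.lookup m i) = Suc d" using assms by (auto simp: homogeneous_polys_def)
  show "Poly_Mapping.single (m - Poly_Mapping.single i 1) (of_nat (Poly_Mapping.lookup m i) * Poly_Mapping.lookup F m)
      \<in> homogeneous_polys d"
  proof (cases "Poly_Mapping.lookup m i = 0")
    case False
    have "(\<Sum>j\<in>UNIV. Poly_Mapping.lookup m j) = (\<Sum>j\<in>UNIV. Poly_Mapping.lookup (m - Poly_Mapping.single i 1) j + (if j = i then 1 else 0))"
      using False by (intro sum.cong) (auto simp: lookup_minus lookup_single when_def)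
    then show ?thesis using m by (intro homogeneous_polys_single) (simp add: sum.distrib)
  qed simp
qed

definition mlin :: "'k::field ^ 'n::finite \<Rightarrow> ('k, 'n) mpoly" where
  "mlin a = (\<Sum>i\<in>UNIV. mconst (vec_nth a i) * mvar i)"

lemma mpoly_eval_mlin: "mpoly_eval (mlin a) v = (\<Sum>i\<in>UNIV. vec_nth a i * vec_nth v i)"
  by (simp add: mlin_def)

lemma homogeneous_polys_mlin: "mlin a \<in> homogeneous_polys 1"
  unfolding mlin_def by (intro homogeneous_polys_sum homogeneous_polys_cmult homogeneous_polys_mvar)

subsection \<open>Taylor coefficients along a line\<close>

definition line_poly :: "'k::field ^ 'n::finite \<Rightarrow> 'k ^ 'n \<Rightarrow> ('k, 'n) mpoly \<Rightarrow> 'k poly" where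
  "line_poly v u F = mev (\<lambda>c. [:c:]) (\<lambda>i. [:vec_nth v i, vec_nth u i:]) F"

lemma type_ring_hom_pconst: "type_ring_hom (\<lambda>c::'a::comm_ring_1. [:c:])"
  by unfold_locales (simp_all add: one_pCons)

lemma type_ring_hom_poly: "type_ring_hom (\<lambda>f. poly f x)"
  by unfold_locales simp_all

lemma poly_line_poly: "poly (line_poly v u F) t = mpoly_eval F (v + t *s u)"
  unfolding line_poly_def mpoly_eval_mev
  by (subst mev_hom[OF type_ring_hom_poly[of t]])
     (auto simp: coeff_hom.intro[OF type_ring_hom_pconst] algebra_simps intro!: arg_cong2[where f = "\<lambda>a b. mev a b F"])

definition tay :: "nat \<Rightarrow> 'k::field ^ 'n::finite \<Rightarrow> ('k, 'n) mpoly \<Rightarrow> 'k ^ 'n \<Rightarrow> 'k" where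
  "tay i u F v = coeff (line_poly v u F) i"

section \<open>Evaluation homomorphisms\<close>

text \<open>The tensor products are rings on a carrier, to which \<open>mev\<close> does not apply.
  Through this homomorphism, identities are proved for polynomials and then transported.\<close>

lemma (in cring) mpoly_hom_exists:
  fixes \<sigma> :: "'k::field \<Rightarrow> 'a" and a :: "'v::finite \<Rightarrow> 'a"
  assumes \<sigma>: "\<And>x. \<sigma> x \<in> carrier R" "\<And>x y. \<sigma> (x + y) = \<sigma> x \<oplus> \<sigma> y" "\<And>x y. \<sigma> (x * y) = \<sigma> x \<otimes> \<sigma> y" "\<sigma> 1 = \<one>"
    and a: "\<And>v. a v \<in> carrier R"
  shows "\<exists>\<theta> :: ('k, 'v) mpoly \<Rightarrow> 'a. (\<forall>F. \<theta> F \<in> carrier R) \<and> (\<forall>F G. \<theta> (F + G) = \<theta> F \<oplus> \<theta> G) \<and>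
    (\<forall>F G. \<theta> (F * G) = \<theta> F \<otimes> \<theta> G) \<and> (\<forall>c. \<theta> (mconst c) = \<sigma> c) \<and> (\<forall>v. \<theta> (mvar v) = a v)"
proof -
  define mon where "mon m = finprod R (\<lambda>v. a v [^] Poly_Mapping.lookup m v) UNIV" for m :: "'v \<Rightarrow>\<^sub>0 nat"
  define \<theta> where "\<theta> F = finsum R (\<lambda>m. \<sigma> (Poly_Mapping.lookup F m) \<otimes> mon m) (Poly_Mapping.keys F)" for F :: "('k, 'v) mpoly"
  have mon [simp]: "mon m \<in> carrier R" for m unfolding mon_def by (rule finprod_closed) (simp add: a)
  have mon0: "mon 0 = \<one>" unfolding mon_def by (simp add: finprod_one_eqI)
  have mon_add: "mon (m + m') = mon m \<otimes> mon m'" for m m'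
    unfolding mon_def by (subst finprod_multf[symmetric]) (auto simp: a lookup_add nat_pow_mult)
  have mon_var: "mon (Poly_Mapping.single v 1) = a v" for v
  proof -
    have "mon (Poly_Mapping.single v 1) = finprod R (\<lambda>w. if v = w then a w else \<one>) UNIV"
      unfolding mon_def by (rule finprod_cong') (auto simp: a lookup_single when_def)
    also have "\<dots> = a v" by (subst finprod_singleton) (auto simp: a)
    finally show ?thesis .
  qed
  have \<sigma>0: "\<sigma> 0 = \<zero>" using \<sigma>(2)[of 0 0] \<sigma>(1)[of 0] add.r_cancel_one' by simp
  note [simp] = \<sigma>(1)
  have sup: "\<theta> F = finsum R (\<lambda>m. \<sigma> (Poly_Mapping.lookup F m) \<otimes> mon m) S"
    if "finite S" "Poly_Mapping.keys F \<subseteq> S" for F S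
    unfolding \<theta>_def
    by (rule add.finprod_mono_neutral_cong_left) (use that \<sigma>0 in \<open>auto simp: not_in_keys_iff_lookup_eq_zero\<close>)
  have closed: "\<theta> F \<in> carrier R" for F unfolding \<theta>_def by (rule finsum_closed) simp
  have add: "\<theta> (F + G) = \<theta> F \<oplus> \<theta> G" for F G
  proof -
    let ?S = "Poly_Mapping.keys F \<union> Poly_Mapping.keys G"
    have "Poly_Mapping.keys (F + G) \<subseteq> ?S" by (rule Poly_Mapping.keys_add)
    then have "\<theta> (F + G) = finsum R (\<lambda>m. \<sigma> (Poly_Mapping.lookup F m) \<otimes> mon m \<oplus> \<sigma> (Poly_Mapping.lookup G m) \<otimes> mon m) ?S"
      by (subst sup[of ?S]) (auto simp: lookup_add \<sigma>(2) l_distr intro!: finsum_cong')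
    also have "\<dots> = \<theta> F \<oplus> \<theta> G"
      by (subst finsum_addf) (auto simp: sup[of ?S])
    finally show ?thesis .
  qed
  have single: "\<theta> (Poly_Mapping.single m x) = \<sigma> x \<otimes> mon m" for m x
    by (subst sup[of "{m}"]) auto
  have zero: "\<theta> 0 = \<zero>" by (simp add: \<theta>_def)
  have mult: "\<theta> (F * G) = \<theta> F \<otimes> \<theta> G" for F G
  proof (induction F rule: mpoly_sum_induct)
    case zero then show ?case by (simp add: \<open>\<theta> 0 = \<zero>\<close> closed)
  next
    case (add F m x)
    have "\<theta> (Poly_Mapping.single m x * G) = \<theta> (Poly_Mapping.single m x) \<otimes> \<theta> G"
    proof (induction G rule: mpoly_sum_induct)
      case zero then show ?case by (simp add: \<open>\<theta> 0 = \<zero>\<close> closed)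
    next
      case (add G m' x')
      then show ?case
        by (simp add: distrib_left \<open>\<And>F G. \<theta> (F + G) = \<theta> F \<oplus> \<theta> G\<close> closed r_distr mult_single single mon_add \<sigma>(3) m_ac)
    qed
    then show ?case using add
      by (simp add: distrib_right \<open>\<And>F G. \<theta> (F + G) = \<theta> F \<oplus> \<theta> G\<close> closed l_distr)
  qed
  have "\<theta> (mconst c) = \<sigma> c" for c by (simp add: single mon0)
  moreover have "\<theta> (mvar v) = a v" for v using mon_var[of v] by (simp add: mvar_def single \<sigma>(4) a)
  ultimately show ?thesis using closed add mult by (intro exI[of _ \<theta>]) simp
qed

definition pev :: "('a::comm_ring_1 \<Rightarrow> 'b::comm_ring_1) \<Rightarrow> 'b \<Rightarrow> 'a poly \<Rightarrow> 'b" where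
  "pev c x f = poly (map_poly c f) x"

context type_ring_hom
begin

lemma pev_pCons [simp]: "pev h x (pCons a f) = h a + x * pev h x f"
  by (simp add: pev_def map_poly_pCons)

lemma pev_zero [simp]: "pev h x 0 = 0"
  by (simp add: pev_def)

lemma pev_add [simp]: "pev h x (f + g) = pev h x f + pev h x g"
proof (induction f arbitrary: g)
  case (pCons a f)
  then show ?case by (cases g) (simp add: algebra_simps)
qed simp

lemma pev_smult [simp]: "pev h x (smult a f) = h a * pev h x f"
  by (induction f) (simp_all add: algebra_simps)

lemma pev_mult [simp]: "pev h x (f * g) = pev h x f * pev h x g"
  by (induction f) (simp_all add: algebra_simps)

lemma type_ring_hom_pev: "type_ring_hom (pev h x)"
  by unfold_locales (simp_all add: one_pCons)

lemma pev_hom: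
  assumes "type_ring_hom k"
  shows "k (pev h x f) = pev (\<lambda>a. k (h a)) (k x) f"
proof -
  interpret k: type_ring_hom k by fact
  interpret kh: type_ring_hom "\<lambda>a. k (h a)" by (rule type_ring_hom_comp) unfold_locales
  show ?thesis by (induction f) simp_all
qed

end

text \<open>Written with \<open>pCons\<close> so that the coefficient of order M stays visible next
  to the higher terms.\<close>

lemma poly_low_coeffs_zero:
  assumes "\<And>i. i < M \<Longrightarrow> coeff (f :: 'a::comm_ring_1 poly) i = 0"
  shows "\<exists>g. f = [:0, 1:] ^ M * pCons (coeff f M) g"
  using assms
proof (induction M arbitrary: f)
  case 0 then show ?case by (cases f) auto
next
  case (Suc M)
  obtain a g where f: "f = pCons a g" by (cases f)
  have "a = 0" using Suc.prems[of 0] f by simp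
  moreover have "coeff g i = 0" if "i < M" for i using Suc.prems[of "Suc i"] that f by simp
  then obtain g' where "g = [:0, 1:] ^ M * pCons (coeff g M) g'" using Suc.IH by blast
  then have "f = [:0, 1:] ^ Suc M * pCons (coeff f (Suc M)) g'"
    unfolding f \<open>a = 0\<close> by simp
  then show ?case by blast
qed

section \<open>Deformations over truncated polynomial algebras\<close>

lemma module_of_ring_hom:
  fixes A :: "('a, 'c) ring_scheme" and Q :: "('q, 'd) ring_scheme"
  assumes "cring A" "cring Q" "h \<in> ring_hom A Q"
    "carrier F = carrier Q" "ring.zero F = ring.zero Q" "ring.add F = ring.add Q"
    and sm: "\<And>a q. a \<odot>\<^bsub>F\<^esub> q = h a \<otimes>\<^bsub>Q\<^esub> q"
  shows "module A F"
proof -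
  interpret A: cring A by fact
  interpret Q: cring Q by fact
  note h = ring_hom_closed[OF assms(3)] ring_hom_mult[OF assms(3)] ring_hom_add[OF assms(3)] ring_hom_one[OF assms(3)]
  have "abelian_group F"
    by (rule abelian_groupI) (auto simp: assms(4-6) Q.a_ac intro: Q.l_neg)
  then show ?thesis
    by (intro moduleI assms(1)) (auto simp: assms(4-6) sm h Q.l_distr Q.r_distr Q.m_assoc)
qed

locale tensor_k_algebras = tensor_algebras base_field R A
  for R :: "('k::field, 'r, 'c) module_scheme" and A :: "('k, 'a, 'd) module_scheme"
begin

lemma pure_one_hom: "(\<lambda>a. pure \<one>\<^bsub>R\<^esub> a) \<in> ring_hom A TT"
  by (rule ring_hom_memI) (simp_all add: pure_mult pure_add_right pure_one)

lemma family_module_simps: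
  "carrier (family_module R A I) = carrier (TT Quot I)"
  "ring.zero (family_module R A I) = ring.zero (TT Quot I)"
  "ring.add (family_module R A I) = ring.add (TT Quot I)"
  "a \<odot>\<^bsub>family_module R A I\<^esub> q = (I +>\<^bsub>TT\<^esub> pure \<one>\<^bsub>R\<^esub> a) \<otimes>\<^bsub>TT Quot I\<^esub> q"
  by (simp_all add: family_module_def Let_def)

lemma module_family_module:
  assumes "ideal I TT"
  shows "module A (family_module R A I)"
proof -
  interpret I: ideal I TT by fact
  have "(\<lambda>a. I +>\<^bsub>TT\<^esub> pure \<one>\<^bsub>R\<^esub> a) \<in> ring_hom A (TT Quot I)"
    using ring_hom_trans[OF pure_one_hom I.rcos_ring_hom] by (simp add: comp_def)
  then show ?thesis
    by (rule module_of_ring_hom[OF N.M_cring I.quotient_is_cring[OF T.cring_axioms]]) (rule family_module_simps)+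
qed

lemma family_carrier_cases:
  assumes "q \<in> carrier (family_module R A I)"
  obtains t where "t \<in> carrier TT" "q = I +>\<^bsub>TT\<^esub> t"
  using assms unfolding family_module_simps FactRing_def A_RCOSETS_def' by auto

lemma family_add:
  assumes "ideal I TT" "s \<in> carrier TT" "t \<in> carrier TT"
  shows "(I +>\<^bsub>TT\<^esub> s) \<oplus>\<^bsub>family_module R A I\<^esub> (I +>\<^bsub>TT\<^esub> t) = I +>\<^bsub>TT\<^esub> (s \<oplus>\<^bsub>TT\<^esub> t)"
  unfolding family_module_simps by (rule ring_hom_add[OF ideal.rcos_ring_hom[OF assms(1)] assms(2,3), symmetric])

lemma family_smult:
  assumes "ideal I TT" "a \<in> carrier A" "t \<in> carrier TT"
  shows "a \<odot>\<^bsub>family_module R A I\<^esub> (I +>\<^bsub>TT\<^esub> t) = I +>\<^bsub>TT\<^esub> (pure \<one>\<^bsub>R\<^esub> a \<otimes>\<^bsub>TT\<^esub> t)"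
  unfolding family_module_simps
  by (rule ring_hom_mult[OF ideal.rcos_ring_hom[OF assms(1)], symmetric]) (use assms in auto)

lemma family_closed: "ideal I TT \<Longrightarrow> t \<in> carrier TT \<Longrightarrow> I +>\<^bsub>TT\<^esub> t \<in> carrier (family_module R A I)"
  unfolding family_module_simps by (rule ring_hom_closed[OF ideal.rcos_ring_hom])

lemma family_eq:
  assumes "ideal I TT" "s \<in> carrier TT" "t \<in> carrier TT"
  shows "I +>\<^bsub>TT\<^esub> s = I +>\<^bsub>TT\<^esub> t \<longleftrightarrow> s \<oplus>\<^bsub>TT\<^esub> \<ominus>\<^bsub>TT\<^esub> t \<in> I"
proof -
  interpret I: ideal I TT by fact
  show ?thesis
  proof
    assume "I +>\<^bsub>TT\<^esub> s = I +>\<^bsub>TT\<^esub> t"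
    then have "s \<in> I +>\<^bsub>TT\<^esub> t" using I.a_rcos_self[OF assms(2)] by simp
    then show "s \<oplus>\<^bsub>TT\<^esub> \<ominus>\<^bsub>TT\<^esub> t \<in> I" using assms by (intro I.a_rcos_module_imp)
  next
    assume "s \<oplus>\<^bsub>TT\<^esub> \<ominus>\<^bsub>TT\<^esub> t \<in> I"
    then have "s \<in> I +>\<^bsub>TT\<^esub> t" using assms by (intro I.a_rcos_module_rev)
    then show "I +>\<^bsub>TT\<^esub> s = I +>\<^bsub>TT\<^esub> t" using I.a_repr_independence'[of s t] assms by simp
  qed
qed

end

text \<open>The data of a displaced line near a point in abstract form: R plays the local ring of X,
  K the field of functions on the line, E the functions regular at the point and \<Phi> the
  expansion of a germ in \<epsilon>. \<Phi> is additive but multiplicative only below order M,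
  because the displaced line lies on X only to that order. \<open>E_lift\<close> provides germs
  whose expansion is a prescribed constant below order M; they are what makes the quotient by the
  ideal of the family free.\<close>

locale deform =
  R: algebra base_field R
  for R :: "('k::field, 'r) module" +
  fixes M :: nat and \<iota> :: "'k \<Rightarrow> 'K::field" and \<Phi> :: "'r \<Rightarrow> 'K fps" and E :: "'K set"
  assumes M: "0 < M" and \<iota>: "type_ring_hom \<iota>"
    and \<Phi>_add: "\<And>x y. x \<in> carrier R \<Longrightarrow> y \<in> carrier R \<Longrightarrow> \<Phi> (x \<oplus>\<^bsub>R\<^esub> y) = \<Phi> x + \<Phi> y"
    and \<Phi>_smult: "\<And>c x. x \<in> carrier R \<Longrightarrow> \<Phi> (c \<odot>\<^bsub>R\<^esub> x) = fps_const (\<iota> c) * \<Phi> x"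
    and \<Phi>_mult: "\<And>x y i. x \<in> carrier R \<Longrightarrow> y \<in> carrier R \<Longrightarrow> i < M \<Longrightarrow> fps_nth (\<Phi> (x \<otimes>\<^bsub>R\<^esub> y)) i = fps_nth (\<Phi> x * \<Phi> y) i"
    and \<Phi>_one: "\<And>i. i < M \<Longrightarrow> fps_nth (\<Phi> \<one>\<^bsub>R\<^esub>) i = fps_nth 1 i"
    and E_coeff: "\<And>x i. x \<in> carrier R \<Longrightarrow> i < M \<Longrightarrow> fps_nth (\<Phi> x) i \<in> E"
    and E_lift: "\<And>e. e \<in> E \<Longrightarrow> \<exists>x\<in>carrier R. \<forall>i<M. fps_nth (\<Phi> x) i = (if i = 0 then e else 0)"
    and E_zero: "0 \<in> E" and E_add: "\<And>x y. x \<in> E \<Longrightarrow> y \<in> E \<Longrightarrow> x + y \<in> E"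
    and E_scale: "\<And>c x. x \<in> E \<Longrightarrow> \<iota> c * x \<in> E"
begin

sublocale \<iota>: type_ring_hom \<iota> by (rule \<iota>)

sublocale tn: tensor_k_algebras R "trunc n :: ('k, nat \<Rightarrow> 'k) module" for n
  by (intro tensor_k_algebras.intro tensor_algebras.intro algebra_trunc R.algebra_axioms)

abbreviation "T n \<equiv> tensor base_field R (trunc n :: ('k, nat \<Rightarrow> 'k) module)"
abbreviation "pt n r a \<equiv> pure_tensor base_field R (trunc n :: ('k, nat \<Rightarrow> 'k) module) r a"

text \<open>The map r \<otimes> a \<mapsto> \<Phi> r times a, which exists by the universal
  property. The index n varies because the family over order M is compared with its extension over
  order M + 1.\<close>

definition \<phi> :: "nat \<Rightarrow> ('r \<times> (nat \<Rightarrow> 'k) \<Rightarrow>\<^sub>0 int) set \<Rightarrow> 'K fps" where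
  "\<phi> n = (SOME h. (\<forall>s\<in>carrier (T n). \<forall>t\<in>carrier (T n). h (s \<oplus>\<^bsub>T n\<^esub> t) = h s + h t) \<and>
     (\<forall>r\<in>carrier R. \<forall>a\<in>carrier (trunc n). h (pt n r a) = \<Phi> r * Abs_fps (\<lambda>i. \<iota> (a i))))"

lemma \<phi>_props:
  "(\<forall>s\<in>carrier (T n). \<forall>t\<in>carrier (T n). \<phi> n (s \<oplus>\<^bsub>T n\<^esub> t) = \<phi> n s + \<phi> n t) \<and>
     (\<forall>r\<in>carrier R. \<forall>a\<in>carrier (trunc n). \<phi> n (pt n r a) = \<Phi> r * Abs_fps (\<lambda>i. \<iota> (a i)))"
proof -
  have abs_add: "Abs_fps (\<lambda>i. \<iota> (a i + b i)) = Abs_fps (\<lambda>i. \<iota> (a i)) + Abs_fps (\<lambda>i. \<iota> (b i))" for a b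
    by (simp add: fps_eq_iff)
  have abs_sm: "Abs_fps (\<lambda>i. \<iota> (c * b i)) = fps_const (\<iota> c) * Abs_fps (\<lambda>i. \<iota> (b i))" for c b
    by (simp add: fps_eq_iff)
  have "\<exists>h. (\<forall>t\<in>carrier (T n). h t \<in> carrier (add_ring :: 'K fps ring)) \<and>
    (\<forall>s\<in>carrier (T n). \<forall>t\<in>carrier (T n). h (s \<oplus>\<^bsub>T n\<^esub> t) = h s \<oplus>\<^bsub>add_ring\<^esub> h t) \<and>
    (\<forall>r\<in>carrier R. \<forall>a\<in>carrier (trunc n). h (pt n r a) = \<Phi> r * Abs_fps (\<lambda>i. \<iota> (a i)))"
  proof (rule tn.universal[OF abelian_group_add_ring])
    fix s x and y :: "nat \<Rightarrow> 'k"
    assume "s \<in> carrier (base_field :: ('k, 'k) module)" "x \<in> carrier R" "y \<in> carrier (trunc n)"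
    then show "\<Phi> (s \<odot>\<^bsub>R\<^esub> x) * Abs_fps (\<lambda>i. \<iota> (y i)) = \<Phi> x * Abs_fps (\<lambda>i. \<iota> ((s \<odot>\<^bsub>trunc n\<^esub> y) i))"
      by (simp only: trunc_smult_apply abs_sm \<Phi>_smult mult_ac)
  qed (simp_all add: add_ring_def \<Phi>_add trunc_add_apply abs_add distrib_left distrib_right del: \<iota>.add)
  then have "\<exists>h. (\<forall>s\<in>carrier (T n). \<forall>t\<in>carrier (T n). h (s \<oplus>\<^bsub>T n\<^esub> t) = h s + h t) \<and>
     (\<forall>r\<in>carrier R. \<forall>a\<in>carrier (trunc n). h (pt n r a) = \<Phi> r * Abs_fps (\<lambda>i. \<iota> (a i)))"
    by (simp add: add_ring_def)
  then show ?thesis unfolding \<phi>_def by (rule someI_ex)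
qed

lemma \<phi>_add: "s \<in> carrier (T n) \<Longrightarrow> t \<in> carrier (T n) \<Longrightarrow> \<phi> n (s \<oplus>\<^bsub>T n\<^esub> t) = \<phi> n s + \<phi> n t"
  using \<phi>_props by blast

lemma \<phi>_pure: "r \<in> carrier R \<Longrightarrow> a \<in> carrier (trunc n) \<Longrightarrow> \<phi> n (pt n r a) = \<Phi> r * Abs_fps (\<lambda>i. \<iota> (a i))"
  using \<phi>_props by blast

lemma \<phi>_zero: "\<phi> n \<zero>\<^bsub>T n\<^esub> = 0"
  using \<phi>_add[of "\<zero>\<^bsub>T n\<^esub>" n "\<zero>\<^bsub>T n\<^esub>"]
  by (simp only: tn.T.l_zero tn.T.zero_closed add_cancel_right_right)

lemma \<phi>_uminus: "t \<in> carrier (T n) \<Longrightarrow> \<phi> n (\<ominus>\<^bsub>T n\<^esub> t) = - \<phi> n t"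
  using \<phi>_add[of "\<ominus>\<^bsub>T n\<^esub> t" n t] by (simp add: tn.T.l_neg \<phi>_zero eq_neg_iff_add_eq_0)

abbreviation lo :: "nat \<Rightarrow> 'K fps \<Rightarrow> 'K fps \<Rightarrow> bool" where
  "lo n f g \<equiv> (\<forall>i<n. fps_nth f i = fps_nth g i)"

lemma lo_mult: "lo n f f' \<Longrightarrow> lo n g g' \<Longrightarrow> lo n (f * g) (f' * g')"
  by (auto simp: fps_mult_nth intro!: sum.cong)

text \<open>From order n on, agreement is lost by the truncation of the base, and from order M on
  because \<Phi> is multiplicative only below M.\<close>

lemma \<phi>_mult:
  assumes s: "s \<in> carrier (T n)" and t: "t \<in> carrier (T n)"
  shows "lo (min n M) (\<phi> n (s \<otimes>\<^bsub>T n\<^esub> t)) (\<phi> n s * \<phi> n t)"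
  using s
proof (induction rule: tn.tensor_induct)
  case (pure r a)
  from t show ?case
  proof (induction rule: tn.tensor_induct)
    case (pure r' a')
    have 1: "\<phi> n (pt n r a \<otimes>\<^bsub>T n\<^esub> pt n r' a') = \<Phi> (r \<otimes>\<^bsub>R\<^esub> r') * Abs_fps (\<lambda>i. \<iota> ((a \<otimes>\<^bsub>trunc n\<^esub> a') i))"
      using pure \<open>r \<in> carrier R\<close> \<open>a \<in> carrier (trunc n)\<close> cring.cring_simprules(5)[OF cring_trunc]
      by (simp add: tn.pure_mult \<phi>_pure)
    have 2: "\<phi> n (pt n r a) * \<phi> n (pt n r' a') = (\<Phi> r * \<Phi> r') * (Abs_fps (\<lambda>i. \<iota> (a i)) * Abs_fps (\<lambda>i. \<iota> (a' i)))"
      using pure \<open>r \<in> carrier R\<close> \<open>a \<in> carrier (trunc n)\<close> by (simp add: \<phi>_pure mult_ac)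
    show ?case unfolding 1 2
    proof (rule lo_mult)
      show "lo (min n M) (\<Phi> (r \<otimes>\<^bsub>R\<^esub> r')) (\<Phi> r * \<Phi> r')" using pure \<open>r \<in> carrier R\<close> by (simp add: \<Phi>_mult)
      show "lo (min n M) (Abs_fps (\<lambda>i. \<iota> ((a \<otimes>\<^bsub>trunc n\<^esub> a') i))) (Abs_fps (\<lambda>i. \<iota> (a i)) * Abs_fps (\<lambda>i. \<iota> (a' i)))"
        by (simp add: trunc_mult_apply fps_mult_nth)
    qed
  next
    case (add s t)
    then show ?case using \<open>r \<in> carrier R\<close> \<open>a \<in> carrier (trunc n)\<close>
      by (simp add: tn.T.r_distr \<phi>_add distrib_left)
  qed
next
  case (add s s')
  then show ?case using t by (simp add: tn.T.l_distr \<phi>_add distrib_right)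
qed

lemma E_sum: "(\<And>i. i \<in> I \<Longrightarrow> f i \<in> E) \<Longrightarrow> (\<Sum>i\<in>I. f i) \<in> E"
  by (induction I rule: infinite_finite_induct) (auto intro: E_zero E_add)

lemma \<phi>_E:
  assumes "t \<in> carrier (T n)" "i < M"
  shows "fps_nth (\<phi> n t) i \<in> E"
  using assms(1)
proof (induction rule: tn.tensor_induct)
  case (pure r a)
  have "fps_nth (\<Phi> r) j * \<iota> (a (i - j)) \<in> E" if "j \<le> i" for j
    using E_scale[OF E_coeff[of r j], of "a (i - j)"] pure that assms(2) by (simp add: mult.commute)
  then show ?case using pure by (auto simp: \<phi>_pure fps_mult_nth intro!: E_sum)
next
  case (add s t) then show ?case by (simp add: \<phi>_add E_add)
qed

definition "I = {t \<in> carrier (T M). \<forall>i<M. fps_nth (\<phi> M t) i = 0}"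

lemma ideal_I: "ideal I (T M)"
proof (rule idealI)
  show "ring (T M)" ..
  show "subgroup I (add_monoid (T M))"
  proof (rule tn.T.add.subgroupI)
    show "I \<noteq> {}" unfolding I_def using \<phi>_zero[of M] by auto
  qed (auto simp: I_def \<phi>_add \<phi>_uminus \<phi>_uminus[unfolded a_inv_def])
  fix a x assume a: "a \<in> I" and x: "x \<in> carrier (T M)"
  then have ac: "a \<in> carrier (T M)" and a0: "lo M (\<phi> M a) 0" by (auto simp: I_def)
  have "lo M (\<phi> M x * \<phi> M a) 0" using lo_mult[OF _ a0, of "\<phi> M x" "\<phi> M x"] by simp
  then show "x \<otimes>\<^bsub>T M\<^esub> a \<in> I" using \<phi>_mult[OF x ac] x ac by (simp add: I_def)
  then show "a \<otimes>\<^bsub>T M\<^esub> x \<in> I" using tn.T.m_comm[OF x ac] by simp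
qed

lemma coset_eq_iff:
  assumes "s \<in> carrier (T M)" "t \<in> carrier (T M)"
  shows "I +>\<^bsub>T M\<^esub> s = I +>\<^bsub>T M\<^esub> t \<longleftrightarrow> lo M (\<phi> M s) (\<phi> M t)"
  unfolding tn.family_eq[OF ideal_I assms] using assms by (simp add: I_def \<phi>_add \<phi>_uminus)

lemma vector_space_E: "vector_space (\<lambda>c e. \<iota> c * e)"
  by unfold_locales (simp_all add: algebra_simps)

text \<open>The quotient is isomorphic to the truncated polynomials over \<open>E\<close>, hence free with any
  \<open>k\<close>-basis of \<open>E\<close> as a basis.\<close>

lemma flat_I: "flat_module (trunc M) (family_module R (trunc M) I)"
proof -
  interpret E: vector_space "\<lambda>c e. \<iota> c * e" by (rule vector_space_E)
  obtain Bs where Bs: "Bs \<subseteq> E" "E.independent Bs" "E \<subseteq> E.span Bs"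
    using E.maximal_independent_subset[of E] by blast
  define rep where "rep = E.representation Bs"
  have "\<exists>r. r \<in> carrier R \<and> (\<forall>i<M. fps_nth (\<Phi> r) i = (if i = 0 then b else 0))" if "b \<in> Bs" for b
    using E_lift[of b] Bs(1) that by blast
  then obtain r where r: "\<And>b. b \<in> Bs \<Longrightarrow> r b \<in> carrier R"
    "\<And>b i. b \<in> Bs \<Longrightarrow> i < M \<Longrightarrow> fps_nth (\<Phi> (r b)) i = (if i = 0 then b else 0)" by metis
  \<comment> \<open>Coordinates are read off a representative; by \<open>coset_eq_iff\<close> the
    coefficients below M do not depend on it.\<close>
  define rp where "rp q = (SOME t. t \<in> carrier (T M) \<and> q = I +>\<^bsub>T M\<^esub> t)" for q
  have rp: "lo M (\<phi> M (rp (I +>\<^bsub>T M\<^esub> t))) (\<phi> M t)" if "t \<in> carrier (T M)" for t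
  proof -
    have "rp (I +>\<^bsub>T M\<^esub> t) \<in> carrier (T M) \<and> I +>\<^bsub>T M\<^esub> t = I +>\<^bsub>T M\<^esub> rp (I +>\<^bsub>T M\<^esub> t)"
      unfolding rp_def by (rule someI[of _ t]) (simp add: that)
    then show ?thesis using coset_eq_iff that by metis
  qed
  define co where "co b q = (\<lambda>i. if i < M then rep (fps_nth (\<phi> M (rp q)) i) b else 0)" for b q
  define co' where "co' b t = (\<lambda>i. if i < M then rep (fps_nth (\<phi> M t) i) b else 0)" for b t
  have co: "co b (I +>\<^bsub>T M\<^esub> t) = co' b t" if "t \<in> carrier (T M)" for b t
    using rp[OF that] by (auto simp: co_def co'_def)
  have cc: "co' b t \<in> carrier (trunc M)" for b t by (simp add: co'_def trunc_carrier_iff)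
  have span: "x \<in> E.span Bs" if "x \<in> E" for x using Bs(3) that by blast
  have rep_add: "rep (x + y) b = rep x b + rep y b" if "x \<in> E" "y \<in> E" for x y b
    unfolding rep_def using E.representation_add[OF Bs(2) span[OF that(2)] span[OF that(1)]] by (simp add: add.commute)
  have rep_scale: "rep (\<iota> c * x) b = c * rep x b" if "x \<in> E" for c x b
    unfolding rep_def using E.representation_scale[OF Bs(2) span[OF that]] by simp
  have rep_sum: "rep (\<Sum>i\<in>S. f i) b = (\<Sum>i\<in>S. rep (f i) b)" if "\<And>i. i \<in> S \<Longrightarrow> f i \<in> E" for S :: "nat set" and f b
    using that
  proof (induction S rule: infinite_finite_induct)
    case (insert x F) then show ?case by (simp add: rep_add E_sum)
  qed (simp_all add: rep_def E.representation_zero)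
  show ?thesis
  proof (rule flat_module_free[where Bs = Bs and co = co and e = "\<lambda>b. I +>\<^bsub>T M\<^esub> pt M (r b) \<one>\<^bsub>trunc M\<^esub>"])
    show "module (trunc M) (family_module R (trunc M) I)" by (rule tn.module_family_module[OF ideal_I])
  next
    fix b assume "b \<in> Bs"
    then show "I +>\<^bsub>T M\<^esub> pt M (r b) \<one>\<^bsub>trunc M\<^esub> \<in> carrier (family_module R (trunc M) I)"
      by (intro tn.family_closed ideal_I tn.pure_closed r) (simp_all add: trunc_one)
  next
    fix b q assume "q \<in> carrier (family_module R (trunc M) I)"
    then obtain t where "t \<in> carrier (T M)" "q = I +>\<^bsub>T M\<^esub> t" by (rule tn.family_carrier_cases)
    then show "co b q \<in> carrier (trunc M)" by (simp add: co cc)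
  next
    fix b q q' assume q: "q \<in> carrier (family_module R (trunc M) I)" "q' \<in> carrier (family_module R (trunc M) I)"
    obtain t where t: "t \<in> carrier (T M)" "q = I +>\<^bsub>T M\<^esub> t" using q(1) by (rule tn.family_carrier_cases)
    obtain t' where t': "t' \<in> carrier (T M)" "q' = I +>\<^bsub>T M\<^esub> t'" using q(2) by (rule tn.family_carrier_cases)
    have "co' b (t \<oplus>\<^bsub>T M\<^esub> t') = co' b t \<oplus>\<^bsub>trunc M\<^esub> co' b t'"
      by (auto simp: co'_def trunc_add_apply fun_eq_iff \<phi>_add t t' rep_add \<phi>_E)
    then show "co b (q \<oplus>\<^bsub>family_module R (trunc M) I\<^esub> q') = co b q \<oplus>\<^bsub>trunc M\<^esub> co b q'"
      unfolding t(2) t'(2) tn.family_add[OF ideal_I t(1) t'(1)] using t t' by (simp add: co)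
  next
    fix b q and a :: "nat \<Rightarrow> 'k" assume q: "q \<in> carrier (family_module R (trunc M) I)" and a: "a \<in> carrier (trunc M)"
    obtain t where t: "t \<in> carrier (T M)" "q = I +>\<^bsub>T M\<^esub> t" using q by (rule tn.family_carrier_cases)
    have p1: "pt M \<one>\<^bsub>R\<^esub> a \<in> carrier (T M)" using a by (intro tn.pure_closed) simp_all
    have "co' b (pt M \<one>\<^bsub>R\<^esub> a \<otimes>\<^bsub>T M\<^esub> t) i = (a \<otimes>\<^bsub>trunc M\<^esub> co' b t) i" for i
    proof (cases "i < M")
      case True
      have "lo M (\<phi> M (pt M \<one>\<^bsub>R\<^esub> a \<otimes>\<^bsub>T M\<^esub> t)) (\<phi> M (pt M \<one>\<^bsub>R\<^esub> a) * \<phi> M t)"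
        using \<phi>_mult[OF p1 t(1)] by simp
      moreover have "lo M (\<phi> M (pt M \<one>\<^bsub>R\<^esub> a)) (1 * Abs_fps (\<lambda>i. \<iota> (a i)))"
        using lo_mult[of M "\<Phi> \<one>\<^bsub>R\<^esub>" 1 "Abs_fps (\<lambda>i. \<iota> (a i))" "Abs_fps (\<lambda>i. \<iota> (a i))"] \<Phi>_one a by (simp add: \<phi>_pure)
      then have "lo M (\<phi> M (pt M \<one>\<^bsub>R\<^esub> a) * \<phi> M t) (Abs_fps (\<lambda>i. \<iota> (a i)) * \<phi> M t)"
        by (intro lo_mult) simp_all
      ultimately have "fps_nth (\<phi> M (pt M \<one>\<^bsub>R\<^esub> a \<otimes>\<^bsub>T M\<^esub> t)) i = (\<Sum>j=0..i. \<iota> (a j) * fps_nth (\<phi> M t) (i - j))"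
        using True by (simp add: fps_mult_nth)
      moreover have "rep (\<Sum>j=0..i. \<iota> (a j) * fps_nth (\<phi> M t) (i - j)) b = (\<Sum>j=0..i. a j * rep (fps_nth (\<phi> M t) (i - j)) b)"
        using True t by (subst rep_sum) (auto intro!: E_scale \<phi>_E sum.cong rep_scale)
      ultimately show ?thesis using True by (auto simp: co'_def trunc_mult_apply fps_mult_nth intro!: sum.cong)
    next
      case False
      have "a \<otimes>\<^bsub>trunc M\<^esub> co' b t \<in> carrier (trunc M)"
        using a cc by (intro cring.cring_simprules(5)[OF cring_trunc])
      then show ?thesis using False by (simp add: co'_def trunc_carrier_iff)
    qed
    then have "co' b (pt M \<one>\<^bsub>R\<^esub> a \<otimes>\<^bsub>T M\<^esub> t) = a \<otimes>\<^bsub>trunc M\<^esub> co' b t" by (rule ext)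
    then show "co b (a \<odot>\<^bsub>family_module R (trunc M) I\<^esub> q) = a \<otimes>\<^bsub>trunc M\<^esub> co b q"
      unfolding t(2) tn.family_smult[OF ideal_I a t(1)] using t p1 by (simp add: co)
  next
    fix q assume q: "q \<in> carrier (family_module R (trunc M) I)"
    obtain t where t: "t \<in> carrier (T M)" "q = I +>\<^bsub>T M\<^esub> t" using q by (rule tn.family_carrier_cases)
    \<comment> \<open>Each of the M coefficients involves finitely many basis elements.\<close>
    define S where "S = (\<Union>i<M. {b. rep (fps_nth (\<phi> M t) i) b \<noteq> 0})"
    have "finite S" unfolding S_def rep_def by (auto intro: E.finite_representation)
    moreover have "S \<subseteq> Bs" unfolding S_def rep_def using E.representation_ne_zero by blast
    moreover have "q = finsum (family_module R (trunc M) I) (\<lambda>b. co b q \<odot>\<^bsub>family_module R (trunc M) I\<^esub> (I +>\<^bsub>T M\<^esub> pt M (r b) \<one>\<^bsub>trunc M\<^esub>)) S'"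
      if S': "finite S' \<and> S \<subseteq> S' \<and> S' \<subseteq> Bs" for S'
    proof -
      interpret Q: module "trunc M :: ('k, nat \<Rightarrow> 'k) module" "family_module R (trunc M) I" by (rule tn.module_family_module[OF ideal_I])
      have o: "\<one>\<^bsub>trunc M\<^esub> \<in> carrier (trunc M :: ('k, nat \<Rightarrow> 'k) module)" by (simp add: trunc_one)
      have g: "(\<lambda>b. pt M (r b) (co' b t)) \<in> S' \<rightarrow> carrier (T M)" using S' r cc by auto
      \<comment> \<open>The candidate expansion is formed in the tensor product itself; it
        represents q as soon as its coefficients below M agree with those of t.\<close>
      define s where "s = finsum (T M) (\<lambda>b. pt M (r b) (co' b t)) S'"
      have s: "s \<in> carrier (T M)" unfolding s_def by (rule tn.T.finsum_closed[OF g])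
      have "\<phi> M s = finsum add_ring (\<lambda>b. \<phi> M (pt M (r b) (co' b t))) S'"
        unfolding s_def using S' g
        by (intro additive_finsum tn.T.abelian_group_axioms abelian_group_add_ring) (auto simp: add_ring_def \<phi>_add)
      also have "\<dots> = (\<Sum>b\<in>S'. \<phi> M (pt M (r b) (co' b t)))"
      proof -
        interpret G: abelian_group "add_ring :: 'K fps ring" by (rule abelian_group_add_ring)
        show ?thesis using S'[THEN conjunct1]
        proof (induction S' rule: finite_induct)
          case empty
          then show ?case using G.finsum_empty by (simp add: add_ring_def)
        next
          case (insert x F)
          then show ?case by (subst G.finsum_insert) (auto simp: add_ring_def)
        qed
      qed
      finally have \<phi>s: "\<phi> M s = (\<Sum>b\<in>S'. \<Phi> (r b) * Abs_fps (\<lambda>i. \<iota> (co' b t i)))"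
        using S' r cc by (simp add: \<phi>_pure subset_iff)
      have "lo M (\<phi> M s) (\<phi> M t)"
      proof (intro allI impI)
        fix i assume i: "i < M"
        have "fps_nth (\<Phi> (r b) * Abs_fps (\<lambda>i. \<iota> (co' b t i))) i = \<iota> (rep (fps_nth (\<phi> M t) i) b) * b" if "b \<in> S'" for b
        proof -
          have "lo M (\<Phi> (r b)) (fps_const b)" using that S' r(2) by auto
          then have "lo M (\<Phi> (r b) * Abs_fps (\<lambda>i. \<iota> (co' b t i))) (fps_const b * Abs_fps (\<lambda>i. \<iota> (co' b t i)))"
            by (rule lo_mult) simp
          then show ?thesis using i by (simp add: co'_def mult.commute)
        qed
        then have "fps_nth (\<phi> M s) i = (\<Sum>b\<in>S'. \<iota> (rep (fps_nth (\<phi> M t) i) b) * b)"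
          unfolding \<phi>s by (simp add: fps_sum_nth)
        also have "\<dots> = (\<Sum>b | rep (fps_nth (\<phi> M t) i) b \<noteq> 0. \<iota> (rep (fps_nth (\<phi> M t) i) b) * b)"
          by (rule sum.mono_neutral_right) (use S' i in \<open>auto simp: S_def\<close>)
        also have "\<dots> = fps_nth (\<phi> M t) i"
          unfolding rep_def using t i by (intro E.sum_nonzero_representation_eq Bs span \<phi>_E)
        finally show "fps_nth (\<phi> M s) i = fps_nth (\<phi> M t) i" .
      qed
      then have "q = I +>\<^bsub>T M\<^esub> s" unfolding t(2) using coset_eq_iff[OF s t(1)] by simp
      also have "\<dots> = finsum (family_module R (trunc M) I) (\<lambda>b. I +>\<^bsub>T M\<^esub> pt M (r b) (co' b t)) S'"
        unfolding s_def using S' g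
        by (intro additive_finsum tn.T.abelian_group_axioms Q.abelian_group_axioms)
           (auto simp: tn.family_add[OF ideal_I] tn.family_closed[OF ideal_I])
      also have "\<dots> = finsum (family_module R (trunc M) I) (\<lambda>b. co b q \<odot>\<^bsub>family_module R (trunc M) I\<^esub> (I +>\<^bsub>T M\<^esub> pt M (r b) \<one>\<^bsub>trunc M\<^esub>)) S'"
      proof (rule Q.finsum_cong')
        have eq: "co b q \<odot>\<^bsub>family_module R (trunc M) I\<^esub> (I +>\<^bsub>T M\<^esub> pt M (r b) \<one>\<^bsub>trunc M\<^esub>) = I +>\<^bsub>T M\<^esub> pt M (r b) (co' b t)"
          if "b \<in> S'" for b
        proof -
          have "r b \<in> carrier R" using that S' r by auto
          moreover have "co' b t \<otimes>\<^bsub>trunc M\<^esub> \<one>\<^bsub>trunc M\<^esub> = co' b t"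
            using cring.cring_simprules(11,6)[OF cring_trunc] cring.cring_simprules(12)[OF cring_trunc] cc[of b t] o cring.cring_simprules(14)[OF cring_trunc]
            by metis
          ultimately show ?thesis
            unfolding t(2) using t(1) cc[of b t] o
            by (simp add: co tn.family_smult[OF ideal_I] tn.pure_mult)
        qed
        then show "(\<lambda>b. co b q \<odot>\<^bsub>family_module R (trunc M) I\<^esub> (I +>\<^bsub>T M\<^esub> pt M (r b) \<one>\<^bsub>trunc M\<^esub>)) \<in> S' \<rightarrow> carrier (family_module R (trunc M) I)"
          using g by (auto simp: eq intro!: tn.family_closed[OF ideal_I])
        show "I +>\<^bsub>T M\<^esub> pt M (r b) (co' b t) = co b q \<odot>\<^bsub>family_module R (trunc M) I\<^esub> (I +>\<^bsub>T M\<^esub> pt M (r b) \<one>\<^bsub>trunc M\<^esub>)" if "b \<in> S'" for b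
          using eq[OF that] by simp
      qed simp
      finally show ?thesis .
    qed
    ultimately show "\<exists>S. finite S \<and> S \<subseteq> Bs \<and> (\<forall>S'. finite S' \<and> S \<subseteq> S' \<and> S' \<subseteq> Bs \<longrightarrow>
      q = finsum (family_module R (trunc M) I) (\<lambda>b. co b q \<odot>\<^bsub>family_module R (trunc M) I\<^esub> (I +>\<^bsub>T M\<^esub> pt M (r b) \<one>\<^bsub>trunc M\<^esub>)) S')"
      by (intro exI[of _ S]) simp
  qed
qed

end

text \<open>HOL-level copies of the module of the truncated algebra itself and of its socle, with
  carriers of the type used in the definition of flatness.\<close>

definition emb :: "(nat \<Rightarrow> 'k::field) \<Rightarrow> (nat \<Rightarrow> nat \<Rightarrow> 'k) set" where
  "emb b = {\<lambda>_. b}"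

definition unemb :: "(nat \<Rightarrow> nat \<Rightarrow> 'k::field) set \<Rightarrow> nat \<Rightarrow> 'k" where
  "unemb X = the_elem X 0"

lemma unemb_emb [simp]: "unemb (emb b) = b"
  by (simp add: unemb_def emb_def)

definition emb_module :: "nat \<Rightarrow> (nat \<Rightarrow> 'k::field) set \<Rightarrow> (nat \<Rightarrow> 'k, (nat \<Rightarrow> nat \<Rightarrow> 'k) set) module" where
  "emb_module n K = \<lparr>carrier = emb ` K, monoid.mult = (\<lambda>X Y. X), monoid.one = emb \<zero>\<^bsub>trunc n\<^esub>,
     ring.zero = emb \<zero>\<^bsub>trunc n\<^esub>, ring.add = (\<lambda>X Y. emb (unemb X \<oplus>\<^bsub>trunc n\<^esub> unemb Y)),
     module.smult = (\<lambda>b X. emb (b \<otimes>\<^bsub>trunc n\<^esub> unemb X))\<rparr>"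

lemma module_emb_module:
  fixes K :: "(nat \<Rightarrow> 'k::field) set"
  assumes "ideal K (trunc n :: ('k, nat \<Rightarrow> 'k) module)"
  shows "module (trunc n) (emb_module n K)"
proof -
  interpret B: cring "trunc n :: ('k, nat \<Rightarrow> 'k) module" by (rule cring_trunc)
  interpret K: ideal K "trunc n :: ('k, nat \<Rightarrow> 'k) module" by fact
  have sub: "x \<in> carrier (trunc n)" if "x \<in> K" for x using K.a_subset that by (rule subsetD)
  have "abelian_group (emb_module n K)"
  proof (rule abelian_groupI)
    fix x assume "x \<in> carrier (emb_module n K)"
    then obtain y where y: "y \<in> K" "x = emb y" by (auto simp: emb_module_def)
    have "emb (\<ominus>\<^bsub>trunc n\<^esub> y) \<in> carrier (emb_module n K)" using y by (simp add: emb_module_def)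
    moreover have "emb (\<ominus>\<^bsub>trunc n\<^esub> y) \<oplus>\<^bsub>emb_module n K\<^esub> x = \<zero>\<^bsub>emb_module n K\<^esub>"
      using y sub by (simp add: emb_module_def B.l_neg)
    ultimately show "\<exists>y\<in>carrier (emb_module n K). y \<oplus>\<^bsub>emb_module n K\<^esub> x = \<zero>\<^bsub>emb_module n K\<^esub>" by (rule bexI[rotated])
  qed (auto simp: emb_module_def sub B.a_ac)
  then show ?thesis
    by (intro moduleI B.cring_axioms)
       (auto simp: emb_module_def sub B.l_distr B.r_distr B.m_assoc K.I_l_closed)
qed

section \<open>Residue family, lifting, and the kernel of the small extension\<close>

context deform
begin

abbreviation "I0 \<equiv> {r \<in> carrier R. fps_nth (\<Phi> r) 0 = 0}"

lemma trunc_one_carrier: "\<one>\<^bsub>trunc n\<^esub> \<in> carrier (trunc n :: ('k, nat \<Rightarrow> 'k) module)"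
  by (simp add: trunc_one)

definition \<epsilon> :: "nat \<Rightarrow> nat \<Rightarrow> nat \<Rightarrow> 'k" where
  "\<epsilon> n i = trunc_coeffs n (fps_X ^ i)"

lemma \<epsilon>_carrier [simp]: "\<epsilon> n i \<in> carrier (trunc n)"
  by (simp add: \<epsilon>_def)

lemma \<epsilon>_apply: "\<epsilon> n i j = (if i = j \<and> j < n then 1 else 0)"
  by (simp add: \<epsilon>_def trunc_coeffs_def)

lemma residue_hom: "(\<lambda>f. f 0) \<in> algebra_homs (trunc M :: ('k, nat \<Rightarrow> 'k) module) base_field"
  using M by (auto simp: algebra_homs_def ring_hom_def linear_maps_def base_field_def trunc_mult_apply
      trunc_add_apply trunc_smult_apply trunc_one trunc_coeffs_def)

text \<open>One inclusion takes constant terms. For the other, a germ that vanishes on the line has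
  to be lifted to an element of the family: starting from r \<otimes> 1, terms s \<otimes>
  \<epsilon>^(m+1) cancel one further coefficient at a time and restrict to zero.\<close>

lemma restrict_residue:
  "restrict_family R base_field (\<lambda>f. f 0) I = (\<lambda>r. pure_tensor base_field R base_field r 1) ` I0"
proof -
  interpret k: algebra base_field "base_field :: ('k, 'k) module" by (rule algebra_base_field)
  interpret tk: tensor_modules base_field R "base_field :: ('k, 'k) module"
    by (intro tensor_modules.intro R.module k.module)
  interpret th: tensor_hom base_field R "trunc M :: ('k, nat \<Rightarrow> 'k) module" R "base_field :: ('k, 'k) module" id "\<lambda>f. f 0"
    by (intro tensor_hom.intro tn.tensor_modules_axioms tk.tensor_modules_axioms tensor_hom_axioms.intro)
       (use residue_hom in \<open>auto simp: algebra_homs_def linear_maps_def\<close>)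
  define pk where "pk r = pure_tensor base_field R (base_field :: ('k, 'k) module) r 1" for r
  have pk_carrier: "pk r \<in> carrier tk.TT" if "r \<in> carrier R" for r
    unfolding pk_def using that by (intro tk.pure_closed) (simp_all add: base_field_def)
  have pk_add: "pk (r \<oplus>\<^bsub>R\<^esub> s) = pk r \<oplus>\<^bsub>tk.TT\<^esub> pk s" if "r \<in> carrier R" "s \<in> carrier R" for r s
    unfolding pk_def using that by (intro tk.pure_add_left) (simp_all add: base_field_def)
  have tm_pure: "th.tm (pt M r a) = pk (a 0 \<odot>\<^bsub>R\<^esub> r)" if "r \<in> carrier R" for r a
  proof -
    have "th.tm (pt M r a) = pure_tensor base_field R base_field r (a 0)"
      unfolding th.tensor_map_pure by simp
    also have "\<dots> = pure_tensor base_field R base_field r (a 0 \<odot>\<^bsub>base_field\<^esub> 1)" by (simp add: base_field_def)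
    also have "\<dots> = pk (a 0 \<odot>\<^bsub>R\<^esub> r)" unfolding pk_def
      by (rule tk.pure_smult[symmetric]) (use that in \<open>auto simp: base_field_def\<close>)
    finally show ?thesis .
  qed
  have res: "\<exists>r\<in>carrier R. th.tm t = pk r \<and> fps_nth (\<phi> M t) 0 = fps_nth (\<Phi> r) 0" if "t \<in> carrier (T M)" for t
    using that
  proof (induction rule: tn.tensor_induct)
    case (pure r a)
    have "a 0 \<odot>\<^bsub>R\<^esub> r \<in> carrier R" using pure by (intro R.smult_closed) (simp_all add: base_field_def)
    then show ?case unfolding tm_pure[OF pure(1)] using pure
      by (intro bexI[of _ "a 0 \<odot>\<^bsub>R\<^esub> r"]) (simp_all add: \<phi>_pure \<Phi>_smult mult.commute)
  next
    case (add s t)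
    obtain r1 r2 where "r1 \<in> carrier R" "th.tm s = pk r1" "fps_nth (\<phi> M s) 0 = fps_nth (\<Phi> r1) 0"
      "r2 \<in> carrier R" "th.tm t = pk r2" "fps_nth (\<phi> M t) 0 = fps_nth (\<Phi> r2) 0" using add by blast
    then show ?case unfolding th.tensor_map_add[OF add(1,2)] using add(1,2)
      by (intro bexI[of _ "r1 \<oplus>\<^bsub>R\<^esub> r2"]) (simp_all add: pk_add \<phi>_add \<Phi>_add id_def)
  qed
  have "th.tm t \<in> pk ` I0" if t: "t \<in> I" for t
  proof -
    have tc: "t \<in> carrier (T M)" "fps_nth (\<phi> M t) 0 = 0" using t M by (auto simp: I_def)
    then obtain r where "r \<in> carrier R" "th.tm t = pk r" "fps_nth (\<Phi> r) 0 = 0" using res by metis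
    then show ?thesis by auto
  qed
  moreover have "pk r \<in> th.tm ` I" if r: "r \<in> I0" for r
  proof -
    have rc: "r \<in> carrier R" "fps_nth (\<Phi> r) 0 = 0" using r by auto
    have "\<exists>t\<in>carrier (T M). (\<forall>i<Suc m. fps_nth (\<phi> M t) i = 0) \<and> th.tm t = pk r" if "m < M" for m
      using that
    proof (induction m)
      case 0
      have e: "\<epsilon> M 0 0 = 1" using M by (simp add: \<epsilon>_apply)
      have "th.tm (pt M r (\<epsilon> M 0)) = pk r"
        using tm_pure[OF rc(1), of "\<epsilon> M 0"] R.smult_one[OF rc(1)] unfolding e
        by (simp only: base_field_def monoid.simps)
      moreover have "fps_nth (\<phi> M (pt M r (\<epsilon> M 0))) 0 = 0" using rc by (simp add: \<phi>_pure)
      ultimately show ?case using rc by (intro bexI[of _ "pt M r (\<epsilon> M 0)"] conjI) (simp_all del: id_apply add: id_def)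
    next
      case (Suc m)
      from Suc.IH[OF Suc_lessD[OF Suc.prems]]
      obtain t where t: "t \<in> carrier (T M)" "\<forall>i<Suc m. fps_nth (\<phi> M t) i = 0" "th.tm t = pk r"
        by (elim bexE conjE)
      \<comment> \<open>The negative is written as a scalar multiple since E is assumed closed under
        sums and under scalars from k.\<close>
      have "\<iota> (- 1) * fps_nth (\<phi> M t) (Suc m) \<in> E" using t Suc.prems by (intro E_scale \<phi>_E) simp_all
      then obtain s where s: "s \<in> carrier R" "\<forall>i<M. fps_nth (\<Phi> s) i = (if i = 0 then - fps_nth (\<phi> M t) (Suc m) else 0)"
        using E_lift[of "\<iota> (- 1) * fps_nth (\<phi> M t) (Suc m)"] by auto
      let ?t = "t \<oplus>\<^bsub>T M\<^esub> pt M s (\<epsilon> M (Suc m))"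
      have "Abs_fps (\<lambda>i. \<iota> (\<epsilon> M (Suc m) i)) = fps_X ^ Suc m"
        using Suc.prems by (auto simp: fps_eq_iff \<epsilon>_apply simp del: power_Suc)
      then have "fps_nth (\<phi> M ?t) i = fps_nth (\<phi> M t) i + (if i < Suc m then 0 else fps_nth (\<Phi> s) (i - Suc m))" for i
        using s t by (simp add: \<phi>_add \<phi>_pure fps_X_power_mult_right_nth del: power_Suc)
      then have "\<forall>i<Suc (Suc m). fps_nth (\<phi> M ?t) i = 0"
        using t(2) s(2) M by (auto simp: less_Suc_eq)
      moreover have "th.tm ?t = pk r"
      proof -
        have "th.tm (pt M s (\<epsilon> M (Suc m))) = pk (0 \<odot>\<^bsub>R\<^esub> s)" using s by (simp add: tm_pure \<epsilon>_apply)
        also have "0 \<odot>\<^bsub>R\<^esub> s = \<zero>\<^bsub>R\<^esub>" using R.smult_l_null[OF s(1)] by (simp add: base_field_def)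
        also have "pk \<zero>\<^bsub>R\<^esub> = \<zero>\<^bsub>tk.TT\<^esub>" unfolding pk_def by (rule tk.pure_zero_left) (simp add: base_field_def)
        finally have *: "th.tm (pt M s (\<epsilon> M (Suc m))) = \<zero>\<^bsub>tk.TT\<^esub>" .
        show ?thesis
          unfolding th.tensor_map_add[OF t(1) tn.pure_closed[OF s(1) \<epsilon>_carrier]] * t(3)
          using pk_carrier[OF rc(1)] by simp
      qed
      moreover have "?t \<in> carrier (T M)" using s t by simp
      ultimately show ?case by (intro bexI[of _ ?t] conjI)
    qed
    from this[of "M - 1"] obtain t where "t \<in> carrier (T M)" "\<forall>i<M. fps_nth (\<phi> M t) i = 0" "th.tm t = pk r"
      using M by auto
    then have "t \<in> I" "pk r = th.tm t" by (simp_all add: I_def)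
    then show ?thesis by (rule image_eqI[rotated])
  qed
  ultimately show ?thesis unfolding restrict_family_def pk_def[symmetric] by blast
qed

lemma embedded_deformation_I: "embedded_deformation R I0 (trunc M) I"
  unfolding embedded_deformation_def flat_family_def
  using ideal_I flat_I residue_hom restrict_residue by blast

lemma lifting_exists:
  assumes "deformations_unobstructed R I0"
  obtains J where "flat_family R (trunc (Suc M)) J"
    "tensor_map base_field R (trunc M) id (trunc_restr M) ` J = I"
proof -
  have "\<exists>J. flat_family R (trunc (Suc M)) J \<and> restrict_family R (trunc M) (trunc_restr M) J = I"
    by (rule assms[unfolded deformations_unobstructed_def, rule_format])
       (intro conjI local_artin_algebra_trunc M small_extension_trunc embedded_deformation_I zero_less_Suc)
  then show ?thesis using that unfolding restrict_family_def by blast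
qed

sublocale tr: tensor_hom base_field R "trunc (Suc M) :: ('k, nat \<Rightarrow> 'k) module"
  R "trunc M :: ('k, nat \<Rightarrow> 'k) module" id "trunc_restr M"
  by (intro tensor_hom.intro tn.tensor_modules_axioms tensor_hom_axioms.intro)
     (use trunc_restr_hom[of M "Suc M"] in \<open>auto simp: algebra_homs_def linear_maps_def\<close>)

lemma \<phi>_restr:
  assumes "t \<in> carrier (T (Suc M))"
  shows "lo M (\<phi> M (tr.tm t)) (\<phi> (Suc M) t)"
  using assms
proof (induction rule: tn.tensor_induct)
  case (pure r a)
  then have "trunc_restr M a \<in> carrier (trunc M)" by (simp add: trunc_restr_def)
  moreover have "lo M (Abs_fps (\<lambda>i. \<iota> (trunc_restr M a i))) (Abs_fps (\<lambda>i. \<iota> (a i)))"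
    by (simp add: trunc_restr_def trunc_coeffs_def)
  then have "lo M (\<Phi> r * Abs_fps (\<lambda>i. \<iota> (trunc_restr M a i))) (\<Phi> r * Abs_fps (\<lambda>i. \<iota> (a i)))"
    by (intro lo_mult) simp_all
  ultimately show ?case using pure unfolding tr.tensor_map_pure by (simp add: \<phi>_pure)
next
  case (add s t)
  then show ?case
    using tr.tensor_map_closed[OF add(1)] tr.tensor_map_closed[OF add(2)]
    unfolding tr.tensor_map_add[OF add(1,2)] by (simp add: \<phi>_add id_def)
qed

text \<open>Extending a truncated sequence by zero is linear over k, though not multiplicative, and
  splits the truncation. On a pure tensor the difference from the splitting is a germ times
  \<epsilon>^M, and such elements are closed under sums.\<close>

lemma restr_kernel:
  assumes "t \<in> carrier (T (Suc M))" "t' \<in> carrier (T (Suc M))" "tr.tm t = tr.tm t'"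
  obtains \<gamma> where "\<gamma> \<in> carrier R" "t = t' \<oplus>\<^bsub>T (Suc M)\<^esub> pt (Suc M) \<gamma> (\<epsilon> (Suc M) M)"
proof -
  have incl: "f \<in> carrier (trunc (Suc M))" if "f \<in> carrier (trunc M)" for f :: "nat \<Rightarrow> 'k"
    using that by (simp add: trunc_carrier_iff)
  interpret s: tensor_hom base_field R "trunc M :: ('k, nat \<Rightarrow> 'k) module"
    R "trunc (Suc M) :: ('k, nat \<Rightarrow> 'k) module" id "\<lambda>f. f"
    by (intro tensor_hom.intro tn.tensor_modules_axioms tensor_hom_axioms.intro)
       (auto simp: linear_maps_def incl trunc_def)
  have ex: "\<exists>\<gamma>\<in>carrier R. t = s.tm (tr.tm t) \<oplus>\<^bsub>T (Suc M)\<^esub> pt (Suc M) \<gamma> (\<epsilon> (Suc M) M)" if "t \<in> carrier (T (Suc M))" for t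
    using that
  proof (induction rule: tn.tensor_induct)
    case (pure r a)
    have rc: "trunc_restr M a \<in> carrier (trunc (Suc M))" by (rule incl) (simp add: trunc_restr_def)
    have a: "a = trunc_restr M a \<oplus>\<^bsub>trunc (Suc M)\<^esub> (a M \<odot>\<^bsub>trunc (Suc M)\<^esub> \<epsilon> (Suc M) M)"
      using pure(2) by (auto simp: fun_eq_iff trunc_add_apply trunc_smult_apply \<epsilon>_apply trunc_restr_def trunc_coeffs_def trunc_carrier_iff not_less_eq)
    have sm: "a M \<odot>\<^bsub>trunc (Suc M)\<^esub> \<epsilon> (Suc M) M \<in> carrier (trunc (Suc M))"
      by (simp add: trunc_carrier_iff trunc_smult_apply \<epsilon>_apply)
    have "pt (Suc M) r a = pt (Suc M) r (trunc_restr M a) \<oplus>\<^bsub>T (Suc M)\<^esub> pt (Suc M) r (a M \<odot>\<^bsub>trunc (Suc M)\<^esub> \<epsilon> (Suc M) M)"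
      by (subst a, rule tn.pure_add_right[OF pure(1) rc sm])
    also have "pt (Suc M) r (a M \<odot>\<^bsub>trunc (Suc M)\<^esub> \<epsilon> (Suc M) M) = pt (Suc M) (a M \<odot>\<^bsub>R\<^esub> r) (\<epsilon> (Suc M) M)"
      using pure by (intro tn.pure_smult[symmetric]) (simp_all add: base_field_def)
    finally have "pt (Suc M) r a = s.tm (tr.tm (pt (Suc M) r a)) \<oplus>\<^bsub>T (Suc M)\<^esub> pt (Suc M) (a M \<odot>\<^bsub>R\<^esub> r) (\<epsilon> (Suc M) M)"
      unfolding tr.tensor_map_pure s.tensor_map_pure id_apply .
    moreover have "a M \<odot>\<^bsub>R\<^esub> r \<in> carrier R" using pure by (intro R.smult_closed) (simp_all add: base_field_def)
    ultimately show ?case by (rule bexI)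
  next
    case (add t t')
    obtain \<gamma> where g: "\<gamma> \<in> carrier R" "t = s.tm (tr.tm t) \<oplus>\<^bsub>T (Suc M)\<^esub> pt (Suc M) \<gamma> (\<epsilon> (Suc M) M)"
      using add(3) by (elim bexE)
    obtain \<gamma>' where g': "\<gamma>' \<in> carrier R" "t' = s.tm (tr.tm t') \<oplus>\<^bsub>T (Suc M)\<^esub> pt (Suc M) \<gamma>' (\<epsilon> (Suc M) M)"
      using add(4) by (elim bexE)
    define x x' where "x = s.tm (tr.tm t)" "x' = s.tm (tr.tm t')"
    have x: "x \<in> carrier (T (Suc M))" "x' \<in> carrier (T (Suc M))"
      unfolding x_x'_def by (intro s.tensor_map_closed tr.tensor_map_closed add)+
    have "t \<oplus>\<^bsub>T (Suc M)\<^esub> t' = (x \<oplus>\<^bsub>T (Suc M)\<^esub> pt (Suc M) \<gamma> (\<epsilon> (Suc M) M)) \<oplus>\<^bsub>T (Suc M)\<^esub> (x' \<oplus>\<^bsub>T (Suc M)\<^esub> pt (Suc M) \<gamma>' (\<epsilon> (Suc M) M))"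
      by (rule arg_cong2[where f = "ring.add (T (Suc M))", OF g(2)[folded x_x'_def] g'(2)[folded x_x'_def]])
    also have "\<dots> = (x \<oplus>\<^bsub>T (Suc M)\<^esub> x') \<oplus>\<^bsub>T (Suc M)\<^esub> (pt (Suc M) \<gamma> (\<epsilon> (Suc M) M) \<oplus>\<^bsub>T (Suc M)\<^esub> pt (Suc M) \<gamma>' (\<epsilon> (Suc M) M))"
      using x g(1) g'(1) by (simp add: tn.T.a_ac)
    also have "\<dots> = (x \<oplus>\<^bsub>T (Suc M)\<^esub> x') \<oplus>\<^bsub>T (Suc M)\<^esub> pt (Suc M) (\<gamma> \<oplus>\<^bsub>R\<^esub> \<gamma>') (\<epsilon> (Suc M) M)"
      using g(1) g'(1) by (simp add: tn.pure_add_left)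
    also have "x \<oplus>\<^bsub>T (Suc M)\<^esub> x' = s.tm (tr.tm (t \<oplus>\<^bsub>T (Suc M)\<^esub> t'))"
      unfolding x_x'_def tr.tensor_map_add[OF add(1,2)]
      by (rule s.tensor_map_add[OF tr.tensor_map_closed[OF add(1)] tr.tensor_map_closed[OF add(2)], symmetric])
    finally show ?case by (rule bexI) (use g(1) g'(1) in simp)
  qed
  obtain g where g: "g \<in> carrier R" "t = s.tm (tr.tm t) \<oplus>\<^bsub>T (Suc M)\<^esub> pt (Suc M) g (\<epsilon> (Suc M) M)"
    using ex[OF assms(1)] by (elim bexE)
  obtain g' where g': "g' \<in> carrier R" "t' = s.tm (tr.tm t') \<oplus>\<^bsub>T (Suc M)\<^esub> pt (Suc M) g' (\<epsilon> (Suc M) M)"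
    using ex[OF assms(2)] by (elim bexE)
  define x where "x = s.tm (tr.tm t')"
  have x: "x \<in> carrier (T (Suc M))" unfolding x_def by (intro s.tensor_map_closed tr.tensor_map_closed assms)
  have t: "t = x \<oplus>\<^bsub>T (Suc M)\<^esub> pt (Suc M) g (\<epsilon> (Suc M) M)" "t' = x \<oplus>\<^bsub>T (Suc M)\<^esub> pt (Suc M) g' (\<epsilon> (Suc M) M)"
    using g(2) g'(2) unfolding assms(3) x_def .
  have "g = g' \<oplus>\<^bsub>R\<^esub> (g \<ominus>\<^bsub>R\<^esub> g')" using g(1) g'(1) by (metis R.minus_eq R.a_lcomm R.r_neg R.a_inv_closed R.r_zero)
  then have "pt (Suc M) g (\<epsilon> (Suc M) M) = pt (Suc M) (g' \<oplus>\<^bsub>R\<^esub> (g \<ominus>\<^bsub>R\<^esub> g')) (\<epsilon> (Suc M) M)" by (rule arg_cong)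
  also have "\<dots> = pt (Suc M) g' (\<epsilon> (Suc M) M) \<oplus>\<^bsub>T (Suc M)\<^esub> pt (Suc M) (g \<ominus>\<^bsub>R\<^esub> g') (\<epsilon> (Suc M) M)"
    using g(1) g'(1) by (intro tn.pure_add_left) simp_all
  finally have "t = t' \<oplus>\<^bsub>T (Suc M)\<^esub> pt (Suc M) (g \<ominus>\<^bsub>R\<^esub> g') (\<epsilon> (Suc M) M)"
    unfolding t using x g(1) g'(1) by (simp add: tn.T.a_assoc)
  then show ?thesis using g(1) g'(1) by (intro that[of "g \<ominus>\<^bsub>R\<^esub> g'"]) simp_all
qed

subsection \<open>Consequences of flatness\<close>

text \<open>The inclusion of the socle (\<epsilon>^M) into B = k[\<epsilon>]/(\<epsilon>^(M+1))
  stays injective after tensoring with the flat quotient Q. In Q \<otimes> B the element t \<otimes>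
  \<epsilon>^M equals \<epsilon>^M t \<otimes> 1 = 0, so it is zero already in Q \<otimes>
  (\<epsilon>^M), where the value of t at \<epsilon> = 0 can be read off. \<open>kill\<close> makes
  that value well defined on Q.\<close>

lemma flat_extract:
  assumes J: "flat_family R (trunc (Suc M)) J"
    and kill: "\<And>s. s \<in> J \<Longrightarrow> fps_nth (\<phi> (Suc M) s) 0 = 0"
    and t: "t \<in> carrier (T (Suc M))" and tJ: "pt (Suc M) \<one>\<^bsub>R\<^esub> (\<epsilon> (Suc M) M) \<otimes>\<^bsub>T (Suc M)\<^esub> t \<in> J"
  shows "fps_nth (\<phi> (Suc M) t) 0 = 0"
proof -
  let ?B = "trunc (Suc M) :: ('k, nat \<Rightarrow> 'k) module"
  let ?Q = "family_module R ?B J"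
  have idJ: "ideal J (T (Suc M))" and flat: "flat_module ?B ?Q" using J by (auto simp: flat_family_def)
  interpret J: ideal J "T (Suc M)" by (rule idJ)
  interpret Q: module ?B ?Q by (rule tn.module_family_module[OF idJ])
  define N where "N = emb_module (Suc M) (carrier ?B)"
  define N' :: "(nat \<Rightarrow> 'k, (nat \<Rightarrow> nat \<Rightarrow> 'k) set) module"
    where "N' = emb_module (Suc M) (trunc_order (Suc M) M)"
  interpret N: module ?B N unfolding N_def by (rule module_emb_module) (rule ring.oneideal[OF cring.axioms(1)[OF cring_trunc]])
  interpret N': module ?B N' unfolding N'_def by (rule module_emb_module) (rule ideal_trunc_order)
  have lin: "id \<in> linear_maps ?B N' N"
    by (auto simp: linear_maps_def N_def N'_def emb_module_def)
  interpret th: tensor_hom ?B ?Q N' ?Q N id id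
    by unfold_locales (use lin in \<open>auto simp: linear_maps_def\<close>)
  have inj: "inj_on th.tm (carrier th.A.TT)"
    using flat lin N.module_axioms N'.module_axioms unfolding flat_module_def by (auto simp: inj_on_def id_def)
  define q where "q = J +>\<^bsub>T (Suc M)\<^esub> t"
  have q: "q \<in> carrier ?Q" unfolding q_def by (rule tn.family_closed[OF idJ t])
  have eN': "emb (\<epsilon> (Suc M) M) \<in> carrier N'" by (simp add: N'_def emb_module_def \<epsilon>_apply)
  have oN: "emb \<one>\<^bsub>?B\<^esub> \<in> carrier N" by (simp add: N_def emb_module_def)
  have zQ: "\<epsilon> (Suc M) M \<odot>\<^bsub>?Q\<^esub> q = \<zero>\<^bsub>?Q\<^esub>"
  proof -
    have "\<epsilon> (Suc M) M \<odot>\<^bsub>?Q\<^esub> q = J +>\<^bsub>T (Suc M)\<^esub> (pt (Suc M) \<one>\<^bsub>R\<^esub> (\<epsilon> (Suc M) M) \<otimes>\<^bsub>T (Suc M)\<^esub> t)"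
      unfolding q_def by (rule tn.family_smult[OF idJ _ t]) simp
    also have "\<dots> = J" using tJ J.a_rcos_const by simp
    also have "\<dots> = \<zero>\<^bsub>?Q\<^esub>" by (simp add: tn.family_module_simps FactRing_def)
    finally show ?thesis .
  qed
  have eN: "emb (\<epsilon> (Suc M) M) = \<epsilon> (Suc M) M \<odot>\<^bsub>N\<^esub> emb \<one>\<^bsub>?B\<^esub>"
    by (simp add: N_def emb_module_def)
  have "th.B.pure q (emb (\<epsilon> (Suc M) M)) = th.B.pure (\<epsilon> (Suc M) M \<odot>\<^bsub>?Q\<^esub> q) (emb \<one>\<^bsub>?B\<^esub>)"
    unfolding eN by (rule th.B.pure_smult[symmetric]) (use q oN in simp_all)
  also have "\<dots> = \<zero>\<^bsub>th.B.TT\<^esub>" unfolding zQ by (rule th.B.pure_zero_left[OF oN])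
  also have "\<dots> = th.tm \<zero>\<^bsub>th.A.TT\<^esub>"
    by (rule additive_zero[OF th.A.abelian_group_tensor th.B.abelian_group_tensor th.tensor_map_closed th.tensor_map_add, symmetric])
  finally have "th.tm (th.A.pure q (emb (\<epsilon> (Suc M) M))) = th.tm \<zero>\<^bsub>th.A.TT\<^esub>"
    unfolding th.tensor_map_pure id_apply .
  then have zero: "th.A.pure q (emb (\<epsilon> (Suc M) M)) = \<zero>\<^bsub>th.A.TT\<^esub>"
    by (rule inj_onD[OF inj _ th.A.pure_closed[OF q eN'] th.A.T.zero_closed])
  define rp where "rp q = (SOME t. t \<in> carrier (T (Suc M)) \<and> q = J +>\<^bsub>T (Suc M)\<^esub> t)" for q
  define ev where "ev q = fps_nth (\<phi> (Suc M) (rp q)) 0" for q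
  have ev: "ev (J +>\<^bsub>T (Suc M)\<^esub> s) = fps_nth (\<phi> (Suc M) s) 0" if s: "s \<in> carrier (T (Suc M))" for s
  proof -
    define s' where "s' = rp (J +>\<^bsub>T (Suc M)\<^esub> s)"
    have s': "s' \<in> carrier (T (Suc M))" "J +>\<^bsub>T (Suc M)\<^esub> s = J +>\<^bsub>T (Suc M)\<^esub> s'"
      using someI[of "\<lambda>t. t \<in> carrier (T (Suc M)) \<and> J +>\<^bsub>T (Suc M)\<^esub> s = J +>\<^bsub>T (Suc M)\<^esub> t" s] s
      unfolding s'_def rp_def by auto
    then have "s \<oplus>\<^bsub>T (Suc M)\<^esub> \<ominus>\<^bsub>T (Suc M)\<^esub> s' \<in> J" using tn.family_eq[OF idJ s] by simp
    from kill[OF this] show ?thesis using s s' unfolding ev_def s'_def[symmetric] by (simp add: \<phi>_add \<phi>_uminus)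
  qed
  have ev_add: "ev (x \<oplus>\<^bsub>?Q\<^esub> y) = ev x + ev y" if xy: "x \<in> carrier ?Q" "y \<in> carrier ?Q" for x y
  proof -
    obtain s where s: "s \<in> carrier (T (Suc M))" "x = J +>\<^bsub>T (Suc M)\<^esub> s" using xy(1) by (rule tn.family_carrier_cases)
    obtain s' where s': "s' \<in> carrier (T (Suc M))" "y = J +>\<^bsub>T (Suc M)\<^esub> s'" using xy(2) by (rule tn.family_carrier_cases)
    show ?thesis unfolding s(2) s'(2) using s(1) s'(1) by (simp add: tn.family_add[OF idJ] ev \<phi>_add)
  qed
  have ev_smult: "ev (b \<odot>\<^bsub>?Q\<^esub> x) = \<iota> (b 0) * ev x" if b: "b \<in> carrier ?B" and x: "x \<in> carrier ?Q" for b x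
  proof -
    obtain s where s: "s \<in> carrier (T (Suc M))" "x = J +>\<^bsub>T (Suc M)\<^esub> s" using x by (rule tn.family_carrier_cases)
    have p1: "pt (Suc M) \<one>\<^bsub>R\<^esub> b \<in> carrier (T (Suc M))" using b by (intro tn.pure_closed) simp_all
    have "fps_nth (\<phi> (Suc M) (pt (Suc M) \<one>\<^bsub>R\<^esub> b \<otimes>\<^bsub>T (Suc M)\<^esub> s)) 0 = \<iota> (b 0) * fps_nth (\<phi> (Suc M) s) 0"
      using \<phi>_mult[OF p1 s(1)] M \<Phi>_one[of 0] b by (simp add: \<phi>_pure)
    then show ?thesis unfolding s(2) using s(1) b p1 by (simp add: tn.family_smult[OF idJ] ev)
  qed
  have "\<exists>h. (\<forall>t\<in>carrier th.A.TT. h t \<in> carrier (add_ring :: 'K ring)) \<and>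
    (\<forall>s\<in>carrier th.A.TT. \<forall>t\<in>carrier th.A.TT. h (s \<oplus>\<^bsub>th.A.TT\<^esub> t) = h s \<oplus>\<^bsub>add_ring\<^esub> h t) \<and>
    (\<forall>x\<in>carrier ?Q. \<forall>y\<in>carrier N'. h (th.A.pure x y) = ev x * \<iota> (unemb y M))"
  proof (rule th.A.universal[OF abelian_group_add_ring])
    \<comment> \<open>On the socle b acts through its constant term, and \<open>ev\<close> lets b
      act on Q through the same scalar; therefore the functional is balanced.\<close>
    fix b x y assume b: "b \<in> carrier ?B" and x: "x \<in> carrier ?Q" and y: "y \<in> carrier N'"
    obtain z where z: "z \<in> trunc_order (Suc M) M" "y = emb z" using y by (auto simp: N'_def emb_module_def)
    have "(b \<otimes>\<^bsub>?B\<^esub> z) M = (\<Sum>i=0..M. b i * z (M - i))" by (simp add: trunc_mult_apply fps_mult_nth)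
    also have "\<dots> = (\<Sum>i\<in>{0}. b i * z (M - i))"
      by (rule sum.mono_neutral_right) (use z in auto)
    finally have "(b \<otimes>\<^bsub>?B\<^esub> z) M = b 0 * z M" by simp
    then show "ev (b \<odot>\<^bsub>?Q\<^esub> x) * \<iota> (unemb y M) = ev x * \<iota> (unemb (b \<odot>\<^bsub>N'\<^esub> y) M)"
      unfolding ev_smult[OF b x] z by (simp add: N'_def emb_module_def)
  next
    fix x y y' assume "x \<in> carrier ?Q" "y \<in> carrier N'" "y' \<in> carrier N'"
    then show "ev x * \<iota> (unemb (y \<oplus>\<^bsub>N'\<^esub> y') M) = ev x * \<iota> (unemb y M) \<oplus>\<^bsub>add_ring\<^esub> ev x * \<iota> (unemb y' M)"
      by (auto simp: N'_def emb_module_def trunc_add_apply add_ring_def distrib_left)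
  qed (simp_all add: add_ring_def ev_add distrib_right)
  then obtain h where hadd: "\<forall>s\<in>carrier th.A.TT. \<forall>t\<in>carrier th.A.TT. h (s \<oplus>\<^bsub>th.A.TT\<^esub> t) = h s + h t"
    and hp: "\<forall>x\<in>carrier ?Q. \<forall>y\<in>carrier N'. h (th.A.pure x y) = ev x * \<iota> (unemb y M)"
    by (elim exE conjE) (simp add: add_ring_def)
  have "h \<zero>\<^bsub>th.A.TT\<^esub> = h \<zero>\<^bsub>th.A.TT\<^esub> + h \<zero>\<^bsub>th.A.TT\<^esub>"
    using hadd[rule_format, of "\<zero>\<^bsub>th.A.TT\<^esub>" "\<zero>\<^bsub>th.A.TT\<^esub>"] by (simp only: th.A.T.l_zero th.A.T.zero_closed)
  then have "h \<zero>\<^bsub>th.A.TT\<^esub> = 0" by (simp only: add_cancel_right_right)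
  moreover have "h \<zero>\<^bsub>th.A.TT\<^esub> = ev q * \<iota> (unemb (emb (\<epsilon> (Suc M) M)) M)"
    using hp[rule_format, OF q eN'] unfolding zero .
  ultimately have "ev q = 0" by (simp add: \<epsilon>_apply)
  then show ?thesis unfolding q_def ev[OF t] .
qed

end

section \<open>The obstruction equation\<close>

lemma type_ring_hom_pconst2: "type_ring_hom (\<lambda>c::'a::comm_ring_1. [:[:c:]:])"
  by (rule type_ring_hom_comp[OF type_ring_hom_pconst type_ring_hom_pconst])

context deform
begin

text \<open>The multipliers \<open>\<gamma>\<close> are the coefficients of \<open>\<epsilon>\<^sup>M\<close> in lifts of the generators
  \<open>y\<^sub>j - p\<^sub>j - \<tau> q\<^sub>j - \<epsilon> u\<^sub>j\<close> of the ideal of the family.\<close>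

lemma obstruction_equation:
  fixes \<rho> :: "('k, 'n::finite) mpoly \<Rightarrow> 'r" and p q u :: "'n \<Rightarrow> 'k" and \<tau> :: 'K and Bf :: "('k, 'n) mpoly"
  assumes \<rho>: "\<And>F. \<rho> F \<in> carrier R" "\<And>F G. \<rho> (F + G) = \<rho> F \<oplus>\<^bsub>R\<^esub> \<rho> G" "\<And>F G. \<rho> (F * G) = \<rho> F \<otimes>\<^bsub>R\<^esub> \<rho> G"
      "\<And>c. \<rho> (mconst c) = c \<odot>\<^bsub>R\<^esub> \<one>\<^bsub>R\<^esub>"
    and coord: "\<And>j. lo M (\<Phi> (\<rho> (mvar j))) (fps_const (\<iota> (p j) + \<tau> * \<iota> (q j)) + fps_X * fps_const (\<iota> (u j)))"
    and Bf: "lo M (\<Phi> (\<rho> Bf)) (fps_const \<tau>)"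
    and unob: "deformations_unobstructed R I0"
  shows "\<exists>\<gamma> :: 'n \<Rightarrow> 'K. (\<forall>j. \<gamma> j \<in> E) \<and> (\<forall>F. \<rho> F = \<zero>\<^bsub>R\<^esub> \<longrightarrow>
     (\<forall>i<M. coeff (mev (\<lambda>c. [:[:c:]:]) (\<lambda>j. [:[:p j, q j:], [:u j:]:]) F) i = 0) \<longrightarrow>
     pev \<iota> \<tau> (coeff (mev (\<lambda>c. [:[:c:]:]) (\<lambda>j. [:[:p j, q j:], [:u j:]:]) F) M) =
     (\<Sum>j\<in>UNIV. mev \<iota> (\<lambda>j. \<iota> (p j) + \<tau> * \<iota> (q j)) (mpoly_pderiv j F) * \<gamma> j))"
proof -
  let ?B = "trunc (Suc M) :: ('k, nat \<Rightarrow> 'k) module"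
  let ?T = "T (Suc M)"
  let ?e = "\<one>\<^bsub>?B\<^esub>" and ?pt = "pt (Suc M)" and ?\<epsilon> = "\<epsilon> (Suc M)"
  let ?W = "mev (\<lambda>c. [:[:c:]:]) (\<lambda>j. [:[:p j, q j:], [:u j:]:])"
    and ?ev0 = "mev \<iota> (\<lambda>j. \<iota> (p j) + \<tau> * \<iota> (q j))"
  obtain J where J: "flat_family R ?B J" and JI: "tr.tm ` J = I"
    using lifting_exists[OF unob] .
  interpret J: ideal J ?T using J by (simp add: flat_family_def)
  have one: "?e \<in> carrier ?B" by (rule trunc_one_carrier)
  have \<epsilon>0: "\<epsilon> n 0 = \<one>\<^bsub>trunc n\<^esub>" for n by (simp add: \<epsilon>_def trunc_one)
  have \<epsilon>_mult: "\<epsilon> n i \<otimes>\<^bsub>trunc n\<^esub> \<epsilon> n j = \<epsilon> n (i + j)" for n i j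
    by (simp add: \<epsilon>_def trunc_mult power_add)
  have \<epsilon>1: "\<epsilon> n i \<otimes>\<^bsub>trunc n\<^esub> \<one>\<^bsub>trunc n\<^esub> = \<epsilon> n i" "\<one>\<^bsub>trunc n\<^esub> \<otimes>\<^bsub>trunc n\<^esub> \<epsilon> n i = \<epsilon> n i" for n i
    using \<epsilon>_mult[of n i 0] \<epsilon>_mult[of n 0 i] unfolding \<epsilon>0 by simp_all
  have o1: "?e \<otimes>\<^bsub>?B\<^esub> ?e = ?e"
    using \<epsilon>1(1)[of "Suc M" 0] unfolding \<epsilon>0 .
  have \<epsilon>_top: "\<epsilon> n i = \<zero>\<^bsub>trunc n\<^esub>" if "n \<le> i" for n i
    using that by (auto simp: fun_eq_iff \<epsilon>_apply trunc_zero_apply)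
  have abs\<epsilon>: "Abs_fps (\<lambda>j. \<iota> (\<epsilon> n i j)) = fps_X ^ i" if "i < n" for n i
    using that by (auto simp: fps_eq_iff \<epsilon>_apply)
  have abs1: "Abs_fps (\<lambda>j. \<iota> (\<one>\<^bsub>trunc n\<^esub> j)) = 1" if "0 < n" for n
    using abs\<epsilon>[of 0 n] that unfolding \<epsilon>0 by simp
  have k1: "(1::'k) = \<one>\<^bsub>base_field\<^esub>" by (simp add: base_field_def)
  have kc: "c \<in> carrier (base_field :: ('k, 'k) module)" for c by (simp add: base_field_def)
  have \<rho>1: "\<rho> 1 = \<one>\<^bsub>R\<^esub>"
  proof -
    have "\<rho> 1 = 1 \<odot>\<^bsub>R\<^esub> \<one>\<^bsub>R\<^esub>" using \<rho>(4)[of 1] by simp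
    also have "\<dots> = \<one>\<^bsub>R\<^esub>" unfolding k1 by (rule R.smult_one) simp
    finally show ?thesis .
  qed
  have \<rho>_um: "\<rho> (- F) = \<ominus>\<^bsub>R\<^esub> \<rho> F" for F
  proof (rule R.minus_equality[symmetric])
    have "\<rho> 0 = \<rho> 0 \<oplus>\<^bsub>R\<^esub> \<rho> 0" using \<rho>(2)[of 0 0] by simp
    then have "\<rho> 0 = \<zero>\<^bsub>R\<^esub>" using \<rho>(1)[of 0] R.add.r_cancel_one' by metis
    then show "\<rho> (- F) \<oplus>\<^bsub>R\<^esub> \<rho> F = \<zero>\<^bsub>R\<^esub>" using \<rho>(2)[of "- F" F] by simp
  qed (simp_all add: \<rho>)
  have \<Phi>c: "lo M (\<Phi> (\<rho> (mconst c))) (fps_const (\<iota> c))" for c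
    unfolding \<rho>(4) using \<Phi>_one by (simp add: \<Phi>_smult)
  have \<Phi>m: "lo M (\<Phi> (\<rho> (F * G))) (\<Phi> (\<rho> F) * \<Phi> (\<rho> G))" for F G
    unfolding \<rho>(3) using \<Phi>_mult \<rho>(1) by simp
  \<comment> \<open>\<open>Bf\<close> represents the parameter of the line, so this function has the
    constant expansion p_j + \<tau> q_j below order M: the coordinate of the undisplaced
    line.\<close>
  define Lf where "Lf j = mconst (p j) + Bf * mconst (q j)" for j
  have \<Phi>L: "lo M (\<Phi> (\<rho> (Lf j))) (fps_const (\<iota> (p j) + \<tau> * \<iota> (q j)))" for j
  proof -
    have "lo M (\<Phi> (\<rho> (Bf * mconst (q j)))) (fps_const \<tau> * fps_const (\<iota> (q j)))"
      using \<Phi>m[of Bf "mconst (q j)"] lo_mult[OF Bf \<Phi>c[of "q j"]] by simp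
    then show ?thesis using \<Phi>c[of "p j"] unfolding Lf_def \<rho>(2)
      by (simp add: \<Phi>_add \<rho>(1) del: fps_const_mult fps_const_add)
  qed
  define x where "x j = \<rho> (mvar j - Lf j)" for j
  have xc: "x j \<in> carrier R" for j unfolding x_def by (rule \<rho>)
  have \<Phi>x: "lo M (\<Phi> (x j)) (fps_X * fps_const (\<iota> (u j)))" for j
  proof -
    have "mvar j = (mvar j - Lf j) + Lf j" by simp
    then have "\<Phi> (\<rho> (mvar j)) = \<Phi> (x j) + \<Phi> (\<rho> (Lf j))"
      unfolding x_def by (metis \<Phi>_add \<rho>(1,2))
    then have "\<Phi> (x j) = \<Phi> (\<rho> (mvar j)) - \<Phi> (\<rho> (Lf j))" by simp
    then show ?thesis using coord[of j] \<Phi>L[of j] by simp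
  qed
  \<comment> \<open>The element y_j - Lf_j - \<epsilon> u_j over k[\<epsilon>]/(\<epsilon>^(M+1)).
    Its expansion vanishes below order M, so its truncation lies in the ideal of the family.\<close>
  define D where "D j = ?pt (x j) ?e \<oplus>\<^bsub>?T\<^esub> ?pt (\<rho> (mconst (- u j))) (?\<epsilon> 1)" for j
  have Dc: "D j \<in> carrier ?T" for j unfolding D_def using xc \<rho>(1) one by simp
  have "tr.tm (D j) \<in> I" for j
  proof -
    have "lo M (\<phi> (Suc M) (D j)) (fps_X * fps_const (\<iota> (u j)) + fps_const (\<iota> (- u j)) * fps_X)"
    proof -
      have "\<phi> (Suc M) (D j) = \<Phi> (x j) + \<Phi> (\<rho> (mconst (- u j))) * fps_X"
        unfolding D_def using xc \<rho>(1) one M abs1[of "Suc M"] abs\<epsilon>[of 1 "Suc M"] by (simp add: \<phi>_add \<phi>_pure)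
      moreover have "lo M (\<Phi> (\<rho> (mconst (- u j))) * fps_X) (fps_const (\<iota> (- u j)) * fps_X)"
        by (rule lo_mult[OF \<Phi>c]) simp
      ultimately show ?thesis using \<Phi>x by simp
    qed
    then have "lo M (\<phi> (Suc M) (D j)) 0" by (simp add: mult.commute)
    then show ?thesis using \<phi>_restr[OF Dc[of j]] tr.tensor_map_closed[OF Dc[of j]] unfolding I_def by simp
  qed
  then have "\<exists>s. s \<in> J \<and> tr.tm s = tr.tm (D j)" for j
    unfolding JI[symmetric] by (metis imageE)
  then obtain G where G: "\<And>j. G j \<in> J" "\<And>j. tr.tm (G j) = tr.tm (D j)" by metis
  have Gc: "G j \<in> carrier ?T" for j using G(1) J.a_subset by (rule subsetD[rotated])
  \<comment> \<open>The lift chosen in J and \<open>D j\<close> have the same truncation, so they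
    differ by a multiple of \<epsilon>^M. This multiple is the unknown of the equation.\<close>
  have "\<exists>d. d \<in> carrier R \<and> D j = G j \<oplus>\<^bsub>?T\<^esub> ?pt d (?\<epsilon> M)" for j
    using restr_kernel[OF Dc Gc G(2)[symmetric]] by metis
  then obtain d where d: "\<And>j. d j \<in> carrier R" "\<And>j. D j = G j \<oplus>\<^bsub>?T\<^esub> ?pt (d j) (?\<epsilon> M)" by metis
  \<comment> \<open>One variable for \<open>Bf\<close>, one for \<epsilon>, and for every j one for
    \<open>d j\<close> and one for the lift \<open>G j\<close>. Forms are expanded in this
    polynomial ring, where Taylor's formula is available, and the result is mapped to the tensor
    product by \<theta>.\<close>
  define a :: "bool + 'n + 'n \<Rightarrow> _" where
    "a v = (case v of Inl b \<Rightarrow> if b then ?pt \<one>\<^bsub>R\<^esub> (?\<epsilon> 1) else ?pt (\<rho> Bf) ?e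
       | Inr w \<Rightarrow> (case w of Inl j \<Rightarrow> ?pt (d j) ?e | Inr j \<Rightarrow> G j))" for v
  define \<sigma> where "\<sigma> c = ?pt (\<rho> (mconst c)) ?e" for c
  have "\<exists>\<theta> :: ('k, bool + 'n + 'n) mpoly \<Rightarrow> _. (\<forall>F. \<theta> F \<in> carrier ?T) \<and> (\<forall>F G. \<theta> (F + G) = \<theta> F \<oplus>\<^bsub>?T\<^esub> \<theta> G) \<and>
    (\<forall>F G. \<theta> (F * G) = \<theta> F \<otimes>\<^bsub>?T\<^esub> \<theta> G) \<and> (\<forall>c. \<theta> (mconst c) = \<sigma> c) \<and> (\<forall>v. \<theta> (mvar v) = a v)"
  proof (rule tn.T.mpoly_hom_exists)
    show "\<sigma> c \<in> carrier ?T" for c unfolding \<sigma>_def by (intro tn.pure_closed \<rho> one)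
    show "\<sigma> (c + c') = \<sigma> c \<oplus>\<^bsub>?T\<^esub> \<sigma> c'" for c c'
      unfolding \<sigma>_def single_add \<rho>(2) by (intro tn.pure_add_left \<rho> one)
    show "\<sigma> (c * c') = \<sigma> c \<otimes>\<^bsub>?T\<^esub> \<sigma> c'" for c c'
    proof -
      have "mconst (c * c') = mconst c * (mconst c' :: ('k, 'n) mpoly)" by (simp add: mult_single)
      then have "\<rho> (mconst (c * c')) = \<rho> (mconst c) \<otimes>\<^bsub>R\<^esub> \<rho> (mconst c')" by (simp add: \<rho>(3))
      then show ?thesis unfolding \<sigma>_def using one \<rho>(1) by (simp add: tn.pure_mult o1 \<epsilon>1)
    qed
    show "\<sigma> 1 = \<one>\<^bsub>?T\<^esub>" unfolding \<sigma>_def using \<rho>1 by (simp add: tn.pure_one)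
    show "a v \<in> carrier ?T" for v
      unfolding a_def using one Gc d \<rho>(1) by (auto split: sum.split)
  qed
  then obtain \<theta> :: "('k, bool + 'n + 'n) mpoly \<Rightarrow> _" where \<theta>': "\<forall>F. \<theta> F \<in> carrier ?T"
      "\<forall>F G. \<theta> (F + G) = \<theta> F \<oplus>\<^bsub>?T\<^esub> \<theta> G" "\<forall>F G. \<theta> (F * G) = \<theta> F \<otimes>\<^bsub>?T\<^esub> \<theta> G"
      "\<forall>c. \<theta> (mconst c) = \<sigma> c" "\<forall>v. \<theta> (mvar v) = a v"
    by (elim exE conjE)
  note \<theta> = \<theta>'[rule_format]
  define vt ve :: "('k, bool + 'n + 'n) mpoly" where "vt = mvar (Inl False)" and "ve = mvar (Inl True)"
  define vg vG :: "'n \<Rightarrow> ('k, bool + 'n + 'n) mpoly" where "vg j = mvar (Inr (Inl j))" and "vG j = mvar (Inr (Inr j))" for j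
  have \<theta>v: "\<theta> vt = ?pt (\<rho> Bf) ?e" "\<theta> ve = ?pt \<one>\<^bsub>R\<^esub> (?\<epsilon> 1)"
    "\<theta> (vg j) = ?pt (d j) ?e" "\<theta> (vG j) = G j" for j
    by (simp_all add: vt_def ve_def vg_def vG_def \<theta>(5) a_def)
  have \<theta>1: "\<theta> 1 = \<one>\<^bsub>?T\<^esub>"
    using \<theta>(4)[of 1] \<rho>1 by (simp add: \<sigma>_def tn.pure_one)
  have \<theta>e: "\<theta> (ve ^ i) = ?pt \<one>\<^bsub>R\<^esub> (?\<epsilon> i)" for i
  proof (induction i)
    case 0 then show ?case by (simp add: \<theta>1 \<epsilon>0 tn.pure_one)
  next
    case (Suc i)
    then show ?case by (simp add: \<theta>(3) \<theta>v tn.pure_mult \<epsilon>_mult)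
  qed
  define a0 where "a0 j = mconst (p j) + vt * mconst (q j)" for j
  \<comment> \<open>Solves the definition of \<open>D j\<close> for the coordinate y_j, using D_j =
    G_j + d_j \<epsilon>^M.\<close>
  define Y where "Y j = (a0 j + ve * mconst (u j)) + ve ^ M * vg j + vG j" for j
  have \<theta>Y: "\<theta> (Y j) = ?pt (\<rho> (mvar j)) ?e" for j
  proof -
    have 1: "\<theta> (a0 j) = ?pt (\<rho> (Lf j)) ?e"
      unfolding a0_def Lf_def \<theta>(2,3,4) \<theta>v \<sigma>_def \<rho>(2,3)
      using one \<rho>(1) by (simp add: tn.pure_mult tn.pure_add_left o1 \<epsilon>1)
    have 2: "\<theta> (ve * mconst (u j)) = ?pt (\<rho> (mconst (u j))) (?\<epsilon> 1)"
      unfolding \<theta>(3,4) \<theta>v \<sigma>_def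
      using one \<rho>(1) by (simp add: tn.pure_mult o1 \<epsilon>1)
    have 3: "\<theta> (ve ^ M * vg j) = ?pt (d j) (?\<epsilon> M)"
      unfolding \<theta>(3) \<theta>e \<theta>v
      using one d(1) by (simp add: tn.pure_mult o1 \<epsilon>1)
    let ?a = "?pt (\<rho> (Lf j)) ?e" and ?b = "?pt (\<rho> (mconst (u j))) (?\<epsilon> 1)"
      and ?c = "?pt (d j) (?\<epsilon> M)"
    have cl: "?a \<in> carrier ?T" "?b \<in> carrier ?T" "?c \<in> carrier ?T" using one \<rho>(1) d(1) by simp_all
    have um: "\<rho> (mconst (- u j)) = \<ominus>\<^bsub>R\<^esub> \<rho> (mconst (u j))" using \<rho>_um[of "mconst (u j)"] by (simp add: single_uminus)
    have "\<theta> (Y j) = ?a \<oplus>\<^bsub>?T\<^esub> ?b \<oplus>\<^bsub>?T\<^esub> ?c \<oplus>\<^bsub>?T\<^esub> G j"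
      unfolding Y_def \<theta>(2) 1 2[unfolded \<theta>(3)] 3[unfolded \<theta>(3)] \<theta>(3) \<theta>v by (simp only: 2[unfolded \<theta>(3) \<theta>v] 3[unfolded \<theta>(3) \<theta>v])
    also have "\<dots> = ?a \<oplus>\<^bsub>?T\<^esub> ?b \<oplus>\<^bsub>?T\<^esub> D j"
      unfolding d(2) using cl Gc by (simp add: tn.T.a_ac)
    also have "D j = ?pt (x j) ?e \<oplus>\<^bsub>?T\<^esub> \<ominus>\<^bsub>?T\<^esub> ?b"
      unfolding D_def um using \<rho>(1) by (simp add: tn.pure_uminus_left)
    also have "?a \<oplus>\<^bsub>?T\<^esub> ?b \<oplus>\<^bsub>?T\<^esub> (?pt (x j) ?e \<oplus>\<^bsub>?T\<^esub> \<ominus>\<^bsub>?T\<^esub> ?b) = ?pt (x j) ?e \<oplus>\<^bsub>?T\<^esub> ?a"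
    proof -
      have xx: "?pt (x j) ?e \<in> carrier ?T" using xc one by simp
      have *: "X \<oplus>\<^bsub>?T\<^esub> Y \<oplus>\<^bsub>?T\<^esub> (Z \<oplus>\<^bsub>?T\<^esub> \<ominus>\<^bsub>?T\<^esub> Y) = Z \<oplus>\<^bsub>?T\<^esub> X"
        if "X \<in> carrier ?T" "Y \<in> carrier ?T" "Z \<in> carrier ?T" for X Y Z
      proof -
        have "X \<oplus>\<^bsub>?T\<^esub> Y \<oplus>\<^bsub>?T\<^esub> (Z \<oplus>\<^bsub>?T\<^esub> \<ominus>\<^bsub>?T\<^esub> Y) = (Z \<oplus>\<^bsub>?T\<^esub> X) \<oplus>\<^bsub>?T\<^esub> (Y \<oplus>\<^bsub>?T\<^esub> \<ominus>\<^bsub>?T\<^esub> Y)"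
          using that tn.T.a_inv_closed[OF that(2)] by (simp only: tn.T.a_ac tn.T.add.m_closed)
        then show ?thesis using that by (simp add: tn.T.r_neg)
      qed
      show ?thesis by (rule *[OF cl(1,2) xx])
    qed
    also have "\<dots> = ?pt (x j \<oplus>\<^bsub>R\<^esub> \<rho> (Lf j)) ?e"
      using xc \<rho>(1) one by (simp add: tn.pure_add_left)
    also have "x j \<oplus>\<^bsub>R\<^esub> \<rho> (Lf j) = \<rho> (mvar j)" unfolding x_def \<rho>(2)[symmetric] by simp
    finally show ?thesis .
  qed
  interpret mc: coeff_hom "mconst :: 'k \<Rightarrow> ('k, bool + 'n + 'n) mpoly" by (rule coeff_hom_mconst)
  have \<theta>ev: "\<theta> (mev mconst Y F) = ?pt (\<rho> F) ?e" for F
  proof (induction F rule: mpoly_induct)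
    case (const c) then show ?case by (simp add: \<theta>(4) \<sigma>_def)
  next
    case (var j) then show ?case by (simp add: \<theta>Y)
  next
    case (add F G) then show ?case using one \<rho>(1) by (simp add: \<theta>(2) \<rho>(2) tn.pure_add_left)
  next
    case (mult F G) then show ?case
      using one \<rho>(1) by (simp add: \<theta>(3) \<rho>(3) tn.pure_mult o1 \<epsilon>1)
  qed
  \<comment> \<open>The value on the line at \<epsilon> = 0; it is multiplicative because order 0
    lies below M.\<close>
  define ev where "ev F = fps_nth (\<phi> (Suc M) (\<theta> F)) 0" for F
  have ev_hom: "type_ring_hom ev"
  proof
    show "ev (F * G) = ev F * ev G" for F G
      using \<phi>_mult[OF \<theta>(1) \<theta>(1), of F G] M by (simp add: ev_def \<theta>(3))
    show add: "ev (F + G) = ev F + ev G" for F G by (simp add: ev_def \<theta>(1,2) \<phi>_add)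
    show "ev 0 = 0" using add[of 0 0] by (simp only: add_0_right add_cancel_right_right)
    show "ev 1 = 1"
      using \<phi>_pure[OF R.one_closed one] abs1[of "Suc M"] \<Phi>_one[of 0] M by (simp add: ev_def \<theta>1 tn.pure_one)
  qed
  interpret ev: type_ring_hom ev by (rule ev_hom)
  have ev_pure1: "ev F = fps_nth (\<Phi> r) 0" if "\<theta> F = ?pt r ?e" "r \<in> carrier R" for F r
    unfolding ev_def that(1) using that(2) one abs1[of "Suc M"] by (simp add: \<phi>_pure)
  have ev_const: "ev (mconst c) = \<iota> c" for c
    using ev_pure1[of "mconst c" "\<rho> (mconst c)"] \<Phi>c[of c] M \<rho>(1) by (simp add: \<theta>(4) \<sigma>_def)
  have ev_t: "ev vt = \<tau>" using ev_pure1[OF \<theta>v(1) \<rho>(1)] Bf M by simp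
  have ev_e: "ev ve = 0"
    unfolding ev_def \<theta>v using abs\<epsilon>[of 1 "Suc M"] M by (simp add: \<phi>_pure)
  have ev_a0: "ev (a0 j) = \<iota> (p j) + \<tau> * \<iota> (q j)" for j
    by (simp add: a0_def ev_const ev_t)
  have evJ: "fps_nth (\<phi> (Suc M) s) 0 = 0" if "s \<in> J" for s
  proof -
    have "tr.tm s \<in> I" unfolding JI[symmetric] using that by (rule imageI)
    moreover have "s \<in> carrier ?T" using that J.a_subset by (rule subsetD[rotated])
    ultimately show ?thesis using \<phi>_restr[of s] M by (simp add: I_def)
  qed
  \<comment> \<open>The sign comes from moving the contribution of \<open>d j\<close> to the other
    side of ev z = 0.\<close>
  define \<gamma> where "\<gamma> j = \<iota> (- 1) * fps_nth (\<Phi> (d j)) 0" for j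
  have "pev \<iota> \<tau> (coeff (?W F) M) =
     (\<Sum>j\<in>UNIV. ?ev0 (mpoly_pderiv j F) * \<gamma> j)"
    if F: "\<rho> F = \<zero>\<^bsub>R\<^esub>" and low: "\<forall>i<M. coeff (?W F) i = 0" for F
  proof -
    \<comment> \<open>F along the displaced line, as a polynomial in \<epsilon> over k[t]. By
      hypothesis it starts at order M.\<close>
    define W where "W = ?W F"
    interpret pt1: type_ring_hom "pev (mconst :: 'k \<Rightarrow> ('k, bool + 'n + 'n) mpoly) vt"
      by (rule mc.type_ring_hom_pev)
    define H where "H = pev (pev (mconst :: 'k \<Rightarrow> ('k, bool + 'n + 'n) mpoly) vt) ve"
    interpret H: type_ring_hom H unfolding H_def by (rule pt1.type_ring_hom_pev)
    obtain W' where W': "W = [:0, 1:] ^ M * pCons (coeff W M) W'"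
      using poly_low_coeffs_zero[of M W] low unfolding W_def by blast
    have "H [:0, 1:] = ve" unfolding H_def by (simp add: one_pCons)
    moreover have "H (pCons (coeff W M) W') = pev mconst vt (coeff W M) + ve * H W'" by (simp add: H_def)
    ultimately have HW: "H W = ve ^ M * (pev mconst vt (coeff W M) + ve * H W')"
      using arg_cong[OF W', of H] by (simp only: H.mult H.power)
    have HW': "H W = mev mconst (\<lambda>j. a0 j + ve * mconst (u j)) F"
      unfolding W_def
      by (subst mev_hom[OF H.type_ring_hom_axioms coeff_hom.intro[OF type_ring_hom_pconst2]])
         (simp add: H_def a0_def algebra_simps)
    obtain r1 where r1: "mev mconst Y F = mev mconst (\<lambda>j. (a0 j + ve * mconst (u j)) + ve ^ M * vg j) F + (\<Sum>j\<in>UNIV. vG j * r1 j)"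
      using mc.mev_add_diff[of "\<lambda>j. (a0 j + ve * mconst (u j)) + ve ^ M * vg j" vG F] unfolding Y_def by blast
    obtain r2 where r2: "mev mconst (\<lambda>j. (a0 j + ve * mconst (u j)) + ve ^ M * vg j) F = mev mconst (\<lambda>j. a0 j + ve * mconst (u j)) F +
        ve ^ M * (\<Sum>j\<in>UNIV. mev mconst (\<lambda>j. a0 j + ve * mconst (u j)) (mpoly_pderiv j F) * vg j) + ve ^ M * ve ^ M * r2"
      using mc.mev_taylor[of "\<lambda>j. a0 j + ve * mconst (u j)" "ve ^ M" vg F] by blast
    \<comment> \<open>The value of F at Y is \<epsilon>^M z plus a combination of the
      \<open>G j\<close>, which lie in J. As it is mapped to zero, \<epsilon>^M z lies in J and
      flatness gives ev z = 0. The second order remainder keeps a factor \<epsilon>^M and disappears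
      at \<epsilon> = 0, as does the multiple of H W'.\<close>
    define z where "z = pev mconst vt (coeff W M) + ve * H W' + (\<Sum>j\<in>UNIV. mev mconst (\<lambda>j. a0 j + ve * mconst (u j)) (mpoly_pderiv j F) * vg j) + ve ^ M * r2"
    have Y: "mev mconst Y F = ve ^ M * z + (\<Sum>j\<in>UNIV. vG j * r1 j)"
      unfolding r1 r2 HW'[symmetric] HW z_def by (simp add: algebra_simps)
    have sumJ: "\<theta> (\<Sum>j\<in>S. vG j * r1 j) \<in> J" for S
    proof (induction S rule: infinite_finite_induct)
      case (insert j S)
      have "G j \<otimes>\<^bsub>?T\<^esub> \<theta> (r1 j) \<in> J" by (rule J.I_r_closed[OF G(1) \<theta>(1)])
      then show ?case using insert by (simp add: \<theta>(2,3) \<theta>v)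
    qed (use \<theta>(2)[of 0 0] \<theta>(1)[of 0] tn.T.add.r_cancel_one' in \<open>simp_all\<close>)
    have "\<theta> (mev mconst Y F) = \<zero>\<^bsub>?T\<^esub>" unfolding \<theta>ev F by (rule tn.pure_zero_left[OF one])
    then have "\<theta> (ve ^ M * z) \<oplus>\<^bsub>?T\<^esub> \<theta> (\<Sum>j\<in>UNIV. vG j * r1 j) = \<zero>\<^bsub>?T\<^esub>" unfolding Y \<theta>(2) .
    then have "\<ominus>\<^bsub>?T\<^esub> \<theta> (\<Sum>j\<in>UNIV. vG j * r1 j) = \<theta> (ve ^ M * z)"
      by (intro tn.T.minus_equality \<theta>(1))
    then have "\<theta> (ve ^ M * z) \<in> J" using J.a_inv_closed[OF sumJ[of UNIV]] by simp
    then have "?pt \<one>\<^bsub>R\<^esub> (?\<epsilon> M) \<otimes>\<^bsub>?T\<^esub> \<theta> z \<in> J" unfolding \<theta>(3) \<theta>e .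
    then have "ev z = 0" unfolding ev_def by (intro flat_extract[OF J evJ \<theta>(1)])
    moreover have "ev (mev mconst (\<lambda>j. a0 j + ve * mconst (u j)) F') = ?ev0 F'" for F' :: "('k, 'n) mpoly"
      by (subst mev_hom[OF ev_hom coeff_hom_mconst]) (simp add: ev_a0 ev_const ev_e)
    moreover have "ev (pev mconst vt f) = pev \<iota> \<tau> f" for f
      by (subst mc.pev_hom[OF ev_hom]) (simp add: ev_t ev_const)
    moreover have "ev (vg j) = fps_nth (\<Phi> (d j)) 0" for j using ev_pure1[OF \<theta>v(3) d(1)] .
    ultimately have "pev \<iota> \<tau> (coeff W M) + (\<Sum>j\<in>UNIV. ?ev0 (mpoly_pderiv j F) * fps_nth (\<Phi> (d j)) 0) = 0"
      unfolding z_def using M by (simp add: ev_e zero_power)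
    then show ?thesis unfolding W_def \<gamma>_def
      by (simp add: sum_negf add_eq_0_iff2)
  qed
  moreover have "\<gamma> j \<in> E" for j unfolding \<gamma>_def by (intro E_scale E_coeff d M)
  ultimately show ?thesis by (intro exI[of _ \<gamma>]) blast
qed

end

section \<open>The Zariski topology\<close>

abbreviation pspan :: "'k::field ^ 'n::finite \<Rightarrow> ('k, 'n) point" where
  "pspan v \<equiv> vec.span {v}"

lemma pspan_iff: "w \<in> pspan v \<longleftrightarrow> (\<exists>c. w = c *s v)"
  by (auto simp: vec.span_singleton)

lemma pspan_in_proj_space: "v \<noteq> 0 \<Longrightarrow> pspan v \<in> proj_space"
  by (simp add: proj_space_def vec.dim_eq_card_independent vec.independent_insert)

lemma proj_space_cases:
  assumes "x \<in> proj_space"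
  obtains v where "v \<noteq> 0" "x = pspan v"
proof -
  have x: "vec.subspace x" "vec.dim x = 1" using assms by (auto simp: proj_space_def)
  obtain B where B: "B \<subseteq> x" "vec.independent B" "x \<subseteq> vec.span B" "card B = 1"
    using vec.basis_exists[of x] x(2) by metis
  obtain v where v: "B = {v}" using B(4) by (auto simp: card_1_singleton_iff)
  have "v \<noteq> 0" using B(2) v vec.dependent_zero by auto
  moreover have "x = pspan v" using B v x(1) vec.span_minimal[of B x] by auto
  ultimately show ?thesis by (rule that)
qed

lemma proj_point_eq_pspan:
  assumes "x \<in> proj_space" "w \<in> x" "w \<noteq> 0"
  shows "x = pspan w"
proof -
  obtain v where v: "v \<noteq> 0" "x = pspan v" using assms(1) by (rule proj_space_cases)
  obtain c where c: "w = c *s v" using assms(2) v by (auto simp: pspan_iff)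
  then have "c \<noteq> 0" using assms(3) by auto
  have "w \<in> pspan v" using c by (auto simp: pspan_iff)
  moreover have "v = inverse c *s w" using c \<open>c \<noteq> 0\<close> by (simp add: vector_smult_assoc)
  then have "v \<in> pspan w" by (auto simp: pspan_iff)
  ultimately show ?thesis unfolding v(2)
    by (intro subset_antisym vec.span_minimal vec.subspace_span) simp_all
qed

lemma proj_point_nonzero:
  assumes "x \<in> proj_space"
  shows "\<exists>v. v \<in> x - {0}"
proof -
  obtain v where "v \<noteq> 0" "x = pspan v" using assms by (rule proj_space_cases)
  then show ?thesis using vec.span_base[of v "{v}"] by blast
qed

lemma vanishes_at_iff:
  assumes "F \<in> homogeneous_polys d" "x \<in> proj_space" "v \<in> x - {0}"
  shows "vanishes_at F x \<longleftrightarrow> mpoly_eval F v = 0"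
proof -
  have "x = pspan v" using assms proj_point_eq_pspan by blast
  then show ?thesis using assms(3)
    by (auto simp: vanishes_at_def pspan_iff mpoly_eval_smult_homogeneous[OF assms(1)])
qed

lemma vanishes_at_pspan:
  assumes "F \<in> homogeneous_polys d" "v \<noteq> 0"
  shows "vanishes_at F (pspan v) \<longleftrightarrow> mpoly_eval F v = 0"
  using vanishes_at_iff[OF assms(1) pspan_in_proj_space[OF assms(2)], of v] assms(2) vec.span_base[of v "{v}"] by blast

definition basic_open :: "('k::field, 'n::finite) mpoly \<Rightarrow> ('k, 'n) point set" where
  "basic_open F = {x \<in> proj_space. \<not> vanishes_at F x}"

lemma basic_open_iff:
  assumes "F \<in> homogeneous_polys d" "x \<in> proj_space" "v \<in> x - {0}"
  shows "x \<in> basic_open F \<longleftrightarrow> mpoly_eval F v \<noteq> 0"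
  using vanishes_at_iff[OF assms] assms(2) by (simp add: basic_open_def)

lemma basic_open_pspan:
  assumes "F \<in> homogeneous_polys d" "v \<noteq> 0"
  shows "pspan v \<in> basic_open F \<longleftrightarrow> mpoly_eval F v \<noteq> 0"
  using vanishes_at_pspan[OF assms] pspan_in_proj_space[OF assms(2)] by (simp add: basic_open_def)

lemma basic_open_mult:
  assumes "F \<in> homogeneous_polys d" "G \<in> homogeneous_polys e"
  shows "basic_open (F * G) = basic_open F \<inter> basic_open G"
proof (rule Set.set_eqI)
  fix x
  show "x \<in> basic_open (F * G) \<longleftrightarrow> x \<in> basic_open F \<inter> basic_open G"
  proof (cases "x \<in> proj_space")
    case True
    then obtain v where "v \<in> x - {0}" using proj_point_nonzero by blast
    then show ?thesis
      using basic_open_iff[OF assms(1) True] basic_open_iff[OF assms(2) True]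
        basic_open_iff[OF homogeneous_polys_mult[OF assms] True] by simp
  qed (simp add: basic_open_def)
qed

lemma basic_open_one: "basic_open 1 = proj_space"
  unfolding basic_open_def vanishes_at_def using proj_point_nonzero by force

lemma openin_basic_open: "F \<in> homogeneous_polys d \<Longrightarrow> openin zariski (basic_open F)"
  unfolding zariski_def basic_open_def
  by (rule topology_generated_by_Basis) blast

text \<open>Products of forms give intersections, so the generating sets are already a base.\<close>

lemma zariski_basis:
  assumes "openin zariski U" "x \<in> U"
  shows "\<exists>d. \<exists>F\<in>homogeneous_polys d. x \<in> basic_open F \<and> basic_open F \<subseteq> U"
  using assms(1)[unfolded zariski_def openin_topology_generated_by_iff] assms(2)
proof (induction arbitrary: x rule: generate_topology_on.induct)
  case (Int a b)
  obtain d F where F: "F \<in> homogeneous_polys d" "x \<in> basic_open F" "basic_open F \<subseteq> a" using Int by blast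
  obtain e G where G: "G \<in> homogeneous_polys e" "x \<in> basic_open G" "basic_open G \<subseteq> b" using Int by blast
  show ?case
    using F G by (intro exI[of _ "d + e"] bexI[of _ "F * G"] homogeneous_polys_mult) (auto simp: basic_open_mult)
next
  case (UN K)
  then obtain k where k: "k \<in> K" "x \<in> k" by blast
  obtain d F where "F \<in> homogeneous_polys d" "x \<in> basic_open F" "basic_open F \<subseteq> k" using UN.IH[OF k] by blast
  then show ?case using k by blast
next
  case (Basis s)
  then obtain F d where "F \<in> homogeneous_polys d" "s = basic_open F" unfolding basic_open_def by blast
  then show ?case using Basis by blast
qed simp

lemma topspace_zariski: "topspace zariski = (proj_space :: ('k::field, 'n::finite) point set)"
proof
  show "topspace zariski \<subseteq> (proj_space :: ('k, 'n) point set)"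
  proof
    fix x :: "('k, 'n) point" assume "x \<in> topspace zariski"
    then obtain d and F :: "('k, 'n) mpoly" where "x \<in> basic_open F" using zariski_basis[OF openin_topspace] by blast
    then show "x \<in> proj_space" by (simp add: basic_open_def)
  qed
  show "(proj_space :: ('k, 'n) point set) \<subseteq> topspace zariski"
    using openin_subset[OF openin_basic_open[OF homogeneous_polys_one]] unfolding basic_open_one .
qed

lemma subvariety_subset: "subvariety X \<Longrightarrow> X \<subseteq> proj_space"
  using closedin_subset topspace_zariski by (auto simp: subvariety_def)

lemma subvariety_closed: "subvariety X \<Longrightarrow> closedin zariski X"
  by (simp add: subvariety_def)

text \<open>A basic open set contained in the complement of X is given by a form that vanishes on
  X.\<close>

lemma closed_mem_iff:
  assumes "closedin zariski X" "x \<in> proj_space"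
  shows "x \<in> X \<longleftrightarrow> (\<forall>d. \<forall>F\<in>vanishing_polys X d. vanishes_at F x)"
proof
  assume "x \<in> X" then show "\<forall>d. \<forall>F\<in>vanishing_polys X d. vanishes_at F x" by (auto simp: vanishing_polys_def)
next
  assume *: "\<forall>d. \<forall>F\<in>vanishing_polys X d. vanishes_at F x"
  show "x \<in> X"
  proof (rule ccontr)
    assume "x \<notin> X"
    then have "x \<in> topspace zariski - X" using assms(2) by (simp add: topspace_zariski)
    moreover have "openin zariski (topspace zariski - X)" using assms(1) by (simp add: closedin_def)
    ultimately obtain d F where F: "F \<in> homogeneous_polys d" "x \<in> basic_open F" "basic_open F \<subseteq> topspace zariski - X"
      using zariski_basis by meson
    have "F \<in> vanishing_polys X d"
      unfolding vanishing_polys_def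
    proof (intro CollectI conjI F(1) ballI)
      fix y assume y: "y \<in> X"
      then have "y \<in> proj_space" using closedin_subset[OF assms(1)] topspace_zariski by auto
      then show "vanishes_at F y" using F(3) y by (auto simp: basic_open_def)
    qed
    then show False using * F(2) by (auto simp: basic_open_def)
  qed
qed

lemma irreducible_open_meet:
  assumes "irreducible_space (subtopology zariski X)" "F \<in> homogeneous_polys d" "G \<in> homogeneous_polys e"
    "x \<in> X" "x \<in> basic_open F" "y \<in> X" "y \<in> basic_open G"
  shows "\<exists>z\<in>X. z \<in> basic_open F \<and> z \<in> basic_open G"
proof (rule ccontr)
  let ?T = "subtopology zariski X"
  assume *: "\<not> ?thesis"
  define C D where "C = topspace ?T - X \<inter> basic_open F" and "D = topspace ?T - X \<inter> basic_open G"
  have o: "openin ?T (X \<inter> basic_open F)" "openin ?T (X \<inter> basic_open G)"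
    using openin_basic_open assms(2,3) by (auto intro: openin_subtopology_Int2)
  have "closedin ?T C" "closedin ?T D"
    unfolding C_def D_def using o by (auto intro!: closedin_diff simp del: topspace_subtopology)
  moreover have "C \<union> D = topspace ?T" using * by (auto simp: C_def D_def)
  ultimately have "C = topspace ?T \<or> D = topspace ?T" using assms(1) by (simp add: irreducible_space_def)
  moreover have "x \<in> topspace ?T" "y \<in> topspace ?T"
    using assms by (auto simp: topspace_zariski basic_open_def)
  ultimately show False using assms by (auto simp: C_def D_def)
qed

text \<open>Complements of two proper closed subsets contain nonempty basic open sets, so it
  suffices that any two of these meet.\<close>

lemma irreducible_spaceI_zariski:
  assumes X: "X \<subseteq> proj_space" "X \<noteq> {}"
    and meet: "\<And>F d G e x y. F \<in> homogeneous_polys d \<Longrightarrow> G \<in> homogeneous_polys e \<Longrightarrow> x \<in> X \<Longrightarrow> x \<in> basic_open F \<Longrightarrow>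
      y \<in> X \<Longrightarrow> y \<in> basic_open G \<Longrightarrow> \<exists>z\<in>X. z \<in> basic_open F \<and> z \<in> basic_open G"
  shows "irreducible_space (subtopology zariski X)"
  unfolding irreducible_space_def
proof (intro conjI allI impI)
  have ts: "topspace (subtopology zariski X) = X" using X by (auto simp: topspace_zariski)
  then show "topspace (subtopology zariski X) \<noteq> {}" using X by simp
  fix C D assume *: "closedin (subtopology zariski X) C \<and> closedin (subtopology zariski X) D \<and> C \<union> D = topspace (subtopology zariski X)"
  have basis: "\<exists>d. \<exists>F\<in>homogeneous_polys d. x \<in> basic_open F \<and> X \<inter> basic_open F \<subseteq> X - C"
    if C: "closedin (subtopology zariski X) C" and "x \<in> X" "x \<notin> C" for C x
  proof -
    obtain S where S: "openin zariski S" "X - C = S \<inter> X"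
      using C unfolding closedin_def ts by (auto simp: openin_subtopology)
    then have "x \<in> S" using that by blast
    then obtain d F where "F \<in> homogeneous_polys d" "x \<in> basic_open F" "basic_open F \<subseteq> S"
      using zariski_basis[OF S(1)] by blast
    then show ?thesis using S(2) by blast
  qed
  show "C = topspace (subtopology zariski X) \<or> D = topspace (subtopology zariski X)"
  proof (rule ccontr)
    assume n: "\<not> ?thesis"
    have "C \<subseteq> X" "D \<subseteq> X" using * closedin_subset ts by blast+
    then obtain x y where "x \<in> X" "x \<notin> C" "y \<in> X" "y \<notin> D" using n ts by blast
    note xy = this
    obtain d F where F: "F \<in> homogeneous_polys d" "x \<in> basic_open F" "X \<inter> basic_open F \<subseteq> X - C"
      using basis[OF conjunct1[OF *] xy(1,2)] by blast
    obtain e G where G: "G \<in> homogeneous_polys e" "y \<in> basic_open G" "X \<inter> basic_open G \<subseteq> X - D"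
      using basis[OF conjunct1[OF conjunct2[OF *]] xy(3,4)] by blast
    obtain z where "z \<in> X" "z \<in> basic_open F" "z \<in> basic_open G"
      using meet[OF F(1) G(1) xy(1) F(2) xy(3) G(2)] by blast
    then have "z \<in> X" "z \<notin> C" "z \<notin> D" using F(3) G(3) by blast+
    then show False using conjunct2[OF conjunct2[OF *]] ts by blast
  qed
qed

section \<open>Linear functionals and linear subvarieties\<close>

definition dotp :: "'k::field ^ 'n::finite \<Rightarrow> 'k ^ 'n \<Rightarrow> 'k" where
  "dotp a v = (\<Sum>i\<in>UNIV. vec_nth a i * vec_nth v i)"

lemma dotp_add [simp]: "dotp a (v + w) = dotp a v + dotp a w"
  and dotp_diff [simp]: "dotp a (v - w) = dotp a v - dotp a w"
  and dotp_smult [simp]: "dotp a (c *s v) = c * dotp a v"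
  and dotp_zero [simp]: "dotp a 0 = 0"
  by (simp_all add: dotp_def distrib_left sum.distrib sum_distrib_left algebra_simps sum_subtractf)

lemma mpoly_eval_mlin_dotp [simp]: "mpoly_eval (mlin a) v = dotp a v"
  by (simp add: mpoly_eval_mlin dotp_def)

lemma functional_exists:
  fixes B :: "('k::field ^ 'n::finite) set"
  assumes "vec.independent B"
  shows "\<exists>a. \<forall>b\<in>B. dotp a b = f b"
proof -
  \<comment> \<open>The linear extension is taken with values in k^n, the prescribed scalar standing
    in every coordinate; one row of the matrix is then the functional.\<close>
  obtain g :: "'k ^ 'n \<Rightarrow> 'k ^ 'n" where g: "Vector_Spaces.linear (*s) (*s) g" "\<forall>x\<in>B. g x = (\<chi> i. f x)"
    using vec.linear_independent_extend[OF assms, of "\<lambda>x. \<chi> i. f x"] by blast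
  obtain k :: 'n where True by simp
  have "dotp (vec_nth (matrix g) k) x = vec_nth (g x) k" for x
    using matrix_works[OF g(1), of x] by (simp add: dotp_def matrix_vector_mult_def vec_eq_iff)
  then show ?thesis using g(2) by (intro exI[of _ "vec_nth (matrix g) k"]) simp
qed

lemma separating_functional:
  fixes W :: "('k::field ^ 'n::finite) set"
  assumes "vec.subspace W" "v \<notin> W"
  shows "\<exists>a. (\<forall>w\<in>W. dotp a w = 0) \<and> dotp a v = 1"
proof -
  obtain B where B: "B \<subseteq> W" "vec.independent B" "W \<subseteq> vec.span B" using vec.basis_exists by metis
  then have nb: "v \<notin> vec.span B" using assms vec.span_minimal[OF B(1) assms(1)] by auto
  then have "vec.independent (insert v B)" using B(2) by (simp add: vec.independent_insert)
  then obtain a where a: "\<forall>b\<in>insert v B. dotp a b = (if b = v then 1 else 0)"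
    using functional_exists[of "insert v B" "\<lambda>b. if b = v then 1 else 0"] by blast
  have "dotp a w = 0" if "w \<in> vec.span B" for w
    using that
  proof (induction rule: vec.span_induct_alt)
    case (step c x y)
    then have "x \<noteq> v" using nb vec.span_base by blast
    then show ?case using step a by simp
  qed simp
  then show ?thesis using a B(3) by (intro exI[of _ a]) auto
qed

lemma proj_subspace_iff:
  assumes "vec.subspace W"
  shows "pspan v \<subseteq> W \<longleftrightarrow> v \<in> W"
  using assms vec.span_base[of v "{v}"] vec.span_minimal[of "{v}" W] by auto

lemma poly_nonzero_point:
  fixes N :: "'k::field_char_0 poly"
  assumes "N \<noteq> 0"
  shows "\<exists>t. poly N t \<noteq> 0"
proof (rule ccontr)
  assume "\<not> ?thesis"
  then have "{t. poly N t = 0} = UNIV" by auto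
  then show False using poly_roots_finite[OF assms] infinite_UNIV_char_0[where 'a = 'k] by simp
qed

lemma closedin_linear:
  fixes W :: "('k::field ^ 'n::finite) set"
  assumes W: "vec.subspace W"
  shows "closedin zariski {x \<in> proj_space. x \<subseteq> W}"
  unfolding closedin_def topspace_zariski
proof
  let ?X = "{x \<in> proj_space. x \<subseteq> W}"
  show "openin zariski (proj_space - ?X)"
  proof (subst openin_subopen, rule ballI)
    fix x assume x: "x \<in> proj_space - ?X"
    then obtain v where v: "v \<noteq> 0" "x = pspan v" using proj_space_cases by blast
    then have "v \<notin> W" using x proj_subspace_iff[OF W] by auto
    then obtain a where a: "\<forall>w\<in>W. dotp a w = 0" "dotp a v = 1" using separating_functional[OF W] by blast
    have "basic_open (mlin a) \<subseteq> proj_space - ?X"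
      using a(1) by (auto simp: basic_open_def vanishes_at_def)
    moreover have "x \<in> basic_open (mlin a)"
      using a(2) v basic_open_pspan[OF homogeneous_polys_mlin v(1)] by simp
    ultimately show "\<exists>T. openin zariski T \<and> x \<in> T \<and> T \<subseteq> proj_space - ?X"
      using openin_basic_open[OF homogeneous_polys_mlin] by blast
  qed
qed auto

text \<open>Irreducibility is seen on the line joining two points.\<close>

lemma subvariety_linear:
  fixes W :: "('k::field_char_0 ^ 'n::finite) set"
  assumes W: "vec.subspace W" "\<exists>v\<in>W. v \<noteq> 0"
  shows "subvariety {x \<in> proj_space. x \<subseteq> W}"
  unfolding subvariety_def
proof
  let ?X = "{x \<in> proj_space. x \<subseteq> W}"
  show "closedin zariski ?X" by (rule closedin_linear[OF W(1)])
  show "irreducible_space (subtopology zariski ?X)"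
  proof (rule irreducible_spaceI_zariski)
    obtain v where "v \<in> W" "v \<noteq> 0" using W(2) by blast
    then have "pspan v \<in> ?X" using pspan_in_proj_space proj_subspace_iff[OF W(1)] by blast
    then show "?X \<noteq> {}" by blast
    fix F G :: "('k, 'n) mpoly" and d e x y
    assume F: "F \<in> homogeneous_polys d" and G: "G \<in> homogeneous_polys e"
      and x: "x \<in> ?X" "x \<in> basic_open F" and y: "y \<in> ?X" "y \<in> basic_open G"
    obtain v where v: "v \<noteq> 0" "x = pspan v" using x by (auto elim: proj_space_cases)
    obtain w where w: "w \<noteq> 0" "y = pspan w" using y by (auto elim: proj_space_cases)
    have vw: "v \<in> W" "w \<in> W" using x y v w proj_subspace_iff[OF W(1)] by auto
    \<comment> \<open>If w is a multiple of v other than v, the joining line passes through 0; the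
      extra factor coming from \<open>a\<close> excludes that parameter.\<close>
    obtain a where a: "dotp a v = 1"
      using separating_functional[of "{0}" v] v by (auto simp: vec.subspace_def)
    have "mpoly_eval F v \<noteq> 0" "mpoly_eval G w \<noteq> 0"
      using x y v w basic_open_pspan[OF F] basic_open_pspan[OF G] by auto
    then have f: "poly (line_poly v (w - v) F) 0 \<noteq> 0" and g: "poly (line_poly v (w - v) G) 1 \<noteq> 0"
      and l: "poly (line_poly v (w - v) (mlin a)) 0 \<noteq> 0"
      using a by (simp_all add: poly_line_poly)
    then have "line_poly v (w - v) F * line_poly v (w - v) G * line_poly v (w - v) (mlin a) \<noteq> 0" by auto
    then obtain t where "poly (line_poly v (w - v) F * line_poly v (w - v) G * line_poly v (w - v) (mlin a)) t \<noteq> 0"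
      using poly_nonzero_point by blast
    then have t: "mpoly_eval F (v + t *s (w - v)) \<noteq> 0" "mpoly_eval G (v + t *s (w - v)) \<noteq> 0"
        "dotp a (v + t *s (w - v)) \<noteq> 0"
      by (simp_all add: poly_line_poly)
    let ?z = "v + t *s (w - v)"
    have "?z \<noteq> 0" using t(3) dotp_zero[of a] by metis
    moreover have "?z \<in> W"
      using W(1) vw by (intro vec.subspace_add vec.subspace_scale vec.subspace_diff)
    ultimately have "pspan ?z \<in> ?X" "pspan ?z \<in> basic_open F" "pspan ?z \<in> basic_open G"
      using pspan_in_proj_space proj_subspace_iff[OF W(1)] t
      by (auto simp: basic_open_pspan[OF F] basic_open_pspan[OF G])
    then show "\<exists>z\<in>?X. z \<in> basic_open F \<and> z \<in> basic_open G" by blast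
  qed auto
qed

lemma subvariety_point:
  fixes x :: "('k::field_char_0, 'n::finite) point"
  assumes "x \<in> proj_space"
  shows "subvariety {x}"
proof -
  obtain v where v: "v \<noteq> 0" "x = pspan v" using assms by (rule proj_space_cases)
  have x: "vec.subspace x" "\<exists>v\<in>x. v \<noteq> 0" unfolding v(2) using v(1) vec.span_base[of v "{v}"] by auto
  have "y = x" if y: "y \<in> proj_space" "y \<subseteq> x" for y
  proof -
    obtain w where w: "w \<noteq> 0" "y = pspan w" using y(1) by (rule proj_space_cases)
    then have "w \<in> x" using y(2) vec.span_base[of w "{w}"] by auto
    then show ?thesis using proj_point_eq_pspan[OF assms] w by simp
  qed
  then have "{y \<in> proj_space. y \<subseteq> x} = {x}" using assms by auto
  then show ?thesis using subvariety_linear[OF x] by simp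
qed

section \<open>Local rings at closed points\<close>

lemma regular_on_subset:
  assumes "regular_on U f" "U' \<subseteq> U"
  shows "regular_on U' f"
  unfolding regular_on_def
proof
  fix x assume "x \<in> U'"
  then obtain W d G H where *: "G \<in> homogeneous_polys d" "H \<in> homogeneous_polys d"
    "openin (subtopology zariski U) W" "x \<in> W"
    "\<forall>y\<in>W. \<forall>v\<in>y - {0}. mpoly_eval H v \<noteq> 0 \<and> f y = mpoly_eval G v / mpoly_eval H v"
    using assms unfolding regular_on_def by blast
  obtain S where "openin zariski S" "W = S \<inter> U" using *(3) by (auto simp: openin_subtopology)
  then have "openin (subtopology zariski U') (W \<inter> U')" using assms(2)
    by (auto simp: openin_subtopology intro!: exI[of _ S])
  then show "\<exists>W d. \<exists>G\<in>homogeneous_polys d. \<exists>H\<in>homogeneous_polys d. openin (subtopology zariski U') W \<and> x \<in> W \<and>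
        (\<forall>y\<in>W. \<forall>v\<in>y - {0}. mpoly_eval H v \<noteq> 0 \<and> f y = mpoly_eval G v / mpoly_eval H v)"
    using * \<open>x \<in> U'\<close> by (intro exI[of _ "W \<inter> U'"] exI[of _ d] bexI[of _ G] bexI[of _ H]) auto
qed

lemma homogeneous_polys_mult':
  "F \<in> homogeneous_polys e \<Longrightarrow> G \<in> homogeneous_polys d \<Longrightarrow> F * G \<in> homogeneous_polys (d + e)"
  using homogeneous_polys_mult[of F e G d] by (simp add: add.commute)

lemma openin_zariski_self:
  assumes "U \<subseteq> proj_space"
  shows "openin (subtopology zariski U) U"
proof -
  have "topspace (subtopology zariski U) = U" using assms by (auto simp: topspace_zariski)
  then show ?thesis using openin_topspace[of "subtopology zariski U"] by simp
qed

lemma regular_on_const: "regular_on U (\<lambda>_. c)" if "U \<subseteq> proj_space"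
  unfolding regular_on_def
proof
  fix x assume "x \<in> U"
  moreover have "openin (subtopology zariski U) U" using that by (rule openin_zariski_self)
  ultimately show "\<exists>W d. \<exists>G\<in>homogeneous_polys d. \<exists>H\<in>homogeneous_polys d. openin (subtopology zariski U) W \<and> x \<in> W \<and>
        (\<forall>y\<in>W. \<forall>v\<in>y - {0}. mpoly_eval H v \<noteq> 0 \<and> c = mpoly_eval G v / mpoly_eval H v)"
    by (intro exI[of _ U] exI[of _ 0] bexI[of _ "mconst c"] bexI[of _ 1])
       (auto simp: homogeneous_polys_mconst homogeneous_polys_one)
qed

lemma regular_on_binop:
  assumes "regular_on U f" "regular_on U g"
  shows "regular_on U (\<lambda>x. f x + g x)" "regular_on U (\<lambda>x. f x * g x)"
proof -
  have "(\<exists>W d. \<exists>G\<in>homogeneous_polys d. \<exists>H\<in>homogeneous_polys d. openin (subtopology zariski U) W \<and> x \<in> W \<and>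
        (\<forall>y\<in>W. \<forall>v\<in>y - {0}. mpoly_eval H v \<noteq> 0 \<and> f y + g y = mpoly_eval G v / mpoly_eval H v)) \<and>
    (\<exists>W d. \<exists>G\<in>homogeneous_polys d. \<exists>H\<in>homogeneous_polys d. openin (subtopology zariski U) W \<and> x \<in> W \<and>
        (\<forall>y\<in>W. \<forall>v\<in>y - {0}. mpoly_eval H v \<noteq> 0 \<and> f y * g y = mpoly_eval G v / mpoly_eval H v))"
    if x: "x \<in> U" for x
  proof -
    obtain W d G H where 1: "G \<in> homogeneous_polys d" "H \<in> homogeneous_polys d"
      "openin (subtopology zariski U) W" "x \<in> W"
      "\<forall>y\<in>W. \<forall>v\<in>y - {0}. mpoly_eval H v \<noteq> 0 \<and> f y = mpoly_eval G v / mpoly_eval H v"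
      using assms(1) x unfolding regular_on_def by blast
    obtain W' d' G' H' where 2: "G' \<in> homogeneous_polys d'" "H' \<in> homogeneous_polys d'"
      "openin (subtopology zariski U) W'" "x \<in> W'"
      "\<forall>y\<in>W'. \<forall>v\<in>y - {0}. mpoly_eval H' v \<noteq> 0 \<and> g y = mpoly_eval G' v / mpoly_eval H' v"
      using assms(2) x unfolding regular_on_def by blast
    have W: "openin (subtopology zariski U) (W \<inter> W')" "x \<in> W \<inter> W'" using 1 2 by auto
    have H: "H * H' \<in> homogeneous_polys (d + d')" "G * G' \<in> homogeneous_polys (d + d')"
      "G * H' + G' * H \<in> homogeneous_polys (d + d')"
      using 1 2 by (simp_all add: homogeneous_polys_mult homogeneous_polys_add homogeneous_polys_mult')
    show ?thesis
    proof (rule conjI)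
      show "\<exists>W d. \<exists>G\<in>homogeneous_polys d. \<exists>H\<in>homogeneous_polys d. openin (subtopology zariski U) W \<and> x \<in> W \<and>
        (\<forall>y\<in>W. \<forall>v\<in>y - {0}. mpoly_eval H v \<noteq> 0 \<and> f y + g y = mpoly_eval G v / mpoly_eval H v)"
        using 1(5) 2(5) W
        by (intro exI[of _ "W \<inter> W'"] exI[of _ "d + d'"] bexI[OF _ H(3)] bexI[OF _ H(1)])
           (auto simp: add_frac_eq)
      show "\<exists>W d. \<exists>G\<in>homogeneous_polys d. \<exists>H\<in>homogeneous_polys d. openin (subtopology zariski U) W \<and> x \<in> W \<and>
        (\<forall>y\<in>W. \<forall>v\<in>y - {0}. mpoly_eval H v \<noteq> 0 \<and> f y * g y = mpoly_eval G v / mpoly_eval H v)"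
        using 1(5) 2(5) W
        by (intro exI[of _ "W \<inter> W'"] exI[of _ "d + d'"] bexI[OF _ H(2)] bexI[OF _ H(1)]) auto
    qed
  qed
  then show "regular_on U (\<lambda>x. f x + g x)" "regular_on U (\<lambda>x. f x * g x)" unfolding regular_on_def by blast+
qed

locale point_ring =
  fixes X :: "('k::field, 'n::finite) point set" and x :: "('k, 'n) point"
  assumes X: "X \<subseteq> proj_space" and x: "x \<in> X"
begin

abbreviation "LS \<equiv> local_sections X {x}"
abbreviation "Rx \<equiv> local_ring X {x}"

definition cls :: "('k, 'n) point set \<Rightarrow> (('k, 'n) point \<Rightarrow> 'k) \<Rightarrow> ('k, 'n) germ" where
  "cls U f = germ_rel X {x} `` {(U, f)}"

lemma LS_iff: "(U, f) \<in> LS \<longleftrightarrow> openin (subtopology zariski X) U \<and> x \<in> U \<and> regular_on U f"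
  by (auto simp: local_sections_def)

lemma germ_rel_iff: "((U, f), (U', g)) \<in> germ_rel X {x} \<longleftrightarrow> (U, f) \<in> LS \<and> (U', g) \<in> LS \<and>
    (\<exists>W. openin (subtopology zariski X) W \<and> x \<in> W \<and> W \<subseteq> U \<inter> U' \<and> (\<forall>y\<in>W. f y = g y))"
  by (auto simp: germ_rel_def)

lemma equiv_germ: "equiv LS (germ_rel X {x})"
proof (rule equivI)
  show "germ_rel X {x} \<subseteq> LS \<times> LS" by (auto simp: germ_rel_def)
  show "refl_on LS (germ_rel X {x})"
    by (auto simp: refl_on_def germ_rel_iff) (auto simp: LS_iff)
  show "sym (germ_rel X {x})"
  proof (rule symI)
    fix a b assume "(a, b) \<in> germ_rel X {x}"
    then show "(b, a) \<in> germ_rel X {x}"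
      by (cases a, cases b) (simp add: germ_rel_iff, metis inf_commute)
  qed
  show "trans (germ_rel X {x})"
  proof (rule transI)
    fix a b c assume ab: "(a, b) \<in> germ_rel X {x}" and bc: "(b, c) \<in> germ_rel X {x}"
    obtain U f where a: "a = (U, f)" by (cases a)
    obtain U' g where b: "b = (U', g)" by (cases b)
    obtain U'' h where c: "c = (U'', h)" by (cases c)
    obtain W where W: "openin (subtopology zariski X) W" "x \<in> W" "W \<subseteq> U \<inter> U'" "\<forall>y\<in>W. f y = g y"
      using ab unfolding a b germ_rel_iff by blast
    obtain W' where W': "openin (subtopology zariski X) W'" "x \<in> W'" "W' \<subseteq> U' \<inter> U''" "\<forall>y\<in>W'. g y = h y"
      using bc unfolding b c germ_rel_iff by blast
    have "openin (subtopology zariski X) (W \<inter> W')" using W(1) W'(1) by (rule openin_Int)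
    moreover have "x \<in> W \<inter> W'" "W \<inter> W' \<subseteq> U \<inter> U''" "\<forall>y\<in>W \<inter> W'. f y = h y" using W W' by auto
    ultimately show "(a, c) \<in> germ_rel X {x}"
      using ab bc unfolding a b c germ_rel_iff by blast
  qed
qed

lemma mem_cls: "a \<in> cls U f \<longleftrightarrow> ((U, f), a) \<in> germ_rel X {x}"
  by (simp add: cls_def)

lemma cls_eq_iff:
  assumes "(U, f) \<in> LS" "(U', g) \<in> LS"
  shows "cls U f = cls U' g \<longleftrightarrow> (\<exists>W. openin (subtopology zariski X) W \<and> x \<in> W \<and> W \<subseteq> U \<inter> U' \<and> (\<forall>y\<in>W. f y = g y))"
  unfolding cls_def using eq_equiv_class_iff[OF equiv_germ assms] assms by (simp add: germ_rel_iff)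

lemma cls_eqI:
  assumes "(U, f) \<in> LS" "(U', g) \<in> LS" "\<And>y. y \<in> U \<Longrightarrow> y \<in> U' \<Longrightarrow> f y = g y"
  shows "cls U f = cls U' g"
  unfolding cls_eq_iff[OF assms(1,2)]
  using assms by (intro exI[of _ "U \<inter> U'"]) (auto simp: LS_iff)

lemma carrier_eq: "carrier Rx = {cls U f |U f. (U, f) \<in> LS}"
  by (auto simp: local_ring_def quotient_def cls_def)

lemma cls_carrier: "(U, f) \<in> LS \<Longrightarrow> cls U f \<in> carrier Rx"
  unfolding carrier_eq by blast

lemma carrier_cases:
  assumes "a \<in> carrier Rx"
  obtains U f where "(U, f) \<in> LS" "a = cls U f"
  using assms unfolding carrier_eq by blast

lemma germ_op_cls:
  assumes h: "\<And>U f U' g. (U, f) \<in> LS \<Longrightarrow> (U', g) \<in> LS \<Longrightarrow> (U \<inter> U', \<lambda>y. h (f y) (g y)) \<in> LS"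
    and f: "(U, f) \<in> LS" and g: "(U', g) \<in> LS"
  shows "germ_op X {x} h (cls U f) (cls U' g) = cls (U \<inter> U') (\<lambda>y. h (f y) (g y))"
proof -
  have eq: "cls (U1 \<inter> U2) (\<lambda>y. h (f1 y) (g1 y)) = cls (U \<inter> U') (\<lambda>y. h (f y) (g y))"
    if f1: "(U1, f1) \<in> cls U f" and g1: "(U2, g1) \<in> cls U' g" for U1 f1 U2 g1
  proof -
    obtain W where W: "openin (subtopology zariski X) W" "x \<in> W" "W \<subseteq> U \<inter> U1" "\<forall>y\<in>W. f y = f1 y" "(U1, f1) \<in> LS"
      using f1 unfolding mem_cls germ_rel_iff by blast
    obtain W' where W': "openin (subtopology zariski X) W'" "x \<in> W'" "W' \<subseteq> U' \<inter> U2" "\<forall>y\<in>W'. g y = g1 y" "(U2, g1) \<in> LS"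
      using g1 unfolding mem_cls germ_rel_iff by blast
    have "openin (subtopology zariski X) (W \<inter> W')" using W(1) W'(1) by (rule openin_Int)
    moreover have "x \<in> W \<inter> W'" "W \<inter> W' \<subseteq> (U1 \<inter> U2) \<inter> (U \<inter> U')"
      "\<forall>y\<in>W \<inter> W'. h (f1 y) (g1 y) = h (f y) (g y)" using W W' by auto
    ultimately show ?thesis unfolding cls_eq_iff[OF h[OF W(5) W'(5)] h[OF f g]] by blast
  qed
  have "(U, f) \<in> cls U f" "(U', g) \<in> cls U' g"
    unfolding mem_cls using equiv_germ f g by (auto simp: equiv_def refl_on_def)
  then have ne: "cls U f \<noteq> {}" "cls U' g \<noteq> {}" by blast+
  let ?C = "cls (U \<inter> U') (\<lambda>y. h (f y) (g y))"
  have "germ_op X {x} h (cls U f) (cls U' g) =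
      (\<Union>a\<in>cls U f. \<Union>b\<in>cls U' g. cls (fst a \<inter> fst b) (\<lambda>y. h (snd a y) (snd b y)))"
    by (simp only: germ_op_def cls_def case_prod_unfold)
  also have "\<dots> = (\<Union>a\<in>cls U f. \<Union>b\<in>cls U' g. ?C)"
    by (intro SUP_cong refl eq) simp_all
  also have "\<dots> = ?C" using ne by simp
  finally show ?thesis .
qed

lemma LS_op:
  assumes "(U, f) \<in> LS" "(U', g) \<in> LS"
  shows "(U \<inter> U', \<lambda>y. f y + g y) \<in> LS" "(U \<inter> U', \<lambda>y. f y * g y) \<in> LS"
  using assms regular_on_subset[of U f "U \<inter> U'"] regular_on_subset[of U' g "U \<inter> U'"]
  by (auto simp: LS_iff intro!: regular_on_binop)

lemma openin_X: "openin (subtopology zariski X) X"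
  using X by (rule openin_zariski_self)

lemma LS_const: "(X, \<lambda>_. c) \<in> LS"
  using openin_X x X by (simp add: LS_iff regular_on_const)

lemma ring_ops:
  assumes "(U, f) \<in> LS" "(U', g) \<in> LS"
  shows "cls U f \<oplus>\<^bsub>Rx\<^esub> cls U' g = cls (U \<inter> U') (\<lambda>y. f y + g y)"
    "cls U f \<otimes>\<^bsub>Rx\<^esub> cls U' g = cls (U \<inter> U') (\<lambda>y. f y * g y)"
proof -
  have "cls U f \<oplus>\<^bsub>Rx\<^esub> cls U' g = germ_op X {x} (+) (cls U f) (cls U' g)" by (simp add: local_ring_def)
  also have "\<dots> = cls (U \<inter> U') (\<lambda>y. f y + g y)" by (rule germ_op_cls[OF LS_op(1) assms])
  finally show "cls U f \<oplus>\<^bsub>Rx\<^esub> cls U' g = cls (U \<inter> U') (\<lambda>y. f y + g y)" .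
  have "cls U f \<otimes>\<^bsub>Rx\<^esub> cls U' g = germ_op X {x} (*) (cls U f) (cls U' g)" by (simp add: local_ring_def)
  also have "\<dots> = cls (U \<inter> U') (\<lambda>y. f y * g y)" by (rule germ_op_cls[OF LS_op(2) assms])
  finally show "cls U f \<otimes>\<^bsub>Rx\<^esub> cls U' g = cls (U \<inter> U') (\<lambda>y. f y * g y)" .
qed

lemma ring_consts:
  "\<one>\<^bsub>Rx\<^esub> = cls X (\<lambda>_. 1)" "\<zero>\<^bsub>Rx\<^esub> = cls X (\<lambda>_. 0)"
  by (simp_all add: local_ring_def const_germ_def cls_def)

lemma ring_smult:
  assumes "(U, f) \<in> LS"
  shows "c \<odot>\<^bsub>Rx\<^esub> cls U f = cls (X \<inter> U) (\<lambda>y. c * f y)"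
proof -
  have "c \<odot>\<^bsub>Rx\<^esub> cls U f = germ_op X {x} (*) (cls X (\<lambda>_. c)) (cls U f)"
    by (simp add: local_ring_def const_germ_def cls_def)
  also have "\<dots> = cls (X \<inter> U) (\<lambda>y. c * f y)" by (rule germ_op_cls[OF LS_op(2) LS_const assms])
  finally show ?thesis .
qed

lemma LS_smult: "(U, f) \<in> LS \<Longrightarrow> (X \<inter> U, \<lambda>y. c * f y) \<in> LS"
  using LS_op(2)[OF LS_const] .

lemma cring_Rx: "cring Rx"
proof (rule cringI)
  show "abelian_group Rx"
  proof (rule abelian_groupI)
    fix a assume "a \<in> carrier Rx"
    then obtain U f where a: "a = cls U f" "(U, f) \<in> LS" by (auto simp: carrier_eq)
    have m: "(X \<inter> U, \<lambda>y. - 1 * f y) \<in> LS" by (rule LS_smult[OF a(2)])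
    have "cls (X \<inter> U) (\<lambda>y. - 1 * f y) \<oplus>\<^bsub>Rx\<^esub> a = \<zero>\<^bsub>Rx\<^esub>"
      unfolding a(1) ring_ops(1)[OF m a(2)] ring_consts
      by (rule cls_eqI[OF LS_op(1)[OF m a(2)] LS_const]) simp
    then show "\<exists>b\<in>carrier Rx. b \<oplus>\<^bsub>Rx\<^esub> a = \<zero>\<^bsub>Rx\<^esub>" using cls_carrier[OF m] by blast
  next
    show "\<zero>\<^bsub>Rx\<^esub> \<in> carrier Rx" unfolding ring_consts by (rule cls_carrier[OF LS_const])
  next
    fix a b assume "a \<in> carrier Rx" "b \<in> carrier Rx"
    then show "a \<oplus>\<^bsub>Rx\<^esub> b \<in> carrier Rx" by (elim carrier_cases) (simp add: ring_ops cls_carrier LS_op)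
  next
    fix a b c assume "a \<in> carrier Rx" "b \<in> carrier Rx" "c \<in> carrier Rx"
    then show "a \<oplus>\<^bsub>Rx\<^esub> b \<oplus>\<^bsub>Rx\<^esub> c = a \<oplus>\<^bsub>Rx\<^esub> (b \<oplus>\<^bsub>Rx\<^esub> c)"
      by (elim carrier_cases) (simp only: ring_ops LS_op ring_consts LS_const, rule cls_eqI, simp add: LS_op LS_const, simp add: LS_op LS_const, simp add: algebra_simps)
  next
    fix a b assume "a \<in> carrier Rx" "b \<in> carrier Rx"
    then show "a \<oplus>\<^bsub>Rx\<^esub> b = b \<oplus>\<^bsub>Rx\<^esub> a" by (elim carrier_cases) (simp only: ring_ops LS_op ring_consts LS_const, rule cls_eqI, simp add: LS_op LS_const, simp add: LS_op LS_const, simp add: algebra_simps)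
  next
    fix a assume "a \<in> carrier Rx"
    then obtain U f where a: "(U, f) \<in> LS" "a = cls U f" by (rule carrier_cases)
    show "\<zero>\<^bsub>Rx\<^esub> \<oplus>\<^bsub>Rx\<^esub> a = a"
      unfolding ring_consts a(2) ring_ops(1)[OF LS_const a(1)]
      by (rule cls_eqI[OF LS_op(1)[OF LS_const a(1)] a(1)]) simp
  qed
  show "Group.comm_monoid Rx"
  proof (rule comm_monoidI)
    show "\<one>\<^bsub>Rx\<^esub> \<in> carrier Rx" unfolding ring_consts by (rule cls_carrier[OF LS_const])
  next
    fix a b assume "a \<in> carrier Rx" "b \<in> carrier Rx"
    then show "a \<otimes>\<^bsub>Rx\<^esub> b \<in> carrier Rx" by (elim carrier_cases) (simp add: ring_ops cls_carrier LS_op)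
  next
    fix a b c assume "a \<in> carrier Rx" "b \<in> carrier Rx" "c \<in> carrier Rx"
    then show "a \<otimes>\<^bsub>Rx\<^esub> b \<otimes>\<^bsub>Rx\<^esub> c = a \<otimes>\<^bsub>Rx\<^esub> (b \<otimes>\<^bsub>Rx\<^esub> c)"
      by (elim carrier_cases) (simp only: ring_ops LS_op ring_consts LS_const, rule cls_eqI, simp add: LS_op LS_const, simp add: LS_op LS_const, simp add: algebra_simps)
  next
    fix a b assume "a \<in> carrier Rx" "b \<in> carrier Rx"
    then show "a \<otimes>\<^bsub>Rx\<^esub> b = b \<otimes>\<^bsub>Rx\<^esub> a" by (elim carrier_cases) (simp only: ring_ops LS_op ring_consts LS_const, rule cls_eqI, simp add: LS_op LS_const, simp add: LS_op LS_const, simp add: algebra_simps)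
  next
    fix a assume "a \<in> carrier Rx"
    then obtain U f where a: "(U, f) \<in> LS" "a = cls U f" by (rule carrier_cases)
    show "\<one>\<^bsub>Rx\<^esub> \<otimes>\<^bsub>Rx\<^esub> a = a"
      unfolding ring_consts a(2) ring_ops(2)[OF LS_const a(1)]
      by (rule cls_eqI[OF LS_op(2)[OF LS_const a(1)] a(1)]) simp
  qed
  fix a b c assume "a \<in> carrier Rx" "b \<in> carrier Rx" "c \<in> carrier Rx"
  then show "(a \<oplus>\<^bsub>Rx\<^esub> b) \<otimes>\<^bsub>Rx\<^esub> c = a \<otimes>\<^bsub>Rx\<^esub> c \<oplus>\<^bsub>Rx\<^esub> b \<otimes>\<^bsub>Rx\<^esub> c"
    by (elim carrier_cases) (simp only: ring_ops LS_op ring_consts LS_const, rule cls_eqI, simp add: LS_op LS_const, simp add: LS_op LS_const, simp add: algebra_simps)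
qed

lemma algebra_Rx: "algebra base_field Rx"
proof (rule algebraI)
  show "cring (base_field :: ('k, 'k) module)" by (rule cring_base_field)
  show "cring Rx" by (rule cring_Rx)
  have B: "a \<oplus>\<^bsub>base_field\<^esub> b = a + b" "a \<otimes>\<^bsub>base_field\<^esub> b = a * b" "\<one>\<^bsub>base_field\<^esub> = (1::'k)" for a b :: 'k
    by (simp_all add: base_field_def)
  fix a :: 'k and r assume "r \<in> carrier Rx"
  then obtain U f where r: "r = cls U f" "(U, f) \<in> LS" by (auto simp: carrier_eq)
  show "a \<odot>\<^bsub>Rx\<^esub> r \<in> carrier Rx" unfolding r ring_smult[OF r(2)] by (rule cls_carrier[OF LS_smult[OF r(2)]])
  show "\<one>\<^bsub>base_field\<^esub> \<odot>\<^bsub>Rx\<^esub> r = r"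
    unfolding B r ring_smult[OF r(2)] by (rule cls_eqI[OF LS_smult[OF r(2)] r(2)]) simp
  show "(a \<oplus>\<^bsub>base_field\<^esub> b) \<odot>\<^bsub>Rx\<^esub> r = a \<odot>\<^bsub>Rx\<^esub> r \<oplus>\<^bsub>Rx\<^esub> b \<odot>\<^bsub>Rx\<^esub> r" for b
    unfolding B r ring_smult[OF r(2)] ring_ops(1)[OF LS_smult[OF r(2)] LS_smult[OF r(2)]]
    by (rule cls_eqI[OF LS_smult[OF r(2)] LS_op(1)[OF LS_smult[OF r(2)] LS_smult[OF r(2)]]]) (simp add: distrib_right)
  show "(a \<otimes>\<^bsub>base_field\<^esub> b) \<odot>\<^bsub>Rx\<^esub> r = a \<odot>\<^bsub>Rx\<^esub> (b \<odot>\<^bsub>Rx\<^esub> r)" for b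
    unfolding B r ring_smult[OF r(2)] ring_smult[OF LS_smult[OF r(2)]]
    by (rule cls_eqI[OF LS_smult[OF r(2)] LS_smult[OF LS_smult[OF r(2)]]]) simp
  fix s assume "s \<in> carrier Rx"
  then obtain U' g where s: "s = cls U' g" "(U', g) \<in> LS" by (auto simp: carrier_eq)
  show "a \<odot>\<^bsub>Rx\<^esub> (r \<oplus>\<^bsub>Rx\<^esub> s) = a \<odot>\<^bsub>Rx\<^esub> r \<oplus>\<^bsub>Rx\<^esub> a \<odot>\<^bsub>Rx\<^esub> s"
    unfolding r s ring_smult[OF r(2)] ring_smult[OF s(2)] ring_ops(1)[OF LS_smult[OF r(2)] LS_smult[OF s(2)]]
      ring_ops(1)[OF r(2) s(2)] ring_smult[OF LS_op(1)[OF r(2) s(2)]]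
    by (rule cls_eqI[OF LS_smult[OF LS_op(1)[OF r(2) s(2)]] LS_op(1)[OF LS_smult[OF r(2)] LS_smult[OF s(2)]]]) (simp add: distrib_left)
  show "(a \<odot>\<^bsub>Rx\<^esub> r) \<otimes>\<^bsub>Rx\<^esub> s = a \<odot>\<^bsub>Rx\<^esub> (r \<otimes>\<^bsub>Rx\<^esub> s)"
    unfolding r s ring_smult[OF r(2)] ring_ops(2)[OF LS_smult[OF r(2)] s(2)]
      ring_ops(2)[OF r(2) s(2)] ring_smult[OF LS_op(2)[OF r(2) s(2)]]
    by (rule cls_eqI[OF LS_op(2)[OF LS_smult[OF r(2)] s(2)] LS_smult[OF LS_op(2)[OF r(2) s(2)]]]) simp
qed

subsection \<open>Germs as quotients of forms\<close>

text \<open>Independent of the chosen vector when both forms have the same degree.\<close>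

definition frac :: "('k, 'n) mpoly \<Rightarrow> ('k, 'n) mpoly \<Rightarrow> ('k, 'n) point \<Rightarrow> 'k" where
  "frac G H y = (let v = SOME v. v \<in> y - {0} in mpoly_eval G v / mpoly_eval H v)"

lemma frac_eq:
  assumes "G \<in> homogeneous_polys d" "H \<in> homogeneous_polys d" "y \<in> proj_space" "v \<in> y - {0}"
  shows "frac G H y = mpoly_eval G v / mpoly_eval H v"
proof -
  define w where "w = (SOME v. v \<in> y - {0})"
  have w: "w \<in> y - {0}" unfolding w_def by (rule someI[of _ v]) (rule assms(4))
  obtain c where c: "w = c *s v" using proj_point_eq_pspan[OF assms(3), of v] assms(4) w by (auto simp: pspan_iff)
  then have "c \<noteq> 0" using w by auto
  then show ?thesis
    unfolding frac_def w_def[symmetric] Let_def c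
    by (simp add: mpoly_eval_smult_homogeneous[OF assms(1)] mpoly_eval_smult_homogeneous[OF assms(2)])
qed

definition gm :: "('k, 'n) mpoly \<Rightarrow> ('k, 'n) mpoly \<Rightarrow> ('k, 'n) germ" where
  "gm G H = cls (X \<inter> basic_open H) (frac G H)"

lemma frac_LS:
  assumes "G \<in> homogeneous_polys d" "H \<in> homogeneous_polys d" "x \<in> basic_open H"
  shows "(X \<inter> basic_open H, frac G H) \<in> LS"
  unfolding LS_iff
proof (intro conjI)
  show o: "openin (subtopology zariski X) (X \<inter> basic_open H)"
    using openin_basic_open[OF assms(2)] by (auto intro: openin_subtopology_Int2)
  show "x \<in> X \<inter> basic_open H" using x assms by simp
  show "regular_on (X \<inter> basic_open H) (frac G H)"
    unfolding regular_on_def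
  proof
    fix y assume y: "y \<in> X \<inter> basic_open H"
    have "openin (subtopology zariski (X \<inter> basic_open H)) (X \<inter> basic_open H)"
      by (rule openin_zariski_self) (use X in auto)
    moreover have "\<forall>y\<in>X \<inter> basic_open H. \<forall>v\<in>y - {0}. mpoly_eval H v \<noteq> 0 \<and> frac G H y = mpoly_eval G v / mpoly_eval H v"
      using X basic_open_iff[OF assms(2)] frac_eq[OF assms(1,2)] by blast
    ultimately show "\<exists>W d. \<exists>G'\<in>homogeneous_polys d. \<exists>H'\<in>homogeneous_polys d. openin (subtopology zariski (X \<inter> basic_open H)) W \<and>
        y \<in> W \<and> (\<forall>y\<in>W. \<forall>v\<in>y - {0}. mpoly_eval H' v \<noteq> 0 \<and> frac G H y = mpoly_eval G' v / mpoly_eval H' v)"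
      using y assms by (intro exI[of _ "X \<inter> basic_open H"] exI[of _ d] bexI[of _ G] bexI[of _ H]) auto
  qed
qed

lemma carrier_gm:
  assumes "G \<in> homogeneous_polys d" "H \<in> homogeneous_polys d" "x \<in> basic_open H"
  shows "gm G H \<in> carrier Rx"
  unfolding gm_def by (rule cls_carrier[OF frac_LS[OF assms]])

text \<open>A regular function is a quotient of forms on some neighbourhood only. Multiplying
  numerator and denominator by a form K, nonzero at the point and zero outside that neighbourhood,
  makes the quotient valid wherever its denominator is nonzero.\<close>

lemma gm_cases:
  assumes "r \<in> carrier Rx"
  obtains d G H where "G \<in> homogeneous_polys d" "H \<in> homogeneous_polys d" "x \<in> basic_open H" "r = gm G H"
proof -
  obtain U f where r: "r = cls U f" "(U, f) \<in> LS" using assms by (auto simp: carrier_eq)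
  obtain W d G H where 1: "G \<in> homogeneous_polys d" "H \<in> homogeneous_polys d"
      "openin (subtopology zariski U) W" "x \<in> W"
      "\<forall>y\<in>W. \<forall>v\<in>y - {0}. mpoly_eval H v \<noteq> 0 \<and> f y = mpoly_eval G v / mpoly_eval H v"
    using r(2) unfolding LS_iff regular_on_def by blast
  have "openin (subtopology zariski X) U" using r(2) by (simp add: LS_iff)
  then have "openin (subtopology zariski X) W" "W \<subseteq> U"
    using 1(3) openin_subset[OF 1(3)] by (auto simp: openin_subtopology openin_Int)
  then obtain S where S: "openin zariski S" "W = S \<inter> X" by (auto simp: openin_subtopology)
  then obtain e K where K: "K \<in> homogeneous_polys e" "x \<in> basic_open K" "basic_open K \<subseteq> S"
    using zariski_basis[OF S(1), of x] 1(4) by blast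
  have xv: "x \<in> proj_space" using x X by blast
  have hom: "G * K \<in> homogeneous_polys (d + e)" "H * K \<in> homogeneous_polys (d + e)"
    using 1 K by (auto intro: homogeneous_polys_mult)
  have xH: "x \<in> basic_open H"
    using proj_point_nonzero[OF xv] basic_open_iff[OF 1(2) xv] 1(4,5) by blast
  then have xHK: "x \<in> basic_open (H * K)" using K by (simp add: basic_open_mult[OF 1(2) K(1)])
  have "r = gm (G * K) (H * K)"
    unfolding r(1) gm_def
  proof (rule cls_eqI[OF r(2) frac_LS[OF hom xHK]])
    fix y assume y: "y \<in> U" "y \<in> X \<inter> basic_open (H * K)"
    then have yW: "y \<in> W" "y \<in> proj_space" "y \<in> basic_open K" using S(2) K X by (auto simp: basic_open_mult[OF 1(2) K(1)])
    then obtain v where v: "v \<in> y - {0}" using proj_point_nonzero by blast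
    then have "mpoly_eval K v \<noteq> 0" using basic_open_iff[OF K(1) yW(2) v] yW by simp
    then show "f y = frac (G * K) (H * K) y"
      using 1(5) yW v frac_eq[OF hom yW(2) v] by simp
  qed
  then show ?thesis using that[OF hom xHK] by blast
qed

text \<open>The germs agree where K is nonzero, and elsewhere the factor K is zero. So equality of
  germs becomes a statement about forms that vanish on all of X.\<close>

lemma gm_eqD:
  assumes G: "G \<in> homogeneous_polys d" "H \<in> homogeneous_polys d" "x \<in> basic_open H"
    and G': "G' \<in> homogeneous_polys e" "H' \<in> homogeneous_polys e" "x \<in> basic_open H'"
    and eq: "gm G H = gm G' H'"
  shows "\<exists>c K. K \<in> homogeneous_polys c \<and> x \<in> basic_open K \<and>
    K * (G * H' - G' * H) \<in> vanishing_polys X (c + (d + e))"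
proof -
  obtain W where W: "openin (subtopology zariski X) W" "x \<in> W" "W \<subseteq> (X \<inter> basic_open H) \<inter> (X \<inter> basic_open H')"
    "\<forall>y\<in>W. frac G H y = frac G' H' y"
    using eq unfolding gm_def cls_eq_iff[OF frac_LS[OF G] frac_LS[OF G']] by blast
  obtain S where S: "openin zariski S" "W = S \<inter> X" using W(1) by (auto simp: openin_subtopology)
  then obtain c K where K: "K \<in> homogeneous_polys c" "x \<in> basic_open K" "basic_open K \<subseteq> S"
    using zariski_basis[OF S(1), of x] W(2) by blast
  have "- 1 * (G' * H) \<in> homogeneous_polys (e + d)"
    using homogeneous_polys_cmult[OF homogeneous_polys_mult[OF G'(1) G(2)], of "- 1"] by (simp add: single_uminus)
  then have "G * H' + - 1 * (G' * H) \<in> homogeneous_polys (d + e)"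
    using homogeneous_polys_mult[OF G(1) G'(2)] by (intro homogeneous_polys_add) (simp_all add: add.commute)
  then have hom: "K * (G * H' - G' * H) \<in> homogeneous_polys (c + (d + e))"
    using homogeneous_polys_mult[OF K(1)] by simp
  have "vanishes_at (K * (G * H' - G' * H)) y" if y: "y \<in> X" for y
  proof -
    have yp: "y \<in> proj_space" using y X by blast
    then obtain v where v: "v \<in> y - {0}" using proj_point_nonzero by blast
    have "mpoly_eval (K * (G * H' - G' * H)) v = 0"
    proof (cases "mpoly_eval K v = 0")
      case False
      then have "y \<in> W" using basic_open_iff[OF K(1) yp v] K(3) S(2) y by auto
      then have "mpoly_eval H v \<noteq> 0" "mpoly_eval H' v \<noteq> 0" "mpoly_eval G v / mpoly_eval H v = mpoly_eval G' v / mpoly_eval H' v"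
        using W(3,4) basic_open_iff[OF G(2) yp v] basic_open_iff[OF G'(2) yp v] frac_eq[OF G(1,2) yp v] frac_eq[OF G'(1,2) yp v]
        by auto
      then show ?thesis by (simp add: frac_eq_eq)
    qed simp
    then show ?thesis using vanishes_at_iff[OF hom yp v] by simp
  qed
  then show ?thesis using K hom unfolding vanishing_polys_def by blast
qed

lemma gm_add:
  assumes G: "G \<in> homogeneous_polys d" "H \<in> homogeneous_polys d" "x \<in> basic_open H"
    and G': "G' \<in> homogeneous_polys e" "H' \<in> homogeneous_polys e" "x \<in> basic_open H'"
  shows "gm G H \<oplus>\<^bsub>Rx\<^esub> gm G' H' = gm (G * H' + G' * H) (H * H')"
    and "gm G H \<otimes>\<^bsub>Rx\<^esub> gm G' H' = gm (G * G') (H * H')"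
    and "G * H' + G' * H \<in> homogeneous_polys (d + e)" and "H * H' \<in> homogeneous_polys (d + e)"
    and "G * G' \<in> homogeneous_polys (d + e)" and "x \<in> basic_open (H * H')"
proof -
  show hom: "G * H' + G' * H \<in> homogeneous_polys (d + e)" "H * H' \<in> homogeneous_polys (d + e)" "G * G' \<in> homogeneous_polys (d + e)"
    using G G' by (simp_all add: homogeneous_polys_mult homogeneous_polys_add homogeneous_polys_mult')
  show xb: "x \<in> basic_open (H * H')" using G G' by (simp add: basic_open_mult[OF G(2) G'(2)])
  have *: "frac (G * H' + G' * H) (H * H') y = frac G H y + frac G' H' y \<and> frac (G * G') (H * H') y = frac G H y * frac G' H' y"
    if y: "y \<in> X" "y \<in> basic_open H" "y \<in> basic_open H'" for y
  proof -
    have yp: "y \<in> proj_space" using y X by blast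
    then obtain v where v: "v \<in> y - {0}" using proj_point_nonzero by blast
    have "mpoly_eval H v \<noteq> 0" "mpoly_eval H' v \<noteq> 0"
      using y basic_open_iff[OF G(2) yp v] basic_open_iff[OF G'(2) yp v] by auto
    then show ?thesis
      unfolding frac_eq[OF hom(1,2) yp v] frac_eq[OF hom(3,2) yp v] frac_eq[OF G(1,2) yp v] frac_eq[OF G'(1,2) yp v]
      by (simp add: add_frac_eq)
  qed
  show "gm G H \<oplus>\<^bsub>Rx\<^esub> gm G' H' = gm (G * H' + G' * H) (H * H')"
    unfolding gm_def ring_ops(1)[OF frac_LS[OF G] frac_LS[OF G']]
    by (rule cls_eqI[OF LS_op(1)[OF frac_LS[OF G] frac_LS[OF G']] frac_LS[OF hom(1,2) xb]]) (use * in auto)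
  show "gm G H \<otimes>\<^bsub>Rx\<^esub> gm G' H' = gm (G * G') (H * H')"
    unfolding gm_def ring_ops(2)[OF frac_LS[OF G] frac_LS[OF G']]
    by (rule cls_eqI[OF LS_op(2)[OF frac_LS[OF G] frac_LS[OF G']] frac_LS[OF hom(3,2) xb]]) (use * in auto)
qed

lemma gm_one: "\<one>\<^bsub>Rx\<^esub> = gm 1 1" "x \<in> basic_open 1"
proof -
  show xo: "x \<in> basic_open 1" using x X basic_open_one by blast
  show "\<one>\<^bsub>Rx\<^esub> = gm 1 1"
    unfolding gm_def ring_consts
    by (rule cls_eqI[OF LS_const frac_LS[OF homogeneous_polys_one homogeneous_polys_one xo]]) (simp add: frac_def)
qed

lemma gm_smult:
  assumes G: "G \<in> homogeneous_polys d" "H \<in> homogeneous_polys d" "x \<in> basic_open H"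
  shows "c \<odot>\<^bsub>Rx\<^esub> gm G H = gm (mconst c * G) H"
  unfolding gm_def ring_smult[OF frac_LS[OF G]]
  by (rule cls_eqI[OF LS_smult[OF frac_LS[OF G]] frac_LS[OF homogeneous_polys_cmult[OF G(1)] G(2,3)]])
     (simp add: frac_def Let_def)

end

section \<open>Expansion of germs along a displaced line\<close>

text \<open>A polynomial in \<epsilon> over k[t], seen as a power series over the field k(t), where
  every series with nonzero constant term is invertible.\<close>

definition fcoeffs :: "'k::field poly poly \<Rightarrow> 'k poly fract fps" where
  "fcoeffs f = Abs_fps (\<lambda>i. to_fract (coeff f i))"

lemma to_fract_sum: "to_fract (\<Sum>i\<in>I. f i) = (\<Sum>i\<in>I. to_fract (f i))"
  by (induction I rule: infinite_finite_induct) auto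

lemma type_ring_hom_fcoeffs: "type_ring_hom fcoeffs"
proof
  show "fcoeffs (x * y) = fcoeffs x * fcoeffs y" for x y :: "'a poly poly"
    by (simp add: fps_eq_iff fcoeffs_def coeff_mult fps_mult_nth to_fract_sum atLeast0AtMost)
  show "fcoeffs 1 = (1 :: 'a poly fract fps)"
    by (auto simp: fps_eq_iff fcoeffs_def coeff_1)
qed (simp_all add: fps_eq_iff fcoeffs_def)

lemma fcoeffs_nth [simp]: "fps_nth (fcoeffs f) i = to_fract (coeff f i)"
  by (simp add: fcoeffs_def)

lemma type_ring_hom_iota: "type_ring_hom (\<lambda>c::'k::field. to_fract [:c:])"
proof -
  have "type_ring_hom (to_fract :: 'k poly \<Rightarrow> _)" by unfold_locales simp_all
  then show ?thesis by (rule type_ring_hom_comp[OF type_ring_hom_pconst])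
qed

text \<open>The local ring of the affine line at t = 0 inside k(t).\<close>

definition reg0 :: "'k::field poly fract set" where
  "reg0 = {f. \<exists>P Q. poly Q 0 \<noteq> 0 \<and> f * to_fract Q = to_fract P}"

lemma reg0I: "poly Q 0 \<noteq> 0 \<Longrightarrow> f * to_fract Q = to_fract P \<Longrightarrow> f \<in> reg0"
  unfolding reg0_def by blast

lemma reg0_to_fract: "to_fract P \<in> reg0"
  by (rule reg0I[of 1]) simp_all

lemma reg0_add: "f \<in> reg0 \<Longrightarrow> g \<in> reg0 \<Longrightarrow> f + g \<in> reg0"
proof -
  assume "f \<in> reg0" "g \<in> reg0"
  then obtain P Q P' Q' where "poly Q 0 \<noteq> 0" "f * to_fract Q = to_fract P" "poly Q' 0 \<noteq> 0" "g * to_fract Q' = to_fract P'"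
    unfolding reg0_def by blast
  moreover from this have "(f + g) * to_fract (Q * Q') = to_fract (P * Q' + P' * Q)"
    by (simp add: algebra_simps)
  ultimately show ?thesis by (intro reg0I[of "Q * Q'" _ "P * Q' + P' * Q"]) simp_all
qed

lemma reg0_mult: "f \<in> reg0 \<Longrightarrow> g \<in> reg0 \<Longrightarrow> f * g \<in> reg0"
proof -
  assume "f \<in> reg0" "g \<in> reg0"
  then obtain P Q P' Q' where "poly Q 0 \<noteq> 0" "f * to_fract Q = to_fract P" "poly Q' 0 \<noteq> 0" "g * to_fract Q' = to_fract P'"
    unfolding reg0_def by blast
  moreover from this have "(f * g) * to_fract (Q * Q') = to_fract (P * P')"
    by (metis (no_types, lifting) mult.assoc mult.left_commute to_fract_mult)
  ultimately show ?thesis by (intro reg0I[of "Q * Q'" _ "P * P'"]) simp_all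
qed

lemma reg0_sum: "(\<And>i. i \<in> I \<Longrightarrow> f i \<in> reg0) \<Longrightarrow> (\<Sum>i\<in>I. f i) \<in> reg0"
  using reg0_to_fract[of 0] by (induction I rule: infinite_finite_induct) (auto intro: reg0_add)

lemma reg0_divide: "f * to_fract Q \<in> reg0 \<Longrightarrow> poly Q 0 \<noteq> 0 \<Longrightarrow> f \<in> reg0"
proof -
  assume "f * to_fract Q \<in> reg0" "poly Q 0 \<noteq> 0"
  then obtain P Q' where "poly Q' 0 \<noteq> 0" "f * to_fract Q * to_fract Q' = to_fract P" unfolding reg0_def by blast
  then show ?thesis using \<open>poly Q 0 \<noteq> 0\<close> by (intro reg0I[of "Q * Q'"]) (simp_all add: mult.assoc)
qed

lemma sum_pCons2: "(\<Sum>i\<in>I. [:f i, g i:]) = [:\<Sum>i\<in>I. f i, \<Sum>i\<in>I. g i:]"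
  by (induction I rule: infinite_finite_induct) auto

lemma sum_pCons1: "(\<Sum>i\<in>I. [:f i:]) = [:\<Sum>i\<in>I. f i:]"
  by (induction I rule: infinite_finite_induct) auto

lemma pconst2_mult: "[:[:x:]:] * [:[:a, b:], [:c:]:] = [:[:x * a, x * b:], [:x * c :: 'a::comm_ring_1:]:]"
  by simp

text \<open>\<open>hv\<close> is constantly 1 on the displaced line p + t q + \<epsilon> u and
  serves as denominator of an affine chart; \<open>bv\<close> restricts to t there. The hypothesis
  \<open>low\<close> says that the displaced line lies on X modulo \<epsilon>^M.\<close>

locale line_germ = point_ring X "pspan p"
  for X :: "('k::field_char_0, 'n::finite) point set" and p :: "'k ^ 'n" +
  fixes q u hv bv :: "'k ^ 'n" and L :: "('k, 'n) point set" and M :: nat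
  assumes M: "0 < M"
    and hv: "dotp hv p = 1" "dotp hv q = 0" "dotp hv u = 0"
    and bv: "dotp bv p = 0" "dotp bv q = 1" "dotp bv u = 0"
    and L: "L = {x \<in> proj_space. x \<subseteq> vec.span {p, q}}" and LX: "L \<subseteq> X"
    and low: "\<And>d F i. F \<in> vanishing_polys X d \<Longrightarrow> i < M \<Longrightarrow>
      coeff (mev (\<lambda>c. [:[:c:]:]) (\<lambda>j. [:[:vec_nth p j, vec_nth q j:], [:vec_nth u j:]:]) F) i = 0"
begin

abbreviation "WW F \<equiv> mev (\<lambda>c. [:[:c:]:]) (\<lambda>j. [:[:vec_nth p j, vec_nth q j:], [:vec_nth u j:]:]) F"

definition "tql F = fcoeffs (WW F)"

sublocale W: coeff_hom "\<lambda>c::'k. [:[:c:]:]"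
  by (rule coeff_hom.intro[OF type_ring_hom_pconst2])

lemma type_ring_hom_tql: "type_ring_hom tql"
  unfolding tql_def by (rule type_ring_hom_comp[OF W.type_ring_hom_mev type_ring_hom_fcoeffs])

sublocale tql: type_ring_hom tql by (rule type_ring_hom_tql)

lemma coeff0_hom: "type_ring_hom (\<lambda>f :: 'k poly poly. coeff f 0)"
  by unfold_locales (simp_all add: coeff_mult)

lemma WW_0: "coeff (WW F) 0 = line_poly p q F"
  unfolding line_poly_def
  by (subst mev_hom[OF coeff0_hom W.coeff_hom_axioms]) simp

lemma tql_0: "fps_nth (tql F) 0 = to_fract (line_poly p q F)"
  by (simp add: tql_def WW_0)

lemma p_nonzero: "p \<noteq> 0" using hv(1) by auto

lemma line_poly_0: "poly (line_poly p q F) 0 = mpoly_eval F p"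
  by (simp add: poly_line_poly)

lemma tql_unit:
  assumes "H \<in> homogeneous_polys d" "pspan p \<in> basic_open H"
  shows "poly (line_poly p q H) 0 \<noteq> 0" "fps_nth (tql H) 0 \<noteq> 0" "tql H * inverse (tql H) = 1"
proof -
  show 1: "poly (line_poly p q H) 0 \<noteq> 0"
    using assms basic_open_pspan[OF assms(1) p_nonzero] by (simp add: line_poly_0)
  then show 2: "fps_nth (tql H) 0 \<noteq> 0" unfolding tql_0 by auto
  show "tql H * inverse (tql H) = 1" by (rule inverse_mult_eq_1'[OF 2])
qed

definition "qt G H = tql G * inverse (tql H)"

abbreviation agr where "agr f g \<equiv> (\<forall>i<M. fps_nth f i = fps_nth (g :: 'k poly fract fps) i)"

lemma lo_mult: "agr f f' \<Longrightarrow> agr g g' \<Longrightarrow> agr (f * g) (f' * g')"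
  by (auto simp: fps_mult_nth intro!: sum.cong)

text \<open>Some K (G H' - G' H) vanishes on X, so its expansion starts at order M or later;
  dividing by the expansions of K, H and H', which are units, leaves the difference of the
  quotients.\<close>

lemma qt_eq:
  assumes G: "G \<in> homogeneous_polys d" "H \<in> homogeneous_polys d" "pspan p \<in> basic_open H"
    and G': "G' \<in> homogeneous_polys e" "H' \<in> homogeneous_polys e" "pspan p \<in> basic_open H'"
    and eq: "gm G H = gm G' H'"
  shows "agr (qt G H) (qt G' H')"
proof -
  obtain c K where K: "K \<in> homogeneous_polys c" "pspan p \<in> basic_open K"
    "K * (G * H' - G' * H) \<in> vanishing_polys X (c + (d + e))"
    using gm_eqD[OF G G' eq] by blast
  let ?i = "inverse (tql K) * inverse (tql H) * inverse (tql H')"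
  have "agr (tql (K * (G * H' - G' * H))) 0" using low[OF K(3)] by (simp add: tql_def)
  then have "agr (tql (K * (G * H' - G' * H)) * ?i) (0 * ?i)" by (rule lo_mult) simp
  moreover have "tql (K * (G * H' - G' * H)) * ?i = qt G H - qt G' H'"
  proof -
    have "tql (K * (G * H' - G' * H)) * ?i =
      (tql K * inverse (tql K)) * (tql G * inverse (tql H)) * (tql H' * inverse (tql H')) -
      (tql K * inverse (tql K)) * (tql G' * inverse (tql H')) * (tql H * inverse (tql H))"
      by (simp add: algebra_simps)
    then show ?thesis by (simp add: tql_unit[OF K(1,2)] tql_unit[OF G(2,3)] tql_unit[OF G'(2,3)] qt_def)
  qed
  ultimately show ?thesis by simp
qed

text \<open>From order M on the quotient depends on the representing fraction, since the displaced
  line may leave X. Cutting the series off there makes \<Phi> independent of the chosen fraction and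
  exactly additive.\<close>

definition \<Phi> :: "('k, 'n) germ \<Rightarrow> 'k poly fract fps" where
  "\<Phi> r = fps_cutoff M (case (SOME (G, H). \<exists>d. G \<in> homogeneous_polys d \<and> H \<in> homogeneous_polys d \<and>
      pspan p \<in> basic_open H \<and> r = gm G H) of (G, H) \<Rightarrow> qt G H)"

lemma \<Phi>_gm:
  assumes G: "G \<in> homogeneous_polys d" "H \<in> homogeneous_polys d" "pspan p \<in> basic_open H"
  shows "\<Phi> (gm G H) = fps_cutoff M (qt G H)"
proof -
  define GH where "GH = (SOME (G', H'). \<exists>d. G' \<in> homogeneous_polys d \<and> H' \<in> homogeneous_polys d \<and>
      pspan p \<in> basic_open H' \<and> gm G H = gm G' H')"
  have "case GH of (G', H') \<Rightarrow> \<exists>d. G' \<in> homogeneous_polys d \<and> H' \<in> homogeneous_polys d \<and>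
      pspan p \<in> basic_open H' \<and> gm G H = gm G' H'"
    unfolding GH_def by (rule someI[of _ "(G, H)"]) (use G in auto)
  then obtain G' H' e where GH: "GH = (G', H')" "G' \<in> homogeneous_polys e" "H' \<in> homogeneous_polys e"
    "pspan p \<in> basic_open H'" "gm G H = gm G' H'" by (cases GH) auto
  have "\<Phi> (gm G H) = fps_cutoff M (qt G' H')"
    unfolding \<Phi>_def GH_def[symmetric] GH(1) by simp
  also have "\<dots> = fps_cutoff M (qt G H)"
    using qt_eq[OF G GH(2-5)] by (simp add: fps_eq_iff)
  finally show ?thesis .
qed

text \<open>Each coefficient times H(p + t q) is determined by the earlier ones and by the
  expansions of G and H, and H(p + t q) is nonzero at t = 0.\<close>

lemma qt_reg0:
  assumes G: "G \<in> homogeneous_polys d" "H \<in> homogeneous_polys d" "pspan p \<in> basic_open H"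
  shows "fps_nth (qt G H) i \<in> reg0"
proof (induction i rule: less_induct)
  case (less i)
  have "qt G H * tql H = tql G" using tql_unit(3)[OF G(2,3)] by (simp add: qt_def mult.assoc mult.commute[of "inverse (tql H)"])
  then have "fps_nth (tql G) i = (\<Sum>j=0..i. fps_nth (qt G H) j * fps_nth (tql H) (i - j))"
    by (metis fps_mult_nth)
  also have "\<dots> = (\<Sum>j<i. fps_nth (qt G H) j * fps_nth (tql H) (i - j)) + fps_nth (qt G H) i * fps_nth (tql H) 0"
    by (simp add: atLeast0AtMost lessThan_Suc_atMost[symmetric])
  finally have "fps_nth (qt G H) i * to_fract (line_poly p q H) =
      to_fract (coeff (WW G) i) + (\<Sum>j<i. fps_nth (qt G H) j * to_fract (- coeff (WW H) (i - j)))"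
    unfolding tql_0 by (simp add: tql_def sum_negf)
  moreover have "\<dots> \<in> reg0" using less by (intro reg0_add reg0_sum reg0_mult reg0_to_fract) auto
  ultimately show ?case using tql_unit(1)[OF G(2,3)] reg0_divide by metis
qed

lemma tql_mlin: "tql (mlin a) = fps_const (to_fract [:dotp a p, dotp a q:]) + fps_X * fps_const (to_fract [:dotp a u:])"
proof -
  have "WW (mlin a) = [:[:dotp a p, dotp a q:], [:dotp a u:]:]"
    by (simp only: mlin_def dotp_def W.ev.sum W.mev_mult W.mev_mconst W.mev_mvar pconst2_mult sum_pCons2 sum_pCons1)
  then show ?thesis by (simp add: tql_def fps_eq_iff coeff_pCons split: nat.split)
qed

lemma tql_hv: "tql (mlin hv) = 1" and tql_bv: "tql (mlin bv) = fps_const (to_fract [:0, 1:])"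
  using type_ring_hom.one[OF type_ring_hom_iota] by (simp_all add: tql_mlin hv bv)

lemma hv_open: "pspan p \<in> basic_open (mlin hv)"
  using basic_open_pspan[OF homogeneous_polys_mlin p_nonzero] hv by simp

text \<open>Homogenization of P to degree m. If m bounds the degree of P, its restriction to the
  displaced line is P(t) without terms in \<epsilon>, because \<open>hv\<close> is 1 and
  \<open>bv\<close> is t there.\<close>

definition homz :: "nat \<Rightarrow> 'k poly \<Rightarrow> ('k, 'n) mpoly" where
  "homz m P = (\<Sum>i\<le>m. mconst (coeff P i) * (mlin bv ^ i * mlin hv ^ (m - i)))"

lemma homogeneous_polys_power: "F \<in> homogeneous_polys d \<Longrightarrow> F ^ i \<in> homogeneous_polys (i * d)"
  by (induction i) (auto simp: homogeneous_polys_one homogeneous_polys_mult)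

lemma homogeneous_homz: "homz m P \<in> homogeneous_polys m"
  unfolding homz_def
proof (intro homogeneous_polys_sum homogeneous_polys_cmult)
  fix i assume "i \<in> {..m}"
  then show "mlin bv ^ i * mlin hv ^ (m - i) \<in> homogeneous_polys m"
    using homogeneous_polys_mult[OF homogeneous_polys_power[OF homogeneous_polys_mlin[of bv], of i]
      homogeneous_polys_power[OF homogeneous_polys_mlin[of hv], of "m - i"]] by simp
qed

lemma tql_const: "tql (mconst c) = fps_const (to_fract [:c:])"
  by (auto simp: tql_def fps_eq_iff coeff_pCons split: nat.split)

lemma tql_homz:
  assumes "degree P \<le> m"
  shows "tql (homz m P) = fps_const (to_fract P)"
proof -
  have "tql (homz m P) = fps_const (\<Sum>i\<le>m. to_fract [:coeff P i:] * to_fract [:0, 1:] ^ i)"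
  proof -
    interpret fc: type_ring_hom "fps_const :: 'k poly fract \<Rightarrow> _"
      by unfold_locales simp_all
    show ?thesis
      by (simp only: homz_def tql_const tql_hv tql_bv tql.sum tql.mult tql.power fc.sum fc.mult fc.power power_one mult_1_right)
  qed
  also have "(\<Sum>i\<le>m. to_fract [:coeff P i:] * to_fract [:0, 1:] ^ i) = to_fract (\<Sum>i\<le>m. monom (coeff P i) i)"
  proof -
    have pw: "to_fract (x ^ i) = to_fract x ^ i" for x :: "'k poly" and i by (induction i) simp_all
    have mon: "monom (coeff P i) i = [:coeff P i:] * [:0, 1:] ^ i" for i by (simp add: monom_altdef)
    show ?thesis by (simp only: mon to_fract_sum to_fract_mult pw)
  qed
  also have "(\<Sum>i\<le>m. monom (coeff P i) i) = P"
    using assms by (rule poly_as_sum_of_monoms')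
  finally show ?thesis .
qed

lemma \<Phi>_lift:
  assumes "e \<in> reg0"
  shows "\<exists>r\<in>carrier Rx. \<forall>i<M. fps_nth (\<Phi> r) i = (if i = 0 then e else 0)"
proof -
  obtain P Q where PQ: "poly Q 0 \<noteq> 0" "e * to_fract Q = to_fract P" using assms by (auto simp: reg0_def)
  then have "Q \<noteq> 0" by auto
  then have e: "e = to_fract P * inverse (to_fract Q)" using PQ by (simp add: field_simps)
  define m where "m = max (degree P) (degree Q)"
  have tP: "tql (homz m P) = fps_const (to_fract P)" and tQ: "tql (homz m Q) = fps_const (to_fract Q)"
    by (simp_all add: tql_homz m_def)
  have "to_fract (line_poly p q (homz m Q)) = to_fract Q" using tql_0[of "homz m Q"] tQ by simp
  then have "mpoly_eval (homz m Q) p \<noteq> 0" using PQ(1) line_poly_0[of "homz m Q"] by simp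
  then have o: "pspan p \<in> basic_open (homz m Q)" using basic_open_pspan[OF homogeneous_homz p_nonzero] by simp
  have "qt (homz m P) (homz m Q) = fps_const e"
    unfolding qt_def tP tQ e using \<open>Q \<noteq> 0\<close> by (simp add: fps_const_inverse flip: fps_const_mult)
  then have "\<forall>i<M. fps_nth (\<Phi> (gm (homz m P) (homz m Q))) i = (if i = 0 then e else 0)"
    by (simp add: \<Phi>_gm[OF homogeneous_homz homogeneous_homz o])
  then show ?thesis using carrier_gm[OF homogeneous_homz homogeneous_homz o] by blast
qed

sublocale D: deform Rx M "\<lambda>c::'k. to_fract [:c:]" \<Phi> reg0
proof (intro deform.intro deform_axioms.intro)
  show "algebra base_field Rx" by (rule algebra_Rx)
  show "0 < M" by (rule M)
  show "type_ring_hom (\<lambda>c::'k. to_fract [:c:])" by (rule type_ring_hom_iota)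
  fix r assume "r \<in> carrier Rx"
  then obtain d G H where G: "G \<in> homogeneous_polys d" "H \<in> homogeneous_polys d" "pspan p \<in> basic_open H" "r = gm G H"
    by (rule gm_cases)
  show "\<Phi> (c \<odot>\<^bsub>Rx\<^esub> r) = fps_const (to_fract [:c:]) * \<Phi> r" for c
    unfolding G(4) gm_smult[OF G(1-3)] \<Phi>_gm[OF G(1-3)] \<Phi>_gm[OF homogeneous_polys_cmult[OF G(1)] G(2,3)]
    by (simp add: qt_def tql_const fps_eq_iff mult.assoc)
  show "fps_nth (\<Phi> r) i \<in> reg0" if "i < M" for i
    unfolding G(4) \<Phi>_gm[OF G(1-3)] using that qt_reg0[OF G(1-3)] by simp
  fix s assume "s \<in> carrier Rx"
  then obtain e G' H' where G': "G' \<in> homogeneous_polys e" "H' \<in> homogeneous_polys e" "pspan p \<in> basic_open H'" "s = gm G' H'"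
    by (rule gm_cases)
  note ga = gm_add[OF G(1-3) G'(1-3)]
  note u = tql_unit(2,3)[OF G(2,3)] tql_unit(2,3)[OF G'(2,3)]
  have iv: "inverse (tql (H * H')) = inverse (tql H) * inverse (tql H')" by (simp add: fps_inverse_mult)
  have "qt (G * H' + G' * H) (H * H') = (tql G * inverse (tql H)) * (tql H' * inverse (tql H')) + (tql G' * inverse (tql H')) * (tql H * inverse (tql H))"
    unfolding qt_def iv by (simp add: algebra_simps)
  then have "qt (G * H' + G' * H) (H * H') = qt G H + qt G' H'" by (simp add: u qt_def)
  then show "\<Phi> (r \<oplus>\<^bsub>Rx\<^esub> s) = \<Phi> r + \<Phi> s"
    unfolding G(4) G'(4) ga(1) \<Phi>_gm[OF G(1-3)] \<Phi>_gm[OF G'(1-3)] \<Phi>_gm[OF ga(3,4,6)] by (simp add: fps_cutoff_add)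
  have "qt (G * G') (H * H') = qt G H * qt G' H'"
    unfolding qt_def iv by (simp add: algebra_simps)
  moreover have "agr (fps_cutoff M (qt G H) * fps_cutoff M (qt G' H')) (qt G H * qt G' H')" by (rule lo_mult) simp_all
  ultimately show "fps_nth (\<Phi> (r \<otimes>\<^bsub>Rx\<^esub> s)) i = fps_nth (\<Phi> r * \<Phi> s) i" if "i < M" for i
    unfolding G(4) G'(4) ga(2) \<Phi>_gm[OF G(1-3)] \<Phi>_gm[OF G'(1-3)] \<Phi>_gm[OF ga(5,4,6)] using that by simp
next
  show "fps_nth (\<Phi> \<one>\<^bsub>Rx\<^esub>) i = fps_nth 1 i" if "i < M" for i
    unfolding gm_one(1) \<Phi>_gm[OF homogeneous_polys_one homogeneous_polys_one gm_one(2)] using that by (simp add: qt_def)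
  show "e \<in> reg0 \<Longrightarrow> \<exists>r\<in>carrier Rx. \<forall>i<M. fps_nth (\<Phi> r) i = (if i = 0 then e else 0)" for e by (rule \<Phi>_lift)
  show "0 \<in> (reg0 :: 'k poly fract set)" using reg0_to_fract[of 0] by simp
qed (auto intro: reg0_add reg0_mult reg0_to_fract)

lemma line_span: "vec.span {p, q} = {s *s p + t *s q |s t. True}"
proof (rule Set.set_eqI)
  fix v
  have "v \<in> vec.span {p, q} \<longleftrightarrow> (\<exists>s t. v - s *s p = t *s q)"
    by (simp add: vec.span_insert[of p "{q}"] vec.span_singleton image_iff)
  also have "\<dots> \<longleftrightarrow> (\<exists>s t. v = s *s p + t *s q)"
    by (simp only: diff_eq_eq add.commute)
  finally show "v \<in> vec.span {p, q} \<longleftrightarrow> v \<in> {s *s p + t *s q |s t. True}" by simp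
qed

lemma in_L:
  assumes "s *s p + t *s q \<noteq> 0"
  shows "pspan (s *s p + t *s q) \<in> L"
proof -
  have "s *s p + t *s q \<in> vec.span {p, q}" unfolding line_span by blast
  then show ?thesis unfolding L using pspan_in_proj_space[OF assms] proj_subspace_iff[OF vec.subspace_span] by blast
qed

text \<open>The constant coefficient of the expansion is the restriction of G/H to the line, as a
  rational function of t. A nonzero polynomial has finitely many roots, so vanishing on a
  neighbourhood of the point in L forces G to vanish along the whole line.\<close>

lemma local_ideal_eq: "D.I0 = local_ideal X L {pspan p}"
proof (rule Set.set_eqI)
  fix r
  show "r \<in> D.I0 \<longleftrightarrow> r \<in> local_ideal X L {pspan p}"
  proof (cases "r \<in> carrier Rx")
    case True
    then obtain d G0 H0 where G0: "G0 \<in> homogeneous_polys d" "H0 \<in> homogeneous_polys d" "pspan p \<in> basic_open H0" "r = gm G0 H0"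
      by (rule gm_cases)
    \<comment> \<open>The factor \<open>hv\<close> in the denominator excludes the point of q, so
      that every point of L in the neighbourhood is p + t q up to scaling.\<close>
    define G H where "G = G0 * mlin hv" and "H = H0 * mlin hv"
    have G: "G \<in> homogeneous_polys (d + 1)" "H \<in> homogeneous_polys (d + 1)" "pspan p \<in> basic_open H"
      unfolding G_def H_def
      by (rule homogeneous_polys_mult[OF G0(1) homogeneous_polys_mlin], rule homogeneous_polys_mult[OF G0(2) homogeneous_polys_mlin])
         (use G0(3) hv_open in \<open>simp add: basic_open_mult[OF G0(2) homogeneous_polys_mlin]\<close>)
    have rG: "r = gm G H"
      unfolding G0(4) gm_def
    proof (rule cls_eqI[OF frac_LS[OF G0(1-3)] frac_LS[OF G]])
      fix y assume y: "y \<in> X \<inter> basic_open H0" "y \<in> X \<inter> basic_open H"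
      then have yp: "y \<in> proj_space" using X by blast
      then obtain v where v: "v \<in> y - {0}" using proj_point_nonzero by blast
      have "mpoly_eval H v \<noteq> 0" using y basic_open_iff[OF G(2) yp v] by simp
      then show "frac G0 H0 y = frac G H y"
        unfolding frac_eq[OF G0(1,2) yp v] frac_eq[OF G(1,2) yp v] by (simp add: G_def H_def)
    qed
    have "fps_nth (\<Phi> r) 0 = to_fract (line_poly p q G) * inverse (to_fract (line_poly p q H))"
      unfolding rG \<Phi>_gm[OF G] using M by (simp add: qt_def tql_0)
    moreover have "line_poly p q H \<noteq> 0" using tql_unit(1)[OF G(2,3)] by auto
    ultimately have *: "fps_nth (\<Phi> r) 0 = 0 \<longleftrightarrow> line_poly p q G = 0" by simp
    have "r \<in> local_ideal X L {pspan p} \<longleftrightarrow> (\<exists>(U, f)\<in>r. \<forall>x\<in>U \<inter> L. f x = 0)"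
      using True by (simp add: local_ideal_def)
    also have "\<dots> \<longleftrightarrow> line_poly p q G = 0"
    proof
      assume "\<exists>(U, f)\<in>r. \<forall>x\<in>U \<inter> L. f x = 0"
      then obtain U f where Uf: "(U, f) \<in> r" "\<forall>x\<in>U \<inter> L. f x = 0" by blast
      then obtain W where W: "openin (subtopology zariski X) W" "pspan p \<in> W" "W \<subseteq> (X \<inter> basic_open H) \<inter> U" "\<forall>y\<in>W. frac G H y = f y"
        unfolding rG gm_def mem_cls germ_rel_iff by blast
      obtain S where S: "openin zariski S" "W = S \<inter> X" using W(1) by (auto simp: openin_subtopology)
      then obtain c K where K: "K \<in> homogeneous_polys c" "pspan p \<in> basic_open K" "basic_open K \<subseteq> S"
        using zariski_basis[OF S(1), of "pspan p"] W(2) by blast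
      have "line_poly p q K \<noteq> 0" using tql_unit(1)[OF K(1,2)] by auto
      moreover have "poly (line_poly p q K * line_poly p q G) t = 0" for t
      proof (cases "poly (line_poly p q K) t = 0")
        case False
        let ?v = "p + t *s q"
        have "dotp hv ?v = 1" by (simp add: hv)
        then have v0: "?v \<noteq> 0" using dotp_zero[of hv] by force
        have yL: "pspan ?v \<in> L" using in_L[of 1 t] v0 by simp
        have "pspan ?v \<in> basic_open K" using False basic_open_pspan[OF K(1) v0] by (simp add: poly_line_poly)
        then have yW: "pspan ?v \<in> W" using K(3) S(2) LX yL by blast
        then have "frac G H (pspan ?v) = 0" using W(3,4) Uf(2) yL by auto
        moreover have yp: "pspan ?v \<in> proj_space" and vy: "?v \<in> pspan ?v - {0}"
          using v0 pspan_in_proj_space vec.span_base[of ?v "{?v}"] by auto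
        moreover have "mpoly_eval H ?v \<noteq> 0" using yW W(3) basic_open_iff[OF G(2) yp vy] by auto
        ultimately have "mpoly_eval G ?v = 0" unfolding frac_eq[OF G(1,2) yp vy] by simp
        then show ?thesis by (simp add: poly_line_poly)
      qed simp
      ultimately show "line_poly p q G = 0"
        using poly_nonzero_point[of "line_poly p q K * line_poly p q G"] by (metis mult_eq_0_iff)
    next
      assume l: "line_poly p q G = 0"
      have "frac G H y = 0" if y: "y \<in> (X \<inter> basic_open H) \<inter> L" for y
      proof -
        have yp: "y \<in> proj_space" using y X by blast
        obtain v where v: "v \<in> y - {0}" using proj_point_nonzero[OF yp] by blast
        then have "v \<in> vec.span {p, q}" using y unfolding L by blast
        then obtain s t where st: "v = s *s p + t *s q" by (auto simp: line_span)
        have "mpoly_eval H v \<noteq> 0" using y basic_open_iff[OF G(2) yp v] by simp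
        then have "dotp hv v \<noteq> 0" by (simp add: H_def)
        then have "s \<noteq> 0" by (simp add: st hv)
        then have "v = s *s (p + (t / s) *s q)" by (simp add: st vector_smult_assoc vec.scale_right_distrib)
        then have "mpoly_eval G v = s ^ (d + 1) * poly (line_poly p q G) (t / s)"
          by (simp add: mpoly_eval_smult_homogeneous[OF G(1)] poly_line_poly)
        then show ?thesis unfolding frac_eq[OF G(1,2) yp v] l by simp
      qed
      moreover have "(X \<inter> basic_open H, frac G H) \<in> r"
        unfolding rG gm_def mem_cls using equiv_germ frac_LS[OF G] by (auto simp: equiv_def refl_on_def)
      ultimately show "\<exists>(U, f)\<in>r. \<forall>x\<in>U \<inter> L. f x = 0" by blast
    qed
    finally show ?thesis using True * by simp
  qed (simp add: local_ideal_def)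
qed

end

section \<open>Specialization of the parameter and common denominators\<close>

lemma pev_to_fract: "pev (\<lambda>c. to_fract [:c:]) (to_fract [:0, 1:]) f = to_fract (f :: 'k::field poly)"
proof (induction f)
  case 0
  then show ?case by (simp add: type_ring_hom.pev_zero[OF type_ring_hom_iota])
next
  case (pCons a f)
  have "pCons a f = [:a:] + [:0, 1:] * f" by simp
  then have "to_fract (pCons a f) = to_fract [:a:] + to_fract [:0, 1:] * to_fract f"
    by (simp only: to_fract_add to_fract_mult)
  then show ?case using pCons by (simp only: type_ring_hom.pev_pCons[OF type_ring_hom_iota])
qed

text \<open>Specializing t commutes with taking the coefficient of \<epsilon>^i, which links
  identities over k[t] with statements at single points of the line.\<close>

lemma poly_coeff_displaced:
  "poly (coeff (mev (\<lambda>c. [:[:c:]:]) (\<lambda>j. [:[:vec_nth p j, vec_nth q j:], [:vec_nth u j:]:]) F) i) t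
    = tay i u F (p + t *s q)"
proof -
  define k where "k = pev (\<lambda>g :: 'a poly. [:poly g t:]) [:0, 1:]"
  have h: "type_ring_hom (\<lambda>g :: 'a poly. [:poly g t:])"
    by (rule type_ring_hom_comp[OF type_ring_hom_poly type_ring_hom_pconst])
  have k: "type_ring_hom k" unfolding k_def by (rule type_ring_hom.type_ring_hom_pev[OF h])
  have kp: "k (pCons a f) = pCons (poly a t) (k f)" for a f
    unfolding k_def type_ring_hom.pev_pCons[OF h] by simp
  have k0: "k 0 = 0" by (rule type_ring_hom.zero[OF k])
  have co: "coeff (k f) i = poly (coeff f i) t" for f i
    by (induction f arbitrary: i) (simp_all add: kp k0 coeff_pCons split: nat.split)
  have "k (mev (\<lambda>c. [:[:c:]:]) (\<lambda>j. [:[:vec_nth p j, vec_nth q j:], [:vec_nth u j:]:]) F) = line_poly (p + t *s q) u F"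
    unfolding line_poly_def
    by (subst mev_hom[OF k coeff_hom.intro[OF type_ring_hom_pconst2]]) (simp add: kp k0)
  then show ?thesis unfolding tay_def by (simp flip: co)
qed

lemma common_denominator:
  assumes "finite S" "\<And>j. j \<in> S \<Longrightarrow> \<gamma> j \<in> reg0"
  shows "\<exists>d. poly d 0 \<noteq> 0 \<and> (\<forall>j\<in>S. \<exists>g. \<gamma> j * to_fract d = to_fract g)"
  using assms
proof (induction S rule: finite_induct)
  case empty then show ?case by (intro exI[of _ 1]) simp
next
  case (insert j S)
  then obtain d where d: "poly d 0 \<noteq> 0" "\<forall>i\<in>S. \<exists>g. \<gamma> i * to_fract d = to_fract g" by auto
  obtain P Q where PQ: "poly Q 0 \<noteq> 0" "\<gamma> j * to_fract Q = to_fract P" using insert.prems[of j] by (auto simp: reg0_def)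
  have "\<exists>g. \<gamma> i * to_fract (d * Q) = to_fract g" if i: "i \<in> insert j S" for i
  proof (cases "i = j")
    case True
    have "\<gamma> j * to_fract (d * Q) = \<gamma> j * to_fract Q * to_fract d" by simp
    also have "\<dots> = to_fract (P * d)" unfolding PQ(2) by simp
    finally show ?thesis using True by blast
  next
    case False
    then obtain g where g: "\<gamma> i * to_fract d = to_fract g" using d i by blast
    have "\<gamma> i * to_fract (d * Q) = \<gamma> i * to_fract d * to_fract Q" by simp
    also have "\<dots> = to_fract (g * Q)" unfolding g by simp
    finally show ?thesis by blast
  qed
  then show ?case using d(1) PQ(1) by (intro exI[of _ "d * Q"]) simp
qed

lemma regular_on_cong:
  assumes "regular_on U f" "\<And>y. y \<in> U \<Longrightarrow> f y = g y"
  shows "regular_on U g"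
  unfolding regular_on_def
proof
  fix x assume "x \<in> U"
  then obtain W d G H where *: "G \<in> homogeneous_polys d" "H \<in> homogeneous_polys d"
    "openin (subtopology zariski U) W" "x \<in> W"
    "\<forall>y\<in>W. \<forall>v\<in>y - {0}. mpoly_eval H v \<noteq> 0 \<and> f y = mpoly_eval G v / mpoly_eval H v"
    using assms unfolding regular_on_def by blast
  have "W \<subseteq> U" using *(3) by (rule openin_imp_subset)
  then have "f y = g y" if "y \<in> W" for y using assms(2) that by blast
  then show "\<exists>W d. \<exists>G\<in>homogeneous_polys d. \<exists>H\<in>homogeneous_polys d. openin (subtopology zariski U) W \<and> x \<in> W \<and>
        (\<forall>y\<in>W. \<forall>v\<in>y - {0}. mpoly_eval H v \<noteq> 0 \<and> g y = mpoly_eval G v / mpoly_eval H v)"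
    using * by (intro exI[of _ W] exI[of _ d] bexI[of _ G] bexI[of _ H]) auto
qed

section \<open>Affine coordinates near the point and the local lifting equation\<close>

context line_germ
begin

text \<open>The representative on the affine hyperplane where \<open>hv\<close> is 1. It turns
  arbitrary polynomials, not only forms, into regular functions on the chart, as the homomorphism in
  the obstruction equation requires.\<close>

definition nrm :: "('k, 'n) point \<Rightarrow> 'k ^ 'n" where
  "nrm y = (let v = SOME v. v \<in> y - {0} in (1 / dotp hv v) *s v)"

abbreviation "U1 \<equiv> X \<inter> basic_open (mlin hv)"

lemma nrm:
  assumes "y \<in> U1"
  shows "nrm y \<in> y - {0}" "dotp hv (nrm y) = 1"
proof -
  have yp: "y \<in> proj_space" using assms X by blast
  define v where "v = (SOME v. v \<in> y - {0})"
  have v: "v \<in> y - {0}" unfolding v_def using someI_ex[OF proj_point_nonzero[OF yp]] by blast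
  have "dotp hv v \<noteq> 0" using assms basic_open_iff[OF homogeneous_polys_mlin yp v] by simp
  moreover have "vec.subspace y" using yp by (simp add: proj_space_def)
  ultimately show "dotp hv (nrm y) = 1" "nrm y \<in> y - {0}"
    using v unfolding nrm_def v_def[symmetric] Let_def by (auto simp: vec.subspace_scale)
qed

lemma nrm_frac:
  assumes "y \<in> U1" "G \<in> homogeneous_polys 1"
  shows "mpoly_eval G (nrm y) = frac G (mlin hv) y"
  using frac_eq[OF assms(2) homogeneous_polys_mlin _ nrm(1)[OF assms(1)]] nrm(2)[OF assms(1)] assms X by auto

lemma nrm_LS: "(U1, \<lambda>y. mpoly_eval F (nrm y)) \<in> LS"
proof -
  have o: "openin (subtopology zariski X) U1 \<and> pspan p \<in> U1"
    using frac_LS[OF homogeneous_polys_mlin homogeneous_polys_mlin hv_open, of hv] by (simp add: LS_iff)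
  have "regular_on U1 (\<lambda>y. mpoly_eval F (nrm y))"
  proof (induction F rule: mpoly_induct)
    case (const c) then show ?case using X by (simp add: regular_on_const le_infI1)
  next
    case (var i)
    have "regular_on U1 (frac (mvar i) (mlin hv))"
      using frac_LS[OF homogeneous_polys_mvar homogeneous_polys_mlin hv_open, of i] by (simp add: LS_iff)
    then show ?case
      by (rule regular_on_cong) (rule nrm_frac[OF _ homogeneous_polys_mvar, symmetric])
  next
    case (add F G) then show ?case by (simp add: regular_on_binop)
  next
    case (mult F G) then show ?case by (simp add: regular_on_binop)
  qed
  then show ?thesis using o by (simp add: LS_iff)
qed

definition "\<rho> F = cls U1 (\<lambda>y. mpoly_eval F (nrm y))"

lemma \<rho>_closed: "\<rho> F \<in> carrier Rx"
  unfolding \<rho>_def by (rule cls_carrier[OF nrm_LS])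

lemma \<rho>_add: "\<rho> (F + G) = \<rho> F \<oplus>\<^bsub>Rx\<^esub> \<rho> G"
  unfolding \<rho>_def ring_ops(1)[OF nrm_LS nrm_LS] by simp

lemma \<rho>_mult: "\<rho> (F * G) = \<rho> F \<otimes>\<^bsub>Rx\<^esub> \<rho> G"
  unfolding \<rho>_def ring_ops(2)[OF nrm_LS nrm_LS] by simp

lemma \<rho>_const: "\<rho> (mconst c) = c \<odot>\<^bsub>Rx\<^esub> \<one>\<^bsub>Rx\<^esub>"
  unfolding \<rho>_def ring_consts ring_smult[OF LS_const]
  by (rule cls_eqI[OF nrm_LS LS_smult[OF LS_const]]) simp

lemma \<rho>_gm: "G \<in> homogeneous_polys 1 \<Longrightarrow> \<rho> G = gm G (mlin hv)"
  unfolding \<rho>_def gm_def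
  by (rule cls_eqI[OF nrm_LS frac_LS[OF _ homogeneous_polys_mlin hv_open]]) (auto intro: nrm_frac)

lemma \<rho>_vanishing:
  assumes "F \<in> vanishing_polys X d"
  shows "\<rho> F = \<zero>\<^bsub>Rx\<^esub>"
  unfolding \<rho>_def ring_consts
proof (rule cls_eqI[OF nrm_LS LS_const])
  fix y assume y: "y \<in> U1" "y \<in> X"
  then have "vanishes_at F y" using assms by (simp add: vanishing_polys_def)
  then show "mpoly_eval F (nrm y) = 0" using nrm(1)[OF y(1)] by (simp add: vanishes_at_def)
qed

lemma \<Phi>_\<rho>_linear:
  assumes "G \<in> homogeneous_polys 1" "i < M"
  shows "fps_nth (\<Phi> (\<rho> G)) i = fps_nth (tql G) i"
  unfolding \<rho>_gm[OF assms(1)] \<Phi>_gm[OF assms(1) homogeneous_polys_mlin hv_open] qt_def tql_hv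
  using assms(2) by simp

lemma tql_mvar: "tql (mvar j) = fps_const (to_fract [:vec_nth p j:] + to_fract [:0, 1:] * to_fract [:vec_nth q j:])
    + fps_X * fps_const (to_fract [:vec_nth u j:])"
proof -
  have "[:vec_nth p j, vec_nth q j:] = [:vec_nth p j:] + [:0, 1:] * [:vec_nth q j:]" by simp
  then have "to_fract [:vec_nth p j, vec_nth q j:] = to_fract [:vec_nth p j:] + to_fract [:0, 1:] * to_fract [:vec_nth q j:]"
    by (simp only: to_fract_add to_fract_mult)
  moreover have "tql (mvar j) = fps_const (to_fract [:vec_nth p j, vec_nth q j:]) + fps_X * fps_const (to_fract [:vec_nth u j:])"
    unfolding tql_def W.mev_mvar by (simp add: fps_eq_iff coeff_pCons split: nat.split)
  ultimately show ?thesis by simp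
qed

text \<open>The obstruction equation with \<tau> = t, multiplied by a common denominator of the
  finitely many \<gamma> j. These are regular at t = 0, so the denominator can be chosen nonzero
  there. The result is an identity of polynomials in t and may be evaluated at every t.\<close>

lemma lift_equation:
  assumes "deformations_unobstructed Rx (local_ideal X L {pspan p})"
  shows "\<exists>d g. poly d 0 \<noteq> 0 \<and> (\<forall>e. \<forall>F\<in>vanishing_polys X e. \<forall>t.
    poly d t * tay M u F (p + t *s q) = (\<Sum>j\<in>UNIV. mpoly_eval (mpoly_pderiv j F) (p + t *s q) * poly (g j) t))"
proof -
  have "\<exists>\<gamma> :: 'n \<Rightarrow> 'k poly fract. (\<forall>j. \<gamma> j \<in> reg0) \<and> (\<forall>F. \<rho> F = \<zero>\<^bsub>Rx\<^esub> \<longrightarrow>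
     (\<forall>i<M. coeff (WW F) i = 0) \<longrightarrow>
     pev (\<lambda>c. to_fract [:c:]) (to_fract [:0, 1:]) (coeff (WW F) M) =
     (\<Sum>j\<in>UNIV. mev (\<lambda>c. to_fract [:c:]) (\<lambda>j. to_fract [:vec_nth p j:] + to_fract [:0, 1:] * to_fract [:vec_nth q j:]) (mpoly_pderiv j F) * \<gamma> j))"
  proof (rule D.obstruction_equation[where Bf = "mlin bv"])
    show "\<forall>i<M. fps_nth (\<Phi> (\<rho> (mvar j))) i = fps_nth (fps_const (to_fract [:vec_nth p j:] + to_fract [:0, 1:] * to_fract [:vec_nth q j:])
        + fps_X * fps_const (to_fract [:vec_nth u j:])) i" for j
      using \<Phi>_\<rho>_linear[OF homogeneous_polys_mvar] by (simp only: tql_mvar) blast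
    show "\<forall>i<M. fps_nth (\<Phi> (\<rho> (mlin bv))) i = fps_nth (fps_const (to_fract [:0, 1:])) i"
      using \<Phi>_\<rho>_linear[OF homogeneous_polys_mlin[of bv]] unfolding tql_bv by blast
    show "deformations_unobstructed Rx D.I0" using assms unfolding local_ideal_eq .
  qed (rule \<rho>_closed \<rho>_add \<rho>_mult \<rho>_const)+
  then obtain \<gamma> :: "'n \<Rightarrow> 'k poly fract" where \<gamma>': "\<forall>j. \<gamma> j \<in> reg0"
    "\<forall>F. \<rho> F = \<zero>\<^bsub>Rx\<^esub> \<longrightarrow> (\<forall>i<M. coeff (WW F) i = 0) \<longrightarrow>
     pev (\<lambda>c. to_fract [:c:]) (to_fract [:0, 1:]) (coeff (WW F) M) =
     (\<Sum>j\<in>UNIV. mev (\<lambda>c. to_fract [:c:]) (\<lambda>j. to_fract [:vec_nth p j:] + to_fract [:0, 1:] * to_fract [:vec_nth q j:]) (mpoly_pderiv j F) * \<gamma> j)"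
    by (elim exE conjE)
  note \<gamma> = \<gamma>'(1)[rule_format] \<gamma>'(2)[rule_format]
  obtain d where d: "poly d 0 \<noteq> 0" "\<forall>j\<in>UNIV. \<exists>g. \<gamma> j * to_fract d = to_fract g"
    using common_denominator[of UNIV \<gamma>] \<gamma>(1) by auto
  then obtain g where g: "\<And>j. \<gamma> j * to_fract d = to_fract (g j)" by (metis UNIV_I)
  have tf: "type_ring_hom (to_fract :: 'k poly \<Rightarrow> _)" by unfold_locales simp_all
  have lp: "mev (\<lambda>c. to_fract [:c:]) (\<lambda>j. to_fract [:vec_nth p j:] + to_fract [:0, 1:] * to_fract [:vec_nth q j:]) F
      = to_fract (line_poly p q F)" for F :: "('k, 'n) mpoly"
  proof -
    have "[:vec_nth p j, vec_nth q j:] = [:vec_nth p j:] + [:0, 1:] * [:vec_nth q j:]" for j by simp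
    then have "to_fract [:vec_nth p j, vec_nth q j:] = to_fract [:vec_nth p j:] + to_fract [:0, 1:] * to_fract [:vec_nth q j:]" for j
      by (simp only: to_fract_add to_fract_mult)
    then show ?thesis
      unfolding line_poly_def by (subst mev_hom[OF tf coeff_hom.intro[OF type_ring_hom_pconst]]) simp
  qed
  have "poly d t * tay M u F (p + t *s q) = (\<Sum>j\<in>UNIV. mpoly_eval (mpoly_pderiv j F) (p + t *s q) * poly (g j) t)"
    if F: "F \<in> vanishing_polys X e" for F e t
  proof -
    have "to_fract (coeff (WW F) M) = (\<Sum>j\<in>UNIV. to_fract (line_poly p q (mpoly_pderiv j F)) * \<gamma> j)"
      using \<gamma>(2)[OF \<rho>_vanishing[OF F] low[OF F]] unfolding pev_to_fract lp .
    then have "to_fract (coeff (WW F) M) * to_fract d = (\<Sum>j\<in>UNIV. to_fract (line_poly p q (mpoly_pderiv j F)) * (\<gamma> j * to_fract d))"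
      by (simp add: sum_distrib_right mult.assoc)
    then have "to_fract (coeff (WW F) M * d) = to_fract (\<Sum>j\<in>UNIV. line_poly p q (mpoly_pderiv j F) * g j)"
      unfolding g by (simp add: to_fract_sum)
    then have "coeff (WW F) M * d = (\<Sum>j\<in>UNIV. line_poly p q (mpoly_pderiv j F) * g j)"
      by (simp only: to_fract_eq_iff)
    then have "poly (coeff (WW F) M * d) t = poly (\<Sum>j\<in>UNIV. line_poly p q (mpoly_pderiv j F) * g j) t" by (rule arg_cong)
    then show ?thesis unfolding poly_mult poly_coeff_displaced poly_sum poly_line_poly by (simp add: mult.commute)
  qed
  then show ?thesis using d(1) by (intro exI[of _ d] exI[of _ g]) blast
qed

end

lemma local_lift_equation:
  fixes X L :: "('k::field_char_0, 'n::finite) point set" and p q u :: "'k ^ 'n"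
  assumes X: "X \<subseteq> proj_space" and L: "L = {x \<in> proj_space. x \<subseteq> vec.span {p, q}}" "L \<subseteq> X"
    and ind: "vec.independent {p, q, u}" "p \<noteq> q" "u \<noteq> p" "u \<noteq> q"
    and M: "0 < M"
    and low: "\<And>d F i v. F \<in> vanishing_polys X d \<Longrightarrow> i < M \<Longrightarrow> v \<in> vec.span {p, q} \<Longrightarrow> tay i u F v = 0"
    and unob: "deformations_unobstructed (local_ring X {pspan p}) (local_ideal X L {pspan p})"
  shows "\<exists>d g. poly d 0 \<noteq> 0 \<and> (\<forall>e. \<forall>F\<in>vanishing_polys X e. \<forall>t.
    poly d t * tay M u F (p + t *s q) = (\<Sum>j\<in>UNIV. mpoly_eval (mpoly_pderiv j F) (p + t *s q) * poly (g j) t))"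
proof -
  obtain hv where hv: "\<forall>b\<in>{p, q, u}. dotp hv b = (if b = p then 1 else 0)"
    using functional_exists[OF ind(1), of "\<lambda>b. if b = p then 1 else 0"] by blast
  obtain bv where bv: "\<forall>b\<in>{p, q, u}. dotp bv b = (if b = q then 1 else 0)"
    using functional_exists[OF ind(1), of "\<lambda>b. if b = q then 1 else 0"] by blast
  have p0: "p \<noteq> 0" using hv by auto
  have mem: "p + t *s q \<in> vec.span {p, q}" for t
    by (intro vec.span_add vec.span_scale vec.span_base) simp_all
  have "pspan p \<in> L" unfolding L(1)
    using pspan_in_proj_space[OF p0] vec.span_mono[of "{p}" "{p, q}"] by auto
  then interpret point_ring X "pspan p" using X L(2) by unfold_locales blast+
  interpret line_germ X p q u hv bv L M
  proof
    \<comment> \<open>The vanishing is given at the points of the line; over an infinite field a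
      polynomial in t without nonzero value is zero.\<close>
    show "coeff (mev (\<lambda>c. [:[:c:]:]) (\<lambda>j. [:[:vec_nth p j, vec_nth q j:], [:vec_nth u j:]:]) F) i = 0"
      if "F \<in> vanishing_polys X d" "i < M" for d F i
    proof (rule ccontr)
      assume "coeff (mev (\<lambda>c. [:[:c:]:]) (\<lambda>j. [:[:vec_nth p j, vec_nth q j:], [:vec_nth u j:]:]) F) i \<noteq> 0"
      then obtain t where "poly (coeff (mev (\<lambda>c. [:[:c:]:]) (\<lambda>j. [:[:vec_nth p j, vec_nth q j:], [:vec_nth u j:]:]) F) i) t \<noteq> 0"
        using poly_nonzero_point by blast
      then show False unfolding poly_coeff_displaced using low[OF that mem] by simp
    qed
  qed (use hv bv ind M L in auto)
  show ?thesis by (rule lift_equation[OF unob])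
qed

section \<open>Tangent spaces\<close>

definition dform :: "('k::field, 'n::finite) mpoly \<Rightarrow> 'k ^ 'n \<Rightarrow> 'k ^ 'n \<Rightarrow> 'k" where
  "dform F z w = (\<Sum>i\<in>UNIV. mpoly_eval (mpoly_pderiv i F) z * vec_nth w i)"

lemma dform_add [simp]: "dform F z (v + w) = dform F z v + dform F z w"
  and dform_diff [simp]: "dform F z (v - w) = dform F z v - dform F z w"
  and dform_smult [simp]: "dform F z (c *s w) = c * dform F z w"
  and dform_zero [simp]: "dform F z 0 = 0"
  by (simp_all add: dform_def algebra_simps sum.distrib sum_distrib_left sum_subtractf)

lemma mpoly_pderiv_homogeneous_0: "F \<in> homogeneous_polys 0 \<Longrightarrow> mpoly_pderiv i F = 0"
  unfolding mpoly_pderiv_def homogeneous_polys_def by (intro sum.neutral) auto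

lemma dform_scale:
  assumes "F \<in> homogeneous_polys d"
  shows "dform F (c *s z) w = c ^ (d - 1) * dform F z w"
proof (cases d)
  case 0
  then show ?thesis using assms by (simp add: dform_def mpoly_pderiv_homogeneous_0)
next
  case (Suc e)
  then have "mpoly_eval (mpoly_pderiv i F) (c *s z) = c ^ e * mpoly_eval (mpoly_pderiv i F) z" for i
    using assms by (intro mpoly_eval_smult_homogeneous homogeneous_polys_pderiv) simp
  then show ?thesis unfolding dform_def
    by (simp add: Suc sum_distrib_left mult.assoc)
qed

lemma vanishing_polys_homogeneous: "F \<in> vanishing_polys X d \<Longrightarrow> F \<in> homogeneous_polys d"
  by (simp add: vanishing_polys_def)

lemma embedded_tangent_space_pspan:
  "embedded_tangent_space X (pspan z) = {w. \<forall>d. \<forall>F\<in>vanishing_polys X d. dform F z w = 0}"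
proof -
  have "(\<forall>v\<in>pspan z. dform F v w = 0) \<longleftrightarrow> dform F z w = 0" if "F \<in> vanishing_polys X d" for F d w
    using vec.span_base[of z "{z}"] dform_scale[OF vanishing_polys_homogeneous[OF that]]
    by (auto simp: pspan_iff)
  then show ?thesis unfolding embedded_tangent_space_def dform_def[symmetric] by blast
qed

lemma subspace_embedded_tangent_space:
  "vec.subspace {w. \<forall>d. \<forall>F\<in>vanishing_polys X d. dform F z w = 0}"
  by (auto simp: vec.subspace_def)

subsection \<open>Taylor coefficients\<close>

lemma tay_0: "tay 0 u F v = mpoly_eval F v"
  using poly_line_poly[of v u F 0] by (simp add: tay_def poly_0_coeff_0)

lemma tay_1: "tay 1 u F v = dform F v u"
proof -
  have const: "mev (\<lambda>c. [:c:]) (\<lambda>i. [:vec_nth v i:]) G = [:mpoly_eval G v:]" for G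
    unfolding mpoly_eval_mev by (subst mev_hom[OF type_ring_hom_pconst coeff_hom_id]) simp
  obtain r where "mev (\<lambda>c. [:c:]) (\<lambda>i. [:vec_nth v i:] + [:0, 1:] * [:vec_nth u i:]) F =
      [:mpoly_eval F v:] + [:0, 1:] * (\<Sum>i\<in>UNIV. [:mpoly_eval (mpoly_pderiv i F) v:] * [:vec_nth u i:]) + [:0, 1:] * [:0, 1:] * r"
    using coeff_hom.mev_taylor[OF coeff_hom.intro[OF type_ring_hom_pconst], of "\<lambda>i. [:vec_nth v i:]" "[:0, 1:]" "\<lambda>i. [:vec_nth u i:]" F] unfolding const by blast
  moreover have "(\<lambda>i. [:vec_nth v i:] + [:0, 1:] * [:vec_nth u i:]) = (\<lambda>i. [:vec_nth v i, vec_nth u i:])" by auto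
  ultimately have "coeff (line_poly v u F) 1 = coeff ([:mpoly_eval F v:] + [:0, 1:] * (\<Sum>i\<in>UNIV. [:mpoly_eval (mpoly_pderiv i F) v:] * [:vec_nth u i:]) + [:0, 1:] * ([:0, 1:] * r)) 1"
    unfolding line_poly_def by (simp only: mult.assoc)
  also have "\<dots> = coeff (\<Sum>i\<in>UNIV. [:mpoly_eval (mpoly_pderiv i F) v:] * [:vec_nth u i:]) 0"
    by (simp add: coeff_pCons)
  also have "\<dots> = dform F v u" unfolding dform_def by (simp add: coeff_sum mult.commute)
  finally show ?thesis by (simp add: tay_def)
qed

text \<open>F(c v + x u) = c^d F(v + (x/c) u), so the coefficient is homogeneous of degree d - M in
  the base point. The identity is between products because d - M may be negative.\<close>

lemma tay_scale:
  fixes F :: "('k::field_char_0, 'n::finite) mpoly"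
  assumes F: "F \<in> homogeneous_polys d" and c: "c \<noteq> 0"
  shows "c ^ M * tay M u F (c *s v) = c ^ d * tay M u F v"
proof -
  have "poly (line_poly (c *s v) u F) = poly (smult (c ^ d) (pcompose (line_poly v u F) [:0, 1 / c:]))"
  proof
    fix t
    have "c *s v + t *s u = c *s (v + (t / c) *s u)" using c by (simp add: vec.scale_right_distrib vector_smult_assoc)
    then show "poly (line_poly (c *s v) u F) t = poly (smult (c ^ d) (pcompose (line_poly v u F) [:0, 1 / c:])) t"
      by (simp add: poly_line_poly poly_pcompose mpoly_eval_smult_homogeneous[OF F])
  qed
  then have "line_poly (c *s v) u F = smult (c ^ d) (pcompose (line_poly v u F) [:0, 1 / c:])" by (simp add: poly_eq_poly_eq_iff)
  then have "tay M u F (c *s v) = c ^ d * ((1 / c) ^ M * tay M u F v)"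
    by (simp add: tay_def coeff_pcompose_linear)
  then show ?thesis using c by (simp add: power_one_over)
qed

lemma tay_polynomial: "\<exists>f. \<forall>t. poly f t = tay M u F (v + t *s w)"
  using poly_coeff_displaced by blast

lemma poly_eq_0I_cofinite:
  fixes f :: "'k::field_char_0 poly"
  assumes "finite A" "\<And>t. t \<notin> A \<Longrightarrow> poly f t = 0"
  shows "f = 0"
proof (rule ccontr)
  assume "f \<noteq> 0"
  then have "finite {t. poly f t = 0}" by (rule poly_roots_finite)
  moreover have "UNIV = A \<union> {t. poly f t = 0}" using assms(2) by auto
  ultimately have "finite (UNIV :: 'k set)" using assms(1) by (metis finite_Un)
  then show False by (simp add: infinite_UNIV_char_0)
qed

lemma tay_eq_0_cofinite:
  fixes F :: "('k::field_char_0, 'n::finite) mpoly"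
  assumes "finite A" "\<And>t. t \<notin> A \<Longrightarrow> tay M u F (v + t *s w) = 0"
  shows "tay M u F (v + t *s w) = 0"
proof -
  obtain f where f: "\<forall>t. poly f t = tay M u F (v + t *s w)" using tay_polynomial by blast
  then have "f = 0" using assms by (intro poly_eq_0I_cofinite[of A]) auto
  then show ?thesis using f by (metis poly_0)
qed

subsection \<open>Reversed polynomials\<close>

text \<open>For e at least the degree of f this is t^e f(1/t), and its coefficient of order e is
  f(0).\<close>

definition revp :: "nat \<Rightarrow> 'k::field poly \<Rightarrow> 'k poly" where
  "revp e f = (\<Sum>i\<le>e. monom (coeff f i) (e - i))"

lemma poly_revp:
  assumes "degree f \<le> e" "t \<noteq> 0"
  shows "poly (revp e f) t = t ^ e * poly f (1 / t)"
proof -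
  have "poly f (1 / t) = (\<Sum>i\<le>e. coeff f i * (1 / t) ^ i)"
    using poly_as_sum_of_monoms'[OF assms(1)] by (metis (no_types, lifting) poly_monom poly_sum sum.cong)
  then have "t ^ e * poly f (1 / t) = (\<Sum>i\<le>e. t ^ e * (coeff f i * (1 / t) ^ i))"
    by (simp only: sum_distrib_left)
  also have "\<dots> = (\<Sum>i\<le>e. coeff f i * t ^ (e - i))"
    using assms(2) by (intro sum.cong) (auto simp: power_diff power_one_over)
  finally show ?thesis unfolding revp_def poly_sum poly_monom ..
qed

lemma degree_revp: "degree (revp e f) \<le> e"
  unfolding revp_def by (intro degree_sum_le) (auto intro: order_trans[OF degree_monom_le])

lemma coeff_revp: "coeff (revp e f) e = coeff f 0"
proof -
  have "coeff (revp e f) e = (\<Sum>i\<le>e. if i = 0 then coeff f i else 0)"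
    unfolding revp_def coeff_sum coeff_monom by (intro sum.cong) auto
  then show ?thesis by simp
qed

section \<open>From local lifts to vanishing on the tangent space\<close>

lemma span_pair: "v \<in> vec.span {p, q} \<longleftrightarrow> (\<exists>s t. v = s *s p + t *s q)"
proof -
  have "v \<in> vec.span {p, q} \<longleftrightarrow> (\<exists>s t. v - s *s p = t *s q)"
    by (simp add: vec.span_insert[of p "{q}"] vec.span_singleton image_iff)
  also have "\<dots> \<longleftrightarrow> (\<exists>s t. v = s *s p + t *s q)"
    by (simp only: diff_eq_eq add.commute)
  finally show ?thesis .
qed

text \<open>The local equation is centred at t = 0; replacing p by p + t q centres it at any other
  point of the chart.\<close>

lemma independent_pair_swap:
  assumes "vec.independent {p, q, u}" "p \<noteq> q" "u \<noteq> p" "u \<noteq> q"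
  shows "vec.independent {p + t *s q, q, u}" "p + t *s q \<noteq> q" "u \<noteq> p + t *s q"
    and "vec.span {p + t *s q, q} = vec.span {p, q}"
proof -
  have q: "q \<in> vec.span {q, u}" "q \<in> vec.span {q}" by (simp_all add: vec.span_base)
  have pn: "p \<notin> vec.span {q, u}" using assms by (simp add: vec.independent_insert)
  have ind: "vec.independent {q, u}" using assms(1) by (rule vec.independent_mono) auto
  have np: "p + t *s q \<notin> vec.span S \<longleftrightarrow> p \<notin> vec.span S" if "q \<in> vec.span S" for S
    by (metis that add_diff_cancel_right' vec.span_add vec.span_diff vec.span_scale)
  have n: "p + t *s q \<notin> vec.span {q, u}" using pn np[OF q(1)] by simp
  then show "vec.independent {p + t *s q, q, u}" using ind by (rule vec.independent_insertI)
  show "p + t *s q \<noteq> q" "u \<noteq> p + t *s q" using n vec.span_base[of q "{q, u}"] vec.span_base[of u "{q, u}"] by auto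
  show "vec.span {p + t *s q, q} = vec.span {p, q}"
  proof (intro subset_antisym vec.span_minimal vec.subspace_span)
    show "{p + t *s q, q} \<subseteq> vec.span {p, q}"
      by (auto intro: vec.span_add vec.span_scale vec.span_base)
    have "p = (p + t *s q) - t *s q" by simp
    then have "p \<in> vec.span {p + t *s q, q}"
      by (metis vec.span_diff vec.span_scale vec.span_base insertI1 insertI2)
    then show "{p, q} \<subseteq> vec.span {p + t *s q, q}" by (simp add: vec.span_base)
  qed
qed

text \<open>J is an ideal of k[t]. A nonzero element of least degree divides every element, so a
  root of it would be a common zero; over an algebraically closed field it is therefore
  constant.\<close>

lemma denominators_trivial:
  fixes J :: "'k::{alg_closed_field, field_char_0} poly set"
  assumes comb: "\<And>a b c d. c \<in> J \<Longrightarrow> d \<in> J \<Longrightarrow> a * c + b * d \<in> J"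
    and pt: "\<And>t. \<exists>d\<in>J. poly d t \<noteq> 0"
  shows "1 \<in> J"
proof -
  obtain d0 where d0: "d0 \<in> J" "poly d0 0 \<noteq> 0" using pt by blast
  define d where "d = arg_min degree (\<lambda>d. d \<in> J \<and> d \<noteq> 0)"
  have d: "d \<in> J \<and> d \<noteq> 0" unfolding d_def by (rule arg_min_natI[of _ d0]) (use d0 in auto)
  have min: "degree d \<le> degree c" if "c \<in> J" "c \<noteq> 0" for c
    unfolding d_def by (rule arg_min_nat_le) (use that in simp)
  have "degree d = 0"
  proof (rule ccontr)
    assume "degree d \<noteq> 0"
    then obtain t where t: "poly d t = 0" using alg_closed_imp_poly_has_root[of d] by auto
    obtain c where c: "c \<in> J" "poly c t \<noteq> 0" using pt by blast
    have "c mod d = 1 * c + (- (c div d)) * d" by (simp add: minus_div_mult_eq_mod[symmetric])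
    then have "c mod d \<in> J" using comb[OF c(1) conjunct1[OF d], of 1 "- (c div d)"] by simp
    then have "c mod d = 0" using min[of "c mod d"] degree_mod_less'[of d c] d by fastforce
    then have "c = c div d * d" by (metis add.right_neutral div_mult_mod_eq)
    then show False using c(2) t by (metis mult_zero_right poly_mult)
  qed
  then obtain a where a: "d = [:a:]" by (metis degree_eq_zeroE)
  then have "a \<noteq> 0" using d by auto
  have "[:1 / a:] * d + 0 * d \<in> J" using comb[of d d "[:1 / a:]" 0] d by blast
  then show ?thesis using a \<open>a \<noteq> 0\<close> by (simp add: one_pCons)
qed

text \<open>At parameters outside A the common kernel of the differentials of forms vanishing on X
  is exactly \<open>Th\<close>; at the parameters in A it contains \<open>Th\<close> but may be
  larger.\<close>

locale contracted_line =
  fixes X L :: "('k::{alg_closed_field, field_char_0}, 'n::finite) point set" and p q :: "'k ^ 'n"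
    and Th :: "('k ^ 'n) set" and A :: "'k set"
  assumes X: "X \<subseteq> proj_space" and L: "L = {x \<in> proj_space. x \<subseteq> vec.span {p, q}}" "L \<subseteq> X"
    and pq: "vec.independent {p, q}" "p \<noteq> q"
    and Th: "vec.subspace Th"
    and tangent: "\<And>d F z w. F \<in> vanishing_polys X d \<Longrightarrow> z \<in> vec.span {p, q} \<Longrightarrow> w \<in> Th \<Longrightarrow> dform F z w = 0"
    and A: "finite A"
    and smooth: "\<And>t w. t \<notin> A \<Longrightarrow> (\<And>d F. F \<in> vanishing_polys X d \<Longrightarrow> dform F (p + t *s q) w = 0) \<Longrightarrow> w \<in> Th"
    and unob: "\<And>x. x \<in> L \<Longrightarrow> deformations_unobstructed (local_ring X {x}) (local_ideal X L {x})"
begin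

lemma vanish_line:
  assumes "F \<in> vanishing_polys X d" "v \<in> vec.span {p, q}"
  shows "mpoly_eval F v = 0"
proof -
  have nz: "mpoly_eval F v = 0" if v: "v \<in> vec.span {p, q}" "v \<noteq> 0" for v
  proof -
    have "pspan v \<in> L" unfolding L(1) using v pspan_in_proj_space proj_subspace_iff[OF vec.subspace_span] by blast
    then have "vanishes_at F (pspan v)" using L(2) assms(1) by (auto simp: vanishing_polys_def)
    then show ?thesis using vec.span_base[of v "{v}"] by (auto simp: vanishes_at_def)
  qed
  show ?thesis
  proof (cases "v = 0")
    case True
    have p: "p \<noteq> 0" using pq(1) vec.dependent_zero by auto
    have "mpoly_eval F p = 0" by (rule nz) (simp_all add: vec.span_base p)
    then have "tay 0 p F (0 + t *s p) = 0" if "t \<notin> {}" for t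
      using mpoly_eval_smult_homogeneous[OF vanishing_polys_homogeneous[OF assms(1)], of t p] by (simp add: tay_0)
    from tay_eq_0_cofinite[OF _ this, of "{}" 0] show ?thesis using True by (simp add: tay_0)
  qed (rule nz[OF assms(2)])
qed

lemma tay_in_line:
  assumes "F \<in> vanishing_polys X d" "v \<in> vec.span {p, q}" "u \<in> vec.span {p, q}"
  shows "tay i u F v = 0"
proof -
  have "poly (line_poly v u F) t = 0" for t
    unfolding poly_line_poly by (rule vanish_line[OF assms(1)]) (intro vec.span_add vec.span_scale assms)
  then have "line_poly v u F = 0" by (intro poly_eq_0I_cofinite[of "{}"]) auto
  then show ?thesis by (simp add: tay_def)
qed

text \<open>Let g solve the equation on the chart and let g'/d' solve it near q in the parameter
  1/t. Solutions are unique modulo \<open>Th\<close> outside A, and homogeneity gives d'(1/t) g(t) =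
  t^(1-M) g'(1/t) modulo \<open>Th\<close>. After applying a functional that annihilates
  \<open>Th\<close> and multiplying by t^(M-1+e), the left side would have degree at least M - 1 + e
  if it were nonzero, while the right side has degree at most e. For M = 2 and beyond this is
  impossible, so g takes values in \<open>Th\<close>, where the differentials vanish.\<close>

lemma tay_step:
  assumes M: "2 \<le> M" and u: "u \<in> Th" "u \<notin> vec.span {p, q}"
    and low: "\<And>d F i v. F \<in> vanishing_polys X d \<Longrightarrow> i < M \<Longrightarrow> v \<in> vec.span {p, q} \<Longrightarrow> tay i u F v = 0"
    and F: "F \<in> vanishing_polys X d"
  shows "tay M u F (p + t *s q) = 0"
proof -
  have ind: "vec.independent {p, q, u}" "u \<noteq> p" "u \<noteq> q"
  proof -
    have "vec.independent (insert u {p, q})" using u(2) pq(1) by (rule vec.independent_insertI)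
    then show "vec.independent {p, q, u}" by (simp add: insert_commute)
    show "u \<noteq> p" "u \<noteq> q" using u(2) vec.span_base by blast+
  qed
  have ptL: "pspan v \<in> L" if "v \<in> vec.span {p, q}" "v \<noteq> 0" for v
    unfolding L(1) using that pspan_in_proj_space proj_subspace_iff[OF vec.subspace_span] by blast
  have nz: "v \<noteq> 0" if "vec.independent (insert v S)" for v :: "'k ^ 'n" and S
    using that vec.dependent_zero by blast
  \<comment> \<open>The denominators that admit a polynomial solution on the chart, the same for all
    forms F.\<close>
  define J where "J = {d. \<exists>g :: 'n \<Rightarrow> 'k poly. \<forall>e. \<forall>F\<in>vanishing_polys X e. \<forall>t.
    poly d t * tay M u F (p + t *s q) = (\<Sum>j\<in>UNIV. mpoly_eval (mpoly_pderiv j F) (p + t *s q) * poly (g j) t)}"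
  have "1 \<in> J"
  proof (rule denominators_trivial)
    fix a b c d assume "c \<in> J" "d \<in> J"
    then obtain g h where g: "\<forall>e. \<forall>F\<in>vanishing_polys X e. \<forall>t.
        poly c t * tay M u F (p + t *s q) = (\<Sum>j\<in>UNIV. mpoly_eval (mpoly_pderiv j F) (p + t *s q) * poly (g j) t)"
      and h: "\<forall>e. \<forall>F\<in>vanishing_polys X e. \<forall>t.
        poly d t * tay M u F (p + t *s q) = (\<Sum>j\<in>UNIV. mpoly_eval (mpoly_pderiv j F) (p + t *s q) * poly (h j) t)"
      unfolding J_def by blast
    have "poly (a * c + b * d) t * tay M u F (p + t *s q) =
       (\<Sum>j\<in>UNIV. mpoly_eval (mpoly_pderiv j F) (p + t *s q) * poly (a * g j + b * h j) t)"
      if "F \<in> vanishing_polys X e" for F e t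
    proof -
      have "poly (a * c + b * d) t * tay M u F (p + t *s q) =
        poly a t * (poly c t * tay M u F (p + t *s q)) + poly b t * (poly d t * tay M u F (p + t *s q))"
        by (simp add: algebra_simps)
      also have "\<dots> = poly a t * (\<Sum>j\<in>UNIV. mpoly_eval (mpoly_pderiv j F) (p + t *s q) * poly (g j) t) +
          poly b t * (\<Sum>j\<in>UNIV. mpoly_eval (mpoly_pderiv j F) (p + t *s q) * poly (h j) t)"
        using g h that by simp
      also have "\<dots> = (\<Sum>j\<in>UNIV. mpoly_eval (mpoly_pderiv j F) (p + t *s q) * poly (a * g j + b * h j) t)"
        by (simp add: sum_distrib_left sum.distrib[symmetric] algebra_simps)
      finally show ?thesis .
    qed
    then show "a * c + b * d \<in> J"
      unfolding J_def by (intro CollectI exI[of _ "\<lambda>j. a * g j + b * h j"]) blast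
  next
    fix t0
    note sw = independent_pair_swap[OF ind(1) pq(2) ind(2,3), of t0]
    have v0: "p + t0 *s q \<noteq> 0" using nz[OF sw(1)] .
    have "p + t0 *s q \<in> vec.span {p, q}" by (intro vec.span_add vec.span_scale vec.span_base) simp_all
    then have "pspan (p + t0 *s q) \<in> L" using v0 by (rule ptL)
    then have "\<exists>d g. poly d 0 \<noteq> 0 \<and> (\<forall>e. \<forall>F\<in>vanishing_polys X e. \<forall>t.
      poly d t * tay M u F ((p + t0 *s q) + t *s q) = (\<Sum>j\<in>UNIV. mpoly_eval (mpoly_pderiv j F) ((p + t0 *s q) + t *s q) * poly (g j) t))"
      using M low L sw ind(3) unob
      by (intro local_lift_equation[of X L]) (auto intro: subsetD[OF X])
    then obtain d g where d: "poly d 0 \<noteq> 0" and g: "\<And>e F t. F \<in> vanishing_polys X e \<Longrightarrow>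
      poly d t * tay M u F ((p + t0 *s q) + t *s q) = (\<Sum>j\<in>UNIV. mpoly_eval (mpoly_pderiv j F) ((p + t0 *s q) + t *s q) * poly (g j) t)"
      by blast
    \<comment> \<open>Undoes the change of base point: the denominator nonzero at 0 becomes one
      nonzero at t0.\<close>
    have shift: "(p + t0 *s q) + (t - t0) *s q = p + t *s q" for t
      by (simp add: vec.scale_left_diff_distrib)
    have "poly (pcompose d [:- t0, 1:]) t * tay M u F (p + t *s q) =
      (\<Sum>j\<in>UNIV. mpoly_eval (mpoly_pderiv j F) (p + t *s q) * poly (pcompose (g j) [:- t0, 1:]) t)"
      if "F \<in> vanishing_polys X e" for F e t
      using g[OF that, of "t - t0"] unfolding shift by (simp add: poly_pcompose)
    then have "pcompose d [:- t0, 1:] \<in> J"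
      unfolding J_def by (intro CollectI exI[of _ "\<lambda>j. pcompose (g j) [:- t0, 1:]"]) blast
    moreover have "poly (pcompose d [:- t0, 1:]) t0 \<noteq> 0" using d by (simp add: poly_pcompose)
    ultimately show "\<exists>d\<in>J. poly d t0 \<noteq> 0" by blast
  qed
  then obtain g :: "'n \<Rightarrow> 'k poly" where g: "\<And>e F t. F \<in> vanishing_polys X e \<Longrightarrow>
    tay M u F (p + t *s q) = (\<Sum>j\<in>UNIV. mpoly_eval (mpoly_pderiv j F) (p + t *s q) * poly (g j) t)"
    unfolding J_def by auto
  have sp: "vec.span {q, p} = vec.span {p, q}" by (simp add: insert_commute)
  have q0: "q \<noteq> 0" using pq(1) vec.dependent_zero by auto
  have "pspan q \<in> L" using q0 by (intro ptL) (simp_all add: vec.span_base)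
  then have "\<exists>d g. poly d 0 \<noteq> 0 \<and> (\<forall>e. \<forall>F\<in>vanishing_polys X e. \<forall>t.
      poly d t * tay M u F (q + t *s p) = (\<Sum>j\<in>UNIV. mpoly_eval (mpoly_pderiv j F) (q + t *s p) * poly (g j) t))"
    using M low L ind pq(2) unob sp
    by (intro local_lift_equation[of X L]) (auto intro: subsetD[OF X] simp: insert_commute)
  then obtain d' g' where d': "poly d' 0 \<noteq> 0" and g': "\<And>e F t. F \<in> vanishing_polys X e \<Longrightarrow>
      poly d' t * tay M u F (q + t *s p) = (\<Sum>j\<in>UNIV. mpoly_eval (mpoly_pderiv j F) (q + t *s p) * poly (g' j) t)"
    by blast
  have inTh: "(\<chi> j. poly d' (1 / t) * poly (g j) t - (1 / t) ^ (M - 1) * poly (g' j) (1 / t)) \<in> Th"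
    if t: "t \<noteq> 0" "t \<notin> A" for t
  proof (rule smooth[OF t(2)])
    fix e F assume F: "F \<in> vanishing_polys X e"
    let ?v = "p + t *s q" and ?s = "1 / t"
    have sv: "q + ?s *s p = ?s *s ?v" using t(1) by (simp add: vec.scale_right_distrib vector_smult_assoc add.commute)
    have Fh: "F \<in> homogeneous_polys e" using F by (rule vanishing_polys_homogeneous)
    define G where "G = (\<chi> j. poly (g j) t)"
    define G' where "G' = (\<chi> j. poly (g' j) ?s)"
    have 1: "tay M u F ?v = dform F ?v G" using g[OF F] by (simp add: dform_def G_def)
    have 2: "poly d' ?s * tay M u F (?s *s ?v) = dform F (?s *s ?v) G'"
      using g'[OF F, of ?s] unfolding sv by (simp add: dform_def G'_def)
    have 3: "?s ^ M * tay M u F (?s *s ?v) = ?s ^ e * tay M u F ?v" using t(1) by (intro tay_scale[OF Fh]) simp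
    \<comment> \<open>The factor ?s avoids the exponent e - 1, whose subtraction would be truncated
      for forms of degree 0.\<close>
    have 4: "?s * dform F (?s *s ?v) G' = ?s ^ e * dform F ?v G'"
    proof (cases e)
      case 0 then show ?thesis using Fh by (simp add: dform_def mpoly_pderiv_homogeneous_0)
    next
      case (Suc m) then show ?thesis by (simp add: dform_scale[OF Fh])
    qed
    have "?s ^ e * (poly d' ?s * dform F ?v G) = poly d' ?s * (?s ^ M * tay M u F (?s *s ?v))"
      unfolding 3 1 by simp
    also have "\<dots> = ?s ^ M * dform F (?s *s ?v) G'" unfolding 2[symmetric] by simp
    also have "\<dots> = ?s ^ (M - 1) * (?s * dform F (?s *s ?v) G')"
      using M by (cases M) simp_all
    also have "\<dots> = ?s ^ e * (?s ^ (M - 1) * dform F ?v G')" unfolding 4 by simp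
    finally have "poly d' ?s * dform F ?v G = ?s ^ (M - 1) * dform F ?v G'" using t(1) by simp
    then have dz: "dform F ?v (poly d' ?s *s G - ?s ^ (M - 1) *s G') = 0" by simp
    have eG: "poly d' ?s *s G - ?s ^ (M - 1) *s G' = (\<chi> j. poly d' ?s * poly (g j) t - ?s ^ (M - 1) * poly (g' j) ?s)"
      by (simp add: G_def G'_def vec_eq_iff)
    show "dform F ?v (\<chi> j. poly d' ?s * poly (g j) t - ?s ^ (M - 1) * poly (g' j) ?s) = 0"
      using dz unfolding eG .
  qed
  have ann: "(\<Sum>j\<in>UNIV. smult (vec_nth a j) (g j)) = 0" if a: "\<And>w. w \<in> Th \<Longrightarrow> dotp a w = 0" for a
  proof (rule ccontr)
    define G where "G = (\<Sum>j\<in>UNIV. smult (vec_nth a j) (g j))"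
    define G' where "G' = (\<Sum>j\<in>UNIV. smult (vec_nth a j) (g' j))"
    assume "\<not> ?thesis"
    then have G0: "G \<noteq> 0" by (simp add: G_def)
    \<comment> \<open>A common degree bound, so that reversing d' and G' clears the same power of
      1/t on both sides.\<close>
    define e where "e = max (degree d') (degree G')"
    have "poly (monom 1 (M - 1) * revp e d' * G - revp e G') t = 0" if t: "t \<notin> insert 0 A" for t
    proof -
      have "t \<noteq> 0" "t \<notin> A" using t by auto
      from a[OF inTh[OF this]] have "poly d' (1 / t) * poly G t = (1 / t) ^ (M - 1) * poly G' (1 / t)"
        by (simp add: dotp_def G_def G'_def poly_sum sum_subtractf sum_distrib_left algebra_simps)
      then have "t ^ (M - 1) * (t ^ e * poly d' (1 / t)) * poly G t = t ^ e * (t ^ (M - 1) * (1 / t) ^ (M - 1)) * poly G' (1 / t)"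
        by (simp add: algebra_simps)
      also have "t ^ (M - 1) * (1 / t) ^ (M - 1) = 1" using \<open>t \<noteq> 0\<close> by (simp add: power_one_over)
      finally show ?thesis using \<open>t \<noteq> 0\<close> by (simp add: poly_revp e_def poly_monom)
    qed
    then have "monom 1 (M - 1) * revp e d' * G - revp e G' = 0"
      using A by (intro poly_eq_0I_cofinite[of "insert 0 A"]) auto
    then have eq: "monom 1 (M - 1) * revp e d' * G = revp e G'" by simp
    \<comment> \<open>Regularity of the second solution at q enters here: d'(0) \<noteq> 0 becomes
      the top coefficient, so the reversed denominator has degree exactly e.\<close>
    have c: "coeff (revp e d') e \<noteq> 0" using d' by (simp add: coeff_revp poly_0_coeff_0)
    then have "degree (revp e d') = e" using degree_revp[of e d'] le_degree[OF c] by simp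
    moreover have "revp e d' \<noteq> 0" using c by auto
    ultimately have "degree (monom 1 (M - 1) * revp e d' * G) = (M - 1) + e + degree G"
      using G0 by (simp add: degree_mult_eq degree_monom_eq)
    then show False using eq degree_revp[of e G'] M by simp
  qed
  have "(\<chi> j. poly (g j) t) \<in> Th"
  proof (rule ccontr)
    assume "(\<chi> j. poly (g j) t) \<notin> Th"
    then obtain a where a: "\<forall>w\<in>Th. dotp a w = 0" "dotp a (\<chi> j. poly (g j) t) = 1"
      using separating_functional[OF Th] by blast
    have "dotp a (\<chi> j. poly (g j) t) = poly (\<Sum>j\<in>UNIV. smult (vec_nth a j) (g j)) t"
      by (simp add: dotp_def poly_sum)
    then show False using ann[of a] a by simp
  qed
  moreover have "p + t *s q \<in> vec.span {p, q}" by (intro vec.span_add vec.span_scale vec.span_base) simp_all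
  ultimately have "dform F (p + t *s q) (\<chi> j. poly (g j) t) = 0" using tangent[OF F] by blast
  then show ?thesis using g[OF F] by (simp add: dform_def)
qed

lemma tay_vanishes:
  assumes u: "u \<in> Th" and "F \<in> vanishing_polys X d" "v \<in> vec.span {p, q}"
  shows "tay M u F v = 0"
  using assms(2,3)
proof (induction M arbitrary: d F v rule: less_induct)
  case (less M)
  consider "M = 0" | "M = 1" | "2 \<le> M" by linarith
  then show ?case
  proof cases
    case 1 then show ?thesis using vanish_line[OF less.prems] by (simp add: tay_0)
  next
    case 2 then show ?thesis using tangent[OF less.prems u] tay_1 by metis
  next
    case 3
    show ?thesis
    proof (cases "u \<in> vec.span {p, q}")
      \<comment> \<open>A displacement within the plane of L stays over X. The step below needs u
        independent of p and q.\<close>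
      case True then show ?thesis by (rule tay_in_line[OF less.prems])
    next
      case False
      \<comment> \<open>The step covers the points p + t q. Homogeneity extends this to s p + t q
        with s \<noteq> 0, and the multiples of q follow because the coefficient depends
        polynomially on x along v + x p.\<close>
      have 1: "tay M u F (p + t *s q) = 0" for t
        by (rule tay_step[OF 3 u False less.IH less.prems(1)])
      have 2: "tay M u F (s *s p + t *s q) = 0" if "s \<noteq> 0" for s t
      proof -
        have "s *s p + t *s q = s *s (p + (t / s) *s q)" using that by (simp add: vec.scale_right_distrib vector_smult_assoc)
        then show ?thesis
          using tay_scale[OF vanishing_polys_homogeneous[OF less.prems(1)] that, of M u "p + (t / s) *s q"] 1 that by simp
      qed
      obtain s t where v: "v = s *s p + t *s q" using less.prems(2) span_pair by blast
      have *: "tay M u F (v + x *s p) = 0" if "x \<notin> {- s}" for x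
      proof -
        have "v + x *s p = (s + x) *s p + t *s q" unfolding v by (simp add: vec.scale_left_distrib)
        moreover have "s + x \<noteq> 0" using that by (auto simp: add_eq_0_iff)
        ultimately show ?thesis using 2 by metis
      qed
      have fin: "finite {- s}" by simp
      have "tay M u F (v + 0 *s p) = 0" by (rule tay_eq_0_cofinite[OF fin *])
      then show ?thesis by simp
    qed
  qed
qed

theorem vanishing_on_tangent_space:
  assumes "F \<in> vanishing_polys X d" "w \<in> Th"
  shows "mpoly_eval F w = 0"
proof -
  \<comment> \<open>Displacing p + t q along p stays in the plane of L, so the linear coefficient
    vanishes there, in particular at a parameter outside A.\<close>
  have pTh: "p \<in> Th"
  proof -
    obtain t where t: "t \<notin> A" using A infinite_UNIV_char_0[where 'a = 'k] ex_new_if_finite by blast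
    show ?thesis
    proof (rule smooth[OF t])
      fix d F assume F: "F \<in> vanishing_polys X d"
      have "tay 1 p F (p + t *s q) = 0"
        by (rule tay_in_line[OF F]) (intro vec.span_add vec.span_scale vec.span_base; simp)+
      then show "dform F (p + t *s q) p = 0" by (simp add: tay_1[symmetric])
    qed
  qed
  \<comment> \<open>All Taylor coefficients at p in the direction w - p vanish; the parameter 1 then
    reaches w.\<close>
  have "coeff (line_poly p (w - p) F) i = 0" for i
    using tay_vanishes[OF vec.subspace_diff[OF Th assms(2) pTh] assms(1), of p i] by (simp add: tay_def vec.span_base)
  then have "line_poly p (w - p) F = 0" by (simp add: poly_eq_iff)
  then have "poly (line_poly p (w - p) F) 1 = 0" by simp
  then show ?thesis by (simp add: poly_line_poly)
qed

end

section \<open>Chains of prime ideals and algebraic independence\<close>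

locale prime_set =
  fixes P :: "'a::comm_ring_1 set"
  assumes zero [simp]: "0 \<in> P" and one: "1 \<notin> P"
    and add: "a \<in> P \<Longrightarrow> b \<in> P \<Longrightarrow> a + b \<in> P"
    and mult: "b \<in> P \<Longrightarrow> a * b \<in> P"
    and prime: "a * b \<in> P \<Longrightarrow> a \<in> P \<or> b \<in> P"
begin

lemma mult': "a \<in> P \<Longrightarrow> a * b \<in> P"
  using mult[of a b] by (simp add: mult.commute)

lemma diff: "a \<in> P \<Longrightarrow> b \<in> P \<Longrightarrow> a - b \<in> P"
  using add[of a "- 1 * b"] mult[of b "- 1"] by simp

lemma sum: "(\<And>i. i \<in> I \<Longrightarrow> f i \<in> P) \<Longrightarrow> (\<Sum>i\<in>I. f i) \<in> P"
  by (induction I rule: infinite_finite_induct) (auto intro: add)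

lemma not_mult: "a \<notin> P \<Longrightarrow> b \<notin> P \<Longrightarrow> a * b \<notin> P"
  using prime by blast

lemma not_power: "a \<notin> P \<Longrightarrow> a ^ n \<notin> P"
  by (induction n) (auto simp: one dest: prime)

lemma diff_iff: "a - b \<in> P \<Longrightarrow> a \<in> P \<longleftrightarrow> b \<in> P"
  using add[of "a - b" b] diff[of a "a - b"] by auto

end

locale subring_set =
  fixes A :: "'a::comm_ring_1 set"
  assumes zero [simp]: "0 \<in> A" and one [simp]: "1 \<in> A"
    and add: "a \<in> A \<Longrightarrow> b \<in> A \<Longrightarrow> a + b \<in> A" and uminus: "a \<in> A \<Longrightarrow> - a \<in> A"
    and mult: "a \<in> A \<Longrightarrow> b \<in> A \<Longrightarrow> a * b \<in> A"
begin

definition polys :: "'a poly set" where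
  "polys = {p. \<forall>i. coeff p i \<in> A}"

lemma diff: "a \<in> A \<Longrightarrow> b \<in> A \<Longrightarrow> a - b \<in> A"
  using add[of a "- b"] uminus[of b] by simp

lemma sum: "(\<And>i. i \<in> I \<Longrightarrow> f i \<in> A) \<Longrightarrow> (\<Sum>i\<in>I. f i) \<in> A"
  by (induction I rule: infinite_finite_induct) (auto intro: add)

lemma power: "a \<in> A \<Longrightarrow> a ^ n \<in> A"
  by (induction n) (auto intro: mult)

lemma polys_zero: "0 \<in> polys"
  and polys_add: "p \<in> polys \<Longrightarrow> q \<in> polys \<Longrightarrow> p + q \<in> polys"
  and polys_diff: "p \<in> polys \<Longrightarrow> q \<in> polys \<Longrightarrow> p - q \<in> polys"
  and polys_mult: "p \<in> polys \<Longrightarrow> q \<in> polys \<Longrightarrow> p * q \<in> polys"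
  and polys_smult: "a \<in> A \<Longrightarrow> p \<in> polys \<Longrightarrow> smult a p \<in> polys"
  and polys_monom: "a \<in> A \<Longrightarrow> monom a e \<in> polys"
  by (auto simp: polys_def coeff_mult coeff_monom intro: add diff mult sum)

lemma polys_coeff: "p \<in> polys \<Longrightarrow> coeff p i \<in> A"
  by (simp add: polys_def)

lemma pseudo_division:
  assumes q: "q \<in> polys" "degree q > 0" and p: "p \<in> polys"
  shows "\<exists>k. \<exists>a\<in>polys. \<exists>r\<in>polys. smult (lead_coeff q ^ k) p = a * q + r \<and>
    degree r < degree q \<and> degree a \<le> degree p - degree q"
  using p
proof (induction "degree p" arbitrary: p rule: less_induct)
  case less
  show ?case
  proof (cases "degree p < degree q")
    case True
    then show ?thesis using less.prems
      by (intro exI[of _ 0] bexI[of _ 0] bexI[of _ p]) (auto simp: polys_zero)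
  next
    case False
    let ?m = "monom (lead_coeff p) (degree p - degree q)"
    define p1 where "p1 = smult (lead_coeff q) p - ?m * q"
    have m: "?m \<in> polys" by (intro polys_monom polys_coeff less.prems)
    have p1: "p1 \<in> polys" unfolding p1_def
      by (intro polys_diff polys_smult polys_mult m less.prems q polys_coeff)
    have "degree p1 < degree p"
    proof (rule degree_lessI)
      show "\<forall>k\<ge>degree p. coeff p1 k = 0"
      proof (intro allI impI)
        fix k assume k: "k \<ge> degree p"
        show "coeff p1 k = 0"
        proof (cases "k = degree p")
          case True
          then show ?thesis using False by (simp add: p1_def coeff_monom_mult)
        next
          case False
          then have "degree p < k" "degree q < k - (degree p - degree q)" using k \<open>\<not> degree p < degree q\<close> by auto
          then show ?thesis by (simp add: p1_def coeff_monom_mult coeff_eq_0)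
        qed
      qed
    qed (use q False in auto)
    then obtain k a r where a: "a \<in> polys" "r \<in> polys" "smult (lead_coeff q ^ k) p1 = a * q + r"
      "degree r < degree q" "degree a \<le> degree p1 - degree q"
      using less.hyps p1 by blast
    have "smult (lead_coeff q ^ Suc k) p = smult (lead_coeff q ^ k) (p1 + ?m * q)"
      by (simp add: p1_def mult.commute)
    also have "\<dots> = (a + smult (lead_coeff q ^ k) ?m) * q + r"
      using a(3) by (simp add: smult_add_right algebra_simps)
    finally have eq: "smult (lead_coeff q ^ Suc k) p = (a + smult (lead_coeff q ^ k) ?m) * q + r" .
    have "degree (a + smult (lead_coeff q ^ k) ?m) \<le> degree p - degree q"
      using a(5) \<open>degree p1 < degree p\<close> degree_smult_le[of "lead_coeff q ^ k" ?m] degree_monom_le[of "lead_coeff p" "degree p - degree q"]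
      by (intro degree_add_le) linarith+
    moreover have "a + smult (lead_coeff q ^ k) ?m \<in> polys"
      by (intro polys_add a polys_smult m power polys_coeff q)
    ultimately show ?thesis using eq a(2,4) by blast
  qed
qed

end

locale subring_prime = subring_set A + P: prime_set P for A P :: "'a::comm_ring_1 set"
begin

lemma lead_reduction:
  assumes "p \<in> polys" "coeff p i \<notin> P"
  shows "\<exists>p'\<in>polys. lead_coeff p' \<notin> P \<and> degree p' \<le> degree p \<and> poly p x - poly p' x \<in> P"
  using assms
proof (induction "degree p" arbitrary: p rule: less_induct)
  case less
  show ?case
  proof (cases "lead_coeff p \<in> P")
    case True
    define p1 where "p1 = p - monom (lead_coeff p) (degree p)"
    have p1: "p1 \<in> polys" unfolding p1_def by (intro polys_diff polys_monom polys_coeff less.prems)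
    have ne: "i \<noteq> degree p" using True less.prems by auto
    have pos: "degree p > 0" using ne less.prems coeff_eq_0[of p i] by (cases "degree p = 0") auto
    have d: "degree p1 < degree p"
    proof (rule degree_lessI)
      show "\<forall>k\<ge>degree p. coeff p1 k = 0" by (auto simp: p1_def coeff_monom coeff_eq_0)
    qed (use pos in simp)
    have "coeff p1 i \<notin> P" using ne less.prems by (simp add: p1_def)
    then obtain p' where p': "p' \<in> polys" "lead_coeff p' \<notin> P" "degree p' \<le> degree p1" "poly p1 x - poly p' x \<in> P"
      using less.hyps[OF d p1] by blast
    have "poly p x - poly p' x = lead_coeff p * x ^ degree p + (poly p1 x - poly p' x)"
      by (simp add: p1_def poly_monom)
    also have "\<dots> \<in> P" using True p'(4) by (intro P.add P.mult')
    finally show ?thesis using p' d by (intro bexI[of _ p']) auto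
  qed (use less.prems in auto)
qed

text \<open>Take a relation of least degree among those whose leading coefficient is outside P. A
  relation of smaller degree with some coefficient outside P would, by dropping leading terms,
  contradict this choice.\<close>

lemma minimal_relation:
  assumes "q \<in> polys" "poly q x \<in> P" "coeff q i \<notin> P"
  shows "\<exists>q\<in>polys. poly q x \<in> P \<and> lead_coeff q \<notin> P \<and> degree q > 0 \<and>
    (\<forall>r\<in>polys. poly r x \<in> P \<and> degree r < degree q \<longrightarrow> (\<forall>i. coeff r i \<in> P))"
proof -
  let ?R = "\<lambda>q. q \<in> polys \<and> poly q x \<in> P \<and> lead_coeff q \<notin> P"
  have red: "\<exists>q'. ?R q' \<and> degree q' \<le> degree q" if "q \<in> polys" "poly q x \<in> P" "coeff q i \<notin> P" for q i
    using lead_reduction[OF that(1,3), of x] that(2) P.diff_iff by blast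
  define q0 where "q0 = arg_min degree ?R"
  have q0: "?R q0" unfolding q0_def using red[OF assms] by (metis (no_types, lifting) arg_min_natI)
  have min: "degree q0 \<le> degree r" if "?R r" for r
    unfolding q0_def by (rule arg_min_nat_le) (use that in simp)
  have "degree q0 > 0"
  proof (rule ccontr)
    assume "\<not> ?thesis"
    then obtain c where "q0 = [:c:]" using degree_eq_zeroE by blast
    then show False using q0 by simp
  qed
  moreover have "\<forall>i. coeff r i \<in> P" if "r \<in> polys" "poly r x \<in> P" "degree r < degree q0" for r
    using red[OF that(1,2)] min that(3) by (meson leD le_less_trans)
  ultimately show ?thesis using q0 by (intro bexI[of _ q0]) auto
qed

text \<open>Elimination of one element that is algebraic modulo \<open>P\<close>: a remainder of the minimal relation
  by a minimal element of \<open>P' - P\<close> is either a smaller such element or a smaller relation.\<close>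

lemma eliminate:
  assumes "prime_set P'" "P \<subseteq> P'"
    and rel: "q \<in> polys" "poly q x \<in> P" "coeff q i \<notin> P"
    and f: "f \<in> polys" "poly f x \<in> P' - P"
  shows "\<exists>g\<in>A. g \<in> P' - P"
proof -
  interpret P': prime_set P' by fact
  obtain Q where Q: "Q \<in> polys" "poly Q x \<in> P" "lead_coeff Q \<notin> P" "degree Q > 0"
    and Qmin: "\<And>r i. r \<in> polys \<Longrightarrow> poly r x \<in> P \<Longrightarrow> degree r < degree Q \<Longrightarrow> coeff r i \<in> P"
    using minimal_relation[OF rel] by blast
  let ?R = "\<lambda>f. f \<in> polys \<and> poly f x \<in> P' - P"
  define g where "g = arg_min degree ?R"
  have g: "?R g" unfolding g_def by (rule arg_min_natI[of ?R f]) (use f in auto)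
  have min: "degree g \<le> degree r" if "?R r" for r
    unfolding g_def by (rule arg_min_nat_le) (use that in simp)
  show ?thesis
  proof (cases "degree g = 0")
    case True
    then obtain c where "g = [:c:]" using degree_eq_zeroE by blast
    then have "c \<in> A" "c \<in> P' - P" using g polys_coeff[of g 0] by auto
    then show ?thesis by blast
  next
    case False
    have "\<exists>i. coeff g i \<notin> P"
    proof (rule ccontr)
      assume "\<not> ?thesis"
      then have "poly g x \<in> P" unfolding poly_altdef by (intro P.sum P.mult') auto
      then show False using g by simp
    qed
    then obtain i where i: "coeff g i \<notin> P" by blast
    obtain h where h: "h \<in> polys" "lead_coeff h \<notin> P" "degree h \<le> degree g" "poly g x - poly h x \<in> P"
      using lead_reduction[OF conjunct1[OF g] i, of x] by blast
    have "poly h x \<in> P' - P"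
      using g P.diff_iff[OF h(4)] P'.diff_iff[OF subsetD[OF assms(2) h(4)]] by auto
    note hR = this
    then have dh: "degree h = degree g" using min[of h] h by simp
    show ?thesis
    proof (cases "degree h < degree Q")
      case False
      \<comment> \<open>The value of the remainder lies again in P' - P, against the minimal degree
        of g.\<close>
      obtain k a r where a: "a \<in> polys" "r \<in> polys" "smult (lead_coeff Q ^ k) h = a * Q + r" "degree r < degree Q"
        using pseudo_division[OF Q(1,4) h(1)] by blast
      have "poly r x = lead_coeff Q ^ k * poly h x - poly a x * poly Q x"
        using arg_cong[OF a(3), of "\<lambda>p. poly p x"] by simp
      moreover have "lead_coeff Q ^ k * poly h x \<in> P' - P"
        using hR P.not_mult[OF P.not_power[OF Q(3)]] P'.mult by blast
      moreover have "poly a x * poly Q x \<in> P" using Q by (intro P.mult)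
      ultimately have "poly r x \<in> P' - P"
        using assms(2) P'.diff P.diff_iff[of "lead_coeff Q ^ k * poly h x - poly a x * poly Q x" "lead_coeff Q ^ k * poly h x"]
          P.add by (metis DiffD1 DiffD2 DiffI diff_add_cancel subsetD)
      then show ?thesis using min[of r] a(2,4) False dh by simp
    next
      case True
      \<comment> \<open>Here the minimal relation is divided by h. Minimality of g puts the value of
        the remainder into P, so the quotient is a relation of smaller degree and has all its
        coefficients in P. This contradicts the top coefficient of \<open>a * h\<close>, which is a
        power of the leading coefficient of h times that of Q.\<close>
      obtain k a r where a: "a \<in> polys" "r \<in> polys" "smult (lead_coeff h ^ k) Q = a * h + r" "degree r < degree h"
          "degree a \<le> degree Q - degree h"
        using pseudo_division[OF h(1) _ Q(1)] False dh by auto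
      have e: "poly r x = lead_coeff h ^ k * poly Q x - poly a x * poly h x"
        using arg_cong[OF a(3), of "\<lambda>p. poly p x"] by simp
      have "lead_coeff h ^ k * poly Q x \<in> P" using Q by (intro P.mult)
      moreover have "poly a x * poly h x \<in> P'" using hR P'.mult by blast
      ultimately have "poly r x \<in> P'" unfolding e using assms(2) by (intro P'.diff) auto
      then have rP: "poly r x \<in> P" using min[of r] a(2,4) dh by auto
      have "poly a x * poly h x = lead_coeff h ^ k * poly Q x - poly r x" unfolding e by simp
      then have "poly a x * poly h x \<in> P" using rP \<open>lead_coeff h ^ k * poly Q x \<in> P\<close> P.diff by metis
      then have "poly a x \<in> P" using hR P.prime by blast
      moreover have "degree a < degree Q" using a(5) False dh Q(4) by simp
      ultimately have "coeff a i \<in> P" for i using Qmin a(1) by blast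
      then have "coeff (a * h) (degree Q) \<in> P"
        unfolding coeff_mult by (intro P.sum P.mult') auto
      moreover have "coeff (a * h) (degree Q) = lead_coeff h ^ k * lead_coeff Q"
        using arg_cong[OF a(3), of "\<lambda>p. coeff p (degree Q)"] a(4) True by (simp add: coeff_eq_0)
      ultimately show ?thesis using P.not_mult[OF P.not_power[OF h(2), of k] Q(3)] by simp
    qed
  qed
qed

end

subsection \<open>Polynomials in a subset of the variables\<close>

definition poly_vars :: "'n set \<Rightarrow> ('k::field, 'n::finite) mpoly set" where
  "poly_vars S = {F. \<forall>m\<in>Poly_Mapping.keys F. \<forall>i. Poly_Mapping.lookup m i \<noteq> 0 \<longrightarrow> i \<in> S}"

lemma subring_set_poly_vars: "subring_set (poly_vars S :: ('k::field, 'n::finite) mpoly set)"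
proof
  fix F G :: "('k, 'n) mpoly"
  assume F: "F \<in> poly_vars S"
  then show "- F \<in> poly_vars S" by (simp add: poly_vars_def)
  assume G: "G \<in> poly_vars S"
  show "F + G \<in> poly_vars S" using F G Poly_Mapping.keys_add[of F G] by (fastforce simp: poly_vars_def)
  show "F * G \<in> poly_vars S" unfolding poly_vars_def
  proof (intro CollectI ballI allI impI)
    fix m i assume m: "m \<in> Poly_Mapping.keys (F * G)" and i: "Poly_Mapping.lookup m i \<noteq> 0"
    obtain a b where ab: "m = a + b" "a \<in> Poly_Mapping.keys F" "b \<in> Poly_Mapping.keys G"
      using subsetD[OF Poly_Mapping.keys_mult m] by blast
    then have "Poly_Mapping.lookup a i \<noteq> 0 \<or> Poly_Mapping.lookup b i \<noteq> 0" using i by (auto simp: lookup_add)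
    then show "i \<in> S" using F G ab by (auto simp: poly_vars_def)
  qed
qed (auto simp: poly_vars_def)

lemma poly_vars_empty: "F \<in> poly_vars {} \<Longrightarrow> \<exists>c. F = mconst c"
proof -
  assume F: "F \<in> poly_vars {}"
  have "m = 0" if "m \<in> Poly_Mapping.keys F" for m
    using F that by (intro poly_mapping_eqI) (auto simp: poly_vars_def)
  then have "F = mconst (Poly_Mapping.lookup F 0)"
    by (intro poly_mapping_eqI) (auto simp: lookup_single when_def not_in_keys_iff_lookup_eq_zero[symmetric])
  then show ?thesis by blast
qed

lemma poly_vars_insert:
  fixes F :: "('k::field, 'n::finite) mpoly"
  assumes "F \<in> poly_vars (insert i S)"
  shows "\<exists>p\<in>subring_set.polys (poly_vars S). F = poly p (mvar i)"
proof -
  interpret A: subring_set "poly_vars S :: ('k, 'n) mpoly set" by (rule subring_set_poly_vars)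
  have pow: "(mvar i :: ('k, 'n) mpoly) ^ e = Poly_Mapping.single (Poly_Mapping.single i e) 1" for e
    by (induction e) (auto simp: mvar_def mult_single single_add[symmetric])
  have mono: "\<exists>p\<in>A.polys. Poly_Mapping.single m c = poly p (mvar i)"
    if m: "m \<in> Poly_Mapping.keys F" for m c
  proof (intro bexI)
    let ?e = "Poly_Mapping.lookup m i" let ?m = "m - Poly_Mapping.single i ?e"
    have "?m + Poly_Mapping.single i ?e = m"
      by (intro poly_mapping_eqI) (auto simp: lookup_add lookup_minus lookup_single when_def)
    then show "Poly_Mapping.single m c = poly (monom (Poly_Mapping.single ?m c) ?e) (mvar i)"
      by (simp add: poly_monom pow mult_single)
    have "Poly_Mapping.single ?m c \<in> poly_vars S"
      using assms m by (auto simp: poly_vars_def lookup_minus lookup_single when_def)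
    then show "monom (Poly_Mapping.single ?m c) ?e \<in> A.polys" by (rule A.polys_monom)
  qed
  have "\<exists>p\<in>A.polys. (\<Sum>m\<in>M. Poly_Mapping.single m (Poly_Mapping.lookup F m)) = poly p (mvar i)"
    if "M \<subseteq> Poly_Mapping.keys F" for M
    using finite_subset[OF that finite_keys] that
  proof (induction M rule: finite_induct)
    case empty
    then show ?case by (intro bexI[of _ 0]) (auto simp: A.polys_zero)
  next
    case (insert m M)
    obtain p where p: "p \<in> A.polys" "(\<Sum>m\<in>M. Poly_Mapping.single m (Poly_Mapping.lookup F m)) = poly p (mvar i)"
      using insert by auto
    obtain q where q: "q \<in> A.polys" "Poly_Mapping.single m (Poly_Mapping.lookup F m) = poly q (mvar i)"
      using mono insert.prems by blast
    show ?case using insert p q by (intro bexI[of _ "q + p"]) (auto intro: A.polys_add)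
  qed
  from this[OF subset_refl] show ?thesis unfolding poly_mapping_sum_singles .
qed

definition independent_mod :: "('k::field, 'n::finite) mpoly set \<Rightarrow> 'n set \<Rightarrow> bool" where
  "independent_mod P J \<longleftrightarrow> (\<forall>F\<in>poly_vars J. F \<in> P \<longrightarrow> F = 0)"

text \<open>If no variable could be added, every variable outside J would be algebraic over J modulo
  P. Eliminating them one by one from an element of P' - P would leave such an element in the
  variables of J, against independence modulo P'. So each strict inclusion of primes yields one more
  independent variable.\<close>

lemma independent_mod_insert:
  fixes P P' :: "('k::field, 'n::finite) mpoly set"
  assumes P: "prime_set P" and P': "prime_set P'" and sub: "P \<subset> P'" and J: "independent_mod P' J"
  shows "\<exists>j. j \<notin> J \<and> independent_mod P (insert j J)"
proof (rule ccontr)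
  assume no: "\<not> ?thesis"
  interpret P: prime_set P by fact
  \<comment> \<open>If every relation of j had all its coefficients in P, these would lie in P' and
    hence be zero, and j could be added to J.\<close>
  have alg: "\<exists>q\<in>subring_set.polys (poly_vars J). poly q (mvar j) \<in> P \<and> (\<exists>i. coeff q i \<notin> P)" if "j \<notin> J" for j
  proof (rule ccontr)
    assume *: "\<not> ?thesis"
    have "F = 0" if F: "F \<in> poly_vars (insert j J)" "F \<in> P" for F
    proof -
      obtain p where p: "p \<in> subring_set.polys (poly_vars J)" "F = poly p (mvar j)"
        using poly_vars_insert[OF F(1)] by blast
      have "coeff p i = 0" for i
      proof -
        have "coeff p i \<in> P'" using * p F(2) sub by blast
        moreover have "coeff p i \<in> poly_vars J" using subring_set.polys_coeff[OF subring_set_poly_vars p(1)] .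
        ultimately show ?thesis using J by (simp add: independent_mod_def)
      qed
      then have "p = 0" by (simp add: poly_eq_iff)
      then show ?thesis using p by simp
    qed
    then show False using no that by (auto simp: independent_mod_def)
  qed
  have "\<exists>f\<in>poly_vars J. f \<in> P' - P" if "finite S" "\<exists>f\<in>poly_vars (J \<union> S). f \<in> P' - P" for S
    using that
  proof (induction S rule: finite_induct)
    case (insert j S)
    show ?case
    proof (cases "j \<in> J")
      case True
      then have "J \<union> insert j S = J \<union> S" by auto
      then show ?thesis using insert by simp
    next
      case False
      interpret A: subring_prime "poly_vars (J \<union> S)" P by (intro subring_prime.intro subring_set_poly_vars P)
      obtain f where "f \<in> poly_vars (insert j (J \<union> S))" "f \<in> P' - P" using insert.prems by auto
      then obtain p where p: "p \<in> A.polys" "poly p (mvar j) \<in> P' - P" using poly_vars_insert by metis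
      obtain q i where q: "q \<in> subring_set.polys (poly_vars J)" "poly q (mvar j) \<in> P" "coeff q i \<notin> P"
        using alg[OF False] by blast
      have "q \<in> A.polys"
        using q(1) unfolding A.polys_def subring_set.polys_def[OF subring_set_poly_vars]
        by (auto simp: poly_vars_def)
      then have "\<exists>g\<in>poly_vars (J \<union> S). g \<in> P' - P"
        using A.eliminate[OF P' _ _ q(2,3) p] sub by blast
      then show ?thesis by (rule insert.IH)
    qed
  qed simp
  moreover have "J \<union> UNIV = UNIV" by simp
  moreover have "F \<in> poly_vars UNIV" for F by (simp add: poly_vars_def)
  ultimately obtain f where "f \<in> poly_vars J" "f \<in> P' - P" using sub by (metis finite psubset_imp_ex_mem)
  then show False using J P.zero by (auto simp: independent_mod_def)
qed

text \<open>After localization an ideal of transcendence degree at least \<open>|J|\<close> needs at most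
  \<open>N + 1 - |J|\<close> generators.\<close>

lemma local_generators:
  fixes P :: "('k::field, 'n::finite) mpoly set"
  assumes P: "prime_set P" and J: "independent_mod P J"
  shows "\<exists>Q :: 'n \<Rightarrow> ('k, 'n) mpoly. (\<forall>j. Q j \<in> P) \<and>
    (\<forall>F\<in>P. \<exists>c a. c \<notin> P \<and> c * F = (\<Sum>j\<in>-J. a j * Q j))"
proof -
  interpret P: prime_set P by fact
  \<comment> \<open>The polynomials generated by the Q_j with j in S after inverting the elements
    outside P.\<close>
  define M where "M S Q = {F. \<exists>c a. c \<notin> P \<and> c * F = (\<Sum>j\<in>S. a j * (Q j :: ('k, 'n) mpoly))}" for S :: "'n set" and Q
  have M0: "0 \<in> M S Q" for S Q
    unfolding M_def using P.one by (intro CollectI exI[of _ 1] exI[of _ "\<lambda>_. 0"]) simp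
  have Madd: "F + G \<in> M S Q" if FG: "F \<in> M S Q" "G \<in> M S Q" for F G S Q
  proof -
    obtain c a where c: "c \<notin> P" "c * F = (\<Sum>j\<in>S. a j * Q j)" using FG(1) unfolding M_def by blast
    obtain d b where d: "d \<notin> P" "d * G = (\<Sum>j\<in>S. b j * Q j)" using FG(2) unfolding M_def by blast
    have "c * d * (F + G) = d * (c * F) + c * (d * G)" by (simp add: algebra_simps)
    also have "\<dots> = (\<Sum>j\<in>S. (d * a j + c * b j) * Q j)"
      unfolding c d by (simp add: sum_distrib_left sum.distrib algebra_simps)
    finally have "c * d * (F + G) = (\<Sum>j\<in>S. (d * a j + c * b j) * Q j)" .
    then show ?thesis using P.not_mult[OF c(1) d(1)]
      unfolding M_def by (intro CollectI exI[of _ "c * d"] exI[of _ "\<lambda>j. d * a j + c * b j"]) simp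
  qed
  have Mmult: "G * F \<in> M S Q" if F: "F \<in> M S Q" for F G S Q
  proof -
    obtain c a where c: "c \<notin> P" "c * F = (\<Sum>j\<in>S. a j * Q j)" using F unfolding M_def by blast
    have "c * (G * F) = G * (c * F)" by (simp add: algebra_simps)
    then have "c * (G * F) = (\<Sum>j\<in>S. (G * a j) * Q j)" unfolding c by (simp add: sum_distrib_left mult.assoc)
    then show ?thesis using c(1)
      unfolding M_def by (intro CollectI exI[of _ c] exI[of _ "\<lambda>j. G * a j"]) simp
  qed
  have Msum: "(\<Sum>i\<in>I. F i) \<in> M S Q" if "\<And>i. i \<in> I \<Longrightarrow> F i \<in> M S Q" for I :: "nat set" and F S Q
    using that by (induction I rule: infinite_finite_induct) (auto intro: M0 Madd)
  have Mdiv: "F \<in> M S Q" if F: "d \<notin> P" "d * F \<in> M S Q" for F d S Q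
  proof -
    obtain c a where c: "c \<notin> P" "c * (d * F) = (\<Sum>j\<in>S. a j * Q j)" using F unfolding M_def by blast
    then show ?thesis using P.not_mult[OF c(1) F(1)]
      unfolding M_def by (intro CollectI exI[of _ "c * d"] exI[of _ a]) (simp add: mult.assoc)
  qed
  have "\<exists>Q. (\<forall>j. Q j \<in> P) \<and> P \<inter> poly_vars (J \<union> S) \<subseteq> M S Q" if "finite S" "S \<inter> J = {}" for S
    using that
  proof (induction S rule: finite_induct)
    case empty
    have "P \<inter> poly_vars J \<subseteq> {0}" using J by (auto simp: independent_mod_def)
    then show ?case using M0 P.zero by (intro exI[of _ "\<lambda>_. 0"]) auto
  next
    case (insert i S)
    obtain Q where Q: "\<forall>j. Q j \<in> P" "P \<inter> poly_vars (J \<union> S) \<subseteq> M S Q" using insert by auto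
    interpret A: subring_prime "poly_vars (J \<union> S)" P by (intro subring_prime.intro subring_set_poly_vars P)
    \<comment> \<open>q is a minimal relation of the i-th variable over the previous ones, or 0 if
      every relation has all its coefficients in P. The remainder of any relation has coefficients
      in P, which the earlier generators cover.\<close>
    have "\<exists>q. poly q (mvar i) \<in> P \<and> (\<forall>p\<in>A.polys. poly p (mvar i) \<in> P \<longrightarrow>
        (\<exists>c a. \<exists>r\<in>A.polys. c \<notin> P \<and> smult c p = a * q + r \<and> (\<forall>j. coeff r j \<in> P)))"
    proof (cases "\<exists>q\<in>A.polys. poly q (mvar i) \<in> P \<and> (\<exists>j. coeff q j \<notin> P)")
      case True
      then obtain q0 j where q0: "q0 \<in> A.polys" "poly q0 (mvar i) \<in> P" "coeff q0 j \<notin> P" by blast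
      obtain q where q: "q \<in> A.polys" "poly q (mvar i) \<in> P" "lead_coeff q \<notin> P" "degree q > 0"
        and qmin: "\<And>r j. r \<in> A.polys \<Longrightarrow> poly r (mvar i) \<in> P \<Longrightarrow> degree r < degree q \<Longrightarrow> coeff r j \<in> P"
        using A.minimal_relation[OF q0] by blast
      have "\<exists>c a. \<exists>r\<in>A.polys. c \<notin> P \<and> smult c p = a * q + r \<and> (\<forall>j. coeff r j \<in> P)"
        if p: "p \<in> A.polys" "poly p (mvar i) \<in> P" for p
      proof -
        obtain k a r where a: "r \<in> A.polys" "smult (lead_coeff q ^ k) p = a * q + r" "degree r < degree q"
          using A.pseudo_division[OF q(1,4) p(1)] by blast
        have "poly r (mvar i) = lead_coeff q ^ k * poly p (mvar i) - poly a (mvar i) * poly q (mvar i)"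
          using arg_cong[OF a(2), of "\<lambda>p. poly p (mvar i)"] by simp
        also have "\<dots> \<in> P" using p q by (intro P.diff P.mult)
        finally have "\<forall>j. coeff r j \<in> P" using qmin a by blast
        then show ?thesis using a(1,2) P.not_power[OF q(3), of k] by blast
      qed
      then show ?thesis using q(2) by blast
    next
      case False
      show ?thesis
      proof (rule exI[of _ 0], intro conjI ballI impI)
        fix p assume p: "p \<in> A.polys" "poly p (mvar i) \<in> P"
        show "\<exists>c a. \<exists>r\<in>A.polys. c \<notin> P \<and> smult c p = a * 0 + r \<and> (\<forall>j. coeff r j \<in> P)"
          using p False P.one by (intro exI[of _ "1 :: ('k, 'n) mpoly"] exI[of _ "0 :: ('k, 'n) mpoly poly"] bexI[of _ p]) auto
      qed simp
    qed
    then obtain q where q: "poly q (mvar i) \<in> P"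
      and qd: "\<And>p. p \<in> A.polys \<Longrightarrow> poly p (mvar i) \<in> P \<Longrightarrow>
        \<exists>c a. \<exists>r\<in>A.polys. c \<notin> P \<and> smult c p = a * q + r \<and> (\<forall>j. coeff r j \<in> P)" by blast
    define Q' where "Q' = Q(i := poly q (mvar i))"
    have incl: "M S Q \<subseteq> M (insert i S) Q'"
    proof
      fix F assume "F \<in> M S Q"
      then obtain c a where c: "c \<notin> P" "c * F = (\<Sum>j\<in>S. a j * Q j)" unfolding M_def by blast
      have "(\<Sum>j\<in>insert i S. (a(i := 0)) j * Q' j) = (\<Sum>j\<in>S. a j * Q j)"
        using insert.hyps by (auto simp: Q'_def intro!: sum.cong)
      then show "F \<in> M (insert i S) Q'" using c unfolding M_def
        by (intro CollectI exI[of _ c] exI[of _ "a(i := 0)"]) simp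
    qed
    have gen: "poly q (mvar i) \<in> M (insert i S) Q'"
    proof -
      have "(\<Sum>j\<in>insert i S. (if j = i then 1 else 0) * Q' j) = poly q (mvar i)"
        using insert.hyps by (auto simp: Q'_def intro!: sum.neutral)
      then show ?thesis using P.one unfolding M_def
        by (intro CollectI exI[of _ 1] exI[of _ "\<lambda>j. if j = i then 1 else 0"]) simp
    qed
    have "F \<in> M (insert i S) Q'" if F: "F \<in> P" "F \<in> poly_vars (J \<union> insert i S)" for F
    proof -
      obtain p where p: "p \<in> A.polys" "F = poly p (mvar i)"
        using poly_vars_insert[of F i "J \<union> S"] F(2) by auto
      obtain c a r where c: "r \<in> A.polys" "c \<notin> P" "smult c p = a * q + r" "\<forall>j. coeff r j \<in> P"
        using qd[OF p(1)] F(1) p(2) by blast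
      have "coeff r j \<in> M (insert i S) Q'" for j
        using c(1,4) A.polys_coeff Q(2) incl by blast
      then have r: "poly r (mvar i) \<in> M (insert i S) Q'"
        unfolding poly_altdef by (intro Msum) (subst mult.commute, blast intro: Mmult)
      have "c * F = poly a (mvar i) * poly q (mvar i) + poly r (mvar i)"
        using arg_cong[OF c(3), of "\<lambda>p. poly p (mvar i)"] by (simp add: p(2))
      also have "\<dots> \<in> M (insert i S) Q'" by (intro Madd Mmult r gen)
      finally show ?thesis by (rule Mdiv[OF c(2)])
    qed
    moreover have "\<forall>j. Q' j \<in> P" using Q(1) q by (simp add: Q'_def)
    ultimately show ?case by blast
  qed
  from this[of "-J"] obtain Q where Q: "\<forall>j. Q j \<in> P" "P \<inter> poly_vars (J \<union> -J) \<subseteq> M (-J) Q" by auto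
  have "F \<in> poly_vars (J \<union> -J)" for F by (simp add: poly_vars_def)
  then show ?thesis using Q unfolding M_def by (intro exI[of _ Q]) blast
qed

section \<open>The dimension of the tangent spaces\<close>

text \<open>All polynomials vanishing on the affine cone, not only forms, so that the results on
  prime ideals of the polynomial ring apply.\<close>

definition cone_ideal :: "('k::field, 'n::finite) point set \<Rightarrow> ('k, 'n) mpoly set" where
  "cone_ideal Z = {F. \<forall>x\<in>Z. \<forall>v\<in>x. mpoly_eval F v = 0}"

lemma homogeneous_decomposition:
  fixes F :: "('k::field, 'n::finite) mpoly"
  shows "\<exists>f N. (\<forall>d. f d \<in> homogeneous_polys d) \<and> (\<forall>M\<ge>N. F = (\<Sum>d\<le>M. f d))"
proof (induction F rule: mpoly_sum_induct)
  case zero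
  then show ?case by (intro exI[of _ "\<lambda>_. 0"] exI[of _ 0]) simp
next
  case (add F m c)
  obtain f N where f: "\<And>d. f d \<in> homogeneous_polys d" "\<And>M. M \<ge> N \<Longrightarrow> F = (\<Sum>d\<le>M. f d)" using add by blast
  define e where "e = (\<Sum>i\<in>UNIV. Poly_Mapping.lookup m i)"
  have "Poly_Mapping.single m c + F = (\<Sum>d\<le>M. (if d = e then Poly_Mapping.single m c else 0) + f d)"
    if "M \<ge> max N e" for M
    using that f(2)[of M] by (simp add: sum.distrib)
  moreover have "(if d = e then Poly_Mapping.single m c else 0) + f d \<in> homogeneous_polys d" for d
    using f(1) by (intro homogeneous_polys_add) (auto simp: e_def intro: homogeneous_polys_single)
  ultimately show ?case by (intro exI[of _ "\<lambda>d. (if d = e then Poly_Mapping.single m c else 0) + f d"] exI[of _ "max N e"]) blast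
qed

text \<open>G is a homogeneous component of F that is nonzero at v: wherever it is nonzero, F is a
  nonzero polynomial along the line through that point. In this way irreducibility, which is tested
  on forms, controls arbitrary polynomials.\<close>

lemma form_detecting_point:
  fixes F :: "('k::field_char_0, 'n::finite) mpoly"
  assumes "v \<noteq> 0" "mpoly_eval F (c *s v) \<noteq> 0"
  shows "\<exists>d. \<exists>G\<in>homogeneous_polys d. mpoly_eval G v \<noteq> 0 \<and>
    (\<forall>u. mpoly_eval G u \<noteq> 0 \<longrightarrow> (\<exists>f. f \<noteq> 0 \<and> (\<forall>c. poly f c = mpoly_eval F (c *s u))))"
proof -
  obtain f N where f: "\<And>d. f d \<in> homogeneous_polys d" "F = (\<Sum>d\<le>N. f d)"
    using homogeneous_decomposition[of F] by blast
  have ev: "mpoly_eval F (c *s u) = (\<Sum>d\<le>N. c ^ d * mpoly_eval (f d) u)" for c u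
    unfolding f(2) using mpoly_eval_smult_homogeneous[OF f(1)] by simp
  obtain d where d: "d \<le> N" "mpoly_eval (f d) v \<noteq> 0"
    using assms(2) unfolding ev by (metis (no_types, lifting) atMost_iff mult_zero_right sum.neutral)
  have "\<exists>g. g \<noteq> 0 \<and> (\<forall>c. poly g c = mpoly_eval F (c *s u))" if u: "mpoly_eval (f d) u \<noteq> 0" for u
  proof (intro exI[of _ "\<Sum>d\<le>N. monom (mpoly_eval (f d) u) d"] conjI allI)
    have "coeff (\<Sum>d\<le>N. monom (mpoly_eval (f d) u) d) d = mpoly_eval (f d) u"
      using d by (simp add: coeff_sum)
    then show "(\<Sum>d\<le>N. monom (mpoly_eval (f d) u) d) \<noteq> 0" using u by (metis coeff_0)
    show "poly (\<Sum>d\<le>N. monom (mpoly_eval (f d) u) d) c = mpoly_eval F (c *s u)" for c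
      by (simp add: ev poly_sum poly_monom mult.commute)
  qed
  then show ?thesis using d f(1) by blast
qed

lemma prime_cone_ideal:
  fixes Z :: "('k::field_char_0, 'n::finite) point set"
  assumes Z: "subvariety Z"
  shows "prime_set (cone_ideal Z)"
proof
  have irr: "irreducible_space (subtopology zariski Z)" using Z by (simp add: subvariety_def)
  have Zp: "Z \<subseteq> proj_space" by (rule subvariety_subset[OF Z])
  have "Z \<noteq> {}" using irr by (auto simp: irreducible_space_def)
  then obtain x where "x \<in> Z" by blast
  moreover obtain v where "v \<in> x" using calculation Zp proj_point_nonzero by blast
  ultimately show "1 \<notin> cone_ideal Z" by (auto simp: cone_ideal_def)
  fix F G :: "('k, 'n) mpoly"
  assume FG: "F * G \<in> cone_ideal Z"
  show "F \<in> cone_ideal Z \<or> G \<in> cone_ideal Z"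
  proof (rule ccontr)
    assume "\<not> ?thesis"
    then obtain x v y w where x: "x \<in> Z" "v \<in> x" "mpoly_eval F v \<noteq> 0" and y: "y \<in> Z" "w \<in> y" "mpoly_eval G w \<noteq> 0"
      by (auto simp: cone_ideal_def)
    obtain a where a: "a \<noteq> 0" "x = pspan a" using x Zp by (auto elim: proj_space_cases)
    obtain b where b: "b \<noteq> 0" "y = pspan b" using y Zp by (auto elim: proj_space_cases)
    obtain s t where st: "v = s *s a" "w = t *s b" using x y a b by (auto simp: pspan_iff)
    obtain d H where H: "H \<in> homogeneous_polys d" "mpoly_eval H a \<noteq> 0"
      "\<And>u. mpoly_eval H u \<noteq> 0 \<Longrightarrow> \<exists>f. f \<noteq> 0 \<and> (\<forall>c. poly f c = mpoly_eval F (c *s u))"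
      using form_detecting_point[OF a(1)] x(3) st(1) by blast
    obtain e K where K: "K \<in> homogeneous_polys e" "mpoly_eval K b \<noteq> 0"
      "\<And>u. mpoly_eval K u \<noteq> 0 \<Longrightarrow> \<exists>f. f \<noteq> 0 \<and> (\<forall>c. poly f c = mpoly_eval G (c *s u))"
      using form_detecting_point[OF b(1)] y(3) st(2) by blast
    have "x \<in> basic_open H" "y \<in> basic_open K"
      using basic_open_pspan[OF H(1) a(1)] basic_open_pspan[OF K(1) b(1)] H(2) K(2) a b by auto
    then obtain z where z: "z \<in> Z" "z \<in> basic_open H" "z \<in> basic_open K"
      using irreducible_open_meet[OF irr H(1) K(1) x(1) _ y(1)] by blast
    obtain u where u: "u \<noteq> 0" "z = pspan u" using z(1) Zp by (auto elim: proj_space_cases)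
    then have "mpoly_eval H u \<noteq> 0" "mpoly_eval K u \<noteq> 0"
      using basic_open_pspan[OF H(1) u(1)] basic_open_pspan[OF K(1) u(1)] z by auto
    then obtain f g where f: "f \<noteq> 0" "\<forall>c. poly f c = mpoly_eval F (c *s u)"
      and g: "g \<noteq> 0" "\<forall>c. poly g c = mpoly_eval G (c *s u)" using H(3) K(3) by blast
    obtain c where "poly (f * g) c \<noteq> 0" using poly_nonzero_point[of "f * g"] f(1) g(1) by auto
    then have "mpoly_eval (F * G) (c *s u) \<noteq> 0" using f(2) g(2) by simp
    moreover have "c *s u \<in> z" using u by (auto simp: pspan_iff)
    ultimately show False using FG z(1) by (auto simp: cone_ideal_def)
  qed
qed (auto simp: cone_ideal_def)

lemma cone_ideal_strict:
  assumes "subvariety Z" "subvariety Z'" "Z \<subset> Z'"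
  shows "cone_ideal Z' \<subset> cone_ideal Z"
proof -
  obtain x where x: "x \<in> Z'" "x \<notin> Z" using assms(3) by blast
  then have xp: "x \<in> proj_space" using subvariety_subset[OF assms(2)] by blast
  obtain d F where F: "F \<in> vanishing_polys Z d" "\<not> vanishes_at F x"
    using closed_mem_iff[OF subvariety_closed[OF assms(1)] xp] x(2) by blast
  have "F \<in> cone_ideal Z" using F(1) by (auto simp: cone_ideal_def vanishing_polys_def vanishes_at_def)
  moreover have "F \<notin> cone_ideal Z'" using F(2) x by (auto simp: cone_ideal_def vanishes_at_def)
  moreover have "cone_ideal Z' \<subseteq> cone_ideal Z" using assms(3) by (auto simp: cone_ideal_def)
  ultimately show ?thesis by blast
qed

text \<open>A finite supremum of natural numbers is attained; otherwise all chain lengths would be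
  at most n - 1.\<close>

lemma variety_dim_chain:
  assumes X: "subvariety X" "variety_dim X = enat n"
  shows "\<exists>Z. (\<forall>i\<le>n. subvariety (Z i) \<and> Z i \<subseteq> X) \<and> (\<forall>i<n. Z i \<subset> Z (Suc i))"
proof (rule ccontr)
  assume no: "\<not> ?thesis"
  have n0: "n \<noteq> 0"
  proof
    assume "n = 0"
    then show False using no X(1) by (auto dest: spec[of _ "\<lambda>_. X"])
  qed
  let ?S = "{enat d | d. \<exists>Z. (\<forall>i\<le>d. subvariety (Z i) \<and> Z i \<subseteq> X) \<and> (\<forall>i<d. Z i \<subset> Z (Suc i))}"
  have S: "Sup ?S = enat n" using X(2) unfolding variety_dim_def .
  have "Sup ?S \<le> enat (n - 1)"
  proof (rule Sup_least)
    fix s assume s: "s \<in> ?S"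
    then obtain d where d: "s = enat d" "\<exists>Z. (\<forall>i\<le>d. subvariety (Z i) \<and> Z i \<subseteq> X) \<and> (\<forall>i<d. Z i \<subset> Z (Suc i))" by blast
    have "s \<le> enat n" using Sup_upper[OF s] S by simp
    moreover have "d \<noteq> n" using d(2) no by blast
    ultimately show "s \<le> enat (n - 1)" using d(1) by simp
  qed
  then show False using S n0 by simp
qed

text \<open>A chain of n + 1 subvarieties gives n + 1 primes of the cone, and the ideal of the
  origin lies strictly above all of them. These n + 1 strict inclusions produce n + 1 independent
  variables, one more than the dimension because of the passage to the cone.\<close>

lemma independent_variables_exist:
  fixes X :: "('k::field_char_0, 'n::finite) point set"
  assumes X: "subvariety X" "variety_dim X = enat n"
  shows "\<exists>J. card J = Suc n \<and> independent_mod (cone_ideal X) J"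
proof -
  obtain Z where Z: "\<And>i. i \<le> n \<Longrightarrow> subvariety (Z i) \<and> Z i \<subseteq> X" "\<And>i. i < n \<Longrightarrow> Z i \<subset> Z (Suc i)"
    using variety_dim_chain[OF X] by blast
  have step: "\<exists>J'. card J' = Suc (card J) \<and> independent_mod P J'"
    if "prime_set P" "prime_set P'" "P \<subset> P'" "independent_mod P' J" for P P' :: "('k, 'n) mpoly set" and J
    using independent_mod_insert[OF that] by (metis card_insert_disjoint finite)
  have "\<exists>J. card J = Suc i \<and> independent_mod (cone_ideal (Z i)) J" if "i \<le> n" for i
    using that
  proof (induction i)
    case 0
    define P0 :: "('k, 'n) mpoly set" where "P0 = {F. mpoly_eval F 0 = 0}"
    have P0: "prime_set P0" by unfold_locales (auto simp: P0_def)
    have "irreducible_space (subtopology zariski (Z 0))" using Z(1)[of 0] by (simp add: subvariety_def)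
    then obtain x where x: "x \<in> Z 0" by (auto simp: irreducible_space_def)
    have Zp: "Z 0 \<subseteq> proj_space" using Z(1)[of 0] subvariety_subset by blast
    obtain v where v: "v \<noteq> 0" "x = pspan v" using x Zp by (auto elim: proj_space_cases)
    obtain a where a: "dotp a v = 1" using separating_functional[of "{0}" v] v by (auto simp: vec.subspace_def)
    have vx: "v \<in> x" using v by (simp add: vec.span_base)
    have "mlin a \<in> P0" "mlin a \<notin> cone_ideal (Z 0)" using a x vx by (auto simp: P0_def cone_ideal_def intro!: bexI[of _ x] bexI[of _ v])
    moreover have "cone_ideal (Z 0) \<subseteq> P0" using x v vec.span_zero[of "{v}"] by (auto simp: P0_def cone_ideal_def)
    ultimately have "cone_ideal (Z 0) \<subset> P0" by blast
    moreover have "independent_mod P0 {}"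
      unfolding independent_mod_def P0_def by (auto dest!: poly_vars_empty)
    ultimately show ?case using step[OF prime_cone_ideal P0, of "Z 0" "{}"] Z(1)[of 0] by simp
  next
    case (Suc i)
    then obtain J where J: "card J = Suc i" "independent_mod (cone_ideal (Z i)) J" by auto
    show ?case
      using step[OF prime_cone_ideal prime_cone_ideal cone_ideal_strict J(2), of "Z (Suc i)"] Z Suc.prems J(1) by simp
  qed
  then obtain J where J: "card J = Suc n" "independent_mod (cone_ideal (Z n)) J" by blast
  have "cone_ideal X \<subseteq> cone_ideal (Z n)" using Z(1)[of n] by (auto simp: cone_ideal_def)
  then show ?thesis using J by (intro exI[of _ J]) (auto simp: independent_mod_def)
qed

subsection \<open>Ranks\<close>

text \<open>A single vector violating a new linear condition spans, together with the smaller
  kernel, the old kernel; so each condition costs at most one dimension.\<close>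

lemma dim_common_kernel:
  fixes a :: "'i \<Rightarrow> 'k::field ^ 'n::finite"
  assumes "finite I"
  shows "CARD('n) \<le> vec.dim {w. \<forall>i\<in>I. dotp (a i) w = 0} + card I"
  using assms
proof (induction I rule: finite_induct)
  case empty
  then show ?case by (simp add: vec.dim_UNIV card_cart_basis)
next
  case (insert i I)
  let ?W = "{w. \<forall>i\<in>I. dotp (a i) w = 0}" and ?W' = "{w. \<forall>i\<in>insert i I. dotp (a i) w = 0}"
  have "\<exists>u. ?W \<subseteq> vec.span (insert u ?W')"
  proof (cases "\<exists>u\<in>?W. dotp (a i) u \<noteq> 0")
    case True
    then obtain u where u: "u \<in> ?W" "dotp (a i) u \<noteq> 0" by blast
    have "w \<in> vec.span (insert u ?W')" if w: "w \<in> ?W" for w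
    proof -
      let ?c = "dotp (a i) w / dotp (a i) u"
      have "w - ?c *s u \<in> ?W'" using u w by auto
      then have "?c *s u + (w - ?c *s u) \<in> vec.span (insert u ?W')"
        by (intro vec.span_add vec.span_scale) (auto intro: vec.span_base)
      then show ?thesis by simp
    qed
    then show ?thesis by blast
  next
    case False
    then have "?W \<subseteq> insert 0 ?W'" by auto
    also have "\<dots> \<subseteq> vec.span (insert 0 ?W')" by (rule vec.span_superset)
    finally show ?thesis by blast
  qed
  then obtain u where "?W \<subseteq> vec.span (insert u ?W')" by blast
  then have "vec.dim ?W \<le> vec.dim (insert u ?W')" using vec.dim_subset[of ?W "vec.span (insert u ?W')"] by (simp only: vec.dim_span)
  also have "\<dots> \<le> Suc (vec.dim ?W')" by (simp add: vec.dim_insert)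
  finally show ?case using insert by simp
qed

lemma dim_zero_coordinates:
  "vec.dim {w :: 'k::field ^ 'n::finite. \<forall>i\<in>I. vec_nth w i = 0} + card I \<le> CARD('n)"
proof -
  have "w \<in> vec.span ((\<lambda>i. axis i 1) ` (- I))" if w: "\<forall>i\<in>I. vec_nth w i = 0" for w :: "'k ^ 'n"
  proof -
    have "w = (\<Sum>i\<in>UNIV. vec_nth w i *s axis i 1)" by (simp add: basis_expansion)
    also have "\<dots> = (\<Sum>i\<in>-I. vec_nth w i *s axis i 1)"
      using w by (intro sum.mono_neutral_right) auto
    also have "\<dots> \<in> vec.span ((\<lambda>i. axis i 1) ` (- I))"
      by (intro vec.span_sum vec.span_scale vec.span_base) auto
    finally show ?thesis .
  qed
  then have "vec.dim {w :: 'k ^ 'n. \<forall>i\<in>I. vec_nth w i = 0} \<le> card ((\<lambda>i. axis i 1 :: 'k ^ 'n) ` (- I))"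
    by (intro vec.dim_le_card) auto
  also have "\<dots> \<le> card (- I)" by (rule card_image_le) simp
  also have "\<dots> = CARD('n) - card I" by (simp add: Compl_eq_Diff_UNIV card_Diff_subset)
  finally show ?thesis using card_mono[of "UNIV :: 'n set" I] by simp
qed

definition gradient :: "('k::field, 'n::finite) mpoly \<Rightarrow> 'k ^ 'n \<Rightarrow> 'k ^ 'n" where
  "gradient F v = (\<chi> i. mpoly_eval (mpoly_pderiv i F) v)"

lemma dotp_gradient: "dotp (gradient F v) w = dform F v w"
  by (simp add: dotp_def gradient_def dform_def)

lemma mpoly_eval_of_int: "mpoly_eval (of_int i) v = of_int i"
  by (rule type_ring_hom.of_int[OF type_ring_hom_mpoly_eval])

lemma mpoly_eval_det:
  fixes M :: "('k::field, 'm::finite) mpoly ^ 'n::finite ^ 'n"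
  shows "mpoly_eval (det M) v = det (\<chi> i j. mpoly_eval (vec_nth (vec_nth M i) j) v)"
  by (simp add: det_def mpoly_eval_of_int)

text \<open>Semicontinuity with an explicit open set. Gradients at v0 forming a basis of their span
  are completed by constant vectors to a basis of k^n, and \<mu> is the determinant of the resulting
  matrix of polynomials. Where \<mu> is nonzero the chosen gradients remain independent.\<close>

lemma dim_tangent_upper_bound:
  fixes X :: "('k::field, 'n::finite) point set" and v0 :: "'k ^ 'n"
  defines "T \<equiv> \<lambda>v. {w. \<forall>d. \<forall>F\<in>vanishing_polys X d. dform F v w = 0}"
  shows "\<exists>I F \<mu>. (\<forall>i\<in>I. \<exists>d. F i \<in> vanishing_polys X d) \<and> mpoly_eval \<mu> v0 \<noteq> 0 \<and>
    (\<forall>v. mpoly_eval \<mu> v \<noteq> 0 \<longrightarrow> vec.dim {w. \<forall>i\<in>(I::'n set). dform (F i) v w = 0} \<le> vec.dim (T v0))"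
proof -
  define G where "G = {gradient F v0 | F. \<exists>d. F \<in> vanishing_polys X d}"
  obtain B where B: "B \<subseteq> G" "vec.independent B" "G \<subseteq> vec.span B" using vec.basis_exists by metis
  obtain C where C: "B \<subseteq> C" "vec.independent C" "UNIV \<subseteq> vec.span C"
    using vec.maximal_independent_subset_extend[of B UNIV] B(2) by (metis subset_UNIV)
  have "vec.dim (UNIV :: ('k ^ 'n) set) = card C" by (rule vec.dim_unique[of C]) (use C in auto)
  then have "card C = CARD('n)" by (simp add: vec.dim_UNIV card_cart_basis)
  moreover have "finite C" using C(2) by (rule vec.finiteI_independent)
  ultimately obtain f where f: "bij_betw f (UNIV :: 'n set) C" using finite_same_card_bij[of "UNIV :: 'n set" C] by auto
  define I where "I = {i. f i \<in> B}"
  have "\<exists>F d. F \<in> vanishing_polys X d \<and> f i = gradient F v0" if "i \<in> I" for i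
    using that subsetD[OF B(1), of "f i"] unfolding G_def I_def by blast
  then obtain F where F: "\<And>i. i \<in> I \<Longrightarrow> \<exists>d. F i \<in> vanishing_polys X d" "\<And>i. i \<in> I \<Longrightarrow> f i = gradient (F i) v0" by metis
  define row where "row i v = (if i \<in> I then gradient (F i) v else f i)" for i v
  define M :: "('k, 'n) mpoly ^ 'n ^ 'n" where
    "M = (\<chi> i j. if i \<in> I then mpoly_pderiv j (F i) else mconst (vec_nth (f i) j))"
  have ev: "mpoly_eval (det M) v = det (\<chi> i. row i v)" for v
    unfolding mpoly_eval_det by (rule arg_cong[of _ _ det]) (simp add: vec_eq_iff M_def row_def gradient_def)
  have v0: "mpoly_eval (det M) v0 \<noteq> 0"
  proof -
    have r: "row i v0 = f i" for i using F(2) by (simp add: row_def)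
    have "(\<chi> i. row i v0) = (\<chi> i. f i)" by (simp add: r)
    moreover have "rows (\<chi> i. f i) = range f" by (auto simp: rows_def Finite_Cartesian_Product.row_def vec_lambda_eta)
    ultimately have "rows (\<chi> i. row i v0) = C" using f by (simp add: bij_betw_def)
    then have "vec.span (rows (\<chi> i. row i v0)) = UNIV" using C(3) by auto
    then have "invertible (\<chi> i. row i v0)"
      unfolding invertible_left_inverse matrix_left_invertible_span_rows_gen .
    then show ?thesis unfolding ev by (simp add: invertible_det_nz)
  qed
  have "card I = card B"
  proof -
    have "f ` I = B" using f C(1) by (auto simp: I_def bij_betw_def)
    then show ?thesis using f by (metis bij_betw_def card_image inj_on_subset subset_UNIV)
  qed
  have TB: "{w. \<forall>i\<in>I. dotp (f i) w = 0} \<subseteq> T v0"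
  proof
    fix w assume w: "w \<in> {w. \<forall>i\<in>I. dotp (f i) w = 0}"
    have bw: "dotp b w = 0" if b: "b \<in> B" for b
    proof -
      have "b \<in> range f" using f b C(1) by (auto simp: bij_betw_def)
      then obtain i where "b = f i" by blast
      then show ?thesis using w b by (simp add: I_def)
    qed
    have "dotp g w = 0" if "g \<in> vec.span B" for g
      using that
    proof (induction rule: vec.span_induct_alt)
      case base then show ?case by (simp add: dotp_def)
    next
      case (step c x y)
      have "dotp (c *s x + y) w = c * dotp x w + dotp y w"
        by (simp add: dotp_def algebra_simps sum.distrib sum_distrib_left)
      then show ?case using bw step by simp
    qed
    then show "w \<in> T v0" unfolding T_def dotp_gradient[symmetric] using B(3) by (auto simp: G_def)
  qed
  have low: "CARD('n) \<le> vec.dim (T v0) + card I"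
    using dim_common_kernel[of I f] vec.dim_subset[OF TB] by simp
  have "vec.dim {w. \<forall>i\<in>I. dform (F i) v w = 0} \<le> vec.dim (T v0)" if "mpoly_eval (det M) v \<noteq> 0" for v
  proof -
    let ?N = "\<chi> i. row i v" let ?K = "{w. \<forall>i\<in>I. dform (F i) v w = 0}"
    have mv: "vec_nth (?N *v w) i = dotp (row i v) w" for w i
      by (simp add: matrix_vector_mult_def dotp_def)
    have z: "vec_nth (?N *v w) i = 0" if "w \<in> ?K" "i \<in> I" for w i
      using that unfolding mv by (simp add: row_def dotp_gradient)
    have "invertible ?N" using that unfolding ev by (simp add: invertible_det_nz)
    then obtain N' where N': "N' ** ?N = mat 1" by (auto simp: invertible_def)
    have "N' *v (?N *v w) = w" for w by (simp add: matrix_vector_mul_assoc N')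
    then have "w \<in> (*v) N' ` ((*v) ?N ` ?K)" if "w \<in> ?K" for w using that by (metis (no_types, lifting) image_eqI)
    then have "vec.dim ?K \<le> vec.dim ((*v) N' ` ((*v) ?N ` ?K))" by (intro vec.dim_subset) blast
    also have "\<dots> \<le> vec.dim ((*v) ?N ` ?K)" by (rule vec.dim_image_le[OF matrix_vector_mul_linear_gen])
    also have "\<dots> \<le> vec.dim {w :: 'k ^ 'n. \<forall>i\<in>I. vec_nth w i = 0}"
      using z by (intro vec.dim_subset) blast
    also have "\<dots> \<le> CARD('n) - card I" using dim_zero_coordinates[of I, where 'k = 'k] by simp
    finally show ?thesis using low by simp
  qed
  then show ?thesis using F(1) v0 by (intro exI[of _ I] exI[of _ F] exI[of _ "det M"]) auto
qed

lemma dform_mult: "dform (F * G) v w = mpoly_eval G v * dform F v w + mpoly_eval F v * dform G v w"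
  by (simp add: dform_def mpoly_pderiv_mult sum_distrib_left sum.distrib algebra_simps)

lemma dform_sum: "dform (\<Sum>i\<in>I. F i) v w = (\<Sum>i\<in>I. dform (F i) v w)"
proof (induction I rule: infinite_finite_induct)
  case (insert i I)
  have "dform (F i + G) v w = dform (F i) v w + dform G v w" for G
    by (simp add: dform_def distrib_right sum.distrib)
  then show ?case using insert by simp
qed (simp_all add: dform_def)

text \<open>Differentiating c_i F_i = \<Sum> a_ij Q_j on the cone shows that dF_i is a combination
  of the dQ_j where c_i is nonzero, and the number of the Q_j is n + 1 less than that of the
  coordinates. As the ideal is prime, some point of the cone has \<mu> and all c_i nonzero;
  semicontinuity carries the bound from there to v0, even if v0 is singular.\<close>

theorem dim_tangent_lower_bound:
  fixes X :: "('k::field_char_0, 'n::finite) point set"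
  assumes X: "subvariety X" "variety_dim X = enat n" and v0: "v0 \<noteq> 0" "pspan v0 \<in> X"
  shows "Suc n \<le> vec.dim {w. \<forall>d. \<forall>F\<in>vanishing_polys X d. dform F v0 w = 0}"
proof -
  let ?P = "cone_ideal X"
  interpret P: prime_set ?P by (rule prime_cone_ideal[OF X(1)])
  obtain J where J: "card J = Suc n" "independent_mod ?P J" using independent_variables_exist[OF X] by blast
  obtain Q where Q: "\<And>j. Q j \<in> ?P" "\<And>F. F \<in> ?P \<Longrightarrow> \<exists>c a. c \<notin> ?P \<and> c * F = (\<Sum>j\<in>-J. a j * Q j)"
    using local_generators[OF P.prime_set_axioms J(2)] by blast
  obtain I F \<mu> where F: "\<And>i. i \<in> I \<Longrightarrow> \<exists>d. F i \<in> vanishing_polys X d" and \<mu>: "mpoly_eval \<mu> v0 \<noteq> 0"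
    "\<And>v. mpoly_eval \<mu> v \<noteq> 0 \<Longrightarrow> vec.dim {w. \<forall>i\<in>(I::'n set). dform (F i) v w = 0} \<le>
       vec.dim {w. \<forall>d. \<forall>F\<in>vanishing_polys X d. dform F v0 w = 0}"
    using dim_tangent_upper_bound[of X v0] by blast
  have FP: "F i \<in> ?P" if "i \<in> I" for i
    using F[OF that] by (auto simp: cone_ideal_def vanishing_polys_def vanishes_at_def)
  then have "\<forall>i\<in>I. \<exists>c a. c \<notin> ?P \<and> c * F i = (\<Sum>j\<in>-J. a j * Q j)" using Q(2) by blast
  then obtain c a where c: "\<And>i. i \<in> I \<Longrightarrow> c i \<notin> ?P" "\<And>i. i \<in> I \<Longrightarrow> c i * F i = (\<Sum>j\<in>-J. a i j * Q j)" by metis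
  have "\<mu> \<notin> ?P" using \<mu>(1) v0 vec.span_base[of v0 "{v0}"] by (auto simp: cone_ideal_def)
  moreover have "(\<Prod>i\<in>I. c i) \<notin> ?P"
    using c(1) by (induction I rule: infinite_finite_induct) (auto simp: P.one dest: P.prime)
  ultimately have "\<mu> * (\<Prod>i\<in>I. c i) \<notin> ?P" by (rule P.not_mult)
  then obtain x v where v: "x \<in> X" "v \<in> x" "mpoly_eval (\<mu> * (\<Prod>i\<in>I. c i)) v \<noteq> 0" by (auto simp: cone_ideal_def)
  then have \<mu>v: "mpoly_eval \<mu> v \<noteq> 0" and cv: "\<And>i. i \<in> I \<Longrightarrow> mpoly_eval (c i) v \<noteq> 0" by auto
  have zero: "mpoly_eval G v = 0" if "G \<in> ?P" for G using that v by (auto simp: cone_ideal_def)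
  have "dform (F i) v w = 0" if i: "i \<in> I" and w: "\<forall>j\<in>-J. dform (Q j) v w = 0" for i w
  proof -
    have "dform (c i * F i) v w = (\<Sum>j\<in>-J. mpoly_eval (Q j) v * dform (a i j) v w + mpoly_eval (a i j) v * dform (Q j) v w)"
      unfolding c(2)[OF i] dform_sum dform_mult ..
    also have "\<dots> = 0" using w zero[OF Q(1)] by (intro sum.neutral) simp
    finally show ?thesis using cv[OF i] zero[OF FP[OF i]] by (simp add: dform_mult)
  qed
  then have sub: "{w. \<forall>j\<in>-J. dotp (gradient (Q j) v) w = 0} \<subseteq> {w. \<forall>i\<in>I. dform (F i) v w = 0}"
    by (auto simp: dotp_gradient)
  have "CARD('n) \<le> vec.dim {w. \<forall>j\<in>-J. dotp (gradient (Q j) v) w = 0} + card (- J)"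
    by (rule dim_common_kernel) simp
  moreover have "card (- J) + Suc n = CARD('n)"
    using J(1) card_mono[of UNIV J] by (simp add: Compl_eq_Diff_UNIV card_Diff_subset)
  ultimately show ?thesis using vec.dim_subset[OF sub] \<mu>(2)[OF \<mu>v] by linarith
qed

section \<open>Hilbert functions\<close>

lemma finite_exponents: "finite {m :: 'n::finite \<Rightarrow>\<^sub>0 nat. (\<Sum>i\<in>UNIV. Poly_Mapping.lookup m i) = d}"
proof (rule finite_imageD[of Poly_Mapping.lookup])
  have "Poly_Mapping.lookup m i \<le> d" if "(\<Sum>i\<in>UNIV. Poly_Mapping.lookup m i) = d" for m :: "'n \<Rightarrow>\<^sub>0 nat" and i
    using that member_le_sum[of i UNIV "Poly_Mapping.lookup m"] by simp
  then have "Poly_Mapping.lookup ` {m :: 'n \<Rightarrow>\<^sub>0 nat. (\<Sum>i\<in>UNIV. Poly_Mapping.lookup m i) = d} \<subseteq> (\<Pi>\<^sub>E i\<in>UNIV. {..d})"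
    by (intro image_subsetI PiE_I) auto
  then show "finite (Poly_Mapping.lookup ` {m :: 'n \<Rightarrow>\<^sub>0 nat. (\<Sum>i\<in>UNIV. Poly_Mapping.lookup m i) = d})"
    by (rule finite_subset) (intro finite_PiE, auto)
qed (simp add: inj_on_def lookup_inject)

lemma homogeneous_polys_finite_span:
  "\<exists>M. finite M \<and> (homogeneous_polys d :: ('k::field, 'n::finite) mpoly set) \<subseteq> mpoly.span M"
proof (intro exI conjI)
  let ?E = "{m :: 'n \<Rightarrow>\<^sub>0 nat. (\<Sum>i\<in>UNIV. Poly_Mapping.lookup m i) = d}"
  let ?M = "(\<lambda>m. Poly_Mapping.single m 1) ` ?E :: ('k, 'n) mpoly set"
  show "finite ?M" using finite_exponents by (rule finite_imageI)
  show "homogeneous_polys d \<subseteq> mpoly.span ?M"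
  proof
    fix F :: "('k, 'n) mpoly" assume F: "F \<in> homogeneous_polys d"
    have "(\<Sum>m\<in>Poly_Mapping.keys F. Poly_Mapping.single m (Poly_Mapping.lookup F m)) \<in> mpoly.span ?M"
    proof (rule mpoly.span_sum)
      fix m assume "m \<in> Poly_Mapping.keys F"
      then have "Poly_Mapping.single m 1 \<in> ?M" using F by (auto simp: homogeneous_polys_def)
      then have "mconst (Poly_Mapping.lookup F m) * Poly_Mapping.single m 1 \<in> mpoly.span ?M"
        by (intro mpoly.span_scale mpoly.span_base)
      then show "Poly_Mapping.single m (Poly_Mapping.lookup F m) \<in> mpoly.span ?M" by (simp add: mult_single)
    qed
    then show "F \<in> mpoly.span ?M" unfolding poly_mapping_sum_singles .
  qed
qed

lemma independent_homogeneous_finite: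
  fixes B :: "('k::field, 'n::finite) mpoly set"
  assumes "mpoly.independent B" "B \<subseteq> homogeneous_polys d"
  shows "finite B"
proof -
  obtain M :: "('k, 'n) mpoly set" where M: "finite M" "homogeneous_polys d \<subseteq> mpoly.span M" using homogeneous_polys_finite_span by blast
  show ?thesis using mpoly.independent_span_bound[OF M(1) assms(1)] assms(2) M(2) by auto
qed

lemma subspace_vanishing_polys: "mpoly.subspace (vanishing_polys X d)"
  by (auto simp: mpoly.subspace_def vanishing_polys_def vanishes_at_def intro: homogeneous_polys_add homogeneous_polys_cmult)

text \<open>Linear independence in the degree m part of the homogeneous coordinate ring, without
  forming the quotient.\<close>

definition independent_forms ::
    "('k::field, 'n::finite) point set \<Rightarrow> nat \<Rightarrow> nat \<Rightarrow> (nat \<Rightarrow> ('k, 'n) mpoly) \<Rightarrow> bool" where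
  "independent_forms X m h f \<longleftrightarrow> (\<forall>i<h. f i \<in> homogeneous_polys m) \<and>
     (\<forall>c. (\<Sum>i<h. mconst (c i) * f i) \<in> vanishing_polys X m \<longrightarrow> (\<forall>i<h. c i = 0))"

lemma hilbert_function_ge:
  fixes X :: "('k::field, 'n::finite) point set"
  assumes f: "independent_forms X m h f"
  shows "h \<le> hilbert_function X m"
proof -
  let ?V = "vanishing_polys X m" and ?H = "homogeneous_polys m :: ('k, 'n) mpoly set"
  obtain B where B: "B \<subseteq> ?V" "mpoly.independent B" "?V \<subseteq> mpoly.span B" "card B = mpoly.dim ?V"
    using mpoly.basis_exists by metis
  obtain D where D: "D \<subseteq> ?H" "mpoly.independent D" "?H \<subseteq> mpoly.span D" "card D = mpoly.dim ?H"
    using mpoly.basis_exists by metis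
  have VH: "?V \<subseteq> ?H" by (auto simp: vanishing_polys_def)
  have fin: "finite B" "finite D"
    using independent_homogeneous_finite[of B m] independent_homogeneous_finite[of D m] B D VH by auto
  have fH: "f i \<in> ?H" if "i < h" for i using f that by (simp add: independent_forms_def)
  have find: "c i = 0" if "(\<Sum>i<h. mconst (c i) * f i) \<in> ?V" "i < h" for c i
    using f that by (auto simp: independent_forms_def)
  have single: "(\<Sum>l<h. mconst (if l = i then x else 0) * f l) = mconst x * f i" if "i < h" for i x
  proof -
    have "(\<Sum>l<h. mconst (if l = i then x else 0) * f l) = (\<Sum>l<h. if l = i then mconst x * f l else 0)"
      by (rule sum.cong) auto
    then show ?thesis using that by simp
  qed
  have inj: "inj_on f {..<h}"
  proof (rule inj_onI)
    fix i j assume ij: "i \<in> {..<h}" "j \<in> {..<h}" "f i = f j"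
    show "i = j"
    proof (rule ccontr)
      assume "i \<noteq> j"
      have "(\<Sum>l<h. mconst ((if l = i then 1 else 0) + (if l = j then - 1 else 0)) * f l) =
          mconst 1 * f i + mconst (- 1) * f j"
        using ij single by (simp only: single_add distrib_right sum.distrib lessThan_iff)
      also have "\<dots> = 0" using ij(3) by (simp flip: distrib_right single_add)
      finally have "(\<Sum>l<h. mconst ((if l = i then 1 else 0) + (if l = j then - 1 else 0)) * f l) \<in> ?V"
        using mpoly.subspace_0[OF subspace_vanishing_polys] by simp
      from find[OF this, of i] show False using ij \<open>i \<noteq> j\<close> by simp
    qed
  qed
  let ?C = "f ` {..<h}"
  have disj: "B \<inter> ?C = {}"
  proof (rule ccontr)
    assume "\<not> ?thesis"
    then obtain i where i: "i < h" "f i \<in> ?V" using B(1) by auto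
    then have "(\<Sum>l<h. mconst (if l = i then 1 else 0) * f l) \<in> ?V" unfolding single[OF i(1)] by simp
    from find[OF this i(1)] show False by simp
  qed
  have "mpoly.independent (B \<union> ?C)"
  proof (rule mpoly.independent_if_scalars_zero)
    show "finite (B \<union> ?C)" using fin by simp
    fix u F assume u: "(\<Sum>F\<in>B \<union> ?C. mconst (u F) * F) = 0" and F: "F \<in> B \<union> ?C"
    have s: "(\<Sum>F\<in>B. mconst (u F) * F) + (\<Sum>i<h. mconst (u (f i)) * f i) = 0"
      using u fin disj inj by (simp add: sum.union_disjoint sum.reindex)
    have "(\<Sum>F\<in>B. mconst (u F) * F) \<in> ?V"
      using B(1) by (intro mpoly.subspace_sum subspace_vanishing_polys mpoly.subspace_scale) auto
    then have "mconst (- 1) * (\<Sum>F\<in>B. mconst (u F) * F) \<in> ?V"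
      by (intro mpoly.subspace_scale subspace_vanishing_polys)
    moreover have "mconst (- 1) * (\<Sum>F\<in>B. mconst (u F) * F) = (\<Sum>i<h. mconst (u (f i)) * f i)"
      using minus_unique[OF s] by (simp add: single_uminus)
    ultimately have c0: "u (f i) = 0" if "i < h" for i using find[of "\<lambda>i. u (f i)"] that by simp
    then have "(\<Sum>F\<in>B. mconst (u F) * F) = 0" using s by simp
    then have "u b = 0" if "b \<in> B" for b
      using B(2) that mpoly.independentD[OF B(2) fin(1) subset_refl, of u b] by simp
    then show "u F = 0" using c0 F by auto
  qed
  moreover have "B \<union> ?C \<subseteq> mpoly.span D" using B(1) VH D(3) fH by auto
  ultimately have "card (B \<union> ?C) \<le> card D" using mpoly.independent_span_bound fin by blast
  moreover have "card (B \<union> ?C) = card B + h" using fin disj inj by (simp add: card_Un_disjoint card_image)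
  ultimately show ?thesis unfolding hilbert_function_def using B(4) D(4) by simp
qed

lemma independent_forms_exist:
  fixes X :: "('k::field, 'n::finite) point set"
  shows "\<exists>f. independent_forms X m (hilbert_function X m) f"
proof -
  let ?V = "vanishing_polys X m" and ?H = "homogeneous_polys m :: ('k, 'n) mpoly set"
  have VH: "?V \<subseteq> ?H" by (auto simp: vanishing_polys_def)
  obtain B where B: "B \<subseteq> ?V" "mpoly.independent B" "?V \<subseteq> mpoly.span B" "card B = mpoly.dim ?V"
    using mpoly.basis_exists by metis
  obtain D where D: "B \<subseteq> D" "D \<subseteq> ?H" "mpoly.independent D" "?H \<subseteq> mpoly.span D"
    using mpoly.maximal_independent_subset_extend[of B ?H] B(1,2) VH by (metis subset_trans)
  have fin: "finite D" using independent_homogeneous_finite D by blast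
  have "card D = mpoly.dim ?H" using mpoly.basis_card_eq_dim[OF D(2,4,3)] .
  then have "card (D - B) = hilbert_function X m"
    unfolding hilbert_function_def using B(4) D(1) fin by (simp add: card_Diff_subset finite_subset)
  then obtain f where f: "bij_betw f {..<hilbert_function X m} (D - B)"
    using fin ex_bij_betw_nat_finite[of "D - B"] by (auto simp: atLeast0LessThan)
  have "c i = 0" if c: "(\<Sum>i<hilbert_function X m. mconst (c i) * f i) \<in> ?V" and i: "i < hilbert_function X m" for c i
  proof -
    define g where "g = inv_into {..<hilbert_function X m} f"
    have gf: "g (f i) = i" if "i < hilbert_function X m" for i
      using f that by (simp add: g_def bij_betw_def inv_into_f_f)
    have eq: "(\<Sum>i<hilbert_function X m. mconst (c i) * f i) = (\<Sum>F\<in>D - B. mconst (c (g F)) * F)"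
      using sum.reindex_bij_betw[OF f, of "\<lambda>F. mconst (c (g F)) * F"] by (simp add: gf)
    have "finite B" using fin D(1) by (rule rev_finite_subset)
    have "(\<Sum>F\<in>D - B. mconst (c (g F)) * F) \<in> mpoly.span B" using c eq B(3) by auto
    then obtain u where u: "(\<Sum>F\<in>D - B. mconst (c (g F)) * F) = (\<Sum>b\<in>B. mconst (u b) * b)"
      unfolding mpoly.span_finite[OF \<open>finite B\<close>] by auto
    have "(\<Sum>F\<in>D. mconst (if F \<in> B then - u F else c (g F)) * F) =
        (\<Sum>F\<in>D - B. mconst (c (g F)) * F) + (\<Sum>F\<in>B. mconst (- u F) * F)"
      unfolding sum.subset_diff[OF D(1) fin] by (intro arg_cong2[where f = "(+)"] sum.cong) auto
    also have "\<dots> = 0" unfolding u by (simp add: single_uminus sum_negf)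
    finally have z: "(\<Sum>F\<in>D. mconst (if F \<in> B then - u F else c (g F)) * F) = 0" .
    have fi: "f i \<in> D - B" using f i by (auto simp: bij_betw_def)
    then have "(if f i \<in> B then - u (f i) else c (g (f i))) = 0"
      using mpoly.independentD[OF D(3) fin subset_refl z] by blast
    then show ?thesis using fi gf[OF i] by simp
  qed
  then show ?thesis using f D(2) unfolding independent_forms_def bij_betw_def by (intro exI[of _ f]) blast
qed

subsection \<open>Growth\<close>

text \<open>A linear form that vanishes at two points of \<open>L\<close> but not on \<open>L\<close> embeds each graded piece of
  the coordinate ring into the next one with cokernel of dimension at least two.\<close>

lemma hilbert_function_growth:
  fixes L :: "('k::field_char_0, 'n::finite) point set"
  assumes L: "subvariety L" and vw: "vec.independent {v, w}" "v \<noteq> w" "pspan v \<in> L" "pspan w \<in> L"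
    and a: "dotp a v = 0" "dotp a w = 0" and u: "x \<in> L" "u \<in> x" "dotp a u \<noteq> 0"
  shows "hilbert_function L m + 2 \<le> hilbert_function L (Suc m)"
proof -
  interpret P: prime_set "cone_ideal L" by (rule prime_cone_ideal[OF L])
  define h where "h = hilbert_function L m"
  obtain f where f: "\<And>i. i < h \<Longrightarrow> f i \<in> homogeneous_polys m"
    "\<And>c i. (\<Sum>i<h. mconst (c i) * f i) \<in> vanishing_polys L m \<Longrightarrow> i < h \<Longrightarrow> c i = 0"
    using independent_forms_exist[of L m] unfolding independent_forms_def h_def[symmetric] by blast
  obtain b where b: "dotp b v = 1" "dotp b w = 0"
    using functional_exists[OF vw(1), of "\<lambda>z. if z = v then 1 else 0"] vw(2) by auto
  obtain b' where b': "dotp b' w = 1" "dotp b' v = 0"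
    using functional_exists[OF vw(1), of "\<lambda>z. if z = w then 1 else 0"] vw(2) by auto
  \<comment> \<open>The multiples of \<open>a\<close> vanish at v and w, while the two powers take
    the values 1, 0 at v and 0, 1 at w. Evaluating there isolates the two new coefficients.\<close>
  define g where "g i = (if i < h then mlin a * f i else if i = h then mlin b ^ Suc m else mlin b' ^ Suc m)" for i
  have pow: "mlin b ^ k \<in> homogeneous_polys k" for b :: "'k ^ 'n" and k
  proof (induction k)
    case (Suc k)
    then show ?case using homogeneous_polys_mult[OF homogeneous_polys_mlin[of b] Suc] by simp
  qed (simp add: homogeneous_polys_one)
  have pw: "mpoly_eval (F ^ k) z = mpoly_eval F z ^ k" for F :: "('k, 'n) mpoly" and k z
    by (induction k) auto
  have sp: "v \<in> pspan v" "w \<in> pspan w" by (simp_all add: vec.span_base)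
  have "independent_forms L (Suc m) (h + 2) g"
    unfolding independent_forms_def
  proof (intro conjI allI impI)
    show "g i \<in> homogeneous_polys (Suc m)" for i
      using homogeneous_polys_mult[OF homogeneous_polys_mlin f(1), of i a] pow[of _ "Suc m"] by (auto simp: g_def)
    fix c i assume c: "(\<Sum>i<h + 2. mconst (c i) * g i) \<in> vanishing_polys L (Suc m)" and i: "i < h + 2"
    define F where "F = (\<Sum>i<h. mconst (c i) * f i)"
    have "(\<Sum>i<h. mconst (c i) * g i) = mlin a * F"
      unfolding F_def sum_distrib_left by (rule sum.cong) (auto simp: g_def mult.left_commute)
    then have eq: "(\<Sum>i<h + 2. mconst (c i) * g i) = mlin a * F + mconst (c h) * mlin b ^ Suc m + mconst (c (Suc h)) * mlin b' ^ Suc m"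
      by (simp add: g_def)
    have van: "mpoly_eval (\<Sum>i<h + 2. mconst (c i) * g i) z = 0" if "z \<in> y" "y \<in> L" for y z
      using c that by (auto simp: vanishing_polys_def vanishes_at_def)
    have c0: "c h = 0" "c (Suc h) = 0"
      using van[OF sp(1) vw(3)] van[OF sp(2) vw(4)] a b b' unfolding eq by (simp_all add: pw del: power_Suc)
    \<comment> \<open>The ideal of L is prime and does not contain the linear form, which can
      therefore be cancelled.\<close>
    have "mlin a * F \<in> cone_ideal L" using van unfolding eq c0 cone_ideal_def by auto
    moreover have "mlin a \<notin> cone_ideal L" using u by (auto simp: cone_ideal_def)
    ultimately have "F \<in> cone_ideal L" using P.prime by blast
    moreover have "F \<in> homogeneous_polys m" unfolding F_def using f(1)
      by (intro homogeneous_polys_sum homogeneous_polys_cmult) auto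
    ultimately have "F \<in> vanishing_polys L m" by (auto simp: vanishing_polys_def cone_ideal_def vanishes_at_def)
    then have "c i = 0" if "i < h" for i using f(2) that unfolding F_def by blast
    moreover have "i < h \<or> i = h \<or> i = Suc h" using i by auto
    ultimately show "c i = 0" using c0 by blast
  qed
  then show ?thesis using hilbert_function_ge unfolding h_def by blast
qed

lemma polynomials_dependent:
  fixes f :: "nat \<Rightarrow> 'k::field poly"
  assumes deg: "\<And>i. i < h \<Longrightarrow> degree (f i) \<le> D" and h: "D + 1 < h"
  shows "\<exists>c. (\<exists>i<h. c i \<noteq> 0) \<and> (\<Sum>i<h. smult (c i) (f i)) = 0"
proof (rule ccontr)
  assume no: "\<not> ?thesis"
  interpret pv: vector_space "smult :: 'k \<Rightarrow> 'k poly \<Rightarrow> 'k poly"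
    by unfold_locales (simp_all add: smult_add_right smult_add_left)
  have z: "c i = 0" if "(\<Sum>i<h. smult (c i) (f i)) = 0" "i < h" for c i using no that by blast
  have inj: "inj_on f {..<h}"
  proof (rule inj_onI)
    fix i j assume ij: "i \<in> {..<h}" "j \<in> {..<h}" "f i = f j"
    show "i = j"
    proof (rule ccontr)
      assume "i \<noteq> j"
      have "(\<Sum>l<h. smult ((if l = i then 1 else 0) + (if l = j then - 1 else 0)) (f l)) =
          (\<Sum>l<h. if l = i then f l else 0) + (\<Sum>l<h. if l = j then - f l else 0)"
        unfolding sum.distrib[symmetric] by (rule sum.cong) auto
      also have "\<dots> = 0" using ij by simp
      finally have "(if i = i then 1 else 0) + (if i = j then - 1 else (0::'k)) = 0" using ij by (intro z) auto
      then show False using \<open>i \<noteq> j\<close> by simp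
    qed
  qed
  have "pv.independent (f ` {..<h})"
  proof (rule pv.independent_if_scalars_zero)
    fix u p assume u: "(\<Sum>p\<in>f ` {..<h}. smult (u p) p) = 0" and p: "p \<in> f ` {..<h}"
    have "(\<Sum>i<h. smult (u (f i)) (f i)) = 0" using u inj by (simp add: sum.reindex)
    then show "u p = 0" using z[of "\<lambda>i. u (f i)"] p by auto
  qed simp
  moreover have "f ` {..<h} \<subseteq> pv.span ((\<lambda>j. monom 1 j) ` {..D})"
  proof (rule image_subsetI)
    fix i assume "i \<in> {..<h}"
    then have "f i = (\<Sum>j\<le>D. smult (coeff (f i) j) (monom 1 j))"
      using poly_as_sum_of_monoms'[OF deg, of i] by (simp add: smult_monom)
    also have "\<dots> \<in> pv.span ((\<lambda>j. monom 1 j) ` {..D})"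
      by (intro pv.span_sum pv.span_scale pv.span_base) auto
    finally show "f i \<in> pv.span ((\<lambda>j. monom 1 j) ` {..D})" .
  qed
  ultimately have "card (f ` {..<h}) \<le> card ((\<lambda>j. monom (1::'k) j) ` {..D})"
    using pv.independent_span_bound[of "(\<lambda>j. monom 1 j) ` {..D}"] by blast
  also have "\<dots> \<le> D + 1" using card_image_le[of "{..D}" "\<lambda>j. monom (1::'k) j"] by simp
  finally show False using h inj by (simp add: card_image)
qed

text \<open>Substituting the parametrization maps forms of degree m to polynomials of degree at most
  e m, a space of dimension e m + 1, and only forms vanishing on L are lost.\<close>

lemma hilbert_function_parametrized_le:
  fixes L :: "('k::field, 'n::finite) point set" and g :: "'n \<Rightarrow> 'k poly"
  assumes deg: "\<And>j. degree (g j) \<le> e"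
    and par: "\<And>m F. F \<in> homogeneous_polys m \<Longrightarrow> mev (\<lambda>c. [:c:]) g F = 0 \<Longrightarrow> F \<in> vanishing_polys L m"
  shows "hilbert_function L m \<le> e * m + 1"
proof (rule ccontr)
  assume h: "\<not> ?thesis"
  define h where "h = hilbert_function L m"
  note hom = coeff_hom.intro[OF type_ring_hom_pconst]
  let ?\<rho> = "mev (\<lambda>c. [:c:]) g"
  obtain f where f: "\<And>i. i < h \<Longrightarrow> f i \<in> homogeneous_polys m"
    "\<And>c i. (\<Sum>i<h. mconst (c i) * f i) \<in> vanishing_polys L m \<Longrightarrow> i < h \<Longrightarrow> c i = 0"
    using independent_forms_exist[of L m] unfolding independent_forms_def h_def[symmetric] by blast
  have "degree (?\<rho> F) \<le> e * m" if F: "F \<in> homogeneous_polys m" for F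
    unfolding mev_def
  proof (rule degree_sum_le)
    fix k assume k: "k \<in> Poly_Mapping.keys F"
    have "degree (\<Prod>i\<in>UNIV. g i ^ Poly_Mapping.lookup k i) \<le> (\<Sum>i\<in>UNIV. degree (g i ^ Poly_Mapping.lookup k i))"
      using degree_prod_sum_le[of UNIV "\<lambda>i. g i ^ Poly_Mapping.lookup k i"] by (simp add: o_def)
    also have "\<dots> \<le> (\<Sum>i\<in>UNIV. e * Poly_Mapping.lookup k i)"
      using deg by (intro sum_mono order_trans[OF degree_power_le] mult_right_mono) auto
    also have "\<dots> = e * m" using F k by (simp add: homogeneous_polys_def sum_distrib_left[symmetric])
    finally show "degree ([:Poly_Mapping.lookup F k:] * (\<Prod>i\<in>UNIV. g i ^ Poly_Mapping.lookup k i)) \<le> e * m"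
      using degree_smult_le order_trans by fastforce
  qed simp
  then obtain c where c: "\<exists>i<h. c i \<noteq> 0" "(\<Sum>i<h. smult (c i) (?\<rho> (f i))) = 0"
    using polynomials_dependent[of h "\<lambda>i. ?\<rho> (f i)" "e * m"] f(1) h unfolding h_def by force
  have "?\<rho> (\<Sum>i<h. mconst (c i) * f i) = (\<Sum>i<h. smult (c i) (?\<rho> (f i)))"
    by (simp add: type_ring_hom.sum[OF coeff_hom.type_ring_hom_mev[OF hom]] coeff_hom.mev_mult[OF hom] coeff_hom.mev_mconst[OF hom])
  then have "?\<rho> (\<Sum>i<h. mconst (c i) * f i) = 0" using c(2) by simp
  moreover have "(\<Sum>i<h. mconst (c i) * f i) \<in> homogeneous_polys m"
    using f(1) by (intro homogeneous_polys_sum homogeneous_polys_cmult) auto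
  ultimately have "(\<Sum>i<h. mconst (c i) * f i) \<in> vanishing_polys L m" by (intro par)
  then show False using f(2) c(1) by blast
qed

subsection \<open>Hilbert polynomials of linear growth\<close>

lemma rat_poly_denominator: "\<exists>N>0. \<forall>m::nat. of_nat N * poly (p :: rat poly) (of_nat m) \<in> \<int>"
proof (induction p)
  case 0
  show ?case by (intro exI[of _ 1]) simp
next
  case (pCons a p)
  obtain N :: nat where N: "N > 0" "\<And>m::nat. of_nat N * poly p (of_nat m) \<in> \<int>" using pCons by blast
  obtain x y where xy: "quotient_of a = (x, y)" by force
  then have y: "y > 0" "a = of_int x / of_int y" using quotient_of_denom_pos quotient_of_div by blast+
  have "of_nat (N * nat y) * poly (pCons a p) (of_nat m) \<in> \<int>" for m
  proof -
    have "of_nat (N * nat y) * poly (pCons a p) (of_nat m) =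
        of_nat N * of_int x + of_int y * of_nat m * (of_nat N * poly p (of_nat m))"
      using y by (simp add: field_simps)
    also have "\<dots> \<in> \<int>" by (intro Ints_add Ints_mult[OF _ N(2)]) (simp_all add: Ints_mult)
    finally show ?thesis .
  qed
  then show ?case using N(1) y(1) by (intro exI[of _ "N * nat y"]) simp
qed

text \<open>\<open>has_degree\<close> prescribes only the coefficient in the degree of the
  dimension, so higher coefficients are excluded by growth. In p = a + b x + x^2 s the values of s
  at natural numbers have bounded denominators and tend to 0, hence vanish from some point on, and s
  = 0.\<close>

lemma linear_growth_poly:
  fixes p :: "rat poly" and h :: "nat \<Rightarrow> nat"
  assumes ev: "\<forall>\<^sub>F m in sequentially. poly p (of_nat m) = of_nat (h m)" and h: "\<And>m. h m \<le> e * m + 1"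
  shows "\<exists>c. p = [:c, coeff p 1:]"
proof -
  obtain a p1 where p: "p = pCons a p1" by (cases p)
  obtain b s where p1: "p1 = pCons b s" by (cases p1)
  obtain N where N: "N > 0" "\<And>m::nat. of_nat N * poly s (of_nat m) \<in> \<int>" using rat_poly_denominator by blast
  obtain m0 where m0: "\<And>m. m \<ge> m0 \<Longrightarrow> poly p (of_nat m) = of_nat (h m)" using ev by (auto simp: eventually_sequentially)
  define K where "K = of_nat e + 1 + \<bar>a\<bar> + \<bar>b\<bar>"
  obtain M :: nat where M: "of_nat N * K < of_nat M" using reals_Archimedean2 by blast
  have "poly s (of_nat m) = 0" if m: "m \<ge> m0" "m \<ge> M" "m \<ge> 1" for m
  proof -
    have r: "of_nat m * of_nat m * poly s (of_nat m) = of_nat (h m) - a - b * of_nat m"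
      using m0[OF m(1)] unfolding p p1 by (simp add: algebra_simps)
    have m1: "(1 :: rat) \<le> of_nat m" using m(3) by simp
    have "of_nat (h m) \<le> (of_nat (e * m + 1) :: rat)" using h[of m] of_nat_le_iff by blast
    then have "of_nat (h m) \<le> (of_nat e * of_nat m + of_nat m :: rat)" using m1 by simp
    moreover have "\<bar>a\<bar> \<le> \<bar>a\<bar> * of_nat m" using m1 mult_left_mono[OF m1, of "\<bar>a\<bar>"] by simp
    moreover have "\<bar>b * of_nat m\<bar> = \<bar>b\<bar> * of_nat m" by (simp add: abs_mult)
    moreover have "(0::rat) \<le> of_nat (h m)" by simp
    ultimately have "\<bar>of_nat (h m) - a - b * of_nat m\<bar> \<le> K * of_nat m"
      unfolding K_def distrib_right by linarith
    then have "of_nat m * (of_nat m * \<bar>poly s (of_nat m)\<bar>) \<le> of_nat m * K"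
      unfolding r[symmetric] by (simp add: abs_mult mult_ac)
    then have le: "of_nat m * \<bar>poly s (of_nat m)\<bar> \<le> K" using m1 by (simp add: mult_le_cancel_left)
    have "of_nat m * \<bar>of_nat N * poly s (of_nat m)\<bar> = of_nat N * (of_nat m * \<bar>poly s (of_nat m)\<bar>)"
      by (simp add: abs_mult)
    also have "\<dots> \<le> of_nat N * K" using le by (intro mult_left_mono) auto
    also have "\<dots> < of_nat M" by (rule M)
    also have "\<dots> \<le> of_nat m" using m(2) by simp
    finally have "\<bar>of_nat N * poly s (of_nat m)\<bar> < 1" using m1 by (simp add: mult_less_cancel_left2)
    then have "of_nat N * poly s (of_nat m) = 0" using N(2)[of m] by (metis Ints_nonzero_abs_ge1 not_le)
    then show ?thesis using N(1) by simp
  qed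
  then have "of_nat ` {max m0 (max M 1)..} \<subseteq> {x. poly s x = 0}" by auto
  moreover have "infinite ((of_nat :: nat \<Rightarrow> rat) ` {max m0 (max M 1)..})"
    by (subst finite_image_iff) (auto simp: inj_on_def infinite_Ici)
  ultimately have "s = 0" using poly_roots_finite finite_subset by blast
  then show ?thesis unfolding p p1 by (intro exI[of _ a]) simp
qed

section \<open>Lines\<close>

lemma openin_zariski_proj_space:
  fixes U :: "('k::field, 'n::finite) point set"
  shows "openin (subtopology zariski proj_space) U \<longleftrightarrow> openin zariski U"
  using subtopology_topspace[of "zariski :: ('k, 'n) point topology"] by (simp add: topspace_zariski)

lemma projective_line_affine_chart:
  fixes v0 :: "'k::field ^ 2"
  assumes "v0 \<noteq> 0"
  shows "\<exists>w0 b. dotp b v0 = 1 \<and> dotp b w0 = 0 \<and> (\<forall>u. dotp b u \<noteq> 0 \<longrightarrow> (\<exists>t s. s \<noteq> 0 \<and> u = s *s (v0 + t *s w0)))"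
proof -
  have "vec.independent {v0}" using assms by (simp add: vec.independent_insert)
  then obtain C where C: "{v0} \<subseteq> C" "vec.independent C" "UNIV \<subseteq> vec.span C"
    using vec.maximal_independent_subset_extend[of "{v0}" UNIV] by (metis subset_UNIV)
  have "vec.dim (UNIV :: ('k ^ 2) set) = card C" by (rule vec.dim_unique[of C]) (use C in auto)
  then have "card C = 2" by (simp add: vec.dim_UNIV card_cart_basis)
  then obtain w0 where w0: "C = {v0, w0}" "v0 \<noteq> w0" using C(1) by (auto simp: card_2_iff)
  obtain b where b: "dotp b v0 = 1" "dotp b w0 = 0"
    using functional_exists[OF C(2), of "\<lambda>z. if z = v0 then 1 else 0"] w0 by auto
  have "\<exists>t s. s \<noteq> 0 \<and> u = s *s (v0 + t *s w0)" if u: "dotp b u \<noteq> 0" for u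
  proof -
    have "u \<in> vec.span {v0, w0}" using C(3) w0 by auto
    then obtain s where "u - s *s v0 \<in> vec.span {w0}" using vec.span_breakdown_eq[of u v0 "{w0}"] by auto
    then obtain t where "u - s *s v0 = t *s w0" by (auto simp: vec.span_singleton)
    then have ust: "u = s *s v0 + t *s w0" by (simp add: algebra_simps)
    then have "s \<noteq> 0" using u b by auto
    then have "u = s *s (v0 + (t / s) *s w0)" by (simp add: ust vec.scale_right_distrib vector_smult_assoc)
    then show ?thesis using \<open>s \<noteq> 0\<close> by blast
  qed
  then show ?thesis using b by blast
qed

text \<open>The affine coordinates x_j / x_i, pulled back along the inverse map, are locally
  quotients of forms; on a chart v0 + t w0 they become quotients of polynomials in t, and clearing
  denominators gives g. The points so parametrized are dense in L, so a form killed by the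
  substitution vanishes on L.\<close>

lemma birational_parametrization:
  fixes L :: "('k::field_char_0, 'n::finite) point set"
  assumes L: "subvariety L" and bir: "birational L (proj_space :: ('k, 2) point set)"
  shows "\<exists>g :: 'n \<Rightarrow> 'k poly. \<forall>m. \<forall>F\<in>homogeneous_polys m. mev (\<lambda>c. [:c:]) g F = 0 \<longrightarrow> F \<in> vanishing_polys L m"
proof -
  have Lp: "L \<subseteq> proj_space" by (rule subvariety_subset[OF L])
  have irr: "irreducible_space (subtopology zariski L)" using L by (simp add: subvariety_def)
  obtain U W \<phi> \<psi> where U: "openin (subtopology zariski L) U" "U \<noteq> {}"
    and W0: "openin (subtopology zariski (proj_space :: ('k, 2) point set)) W"
    and \<phi>: "morphism_on U W \<phi>" and \<psi>: "morphism_on W U \<psi>" and inv: "\<And>x. x \<in> U \<Longrightarrow> \<psi> (\<phi> x) = x"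
    using bir unfolding birational_def by (elim exE conjE) blast
  have W: "openin zariski W" using W0 openin_zariski_proj_space by blast
  have Wp: "W \<subseteq> proj_space" using openin_subset[OF W] by (simp add: topspace_zariski)
  have UL: "U \<subseteq> L" using openin_subset[OF U(1)] by auto
  have \<phi>W: "\<phi> x \<in> W" if "x \<in> U" for x
  proof -
    have "x \<in> topspace (subtopology zariski U)" using that UL Lp by (auto simp: topspace_zariski)
    moreover have "continuous_map (subtopology zariski U) (subtopology zariski W) \<phi>" using \<phi> by (simp add: morphism_on_def)
    ultimately show ?thesis by (auto simp: continuous_map_def)
  qed
  have \<psi>c: "continuous_map (subtopology zariski W) (subtopology zariski U) \<psi>" using \<psi> by (simp add: morphism_on_def)
  have preim: "openin zariski {y \<in> W. \<psi> y \<in> V}" if "openin (subtopology zariski U) V" for V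
  proof -
    have "topspace (subtopology zariski W) = W" using Wp by (auto simp: topspace_zariski)
    then have "openin (subtopology zariski W) {y \<in> W. \<psi> y \<in> V}"
      using \<psi>c that unfolding continuous_map_def by auto
    then show ?thesis using W by (rule openin_trans_full)
  qed
  obtain x0 where x0: "x0 \<in> U" using U(2) by blast
  have "x0 \<in> proj_space" using x0 UL Lp by blast
  then obtain a where a: "a \<noteq> 0" "x0 = pspan a" by (rule proj_space_cases)
  obtain i where i: "vec_nth a i \<noteq> 0" using a(1) by (auto simp: vec_eq_iff)
  \<comment> \<open>Where the i-th coordinate is nonzero, the ratios x_j / x_i are regular and
    determine the point.\<close>
  define V where "V = U \<inter> basic_open (mvar i)"
  have Vo: "openin (subtopology zariski U) V" unfolding V_def
    using openin_basic_open[OF homogeneous_polys_mvar] by (auto simp: openin_subtopology)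
  have Vi: "vec_nth u i \<noteq> 0" if "x \<in> V" "u \<in> x - {0}" for x u
    using basic_open_iff[OF homogeneous_polys_mvar, of x u i] that UL Lp by (auto simp: V_def)
  have x0V: "x0 \<in> V" using x0 i a basic_open_pspan[OF homogeneous_polys_mvar a(1), of i] by (simp add: V_def)
  define f where "f j x = (let u = SOME u. u \<in> x - {0} in vec_nth u j / vec_nth u i)" for j and x :: "('k, 'n) point"
  have f: "f j x = vec_nth u j / vec_nth u i" if x: "x \<in> V" and u: "u \<in> x - {0}" for j x u
  proof -
    define u' where "u' = (SOME u. u \<in> x - {0})"
    have u': "u' \<in> x - {0}" unfolding u'_def by (rule someI[of _ u]) (rule u)
    have "x = pspan u" using proj_point_eq_pspan[of x u] x u UL Lp by (auto simp: V_def)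
    then obtain c where c: "u' = c *s u" using u' by (auto simp: pspan_iff)
    then have "c \<noteq> 0" using u' by auto
    then show ?thesis unfolding f_def Let_def u'_def[symmetric] c by simp
  qed
  have reg: "regular_on V (f j)" for j
    unfolding regular_on_def
  proof
    fix x assume x: "x \<in> V"
    have "openin (subtopology zariski V) V" unfolding openin_subtopology_refl topspace_zariski V_def using UL Lp by blast
    moreover have "\<forall>y\<in>V. \<forall>v\<in>y - {0}. mpoly_eval (mvar i) v \<noteq> 0 \<and> f j y = mpoly_eval (mvar j) v / mpoly_eval (mvar i) v"
      using Vi f by simp
    ultimately show "\<exists>W d. \<exists>G\<in>homogeneous_polys d. \<exists>H\<in>homogeneous_polys d. openin (subtopology zariski V) W \<and> x \<in> W \<and>
        (\<forall>y\<in>W. \<forall>v\<in>y - {0}. mpoly_eval H v \<noteq> 0 \<and> f j y = mpoly_eval G v / mpoly_eval H v)"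
      using x by (intro exI[of _ V] exI[of _ 1] bexI[of _ "mvar j"] bexI[of _ "mvar i"] conjI homogeneous_polys_mvar)
  qed
  define V' where "V' = {y \<in> W. \<psi> y \<in> V}"
  have V'o: "openin zariski V'" unfolding V'_def by (rule preim[OF Vo])
  have reg': "regular_on V' (f j \<circ> \<psi>)" for j
    using \<psi> Vo reg unfolding morphism_on_def V'_def by blast
  define y0 where "y0 = \<phi> x0"
  have y0: "y0 \<in> V'" using \<phi>W[OF x0] inv[OF x0] x0V by (simp add: V'_def y0_def)
  obtain v0 where v0: "v0 \<noteq> 0" "y0 = pspan v0" using y0 Wp by (auto simp: V'_def elim: proj_space_cases)
  obtain w0 b where wb: "dotp b v0 = 1" "dotp b w0 = 0"
    "\<And>u. dotp b u \<noteq> 0 \<Longrightarrow> \<exists>t s. s \<noteq> 0 \<and> u = s *s (v0 + t *s w0)"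
    using projective_line_affine_chart[OF v0(1)] by blast
  have "\<exists>O' G H. openin zariski O' \<and> y0 \<in> O' \<and> O' \<subseteq> V' \<and>
      (\<forall>y\<in>O'. \<forall>v\<in>y - {0}. mpoly_eval H v \<noteq> 0 \<and> f j (\<psi> y) = mpoly_eval G v / mpoly_eval H v)" for j
  proof -
    obtain O' d G H where "openin (subtopology zariski V') O'" "y0 \<in> O'"
      "\<forall>y\<in>O'. \<forall>v\<in>y - {0}. mpoly_eval H v \<noteq> 0 \<and> (f j \<circ> \<psi>) y = mpoly_eval G v / mpoly_eval H v"
      using bspec[OF reg'[of j, unfolded regular_on_def] y0] by (elim exE bexE conjE)
    note O' = this
    have "openin zariski O'" using O'(1) V'o by (simp add: openin_open_subtopology)
    moreover have "O' \<subseteq> V'" using openin_subset[OF O'(1)] by auto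
    ultimately show ?thesis using O'(2,3) by (intro exI[of _ O'] exI[of _ G] exI[of _ H]) simp
  qed
  then have "\<forall>j. \<exists>O' G H. openin zariski O' \<and> y0 \<in> O' \<and> O' \<subseteq> V' \<and>
      (\<forall>y\<in>O'. \<forall>v\<in>y - {0}. mpoly_eval H v \<noteq> 0 \<and> f j (\<psi> y) = mpoly_eval G v / mpoly_eval H v)" by (intro allI)
  then obtain O' G H where "\<forall>j. openin zariski (O' j) \<and> y0 \<in> O' j \<and> O' j \<subseteq> V' \<and>
      (\<forall>y\<in>O' j. \<forall>v\<in>y - {0}. mpoly_eval (H j) v \<noteq> 0 \<and> f j (\<psi> y) = mpoly_eval (G j) v / mpoly_eval (H j) v)"
    unfolding choice_iff by (elim exE)
  note OGH = this[rule_format]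
  have O': "openin zariski (O' j)" "y0 \<in> O' j" "O' j \<subseteq> V'" for j using OGH[of j] by simp_all
  have GH: "mpoly_eval (H j) v \<noteq> 0" "f j (\<psi> y) = mpoly_eval (G j) v / mpoly_eval (H j) v"
    if "y \<in> O' j" "v \<in> y - {0}" for j y v
    using bspec[OF bspec[OF conjunct2[OF conjunct2[OF conjunct2[OF OGH[of j]]]] that(1)] that(2)] by simp_all
  have "openin zariski (\<Inter>j\<in>(UNIV :: 'n set). O' j)" using O'(1) by (intro openin_INT2) auto
  then obtain d K where K: "K \<in> homogeneous_polys d" "y0 \<in> basic_open K" "basic_open K \<subseteq> (\<Inter>j. O' j)"
    using zariski_basis[of "\<Inter>j. O' j" y0] O'(2) by auto
  \<comment> \<open>The second factor restricts to the chart on which every point is v0 + t w0 up to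
    scaling.\<close>
  define K1 where "K1 = K * mlin b"
  have K1h: "K1 \<in> homogeneous_polys (d + 1)" unfolding K1_def by (intro homogeneous_polys_mult K homogeneous_polys_mlin)
  have K1: "basic_open K1 \<subseteq> O' j" for j
    using K(3) unfolding K1_def basic_open_mult[OF K(1) homogeneous_polys_mlin] by blast
  have y0K1: "y0 \<in> basic_open K1"
    unfolding K1_def basic_open_mult[OF K(1) homogeneous_polys_mlin]
    using K(2) wb(1) basic_open_pspan[OF homogeneous_polys_mlin v0(1), of b] v0(2) by simp
  let ?z = "\<lambda>t. v0 + t *s w0"
  have bz: "dotp b (?z t) = 1" for t using wb by simp
  have z0: "?z t \<noteq> 0" for t using bz[of t] dotp_zero[of b] by (metis zero_neq_one)
  define gl hl where "gl j = line_poly v0 w0 (G j)" and "hl j = line_poly v0 w0 (H j)" for j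
  \<comment> \<open>The ratio \<open>gl j / hl j\<close> times the product of all denominators; the
    common factor does not change the projective point.\<close>
  define g where "g j = gl j * (\<Prod>l\<in>UNIV - {j}. hl l)" for j
  have point: "F \<in> homogeneous_polys m \<Longrightarrow> mev (\<lambda>c. [:c:]) g F = 0 \<Longrightarrow> z \<in> basic_open K1 \<Longrightarrow> vanishes_at F (\<psi> z)" for F m z
  proof -
    assume F: "F \<in> homogeneous_polys m" and F0: "mev (\<lambda>c. [:c:]) g F = 0" and z: "z \<in> basic_open K1"
    obtain u where u: "u \<noteq> 0" "z = pspan u" using z by (auto simp: basic_open_def elim: proj_space_cases)
    have "mpoly_eval K1 u \<noteq> 0" using basic_open_pspan[OF K1h u(1)] u(2) z by simp
    then have "dotp b u \<noteq> 0" by (simp add: K1_def)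
    then obtain t s where ts: "s \<noteq> 0" "u = s *s ?z t" using wb(3) by blast
    have "?z t = inverse s *s u" using ts by (simp add: vector_smult_assoc)
    then have "?z t \<in> z" unfolding u(2) pspan_iff by blast
    then have zt: "?z t \<in> z - {0}" using z0 by simp
    have zO: "z \<in> O' j" for j using K1 z by blast
    obtain j0 :: 'n where True by simp
    have \<psi>V: "\<psi> z \<in> V" using zO[of j0] O'(3)[of j0] by (auto simp: V'_def)
    then have \<psi>p: "\<psi> z \<in> proj_space" using UL Lp by (auto simp: V_def)
    obtain r where r: "r \<in> \<psi> z - {0}" using proj_point_nonzero[OF \<psi>p] by blast
    have hlt: "poly (hl j) t \<noteq> 0" for j using GH(1)[OF zO zt] by (simp add: hl_def poly_line_poly)
    have fj: "poly (gl j) t = poly (hl j) t * (vec_nth r j / vec_nth r i)" for j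
      using GH(2)[OF zO[of j] zt] hlt[of j] f[OF \<psi>V r, of j] by (simp add: gl_def hl_def poly_line_poly)
    have gt: "poly (g j) t = (\<Prod>l\<in>UNIV. poly (hl l) t) * (vec_nth r j / vec_nth r i)" for j
      unfolding g_def poly_mult fj poly_prod by (subst prod.remove[of UNIV j]) (simp_all add: mult_ac)
    let ?c = "(\<Prod>l\<in>UNIV. poly (hl l) t) / vec_nth r i"
    have "mpoly_eval F (?c *s r) = poly (mev (\<lambda>c. [:c:]) g F) t"
      unfolding mpoly_eval_mev
      by (subst mev_hom[OF type_ring_hom_poly[of t]])
         (auto simp: coeff_hom.intro[OF type_ring_hom_pconst] gt intro!: arg_cong2[where f = "\<lambda>a b. mev a b F"])
    also have "\<dots> = 0" using F0 by simp
    finally have "?c ^ m * mpoly_eval F r = 0" unfolding mpoly_eval_smult_homogeneous[OF F] .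
    moreover have "?c \<noteq> 0" using hlt Vi[OF \<psi>V r] by simp
    ultimately have "mpoly_eval F r = 0" by simp
    then show "vanishes_at F (\<psi> z)" using vanishes_at_iff[OF F \<psi>p r] by simp
  qed
  have "F \<in> vanishing_polys L m" if F: "F \<in> homogeneous_polys m" and F0: "mev (\<lambda>c. [:c:]) g F = 0" for F m
  proof (rule ccontr)
    \<comment> \<open>By irreducibility of L, the set where F is nonzero meets U; its preimage in
      the projective line is open and, by irreducibility again, meets the parametrized part.\<close>
    assume "F \<notin> vanishing_polys L m"
    then obtain x where "x \<in> L" "\<not> vanishes_at F x" using F by (auto simp: vanishing_polys_def)
    then have x: "x \<in> L" "x \<in> basic_open F" using Lp by (auto simp: basic_open_def)
    obtain S where S: "openin zariski S" "U = S \<inter> L" using U(1) by (auto simp: openin_subtopology)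
    obtain e E where E: "E \<in> homogeneous_polys e" "x0 \<in> basic_open E" "basic_open E \<subseteq> S"
      using zariski_basis[OF S(1), of x0] x0 S(2) by blast
    obtain x' where x': "x' \<in> L" "x' \<in> basic_open F" "x' \<in> basic_open E"
      using irreducible_open_meet[OF irr F E(1) x subsetD[OF UL x0] E(2)] by blast
    have x'U: "x' \<in> U" using x' E(3) S(2) by blast
    have "openin (subtopology zariski U) (U \<inter> basic_open F)"
      using openin_basic_open[OF F] by (auto simp: openin_subtopology)
    then have o: "openin zariski {y \<in> W. \<psi> y \<in> U \<inter> basic_open F}" by (rule preim)
    have "\<phi> x' \<in> {y \<in> W. \<psi> y \<in> U \<inter> basic_open F}" using \<phi>W[OF x'U] inv[OF x'U] x'U x'(2) by simp
    then obtain e' E' where E': "E' \<in> homogeneous_polys e'" "\<phi> x' \<in> basic_open E'"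
      "basic_open E' \<subseteq> {y \<in> W. \<psi> y \<in> U \<inter> basic_open F}"
      using zariski_basis[OF o] by blast
    have "subvariety {x \<in> proj_space :: ('k, 2) point set. x \<subseteq> UNIV}"
      by (rule subvariety_linear) (use v0 in auto)
    then have "irreducible_space (subtopology zariski (proj_space :: ('k, 2) point set))" by (simp add: subvariety_def)
    then obtain z where z: "z \<in> basic_open K1" "z \<in> basic_open E'"
      using irreducible_open_meet[of proj_space K1 "d + 1" E' e' y0 "\<phi> x'"] K1h E'(1,2) y0K1
      by (auto simp: basic_open_def)
    then show False using point[OF F F0 z(1)] E'(3) by (auto simp: basic_open_def)
  qed
  then show ?thesis by blast
qed

lemma variety_dim_one_points:
  assumes "subvariety L" "variety_dim L = 1"
  shows "\<exists>x\<in>L. \<exists>y\<in>L. x \<noteq> y"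
proof -
  have "variety_dim L = enat 1" using assms(2) by (simp add: one_enat_def)
  from variety_dim_chain[OF assms(1) this]
  obtain Z where Z: "(\<forall>i\<le>1. subvariety (Z i) \<and> Z i \<subseteq> L) \<and> (\<forall>i<1. Z i \<subset> Z (Suc i))"
    by (elim exE)
  have 1: "Z 0 \<subset> Z (Suc 0)" using spec[OF conjunct2[OF Z], of 0] by (rule mp) simp
  have 2: "subvariety (Z (Suc 0)) \<and> Z (Suc 0) \<subseteq> L" using spec[OF conjunct1[OF Z], of "Suc 0"] by (rule mp) simp
  have "subvariety (Z 0) \<and> Z 0 \<subseteq> L" using spec[OF conjunct1[OF Z], of 0] by (rule mp) simp
  then have "topspace (subtopology zariski (Z 0)) \<noteq> {}" unfolding subvariety_def irreducible_space_def by (elim conjE)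
  then obtain x where x: "x \<in> Z 0" unfolding topspace_subtopology by (elim ex_in_conv[THEN iffD2, elim_format] exE IntE)
  obtain y where y: "y \<in> Z (Suc 0)" "y \<notin> Z 0" using psubset_imp_ex_mem[OF 1] by (elim exE DiffE)
  have "x \<in> L" "y \<in> L" using x y(1) subsetD[OF psubset_imp_subset[OF 1]] conjunct2[OF 2] by (simp_all only: subsetD)
  moreover have "x \<noteq> y" using x y(2) by (intro notI) simp
  ultimately show ?thesis by (intro bexI[of _ x] bexI[of _ y])
qed

text \<open>A vector of L outside the span yields a linear form as in the growth lemma, so the
  Hilbert function rises by at least 2 at each step. The parametrization makes the Hilbert
  polynomial linear, and its slope is the degree 1.\<close>

lemma line_in_span:
  fixes L :: "('k::field_char_0, 'n::finite) point set"
  assumes L: "line L" and vw: "vec.independent {v, w}" "v \<noteq> w" "pspan v \<in> L" "pspan w \<in> L"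
  shows "L \<subseteq> {x \<in> proj_space. x \<subseteq> vec.span {v, w}}"
proof (rule ccontr)
  assume no: "\<not> ?thesis"
  have sub: "subvariety L" and dim: "variety_dim L = 1" and bir: "birational L (proj_space :: ('k, 2) point set)"
    and deg: "has_degree L 1" using L by (auto simp: line_def)
  obtain x u where x: "x \<in> L" "u \<in> x" "u \<notin> vec.span {v, w}" using no subvariety_subset[OF sub] by blast
  obtain a where a: "\<forall>z\<in>vec.span {v, w}. dotp a z = 0" "dotp a u = 1"
    using separating_functional[OF vec.subspace_span x(3)] by blast
  have grow: "hilbert_function L m + 2 \<le> hilbert_function L (Suc m)" for m
    using a x vw by (intro hilbert_function_growth[OF sub vw]) (auto simp: vec.span_base)
  obtain g :: "'n \<Rightarrow> 'k poly" where g: "\<And>m F. F \<in> homogeneous_polys m \<Longrightarrow> mev (\<lambda>c. [:c:]) g F = 0 \<Longrightarrow> F \<in> vanishing_polys L m"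
    using birational_parametrization[OF sub bir] by blast
  define e where "e = Max (range (\<lambda>j. degree (g j)))"
  have "degree (g j) \<le> e" for j unfolding e_def by (rule Max_ge) auto
  then have le: "hilbert_function L m \<le> e * m + 1" for m using hilbert_function_parametrized_le g by blast
  obtain r and p :: "rat poly" where r: "variety_dim L = enat r" "fact r * coeff p r = (1::rat)"
    and ev: "\<forall>\<^sub>F m in sequentially. poly p (of_nat m) = of_nat (hilbert_function L m)"
    using deg unfolding has_degree_def by auto
  have "r = 1" using r(1) dim by (simp add: one_enat_def)
  then have c1: "coeff p 1 = 1" using r(2) by simp
  obtain c where c: "p = [:c, 1:]" using linear_growth_poly[OF ev le] c1 by auto
  obtain m where "\<forall>k\<ge>m. poly p (of_nat k) = of_nat (hilbert_function L k)"
    using ev unfolding eventually_sequentially by blast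
  then have m: "poly p (of_nat m) = of_nat (hilbert_function L m)"
    "poly p (of_nat (Suc m)) = of_nat (hilbert_function L (Suc m))" by (simp_all del: of_nat_Suc)
  have "of_nat (hilbert_function L (Suc m)) = (of_nat (hilbert_function L m + 1) :: rat)"
    using m unfolding c by simp
  then have "hilbert_function L (Suc m) = hilbert_function L m + 1" using of_nat_eq_iff by blast
  then show False using grow[of m] by simp
qed

text \<open>One inclusion uses the degree. For the other, a missing point yields a form vanishing on
  L but not on the projective line through x and y; its zeros there are finite in number, so L would
  be finite, which irreducibility forbids for a set with two points.\<close>

theorem line_eq_linear:
  fixes L :: "('k::field_char_0, 'n::finite) point set"
  assumes L: "line L"
  shows "\<exists>p q. vec.independent {p, q} \<and> p \<noteq> q \<and> L = {x \<in> proj_space. x \<subseteq> vec.span {p, q}}"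
proof -
  have sub: "subvariety L" and dim: "variety_dim L = 1" using L by (auto simp: line_def)
  have Lp: "L \<subseteq> proj_space" by (rule subvariety_subset[OF sub])
  obtain x y where xy: "x \<in> L" "y \<in> L" "x \<noteq> y" using variety_dim_one_points[OF sub dim] by blast
  obtain p where p: "p \<noteq> 0" "x = pspan p" using xy Lp by (auto elim: proj_space_cases)
  obtain q where q: "q \<noteq> 0" "y = pspan q" using xy Lp by (auto elim: proj_space_cases)
  have "p \<notin> pspan q" using proj_point_eq_pspan[of y p] xy p q Lp by auto
  moreover have "vec.independent {q}" using q(1) by (simp add: vec.independent_insert)
  ultimately have ind: "vec.independent {p, q}" by (rule vec.independent_insertI)
  have pq: "p \<noteq> q" using xy(3) p q by auto
  have L1: "L \<subseteq> {x \<in> proj_space. x \<subseteq> vec.span {p, q}}" using line_in_span[OF L ind pq] xy p q by blast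
  moreover have "{x \<in> proj_space. x \<subseteq> vec.span {p, q}} \<subseteq> L"
  proof (rule ccontr)
    assume "\<not> ?thesis"
    then obtain z where z: "z \<in> proj_space" "z \<subseteq> vec.span {p, q}" "z \<notin> L" by blast
    obtain d F where F: "F \<in> vanishing_polys L d" "\<not> vanishes_at F z"
      using closed_mem_iff[OF subvariety_closed[OF sub] z(1)] z(3) by blast
    have Fh: "F \<in> homogeneous_polys d" by (rule vanishing_polys_homogeneous[OF F(1)])
    obtain u where u: "u \<noteq> 0" "z = pspan u" using z(1) by (auto elim: proj_space_cases)
    have Fu: "mpoly_eval F u \<noteq> 0" using F(2) vanishes_at_pspan[OF Fh u(1)] u(2) by simp
    have FL: "mpoly_eval F v = 0" if "pspan v \<in> L" for v
      using F(1) that vec.span_base[of v "{v}"] by (auto simp: vanishing_polys_def vanishes_at_def)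
    have fin: "finite {t. mpoly_eval F (u + t *s w) = 0}" for w
    proof -
      have "line_poly u w F \<noteq> 0" using Fu poly_line_poly[of u w F 0] by auto
      from poly_roots_finite[OF this] show ?thesis by (simp add: poly_line_poly)
    qed
    note spq = span_pair[of _ p q]
    have "u \<in> vec.span {p, q}" using z(2) u(2) vec.span_base[of u "{u}"] by auto
    then obtain s t where st: "u = s *s p + t *s q" using spq by blast
    \<comment> \<open>Completes u to a spanning pair, so that every point other than that of w is u
      + t w up to scaling.\<close>
    have "\<exists>w. \<forall>v\<in>vec.span {p, q}. \<exists>c d. v = c *s u + d *s w"
    proof (cases "s = 0")
      case True
      then have "t \<noteq> 0" using u st by auto
      have "\<exists>c d. x *s p + y *s q = c *s u + d *s p" for x y
      proof (intro exI)
        show "x *s p + y *s q = (y / t) *s u + x *s p"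
          using \<open>t \<noteq> 0\<close> unfolding st True by (simp add: vector_smult_assoc)
      qed
      then have "\<forall>v\<in>vec.span {p, q}. \<exists>c d. v = c *s u + d *s p" unfolding Ball_def spq by fast
      then show ?thesis by blast
    next
      case False
      have "\<exists>c d. x *s p + y *s q = c *s u + d *s q" for x y
      proof (intro exI)
        show "x *s p + y *s q = (x / s) *s u + (y - x * t / s) *s q"
          using False unfolding st by (simp add: vec.scale_right_distrib vector_smult_assoc vec.scale_left_diff_distrib algebra_simps)
      qed
      then show ?thesis unfolding Ball_def spq by blast
    qed
    then obtain w where w: "\<And>v. v \<in> vec.span {p, q} \<Longrightarrow> \<exists>c d. v = c *s u + d *s w" by blast
    have "L \<subseteq> insert (pspan w) ((\<lambda>t. pspan (u + t *s w)) ` {t. mpoly_eval F (u + t *s w) = 0})"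
    proof
      fix y assume y: "y \<in> L"
      obtain v where v: "v \<noteq> 0" "y = pspan v" using y Lp by (auto elim: proj_space_cases)
      have "v \<in> vec.span {p, q}" using y L1 v(2) vec.span_base[of v "{v}"] by auto
      then obtain c d where cd: "v = c *s u + d *s w" using w by blast
      have yp: "y \<in> proj_space" using y Lp by blast
      show "y \<in> insert (pspan w) ((\<lambda>t. pspan (u + t *s w)) ` {t. mpoly_eval F (u + t *s w) = 0})"
      proof (cases "c = 0")
        case True
        then have "w \<noteq> 0" "d \<noteq> 0" using v(1) cd by auto
        then have "w = inverse d *s v" using cd True by (simp add: vector_smult_assoc)
        then have "w \<in> y" using v(2) by (auto simp: pspan_iff)
        then show ?thesis using proj_point_eq_pspan[OF yp _ \<open>w \<noteq> 0\<close>] by simp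
      next
        case False
        let ?v = "u + (d / c) *s w"
        have e: "?v = inverse c *s v" unfolding cd using False by (simp add: vec.scale_right_distrib vector_smult_assoc divide_inverse mult.commute)
        then have "?v \<in> y" using v(2) by (auto simp: pspan_iff)
        moreover have "?v \<noteq> 0" unfolding e using False v(1) by simp
        ultimately have "y = pspan ?v" by (rule proj_point_eq_pspan[OF yp])
        then show ?thesis using FL[of ?v] y by blast
      qed
    qed
    then have finL: "finite L" by (rule finite_subset) (use fin in simp)
    \<comment> \<open>Finite sets of closed points are closed, so L would split into a point and its
      complement.\<close>
    have cl: "closedin zariski S" if "S \<subseteq> L" for S
    proof -
      have "closedin zariski (\<Union>x\<in>S. {x})"
        using that finite_subset[OF that finL] Lp subvariety_point subvariety_closed by (intro closedin_Union) auto
      then show ?thesis by simp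
    qed
    have "closedin (subtopology zariski L) {x}" "closedin (subtopology zariski L) (L - {x})"
      using cl[of "{x}"] cl[of "L - {x}"] xy(1) by (auto intro: closedin_subset_topspace)
    moreover have "topspace (subtopology zariski L) = L" using Lp by (auto simp: topspace_zariski)
    ultimately have "{x} = L \<or> L - {x} = L" using sub xy(1) unfolding subvariety_def irreducible_space_def
      by (metis insert_Diff insert_is_Un)
    then show False using xy by blast
  qed
  ultimately show ?thesis using ind pq by blast
qed

section \<open>The tangent space along a contracted line\<close>

lemma dform_eq_0_cofinite:
  fixes F :: "('k::field_char_0, 'n::finite) mpoly"
  assumes "finite A" "\<And>t. t \<notin> A \<Longrightarrow> dform F (v + t *s w) u = 0"
  shows "dform F (v + t *s w) u = 0"
  using tay_eq_0_cofinite[of A 1 u F v w t] assms unfolding tay_1 by blast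

text \<open>Contraction gives a common tangent space at the smooth points of L only. Semicontinuity
  at one smooth point bounds the dimension from above where \<mu> is nonzero, and the lower bound
  holds everywhere, so those points are smooth. The vanishing of the differentials on
  \<open>Th\<close> spreads to the rest of the plane because it is polynomial in the
  parameters.\<close>

lemma contracted_line_tangent:
  fixes X L :: "('k::field_char_0, 'n::finite) point set"
  assumes X: "subvariety X" "variety_dim X = enat n"
    and L: "L = {x \<in> proj_space. x \<subseteq> vec.span {p, q}}" "L \<subseteq> X" and ind: "vec.independent {p, q}" "p \<noteq> q"
    and gauss: "gauss_contracted X L"
  shows "\<exists>Th A. vec.subspace Th \<and> vec.dim Th = Suc n \<and> finite A \<and>
    (\<forall>d. \<forall>F\<in>vanishing_polys X d. \<forall>z\<in>vec.span {p, q}. \<forall>w\<in>Th. dform F z w = 0) \<and>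
    (\<forall>t w. t \<notin> A \<longrightarrow> (\<forall>d. \<forall>F\<in>vanishing_polys X d. dform F (p + t *s q) w = 0) \<longrightarrow> w \<in> Th)"
proof -
  define T where "T v = {w. \<forall>d. \<forall>F\<in>vanishing_polys X d. dform F v w = 0}" for v :: "'k ^ 'n"
  have ets: "embedded_tangent_space X (pspan v) = T v" for v unfolding T_def by (rule embedded_tangent_space_pspan)
  have sT: "vec.subspace (T v)" for v unfolding T_def by (rule subspace_embedded_tangent_space)
  have nz: "s *s p + t *s q = 0 \<longleftrightarrow> s = 0 \<and> t = 0" for s t
  proof
    assume z: "s *s p + t *s q = 0"
    obtain a where a: "dotp a p = 1" "dotp a q = 0"
      using functional_exists[OF ind(1), of "\<lambda>z. if z = p then 1 else 0"] ind(2) by auto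
    obtain b where b: "dotp b q = 1" "dotp b p = 0"
      using functional_exists[OF ind(1), of "\<lambda>z. if z = q then 1 else 0"] ind(2) by auto
    show "s = 0 \<and> t = 0"
      using arg_cong[OF z, of "dotp a"] arg_cong[OF z, of "dotp b"] a b by simp
  qed simp
  have pX: "pspan (s *s p + t *s q) \<in> L" if "s \<noteq> 0 \<or> t \<noteq> 0" for s t
  proof -
    have "s *s p + t *s q \<noteq> 0" "s *s p + t *s q \<in> vec.span {p, q}" using nz that span_pair by blast+
    then show ?thesis unfolding L(1) using pspan_in_proj_space proj_subspace_iff[OF vec.subspace_span] by blast
  qed
  have lower: "Suc n \<le> vec.dim (T (s *s p + t *s q))" if "s \<noteq> 0 \<or> t \<noteq> 0" for s t
    unfolding T_def using nz that pX L(2) by (intro dim_tangent_lower_bound[OF X]) blast+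
  have Lne: "\<not> L \<subseteq> singular_locus X" and const: "gauss_map X constant_on (L - singular_locus X)"
    using gauss by (auto simp: gauss_contracted_def)
  have smooth: "pspan v \<in> smooth_locus X \<longleftrightarrow> vec.dim (T v) = Suc n" if "pspan v \<in> X" for v
    unfolding smooth_locus_def using that X(2) by (auto simp: ets one_enat_def)
  obtain x where x: "x \<in> L" "x \<in> smooth_locus X" using Lne L(2) by (auto simp: singular_locus_def)
  obtain v0 where v0: "v0 \<noteq> 0" "x = pspan v0" using x(1) L(1) by (auto elim: proj_space_cases)
  define Th where "Th = T v0"
  have dTh: "vec.dim Th = Suc n" using smooth[of v0] x L(2) v0 by (auto simp: Th_def)
  obtain C where C: "\<And>y. y \<in> L - singular_locus X \<Longrightarrow> gauss_map X y = C" using const unfolding constant_on_def by blast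
  have gm: "T v = Th" if v: "pspan v \<in> L" "vec.dim (T v) = Suc n" for v
  proof -
    have s: "pspan v \<in> smooth_locus X" using smooth v L(2) by blast
    have "gauss_map X (pspan v) = C" "gauss_map X x = C" using C s x v(1) by (auto simp: singular_locus_def)
    then show ?thesis using s x(2) by (simp add: gauss_map_def ets v0(2) Th_def)
  qed
  have "v0 \<in> vec.span {p, q}" using x(1) L(1) v0(2) vec.span_base[of v0 "{v0}"] by auto
  then obtain s0 t0 where st0: "v0 = s0 *s p + t0 *s q" using span_pair by blast
  obtain I F \<mu> where F: "\<And>i. i \<in> I \<Longrightarrow> \<exists>d. F i \<in> vanishing_polys X d" and \<mu>: "mpoly_eval \<mu> v0 \<noteq> 0"
    "\<And>v. mpoly_eval \<mu> v \<noteq> 0 \<Longrightarrow> vec.dim {w. \<forall>i\<in>(I::'n set). dform (F i) v w = 0} \<le> vec.dim (T v0)"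
    using dim_tangent_upper_bound[of X v0] unfolding T_def by blast
  have eqTh: "T (s *s p + t *s q) = Th" if st: "s \<noteq> 0 \<or> t \<noteq> 0" "mpoly_eval \<mu> (s *s p + t *s q) \<noteq> 0" for s t
  proof -
    have "T (s *s p + t *s q) \<subseteq> {w. \<forall>i\<in>I. dform (F i) (s *s p + t *s q) w = 0}" using F unfolding T_def by blast
    then have "vec.dim (T (s *s p + t *s q)) \<le> vec.dim {w. \<forall>i\<in>I. dform (F i) (s *s p + t *s q) w = 0}"
      by (rule vec.dim_subset)
    also have "\<dots> \<le> Suc n" using \<mu>(2)[OF st(2)] dTh unfolding Th_def by simp
    finally have "vec.dim (T (s *s p + t *s q)) \<le> Suc n" .
    then show ?thesis using lower[OF st(1)] by (intro gm pX st(1)) simp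
  qed
  text \<open>\<open>\<mu>\<close> need not be homogeneous, so its restriction to the affine line through \<open>p\<close> in
    direction \<open>q\<close> might vanish; a suitable multiple of that line avoids this.\<close>
  have "\<exists>s. s \<noteq> 0 \<and> (\<exists>t. mpoly_eval \<mu> (s *s p + t *s q) \<noteq> 0)"
  proof -
    have "poly (line_poly v0 p \<mu>) 0 \<noteq> 0" using \<mu>(1) by (simp add: poly_line_poly)
    then have "line_poly v0 p \<mu> \<noteq> 0" by auto
    then have "line_poly v0 p \<mu> * [:s0, 1:] \<noteq> 0" unfolding mult_eq_0_iff by simp
    then obtain c where c: "poly (line_poly v0 p \<mu> * [:s0, 1:]) c \<noteq> 0" using poly_nonzero_point by blast
    then have "poly (line_poly v0 p \<mu>) c \<noteq> 0" "poly [:s0, 1:] c \<noteq> 0"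
      unfolding poly_mult mult_eq_0_iff by simp_all
    then have "mpoly_eval \<mu> (v0 + c *s p) \<noteq> 0" "s0 + c \<noteq> 0" by (simp_all add: poly_line_poly)
    moreover have "v0 + c *s p = (s0 + c) *s p + t0 *s q" unfolding st0 by (simp add: vec.scale_left_distrib)
    ultimately show ?thesis by metis
  qed
  then obtain s t1 where s: "s \<noteq> 0" "mpoly_eval \<mu> (s *s p + t1 *s q) \<noteq> 0" by blast
  \<comment> \<open>Zeros of \<mu> on the multiple by s of the affine line p + t q; tangent spaces
    are unchanged by this scaling.\<close>
  define A where "A = {t. mpoly_eval \<mu> (s *s p + (s * t) *s q) = 0}"
  have "finite A"
  proof -
    have "poly (line_poly (s *s p) (s *s q) \<mu>) (t1 / s) \<noteq> 0" using s by (simp add: poly_line_poly vector_smult_assoc)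
    then have "line_poly (s *s p) (s *s q) \<mu> \<noteq> 0" by auto
    from poly_roots_finite[OF this] show ?thesis by (simp add: A_def poly_line_poly vector_smult_assoc mult.commute)
  qed
  have scale: "T (c *s v) = T v" if "c \<noteq> 0" for c v
    unfolding T_def using that by (auto simp: dform_scale[OF vanishing_polys_homogeneous])
  have eqA: "T (p + t *s q) = Th" if "t \<notin> A" for t
  proof -
    have "T (s *s p + (s * t) *s q) = Th" using that s(1) by (intro eqTh) (auto simp: A_def)
    moreover have "s *s p + (s * t) *s q = s *s (p + t *s q)" by (simp add: vec.scale_right_distrib vector_smult_assoc)
    ultimately show ?thesis using scale[OF s(1)] by simp
  qed
  have van: "dform F z w = 0" if F: "F \<in> vanishing_polys X d" and z: "z \<in> vec.span {p, q}" and w: "w \<in> Th" for d F z w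
  proof -
    have 1: "dform F (p + t *s q) w = 0" for t
      by (rule dform_eq_0_cofinite[OF \<open>finite A\<close>]) (use eqA F w in \<open>auto simp: T_def\<close>)
    have 2: "dform F (s *s p + t *s q) w = 0" if "s \<noteq> 0" for s t
    proof -
      have "s *s p + t *s q = s *s (p + (t / s) *s q)" using that by (simp add: vec.scale_right_distrib vector_smult_assoc)
      then show ?thesis using 1 by (simp add: dform_scale[OF vanishing_polys_homogeneous[OF F]])
    qed
    obtain s t where st: "z = s *s p + t *s q" using z span_pair by blast
    have 3: "dform F (z + x *s p) w = 0" if "x \<notin> {- s}" for x
    proof -
      have "z + x *s p = (s + x) *s p + t *s q" unfolding st by (simp add: vec.scale_left_distrib)
      moreover have "s + x \<noteq> 0" using that by (auto simp: add_eq_0_iff)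
      ultimately show ?thesis using 2 by metis
    qed
    have fin: "finite {- s}" by simp
    have "dform F (z + 0 *s p) w = 0" by (rule dform_eq_0_cofinite[OF fin 3])
    then show ?thesis by simp
  qed
  have "w \<in> Th" if "t \<notin> A" "\<forall>d. \<forall>F\<in>vanishing_polys X d. dform F (p + t *s q) w = 0" for t w
    using that eqA[OF that(1)] by (auto simp: T_def)
  then show ?thesis using van dTh \<open>finite A\<close> sT[of v0] unfolding Th_def[symmetric] by blast
qed

lemma subspace_flag:
  fixes W :: "('k::field ^ 'n::finite) set"
  assumes "vec.subspace W" "vec.dim W = d"
  shows "\<exists>V. (\<forall>i\<le>d. vec.subspace (V i) \<and> vec.dim (V i) = i) \<and> (\<forall>i<d. V i \<subseteq> V (Suc i)) \<and> V d = W"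
  using assms
proof (induction d arbitrary: W)
  case 0
  then show ?case by (intro exI[of _ "\<lambda>_. W"]) auto
next
  case (Suc d)
  obtain B where B: "B \<subseteq> W" "vec.independent B" "W \<subseteq> vec.span B" "card B = Suc d"
    using vec.basis_exists[of W] Suc.prems(2) by metis
  then obtain b B' where b: "B = insert b B'" "b \<notin> B'" "card B' = d" by (auto simp: card_Suc_eq)
  have "vec.independent B'" by (rule vec.independent_mono[OF B(2)]) (use b(1) in auto)
  then have "vec.dim (vec.span B') = d" using b(3) by (simp add: vec.dim_eq_card_independent)
  then obtain V where V: "\<forall>i\<le>d. vec.subspace (V i) \<and> vec.dim (V i) = i" "\<forall>i<d. V i \<subseteq> V (Suc i)" "V d = vec.span B'"
    using Suc.IH[OF vec.subspace_span] by blast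
  have "vec.span B' \<subseteq> W" using B(1) b(1) Suc.prems(1) by (intro vec.span_minimal) auto
  then show ?case using V Suc.prems
    by (intro exI[of _ "V(Suc d := W)"]) (auto simp: le_Suc_eq less_Suc_eq)
qed

text \<open>A flag in W gives a chain of n + 1 linear subvarieties; a strictly larger X on top of it
  would make a chain longer than the dimension allows.\<close>

lemma linear_subvariety_eq:
  fixes X :: "('k::field_char_0, 'n::finite) point set"
  assumes X: "subvariety X" "variety_dim X = enat n" and W: "vec.subspace W" "vec.dim W = Suc n"
    and sub: "{x \<in> proj_space. x \<subseteq> W} \<subseteq> X"
  shows "X = {x \<in> proj_space. x \<subseteq> W}"
proof (rule ccontr)
  assume ne: "X \<noteq> {x \<in> proj_space. x \<subseteq> W}"
  obtain V where V: "\<And>i. i \<le> Suc n \<Longrightarrow> vec.subspace (V i) \<and> vec.dim (V i) = i" "\<And>i. i < Suc n \<Longrightarrow> V i \<subseteq> V (Suc i)" "V (Suc n) = W"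
    using subspace_flag[OF W] by blast
  define lin where "lin U = {x \<in> proj_space. x \<subseteq> U}" for U :: "('k ^ 'n) set"
  define Z where "Z i = (if i \<le> n then lin (V (Suc i)) else X)" for i
  have VW: "V i \<subseteq> W" if "i \<le> Suc n" for i
    using that
  proof (induction "Suc n - i" arbitrary: i)
    case 0 then show ?case using V(3) by (simp add: le_antisym)
  next
    case (Suc k)
    then have "i < Suc n" "k = Suc n - Suc i" by auto
    then have "V (Suc i) \<subseteq> W" using Suc.hyps(1)[of "Suc i"] by simp
    then show ?case using V(2)[OF \<open>i < Suc n\<close>] by blast
  qed
  have Zs: "subvariety (Z i) \<and> Z i \<subseteq> X" for i
  proof (cases "i \<le> n")
    case True
    have "\<exists>v\<in>V (Suc i). v \<noteq> 0"
    proof (rule ccontr)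
      assume "\<not> ?thesis"
      then have "V (Suc i) \<subseteq> {0}" by auto
      then have "vec.dim (V (Suc i)) \<le> vec.dim {0 :: 'k ^ 'n}" by (rule vec.dim_subset)
      then show False using V(1)[of "Suc i"] True by (simp add: vec.dim_singleton)
    qed
    then have "subvariety (lin (V (Suc i)))" unfolding lin_def using V(1)[of "Suc i"] True by (intro subvariety_linear) auto
    moreover have "lin (V (Suc i)) \<subseteq> X" using sub VW[of "Suc i"] True by (auto simp: lin_def)
    ultimately show ?thesis using True by (simp add: Z_def)
  qed (use X in \<open>auto simp: Z_def\<close>)
  have strict: "Z i \<subset> Z (Suc i)" if i: "i < Suc n" for i
  proof (cases "i = n")
    case True
    then show ?thesis using ne sub V(3) by (auto simp: Z_def lin_def)
  next
    case False
    then have i': "Suc i < Suc n" using i by simp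
    have "\<not> V (Suc (Suc i)) \<subseteq> V (Suc i)"
      using vec.dim_subset[of "V (Suc (Suc i))" "V (Suc i)"] V(1)[of "Suc i"] V(1)[of "Suc (Suc i)"] i' by auto
    then obtain v where v: "v \<in> V (Suc (Suc i))" "v \<notin> V (Suc i)" by blast
    have s: "vec.subspace (V (Suc i))" "vec.subspace (V (Suc (Suc i)))" using V(1) i' by auto
    have "v \<noteq> 0" using v(2) s(1) vec.subspace_0 by blast
    then have "pspan v \<in> lin (V (Suc (Suc i)))" "pspan v \<notin> lin (V (Suc i))"
      using v pspan_in_proj_space proj_subspace_iff[OF s(1)] proj_subspace_iff[OF s(2)] by (auto simp: lin_def)
    moreover have "lin (V (Suc i)) \<subseteq> lin (V (Suc (Suc i)))" using V(2)[OF i'] by (auto simp: lin_def)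
    ultimately have "lin (V (Suc i)) \<subset> lin (V (Suc (Suc i)))" by blast
    then show ?thesis using i' by (simp add: Z_def)
  qed
  have "\<exists>Z. (\<forall>i\<le>Suc n. subvariety (Z i) \<and> Z i \<subseteq> X) \<and> (\<forall>i<Suc n. Z i \<subset> Z (Suc i))"
    by (rule exI[of _ Z], intro conjI allI impI) (simp_all only: Zs strict)
  then have "enat (Suc n) \<in> {enat d | d. \<exists>Z. (\<forall>i\<le>d. subvariety (Z i) \<and> Z i \<subseteq> X) \<and> (\<forall>i<d. Z i \<subset> Z (Suc i))}"
    by (intro CollectI exI[of _ "Suc n"] conjI refl)
  then have "enat (Suc n) \<le> variety_dim X" unfolding variety_dim_def by (rule Sup_upper)
  then show False using X(2) by simp
qed

theorem corollary4p3:
  fixes X L :: "('k::{alg_closed_field, field_char_0}, 'n::finite) point set" and n :: nat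
  assumes "subvariety X" and "variety_dim X = enat n"
    and "line L" and "L \<subseteq> X" and "gauss_contracted X L"
    and "\<not> linear_subspace X"
  shows "locally_obstructed L X"
  unfolding locally_obstructed_def
proof
  assume unob: "locally_unobstructed L X"
  have Xp: "X \<subseteq> proj_space" by (rule subvariety_subset[OF assms(1)])
  obtain p q where pq: "vec.independent {p, q}" "p \<noteq> q" and L: "L = {x \<in> proj_space. x \<subseteq> vec.span {p, q}}"
    using line_eq_linear[OF assms(3)] by (elim exE conjE)
  obtain Th A where ThS: "vec.subspace Th" "vec.dim Th = Suc n" and A: "finite A"
    and tangent: "\<forall>d. \<forall>F\<in>vanishing_polys X d. \<forall>z\<in>vec.span {p, q}. \<forall>w\<in>Th. dform F z w = 0"
    and smooth: "\<forall>t w. t \<notin> A \<longrightarrow> (\<forall>d. \<forall>F\<in>vanishing_polys X d. dform F (p + t *s q) w = 0) \<longrightarrow> w \<in> Th"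
    using contracted_line_tangent[OF assms(1,2) L assms(4) pq assms(5)] by (elim exE conjE)
  \<comment> \<open>Unobstructedness is invoked at the closed points x of L, that is, at the
    subvarieties {x}.\<close>
  interpret contracted_line X L p q Th A
  proof
    show "deformations_unobstructed (local_ring X {x}) (local_ideal X L {x})" if "x \<in> L" for x
    proof -
      have "subvariety {x}" using subvariety_point that assms(4) Xp by blast
      then show ?thesis using unob that unfolding locally_unobstructed_def by simp
    qed
  qed (use Xp L assms(4) pq ThS A tangent smooth in blast)+
  \<comment> \<open>X is cut out by the forms that vanish on it, and all of them vanish on
    \<open>Th\<close>.\<close>
  have "{x \<in> proj_space. x \<subseteq> Th} \<subseteq> X"
  proof
    fix x assume x: "x \<in> {x \<in> proj_space. x \<subseteq> Th}"
    then have xp: "x \<in> proj_space" by simp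
    show "x \<in> X"
      unfolding closed_mem_iff[OF subvariety_closed[OF assms(1)] xp] vanishes_at_def
      using vanishing_on_tangent_space x by blast
  qed
  from linear_subvariety_eq[OF assms(1,2) ThS this] have "linear_subspace X"
    unfolding linear_subspace_def using ThS(1) by blast
  then show False using assms(6) by simp
qed

end
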